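(* Let $\Gamma$ be a countable discrete group. Let $N\subset M$ be an inclusion of $\Gamma$-von Neumann algebras. Assume that the inclusion is centrally $\Gamma$-free. Then the map $$P\mapsto P\mathbin{\bar\rtimes}\Gamma$$ gives a lattice isomorphism between the lattice of intermediate $\Gamma$-von Neumann algebras $P$ of $N\subset M$ and the lattice of intermediate von Neumann algebras of $N\mathbin{\bar\rtimes}\Gamma\subset M\mathbin{\bar\rtimes}\Gamma$.
   Context: Von Neumann algebras $N, M$ have separable predual and inclusions are unital; $N$ is a $\Gamma$-invariant von Neumann subalgebra of $M$. $\bar\rtimes$ is the von Neumann algebra crossed product. Lattice operations are intersection and generated von Neumann algebra. Fix a free ultrafilter $\omega$ on $\mathbb N$. For a von Neumann algebra $M$, let $\ell^\infty(M)$ be the C$^\ast$-algebra of bounded sequences in $M$, and set $\mathcal I_\omega(M)=\{(a_i)_i\in\ell^\infty(M):\ast\text{-strong-}\lim_{i\to\omega}a_i=0\}$, $\mathcal M^\omega(M)=\{a\in\ell^\infty(M): a\,\mathcal I_\omega(M)\subset\mathcal I_\omega(M),\ \mathcal I_\omega(M)\,a\subset\mathcal I_\omega(M)\}$, $\mathcal M_\omega(M)=\{(a_i)_i\in\ell^\infty(M):\lim_{i\to\omega}\|\varphi(a_i\,\cdot)-\varphi(\cdot\,a_i)\|=0\text{ for all }\varphi\in M_\ast\}$. Put $M^\omega=\mathcal M^\omega(M)/\mathcal I_\omega(M)$ and $M_\omega=\mathcal M_\omega(M)/\mathcal I_\omega(M)$; both are von Neumann algebras, and $M_\omega\subset M^\omega$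 is a von Neumann subalgebra. $\Gamma$ acts on $M^\omega$ by the action induced from the pointwise action. For an inclusion $N\subset M$ define $N^\omega\cap M_\omega:=[\ell^\infty(N)\cap\mathcal M_\omega(M)]/\mathcal I_\omega(N)$, a von Neumann subalgebra of $M_\omega$. The inclusion $N\subset M$ of $\Gamma$-von Neumann algebras is centrally $\Gamma$-free if for any $s\in\Gamma\setminus\{e\}$ there is a sequence $(p_i)_{i=1}^\infty$ of projections in $N^\omega\cap M_\omega$ with $\sum_{i=1}^\infty p_i=1$ and $p_j\,s(p_j)=0$ for all $j\in\mathbb N$. *)

theory Defs
  imports "HOL-Analysis.Analysis"
begin

section \<open>Complex Hilbert spaces\<close>

text \<open>
  A complex Hilbert space is a complete real inner product space with a compatible complex
  structure. The complex inner product is linear in the first argument, and its real part is the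
  given real inner product, so that norm and topology are those of the library. In particular the
  norm on bounded operators \<^typ>\<open>'a \<Rightarrow>\<^sub>L 'a\<close> is the usual operator norm.
\<close>

class chilbert_space = real_inner + complete_space +
  fixes scaleC :: "complex \<Rightarrow> 'a \<Rightarrow> 'a" (infixr "*\<^sub>C" 75)
    and cinner :: "'a \<Rightarrow> 'a \<Rightarrow> complex"
  assumes scaleC_add_right: "c *\<^sub>C (x + y) = c *\<^sub>C x + c *\<^sub>C y"
    and scaleC_add_left: "(c + d) *\<^sub>C x = c *\<^sub>C x + d *\<^sub>C x"
    and scaleC_scaleC: "c *\<^sub>C d *\<^sub>C x = (c * d) *\<^sub>C x"
    and scaleC_of_real: "complex_of_real r *\<^sub>C x = r *\<^sub>R x"
    and cinner_commute: "cinner x y = cnj (cinner y x)"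
    and cinner_add_left: "cinner (x + y) z = cinner x z + cinner y z"
    and cinner_scaleC_left: "cinner (c *\<^sub>C x) y = c * cinner x y"
    and Re_cinner: "Re (cinner x y) = inner x y"

lemma cinner_same: "cinner x x = complex_of_real ((norm (x::'a::chilbert_space))\<^sup>2)"
proof (rule complex_eqI)
  show "Re (cinner x x) = Re (complex_of_real ((norm x)\<^sup>2))"
    by (simp add: Re_cinner power2_norm_eq_inner)
  have "Im (cinner x x) = - Im (cinner x x)"
    by (metis cinner_commute cnj.simps(2))
  then show "Im (cinner x x) = Im (complex_of_real ((norm x)\<^sup>2))" by simp
qed

lemma norm_scaleC: "norm (c *\<^sub>C (x::'a::chilbert_space)) = cmod c * norm x"
proof -
  have "cinner (c *\<^sub>C x) (c *\<^sub>C x) = c * cnj c * cinner x x"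
    by (metis cinner_commute cinner_scaleC_left complex_cnj_mult mult.assoc)
  then have "complex_of_real ((norm (c *\<^sub>C x))\<^sup>2) = complex_of_real ((cmod c * norm x)\<^sup>2)"
    by (simp add: cinner_same power_mult_distrib flip: complex_norm_square)
  then have "(norm (c *\<^sub>C x))\<^sup>2 = (cmod c * norm x)\<^sup>2" by (simp only: of_real_eq_iff)
  then show ?thesis by simp
qed

lemma norm_cinner_le: "cmod (cinner x y) \<le> (norm (x::'a::chilbert_space))\<^sup>2 + (norm y)\<^sup>2"
proof -
  have re: "\<bar>Re (cinner u y)\<bar> \<le> norm u * norm y" for u
    by (simp add: Re_cinner Cauchy_Schwarz_ineq2)
  have "Im (cinner x y) = - Re (cinner (\<i> *\<^sub>C x) y)"
    by (simp add: cinner_scaleC_left)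
  then have "\<bar>Im (cinner x y)\<bar> \<le> norm x * norm y"
    using re[of "\<i> *\<^sub>C x"] by (simp add: norm_scaleC)
  then have "cmod (cinner x y) \<le> 2 * norm x * norm y"
    using re[of x] cmod_le[of "cinner x y"] by linarith
  also have "\<dots> \<le> (norm x)\<^sup>2 + (norm y)\<^sup>2" by (rule sum_squares_bound)
  finally show ?thesis .
qed


subsection \<open>Square-summable functions with values in a Hilbert space\<close>

typedef (overloaded) ('g, 'h) ell2 =
  "{f :: 'g \<Rightarrow> 'h::chilbert_space. (\<lambda>t. (norm (f t))\<^sup>2) summable_on UNIV}"
  morphisms ell2_fun Abs_ell2
  by (rule exI[of _ "\<lambda>_. 0"]) simp

setup_lifting type_definition_ell2

lemma ell2_summable: "(\<lambda>t. (norm (ell2_fun f t))\<^sup>2) summable_on UNIV"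
  using ell2_fun[of f] by simp

lemma sq_summable_add:
  fixes f g :: "'g \<Rightarrow> 'h::real_normed_vector"
  assumes "(\<lambda>t. (norm (f t))\<^sup>2) summable_on UNIV" "(\<lambda>t. (norm (g t))\<^sup>2) summable_on UNIV"
  shows "(\<lambda>t. (norm (f t + g t))\<^sup>2) summable_on UNIV"
proof (rule summable_on_comparison_test)
  show "(\<lambda>t. 2 * (norm (f t))\<^sup>2 + 2 * (norm (g t))\<^sup>2) summable_on UNIV"
    by (intro summable_on_add summable_on_cmult_right assms)
  fix t
  have "(norm (f t + g t))\<^sup>2 \<le> (norm (f t) + norm (g t))\<^sup>2"
    by (intro power_mono norm_triangle_ineq) simp
  also have "\<dots> \<le> 2 * (norm (f t))\<^sup>2 + 2 * (norm (g t))\<^sup>2"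
    using sum_squares_bound[of "norm (f t)" "norm (g t)"] by (simp add: power2_sum)
  finally show "(norm (f t + g t))\<^sup>2 \<le> 2 * (norm (f t))\<^sup>2 + 2 * (norm (g t))\<^sup>2" .
qed simp

instantiation ell2 :: (type, chilbert_space) real_vector
begin

lift_definition zero_ell2 :: "('a, 'b) ell2" is "\<lambda>_. 0" by simp
lift_definition plus_ell2 :: "('a, 'b) ell2 \<Rightarrow> ('a, 'b) ell2 \<Rightarrow> ('a, 'b) ell2"
  is "\<lambda>f g t. f t + g t" by (rule sq_summable_add)
lift_definition uminus_ell2 :: "('a, 'b) ell2 \<Rightarrow> ('a, 'b) ell2" is "\<lambda>f t. - f t" by simp
lift_definition minus_ell2 :: "('a, 'b) ell2 \<Rightarrow> ('a, 'b) ell2 \<Rightarrow> ('a, 'b) ell2"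
  is "\<lambda>f g t. f t - g t"
proof -
  fix f g :: "'a \<Rightarrow> 'b"
  assume "(\<lambda>t. (norm (f t))\<^sup>2) summable_on UNIV" "(\<lambda>t. (norm (g t))\<^sup>2) summable_on UNIV"
  then show "(\<lambda>t. (norm (f t - g t))\<^sup>2) summable_on UNIV"
    using sq_summable_add[of f "\<lambda>t. - g t"] by simp
qed
lift_definition scaleR_ell2 :: "real \<Rightarrow> ('a, 'b) ell2 \<Rightarrow> ('a, 'b) ell2"
  is "\<lambda>r f t. r *\<^sub>R f t"
  by (simp add: power_mult_distrib summable_on_cmult_right)

instance
  by standard (transfer; simp add: fun_eq_iff algebra_simps)+

end

lemma ell2_cinner_summable:
  "(\<lambda>t. cinner (ell2_fun f t) (ell2_fun g t)) summable_on UNIV"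
proof (rule abs_summable_summable, rule summable_on_comparison_test)
  show "(\<lambda>t. (norm (ell2_fun f t))\<^sup>2 + (norm (ell2_fun g t))\<^sup>2) summable_on UNIV"
    by (intro summable_on_add ell2_summable)
qed (auto simp: norm_cinner_le)

lemma ell2_inner_summable:
  "(\<lambda>t. inner (ell2_fun f t) (ell2_fun g t)) summable_on UNIV"
  using summable_on_Re[OF ell2_cinner_summable[of f g]] by (simp add: Re_cinner)

instantiation ell2 :: (type, chilbert_space) real_inner
begin

definition inner_ell2 :: "('a, 'b) ell2 \<Rightarrow> ('a, 'b) ell2 \<Rightarrow> real"
  where "inner_ell2 f g = (\<Sum>\<^sub>\<infinity>t. inner (ell2_fun f t) (ell2_fun g t))"
definition norm_ell2 :: "('a, 'b) ell2 \<Rightarrow> real"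
  where "norm_ell2 f = sqrt (inner f f)"
definition sgn_ell2 :: "('a, 'b) ell2 \<Rightarrow> ('a, 'b) ell2"
  where "sgn_ell2 f = f /\<^sub>R norm f"
definition dist_ell2 :: "('a, 'b) ell2 \<Rightarrow> ('a, 'b) ell2 \<Rightarrow> real"
  where "dist_ell2 f g = norm (f - g)"
definition uniformity_ell2 :: "(('a, 'b) ell2 \<times> ('a, 'b) ell2) filter"
  where "uniformity_ell2 = (INF e\<in>{0<..}. principal {(x, y). dist x y < e})"
definition open_ell2 :: "('a, 'b) ell2 set \<Rightarrow> bool"
  where "open_ell2 U = (\<forall>x\<in>U. \<forall>\<^sub>F (x', y) in uniformity. x' = x \<longrightarrow> y \<in> U)"

instance
proof
  fix x y z :: "('a, 'b) ell2" and r :: real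
  show "inner x y = inner y x" by (simp add: inner_ell2_def inner_commute)
  show "inner (x + y) z = inner x z + inner y z"
    by (simp add: inner_ell2_def plus_ell2.rep_eq inner_add_left infsum_add ell2_inner_summable)
  show "inner (r *\<^sub>R x) y = r * inner x y"
    by (simp add: inner_ell2_def scaleR_ell2.rep_eq infsum_cmult_right ell2_inner_summable)
  show "0 \<le> inner x x" by (simp add: inner_ell2_def infsum_nonneg)
  show "inner x x = 0 \<longleftrightarrow> x = 0"
  proof
    assume 0: "inner x x = 0"
    have "inner (ell2_fun x t) (ell2_fun x t) = 0" for t
      by (rule nonneg_infsum_le_0D[OF _ ell2_inner_summable])
        (use 0 in \<open>auto simp: inner_ell2_def\<close>)
    then have "ell2_fun x = ell2_fun 0" by (simp add: fun_eq_iff zero_ell2.rep_eq)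
    then show "x = 0" by (simp only: ell2_fun_inject)
  qed (simp add: inner_ell2_def zero_ell2.rep_eq)
qed (simp_all add: norm_ell2_def sgn_ell2_def dist_ell2_def uniformity_ell2_def open_ell2_def)

end

lemma ell2_norm_sq: "(norm f)\<^sup>2 = (\<Sum>\<^sub>\<infinity>t. (norm (ell2_fun f t))\<^sup>2)"
  by (simp add: power2_norm_eq_inner) (simp add: inner_ell2_def)

lemma ell2_sum_le: "finite F \<Longrightarrow> (\<Sum>t\<in>F. (norm (ell2_fun f t))\<^sup>2) \<le> (norm f)\<^sup>2"
  unfolding ell2_norm_sq by (rule finite_sum_le_infsum[OF ell2_summable]) auto

lemma ell2_component_le: "norm (ell2_fun f t) \<le> norm f"
  using ell2_sum_le[of "{t}" f] by (simp add: power2_le_iff_abs_le)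

instance ell2 :: (type, chilbert_space) complete_space
proof
  fix X :: "nat \<Rightarrow> ('a, 'b) ell2"
  assume X: "Cauchy X"
  have "Cauchy (\<lambda>n. ell2_fun (X n) t)" for t
  proof (rule metric_CauchyI)
    fix e :: real assume "0 < e"
    then obtain M where M: "\<And>m n. m \<ge> M \<Longrightarrow> n \<ge> M \<Longrightarrow> dist (X m) (X n) < e"
      using metric_CauchyD[OF X] by meson
    show "\<exists>M. \<forall>m\<ge>M. \<forall>n\<ge>M. dist (ell2_fun (X m) t) (ell2_fun (X n) t) < e"
      using M ell2_component_le[of "X _ - X _" t]
      by (metis (no_types, lifting) dist_norm minus_ell2.rep_eq order_le_less_trans)
  qed
  then have "\<forall>t. \<exists>l. (\<lambda>n. ell2_fun (X n) t) \<longlonglongrightarrow> l"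
    using Cauchy_convergent_iff convergent_def by blast
  then obtain f where f: "\<And>t. (\<lambda>n. ell2_fun (X n) t) \<longlonglongrightarrow> f t" by metis
  have bound: "\<exists>M. \<forall>n\<ge>M. \<forall>F. finite F \<longrightarrow> (\<Sum>t\<in>F. (norm (ell2_fun (X n) t - f t))\<^sup>2) \<le> e\<^sup>2"
    if e: "0 < e" for e :: real
  proof -
    obtain M where M: "\<And>m n. m \<ge> M \<Longrightarrow> n \<ge> M \<Longrightarrow> dist (X m) (X n) < e"
      using metric_CauchyD[OF X e] by meson
    have "(\<Sum>t\<in>F. (norm (ell2_fun (X n) t - f t))\<^sup>2) \<le> e\<^sup>2" if n: "n \<ge> M" and "finite F" for n F
    proof (rule LIMSEQ_le_const2)
      show "(\<lambda>m. \<Sum>t\<in>F. (norm (ell2_fun (X n) t - ell2_fun (X m) t))\<^sup>2)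
              \<longlonglongrightarrow> (\<Sum>t\<in>F. (norm (ell2_fun (X n) t - f t))\<^sup>2)"
        by (intro tendsto_intros f)
      have "(\<Sum>t\<in>F. (norm (ell2_fun (X n) t - ell2_fun (X m) t))\<^sup>2) \<le> e\<^sup>2" if "m \<ge> M" for m
      proof -
        have "(\<Sum>t\<in>F. (norm (ell2_fun (X n) t - ell2_fun (X m) t))\<^sup>2) \<le> (norm (X n - X m))\<^sup>2"
          using ell2_sum_le[OF \<open>finite F\<close>, of "X n - X m"] by (simp add: minus_ell2.rep_eq)
        also have "\<dots> \<le> e\<^sup>2"
          using M[OF n that] by (intro power_mono) (auto simp: dist_norm)
        finally show ?thesis .
      qed
      then show "\<exists>N. \<forall>m\<ge>N. (\<Sum>t\<in>F. (norm (ell2_fun (X n) t - ell2_fun (X m) t))\<^sup>2) \<le> e\<^sup>2"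
        by blast
    qed
    then show ?thesis by blast
  qed
  have summ: "(\<lambda>t. (norm (ell2_fun (X n) t - f t))\<^sup>2) summable_on UNIV"
    if "\<forall>F. finite F \<longrightarrow> (\<Sum>t\<in>F. (norm (ell2_fun (X n) t - f t))\<^sup>2) \<le> e\<^sup>2" for n e
    by (rule nonneg_bdd_above_summable_on) (use that in \<open>auto intro!: bdd_aboveI2\<close>)
  obtain M where "\<forall>n\<ge>M. \<forall>F. finite F \<longrightarrow> (\<Sum>t\<in>F. (norm (ell2_fun (X n) t - f t))\<^sup>2) \<le> 1\<^sup>2"
    using bound[of 1] by auto
  then have "(\<lambda>t. (norm (ell2_fun (X M) t - f t))\<^sup>2) summable_on UNIV"
    using summ by blast
  then have "(\<lambda>t. (norm (f t - ell2_fun (X M) t))\<^sup>2) summable_on UNIV"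
    by (simp add: norm_minus_commute)
  from sq_summable_add[OF this ell2_summable[of "X M"]]
  have fl: "(\<lambda>t. (norm (f t))\<^sup>2) summable_on UNIV" by simp
  define L where "L = Abs_ell2 f"
  have L: "ell2_fun L = f" unfolding L_def using fl by (simp add: Abs_ell2_inverse)
  have "X \<longlonglongrightarrow> L"
  proof (rule metric_LIMSEQ_I)
    fix e :: real assume e: "0 < e"
    obtain M where M: "\<And>n F. n \<ge> M \<Longrightarrow> finite F \<Longrightarrow>
        (\<Sum>t\<in>F. (norm (ell2_fun (X n) t - f t))\<^sup>2) \<le> (e/2)\<^sup>2"
      using bound[of "e/2"] e by (meson half_gt_zero)
    have "dist (X n) L < e" if "n \<ge> M" for n
    proof -
      have "(norm (X n - L))\<^sup>2 = (\<Sum>\<^sub>\<infinity>t. (norm (ell2_fun (X n) t - f t))\<^sup>2)"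
        by (simp add: ell2_norm_sq minus_ell2.rep_eq L)
      also have "\<dots> \<le> (e/2)\<^sup>2"
        by (rule infsum_le_finite_sums[OF summ]) (use M that in auto)
      finally have "norm (X n - L) \<le> e/2"
        using e by (simp add: power2_le_iff_abs_le)
      then show ?thesis using e by (simp add: dist_norm)
    qed
    then show "\<exists>no. \<forall>n\<ge>no. dist (X n) L < e" by blast
  qed
  then show "convergent X" by (rule convergentI)
qed

instantiation ell2 :: (type, chilbert_space) chilbert_space
begin

lift_definition scaleC_ell2 :: "complex \<Rightarrow> ('a, 'b) ell2 \<Rightarrow> ('a, 'b) ell2"
  is "\<lambda>c f t. c *\<^sub>C f t"
  by (simp add: norm_scaleC power_mult_distrib summable_on_cmult_right)
definition cinner_ell2 :: "('a, 'b) ell2 \<Rightarrow> ('a, 'b) ell2 \<Rightarrow> complex"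
  where "cinner_ell2 f g = (\<Sum>\<^sub>\<infinity>t. cinner (ell2_fun f t) (ell2_fun g t))"

instance
proof
  fix x y z :: "('a, 'b) ell2" and c d :: complex and r :: real
  show "c *\<^sub>C (x + y) = c *\<^sub>C x + c *\<^sub>C y" by transfer (simp add: scaleC_add_right)
  show "(c + d) *\<^sub>C x = c *\<^sub>C x + d *\<^sub>C x" by transfer (simp add: scaleC_add_left)
  show "c *\<^sub>C d *\<^sub>C x = (c * d) *\<^sub>C x" by transfer (simp add: scaleC_scaleC)
  show "complex_of_real r *\<^sub>C x = r *\<^sub>R x" by transfer (simp add: scaleC_of_real)
  show "cinner x y = cnj (cinner y x)"
    unfolding cinner_ell2_def infsum_cnj[symmetric]
    by (rule infsum_cong) (rule cinner_commute)
  show "cinner (x + y) z = cinner x z + cinner y z"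
    by (simp add: cinner_ell2_def plus_ell2.rep_eq cinner_add_left infsum_add ell2_cinner_summable)
  show "cinner (c *\<^sub>C x) y = c * cinner x y"
    by (simp add: cinner_ell2_def scaleC_ell2.rep_eq cinner_scaleC_left infsum_cmult_right
        ell2_cinner_summable)
  show "Re (cinner x y) = inner x y"
    using infsum_Re[OF ell2_cinner_summable[of x y]]
    by (simp add: cinner_ell2_def inner_ell2_def Re_cinner)
qed

end


section \<open>Von Neumann algebras\<close>

type_synonym 'h op = "'h \<Rightarrow>\<^sub>L 'h"

text \<open>
  Elements of \<^typ>\<open>'h \<Rightarrow>\<^sub>L 'h\<close> are only real-linear, so $B(H)$ is a proper subset.
\<close>

definition bounded_ops :: "'h::chilbert_space op set" where
  "bounded_ops = {T. \<forall>c x. blinfun_apply T (c *\<^sub>C x) = c *\<^sub>C blinfun_apply T x}"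

definition cscale :: "complex \<Rightarrow> 'h::chilbert_space op \<Rightarrow> 'h op" where
  "cscale c T = Blinfun (\<lambda>x. c *\<^sub>C blinfun_apply T x)"

definition star :: "'h::chilbert_space op \<Rightarrow> 'h op" where
  "star T = (THE S. \<forall>x y. cinner (blinfun_apply T x) y = cinner x (blinfun_apply S y))"

definition commutant :: "'h::chilbert_space op set \<Rightarrow> 'h op set" where
  "commutant S = {T \<in> bounded_ops. \<forall>a\<in>S. T o\<^sub>L a = a o\<^sub>L T}"

definition von_neumann_algebra :: "'h::chilbert_space op set \<Rightarrow> bool" where
  "von_neumann_algebra M \<longleftrightarrow>
     M \<subseteq> bounded_ops \<and> (\<forall>a\<in>M. star a \<in> M) \<and> commutant (commutant M) = M"

definition vn_generated :: "'h::chilbert_space op set \<Rightarrow> 'h op set" where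
  "vn_generated S = \<Inter>{P. von_neumann_algebra P \<and> S \<subseteq> P}"

text \<open>
  The predual of \<open>M\<close> consists of the \<open>\<sigma>\<close>-weakly continuous functionals. Functionals are total
  functions on operators, of which only the restriction to \<open>M\<close> matters.
\<close>

definition predual :: "'h::chilbert_space op set \<Rightarrow> ('h op \<Rightarrow> complex) set" where
  "predual M = {\<phi>. \<exists>\<xi> \<eta> :: nat \<Rightarrow> 'h.
     summable (\<lambda>n. (norm (\<xi> n))\<^sup>2) \<and> summable (\<lambda>n. (norm (\<eta> n))\<^sup>2) \<and>
     (\<forall>a\<in>M. \<phi> a = (\<Sum>n. cinner (blinfun_apply a (\<xi> n)) (\<eta> n)))}"

definition functional_norm :: "'h::chilbert_space op set \<Rightarrow> ('h op \<Rightarrow> complex) \<Rightarrow> real" where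
  "functional_norm M \<phi> = (SUP a\<in>{a \<in> M. norm a \<le> 1}. cmod (\<phi> a))"

definition separable_predual :: "'h::chilbert_space op set \<Rightarrow> bool" where
  "separable_predual M \<longleftrightarrow> (\<exists>D. countable D \<and> D \<subseteq> predual M \<and>
     (\<forall>\<phi>\<in>predual M. \<forall>\<epsilon>>0. \<exists>\<psi>\<in>D. functional_norm M (\<lambda>a. \<phi> a - \<psi> a) < \<epsilon>))"


section \<open>Group actions and crossed products\<close>

text \<open>
  The discrete group is a type of class \<^class>\<open>group_add\<close>, which is not assumed commutative: the
  product $st$ is \<open>s + t\<close>, the inverse of \<open>s\<close> is \<open>- s\<close>, and the identity is \<open>0\<close>. An action on \<open>M\<close>
  need not be implemented by unitaries; only its values on \<open>M\<close> matter.
\<close>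

definition vn_automorphism :: "'h::chilbert_space op set \<Rightarrow> ('h op \<Rightarrow> 'h op) \<Rightarrow> bool" where
  "vn_automorphism M \<theta> \<longleftrightarrow> bij_betw \<theta> M M \<and>
     (\<forall>a\<in>M. \<forall>b\<in>M. \<theta> (a + b) = \<theta> a + \<theta> b \<and> \<theta> (a o\<^sub>L b) = \<theta> a o\<^sub>L \<theta> b) \<and>
     (\<forall>a\<in>M. \<forall>c. \<theta> (cscale c a) = cscale c (\<theta> a)) \<and>
     (\<forall>a\<in>M. \<theta> (star a) = star (\<theta> a))"

definition vn_action ::
    "'h::chilbert_space op set \<Rightarrow> ('g::group_add \<Rightarrow> 'h op \<Rightarrow> 'h op) \<Rightarrow> bool" where
  "vn_action M \<alpha> \<longleftrightarrow> (\<forall>s. vn_automorphism M (\<alpha> s)) \<and>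
     (\<forall>a\<in>M. \<alpha> 0 a = a) \<and> (\<forall>s t. \<forall>a\<in>M. \<alpha> (s + t) a = \<alpha> s (\<alpha> t a))"

definition invariant :: "('g \<Rightarrow> 'h::chilbert_space op \<Rightarrow> 'h op) \<Rightarrow> 'h op set \<Rightarrow> bool" where
  "invariant \<alpha> P \<longleftrightarrow> (\<forall>s. \<alpha> s ` P \<subseteq> P)"

text \<open>
  On $\ell^2(\Gamma, H)$: $(\pi(a)\xi)(t) = \alpha_{t^{-1}}(a)\,\xi(t)$ and
  $(\lambda_s\xi)(t) = \xi(s^{-1}t)$, so that $\lambda_s\pi(a)\lambda_s^* = \pi(\alpha_s(a))$.
  The crossed product of an invariant subalgebra of \<open>M\<close> is formed with the restricted action, in
  the same representation.
\<close>

definition cp_embed ::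
    "('g::group_add \<Rightarrow> 'h::chilbert_space op \<Rightarrow> 'h op) \<Rightarrow> 'h op \<Rightarrow> ('g, 'h) ell2 op" where
  "cp_embed \<alpha> a =
     Blinfun (\<lambda>\<xi>. Abs_ell2 (\<lambda>t. blinfun_apply (\<alpha> (- t) a) (ell2_fun \<xi> t)))"

definition cp_unitary :: "'g::group_add \<Rightarrow> ('g, 'h::chilbert_space) ell2 op" where
  "cp_unitary s = Blinfun (\<lambda>\<xi>. Abs_ell2 (\<lambda>t. ell2_fun \<xi> (- s + t)))"

definition crossed_product ::
    "('g::group_add \<Rightarrow> 'h::chilbert_space op \<Rightarrow> 'h op) \<Rightarrow> 'h op set \<Rightarrow> ('g, 'h) ell2 op set" where
  "crossed_product \<alpha> P = vn_generated (cp_embed \<alpha> ` P \<union> range cp_unitary)"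


section \<open>Central sequence algebras\<close>

definition free_ultrafilter :: "nat filter \<Rightarrow> bool" where
  "free_ultrafilter \<omega> \<longleftrightarrow> \<omega> \<noteq> bot \<and> \<omega> \<le> cofinite \<and>
     (\<forall>P. eventually P \<omega> \<or> eventually (\<lambda>i. \<not> P i) \<omega>)"

definition bounded_sequences :: "'h::chilbert_space op set \<Rightarrow> (nat \<Rightarrow> 'h op) set" where
  "bounded_sequences M = {a. range a \<subseteq> M \<and> bounded (range a)}"

text \<open>On bounded sequences, \<open>*\<close>-strong convergence is pointwise convergence of \<open>a\<close> and \<open>a*\<close>.\<close>

definition null_sequences ::
    "nat filter \<Rightarrow> 'h::chilbert_space op set \<Rightarrow> (nat \<Rightarrow> 'h op) set" where
  "null_sequences \<omega> M = {a \<in> bounded_sequences M. \<forall>\<xi>.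
     ((\<lambda>i. blinfun_apply (a i) \<xi>) \<longlongrightarrow> 0) \<omega> \<and>
     ((\<lambda>i. blinfun_apply (star (a i)) \<xi>) \<longlongrightarrow> 0) \<omega>}"

definition central_sequences ::
    "nat filter \<Rightarrow> 'h::chilbert_space op set \<Rightarrow> (nat \<Rightarrow> 'h op) set" where
  "central_sequences \<omega> M = {a \<in> bounded_sequences M. \<forall>\<phi>\<in>predual M.
     ((\<lambda>i. functional_norm M (\<lambda>x. \<phi> (a i o\<^sub>L x) - \<phi> (x o\<^sub>L a i))) \<longlongrightarrow> 0) \<omega>}"

text \<open>
  The algebra $N^\omega \cap M_\omega$ is the quotient of \<open>C = \<ell>\<^sup>\<infinity>(N) \<inter> \<M>\<^sub>\<omega>(M)\<close> by
  \<open>I = \<I>\<^sub>\<omega>(N)\<close>. Its elements are handled through representatives in \<open>C\<close>, with all relations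
  understood modulo \<open>I\<close>. The following definitions are for a general pair \<open>C\<close>, \<open>I\<close> of a
  \<open>*\<close>-algebra of sequences and an ideal in it such that the quotient is a von Neumann algebra:
  projections; self-adjoint elements; the order, where positive elements are those of the form
  $c^*c$; least upper bounds in the self-adjoint part; normal positive functionals, which preserve
  least upper bounds of directed sets; and sums of sequences, which converge \<open>\<sigma>\<close>-weakly.
  As the normal positive functionals span the predual of a von Neumann algebra, they determine
  \<open>\<sigma>\<close>-weak convergence; for sums of projections this agrees with strong convergence.
\<close>

definition q_projection ::
    "(nat \<Rightarrow> 'h::chilbert_space op) set \<Rightarrow> (nat \<Rightarrow> 'h op) set \<Rightarrow> (nat \<Rightarrow> 'h op) \<Rightarrow> bool" where
  "q_projection C I p \<longleftrightarrow> p \<in> C \<and> (\<lambda>i. star (p i) - p i) \<in> I \<and> (\<lambda>i. (p i o\<^sub>L p i) - p i) \<in> I"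

definition q_selfadjoint ::
    "(nat \<Rightarrow> 'h::chilbert_space op) set \<Rightarrow> (nat \<Rightarrow> 'h op) set \<Rightarrow> (nat \<Rightarrow> 'h op) set" where
  "q_selfadjoint C I = {x \<in> C. (\<lambda>i. star (x i) - x i) \<in> I}"

definition q_le ::
    "(nat \<Rightarrow> 'h::chilbert_space op) set \<Rightarrow> (nat \<Rightarrow> 'h op) set \<Rightarrow>
     (nat \<Rightarrow> 'h op) \<Rightarrow> (nat \<Rightarrow> 'h op) \<Rightarrow> bool" where
  "q_le C I x y \<longleftrightarrow> (\<exists>c\<in>C. (\<lambda>i. (y i - x i) - (star (c i) o\<^sub>L c i)) \<in> I)"

definition q_is_lub ::
    "(nat \<Rightarrow> 'h::chilbert_space op) set \<Rightarrow> (nat \<Rightarrow> 'h op) set \<Rightarrow>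
     (nat \<Rightarrow> 'h op) set \<Rightarrow> (nat \<Rightarrow> 'h op) \<Rightarrow> bool" where
  "q_is_lub C I D x \<longleftrightarrow> x \<in> q_selfadjoint C I \<and> (\<forall>d\<in>D. q_le C I d x) \<and>
     (\<forall>y\<in>q_selfadjoint C I. (\<forall>d\<in>D. q_le C I d y) \<longrightarrow> q_le C I x y)"

definition q_directed ::
    "(nat \<Rightarrow> 'h::chilbert_space op) set \<Rightarrow> (nat \<Rightarrow> 'h op) set \<Rightarrow> (nat \<Rightarrow> 'h op) set \<Rightarrow> bool" where
  "q_directed C I D \<longleftrightarrow> D \<noteq> {} \<and> D \<subseteq> q_selfadjoint C I \<and>
     (\<forall>x\<in>D. \<forall>y\<in>D. \<exists>z\<in>D. q_le C I x z \<and> q_le C I y z)"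

definition q_positive_functional ::
    "(nat \<Rightarrow> 'h::chilbert_space op) set \<Rightarrow> (nat \<Rightarrow> 'h op) set \<Rightarrow>
     ((nat \<Rightarrow> 'h op) \<Rightarrow> complex) \<Rightarrow> bool" where
  "q_positive_functional C I \<phi> \<longleftrightarrow>
     (\<forall>x\<in>C. \<forall>y\<in>C. \<phi> (\<lambda>i. x i + y i) = \<phi> x + \<phi> y) \<and>
     (\<forall>x\<in>C. \<forall>c. \<phi> (\<lambda>i. cscale c (x i)) = c * \<phi> x) \<and>
     (\<forall>x\<in>I. \<phi> x = 0) \<and>
     (\<forall>c\<in>C. \<phi> (\<lambda>i. star (c i) o\<^sub>L c i) \<in> \<real> \<and> 0 \<le> Re (\<phi> (\<lambda>i. star (c i) o\<^sub>L c i)))"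

definition q_normal_functional ::
    "(nat \<Rightarrow> 'h::chilbert_space op) set \<Rightarrow> (nat \<Rightarrow> 'h op) set \<Rightarrow>
     ((nat \<Rightarrow> 'h op) \<Rightarrow> complex) \<Rightarrow> bool" where
  "q_normal_functional C I \<phi> \<longleftrightarrow> q_positive_functional C I \<phi> \<and>
     (\<forall>D x. q_directed C I D \<and> q_is_lub C I D x \<longrightarrow> Re (\<phi> x) = (SUP d\<in>D. Re (\<phi> d)))"

definition q_sums ::
    "(nat \<Rightarrow> 'h::chilbert_space op) set \<Rightarrow> (nat \<Rightarrow> 'h op) set \<Rightarrow>
     (nat \<Rightarrow> nat \<Rightarrow> 'h op) \<Rightarrow> (nat \<Rightarrow> 'h op) \<Rightarrow> bool" where
  "q_sums C I p x \<longleftrightarrow> (\<forall>\<phi>. q_normal_functional C I \<phi> \<longrightarrow> (\<lambda>j. \<phi> (p j)) sums \<phi> x)"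

text \<open>
  In the following definition, \<open>p j\<close> represents the projection $p_j$ and \<open>p j i\<close> is the \<open>i\<close>-th
  entry of the representing sequence. The equation $p_j\,s(p_j) = 0$ is one in $M^\omega$, where
  the group acts entrywise.
\<close>

definition centrally_free ::
    "nat filter \<Rightarrow> ('g::group_add \<Rightarrow> 'h::chilbert_space op \<Rightarrow> 'h op) \<Rightarrow>
     'h op set \<Rightarrow> 'h op set \<Rightarrow> bool" where
  "centrally_free \<omega> \<alpha> N M \<longleftrightarrow>
     (let C = bounded_sequences N \<inter> central_sequences \<omega> M; I = null_sequences \<omega> N in
      \<forall>s. s \<noteq> 0 \<longrightarrow> (\<exists>p. (\<forall>j. q_projection C I (p j)) \<and>
        q_sums C I p (\<lambda>_. id_blinfun) \<and>
        (\<forall>j. (\<lambda>i. p j i o\<^sub>L \<alpha> s (p j i)) \<in> null_sequences \<omega> M)))"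


section \<open>Lattices of intermediate algebras\<close>

definition intermediate_vn :: "'h::chilbert_space op set \<Rightarrow> 'h op set \<Rightarrow> 'h op set set" where
  "intermediate_vn N M = {P. von_neumann_algebra P \<and> N \<subseteq> P \<and> P \<subseteq> M}"

definition intermediate_invariant_vn ::
    "('g \<Rightarrow> 'h::chilbert_space op \<Rightarrow> 'h op) \<Rightarrow> 'h op set \<Rightarrow> 'h op set \<Rightarrow> 'h op set set" where
  "intermediate_invariant_vn \<alpha> N M = {P \<in> intermediate_vn N M. invariant \<alpha> P}"

definition vn_lattice :: "'h::chilbert_space op set set \<Rightarrow> bool" where
  "vn_lattice L \<longleftrightarrow> (\<forall>P\<in>L. \<forall>Q\<in>L. P \<inter> Q \<in> L \<and> vn_generated (P \<union> Q) \<in> L)"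

definition vn_lattice_isomorphism ::
    "('h::chilbert_space op set \<Rightarrow> 'k::chilbert_space op set) \<Rightarrow>
     'h op set set \<Rightarrow> 'k op set set \<Rightarrow> bool" where
  "vn_lattice_isomorphism \<Phi> L L' \<longleftrightarrow> vn_lattice L \<and> vn_lattice L' \<and> bij_betw \<Phi> L L' \<and>
     (\<forall>P\<in>L. \<forall>Q\<in>L. \<Phi> (P \<inter> Q) = \<Phi> P \<inter> \<Phi> Q \<and>
        \<Phi> (vn_generated (P \<union> Q)) = vn_generated (\<Phi> P \<union> \<Phi> Q))"

end

theory Submission
  imports Defs
begin

text \<open>
  Let \<open>N \<rtimes> \<Gamma> \<subseteq> Q \<subseteq> M \<rtimes> \<Gamma>\<close> and \<open>x \<in> Q\<close>. For \<open>u \<noteq> e\<close> take projections \<open>p\<^sub>j\<close> with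
  sum 1 in \<open>N\<^sup>\<omega> \<inter> M\<^sub>\<omega>\<close> that are moved to orthogonal ones by \<open>u\<^sup>-\<^sup>1\<close>. The averages
  \<open>\<Sum>\<^sub>j \<pi>(p\<^sub>j) x \<pi>(p\<^sub>j)\<^sup>*\<close> lie in \<open>Q\<close> and are bounded by the norm of \<open>x\<close>; since the \<open>p\<^sub>j\<close> are central,
  their weak limit along \<open>\<omega>\<close> has the same coefficient at \<open>e\<close>, while that at \<open>u\<close> becomes 0.
  Doing this for all \<open>u \<noteq> e\<close> successively shows that the conditional expectation onto \<open>M\<close> maps \<open>Q\<close> into itself.
  Hence \<open>Q\<close> contains the Fourier coefficients of its elements, which determine membership
  in \<open>P \<rtimes> \<Gamma>\<close>, and \<open>Q = P \<rtimes> \<Gamma>\<close> with \<open>P = Q \<inter> M\<close>. That vector functionals see the sum of the \<open>p\<^sub>j\<close>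
  requires their limits along \<open>\<omega>\<close> to be normal on \<open>N\<^sup>\<omega> \<inter> M\<^sub>\<omega>\<close>; this is shown by a diagonal argument
  with a sequence separating for \<open>M\<close>.
\<close>

section \<open>Hilbert spaces and adjoints\<close>

text \<open>\<open>q_sums\<close> tests only functionals that preserve suprema of directed sets in
  the quotient. Such a set may be uncountable, its elements have no common norm bound, and its order
  holds only modulo null sequences; moreover the quotient is never shown to be a von Neumann
  algebra. So order and functional calculus are carried out entrywise on representatives. Square
  roots are iterated at a rate independent of the operator and resolvents satisfy a commutator
  identity, which is why both keep a sequence in \<open>C\<close>.

  The action is purely algebraic, and its continuity is available only on bounded sets. Therefore
  every passage to a generated algebra goes through limits of bounded sequences instead of weak
  closures.

  Fourier series in a crossed product need not converge. An element is handled through row 0 of its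
  operator matrix, whose entries are weakly continuous. Infinitely many coefficients can be removed
  because the norm bound of an average is the norm of the averaged element itself, without a
  constant that could accumulate.\<close>

instance chilbert_space \<subseteq> banach ..

lemma scaleC_scaleR: "c *\<^sub>C (r *\<^sub>R (x::'h::chilbert_space)) = r *\<^sub>R (c *\<^sub>C x)"
  by (metis mult.commute scaleC_of_real scaleC_scaleC)

lemma bounded_linear_scaleC: "bounded_linear (\<lambda>x::'h::chilbert_space. c *\<^sub>C x)"
  by (rule bounded_linear_intro[of _ "cmod c"])
    (simp_all add: scaleC_add_right scaleC_scaleR norm_scaleC mult.commute)

lemma scaleC_zero_right [simp]: "c *\<^sub>C (0::'h::chilbert_space) = 0"
  by (rule linear_simps(3)[OF bounded_linear_scaleC])

lemma scaleC_minus_left: "(- c) *\<^sub>C x = - (c *\<^sub>C (x::'h::chilbert_space))"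
proof -
  have "(- c) *\<^sub>C x + c *\<^sub>C x = 0" using scaleC_of_real[of 0 x] by (simp flip: scaleC_add_left)
  then show ?thesis by (simp add: eq_neg_iff_add_eq_0)
qed

lemma scaleC_diff_right: "c *\<^sub>C ((x::'h::chilbert_space) - y) = c *\<^sub>C x - c *\<^sub>C y"
  by (rule linear_simps(2)[OF bounded_linear_scaleC])

lemma cinner_scaleC_right: "cinner x (c *\<^sub>C y) = cnj c * cinner x (y::'h::chilbert_space)"
  by (metis cinner_commute cinner_scaleC_left complex_cnj_mult)

lemma inner_scaleC_left: "inner (c *\<^sub>C x) y = inner x (cnj c *\<^sub>C (y::'h::chilbert_space))"
  by (simp flip: Re_cinner add: cinner_scaleC_left cinner_scaleC_right)

lemma Im_cinner: "Im (cinner x y) = - inner (\<i> *\<^sub>C x) (y::'h::chilbert_space)"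
  by (simp flip: Re_cinner add: cinner_scaleC_left)

lemma cinner_eqI:
  fixes x y u v :: "'h::chilbert_space"
  assumes "inner x y = inner u v" "inner (\<i> *\<^sub>C x) y = inner (\<i> *\<^sub>C u) v"
  shows "cinner x y = cinner u v"
  using assms by (simp add: complex_eq_iff Re_cinner Im_cinner)

lemma bounded_ops_iff: "T \<in> bounded_ops \<longleftrightarrow> (\<forall>c x. T (c *\<^sub>C x) = c *\<^sub>C T x)"
  by (simp add: bounded_ops_def)

lemma cscale_apply [simp]: "cscale c T x = c *\<^sub>C T x"
  unfolding cscale_def
  by (subst bounded_linear_Blinfun_apply)
    (auto intro: bounded_linear_compose[OF bounded_linear_scaleC] blinfun.bounded_linear_right)

lemma cscale_of_real: "cscale (of_real r) T = r *\<^sub>R T"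
  by (rule blinfun_eqI) (simp add: scaleC_of_real blinfun.scaleR_left)

lemma compose_add_left: "(a + b) o\<^sub>L c = (a o\<^sub>L c) + (b o\<^sub>L c)"
  by (rule blinfun_eqI) (simp add: blinfun.bilinear_simps)
lemma compose_add_right: "a o\<^sub>L (b + c) = (a o\<^sub>L b) + (a o\<^sub>L c)"
  by (rule blinfun_eqI) (simp add: blinfun.bilinear_simps)
lemma compose_diff_left: "(a - b) o\<^sub>L c = (a o\<^sub>L c) - (b o\<^sub>L c)"
  by (rule blinfun_eqI) (simp add: blinfun.bilinear_simps)
lemma compose_diff_right: "a o\<^sub>L (b - c) = (a o\<^sub>L b) - (a o\<^sub>L c)"
  by (rule blinfun_eqI) (simp add: blinfun.bilinear_simps)
lemma compose_assoc: "(a o\<^sub>L b) o\<^sub>L c = a o\<^sub>L (b o\<^sub>L c)"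
  by (rule blinfun_eqI) simp
lemma compose_id [simp]: "a o\<^sub>L id_blinfun = a" "id_blinfun o\<^sub>L a = a"
  by (rule blinfun_eqI, simp)+

section \<open>Orthogonal projections, Riesz representation and adjoints\<close>

lemma inner_eqI:
  fixes x y :: "'a::real_inner"
  assumes "\<And>z. inner x z = inner y z" shows "x = y"
  using assms[of "x - y"] by (metis eq_iff_diff_eq_0 inner_diff_left inner_eq_zero_iff)

lemma inner_eqI_right:
  fixes x y :: "'a::real_inner"
  assumes "\<And>z. inner z x = inner z y" shows "x = y"
  by (rule inner_eqI) (metis assms inner_commute)

text \<open>By the parallelogram identity a minimizing sequence for the distance is Cauchy. The
  subspace is only required to be real, because it will also be the orbit of a vector under
  selfadjoint elements.\<close>

lemma ex_orthogonal_projection: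
  fixes L :: "'a::{real_inner,complete_space} set"
  assumes L: "subspace L" "closed L"
  shows "\<exists>v\<in>L. \<forall>w\<in>L. inner (x - v) w = 0"
proof -
  define d where "d = infdist x L"
  have ne: "L \<noteq> {}" using L(1) subspace_0 by auto
  have d0: "d \<ge> 0" unfolding d_def by (rule infdist_nonneg)
  have dle: "d \<le> norm (x - v)" if "v \<in> L" for v
    unfolding d_def using infdist_le[OF that, of x] by (simp add: dist_norm)
  have "\<exists>v\<in>L. norm (x - v) < d + 1 / Suc n" for n
  proof -
    have "infdist x L < d + 1 / Suc n" by (simp add: d_def)
    moreover have "bdd_below (dist x ` L)" by (auto intro: bdd_belowI[of _ 0])
    ultimately show ?thesis
      unfolding infdist_notempty[OF ne] by (simp add: cINF_less_iff[OF ne] dist_norm)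
  qed
  then obtain v where v: "\<And>n. v n \<in> L" "\<And>n. norm (x - v n) < d + 1 / Suc n" by metis
  have par: "(norm (v n - v m))\<^sup>2 \<le> 2 * (norm (x - v n))\<^sup>2 + 2 * (norm (x - v m))\<^sup>2 - 4 * d\<^sup>2" for n m
  proof -
    define w where "w = (1/2) *\<^sub>R (v n + v m)"
    have w: "w \<in> L" unfolding w_def by (intro subspace_mul subspace_add L v)
    have "(norm (v n - v m))\<^sup>2 = 2 * (norm (x - v n))\<^sup>2 + 2 * (norm (x - v m))\<^sup>2 - 4 * (norm (x - w))\<^sup>2"
      unfolding power2_norm_eq_inner w_def
      by (simp add: inner_diff_left inner_diff_right inner_add_left inner_add_right inner_commute field_simps)
    moreover have "d\<^sup>2 \<le> (norm (x - w))\<^sup>2" by (rule power_mono[OF dle[OF w] d0])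
    ultimately show ?thesis by simp
  qed
  have lim: "(\<lambda>n. norm (x - v n)) \<longlonglongrightarrow> d"
  proof (rule tendsto_sandwich[where f = "\<lambda>_. d"])
    show "(\<lambda>n. d + 1 / real (Suc n)) \<longlonglongrightarrow> d"
      using tendsto_add[OF tendsto_const[of d] LIMSEQ_Suc[OF lim_inverse_n']] by simp
    show "\<forall>\<^sub>F n in sequentially. norm (x - v n) \<le> d + 1 / real (Suc n)"
      by (intro always_eventually allI less_imp_le v)
    show "\<forall>\<^sub>F n in sequentially. d \<le> norm (x - v n)"
      by (intro always_eventually allI dle v)
  qed simp
  have "Cauchy v"
  proof (rule metric_CauchyI)
    fix e :: real assume e: "e > 0"
    have "(\<lambda>n. (norm (x - v n))\<^sup>2) \<longlonglongrightarrow> d\<^sup>2" by (intro tendsto_intros lim)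
    then have "\<forall>\<^sub>F n in sequentially. (norm (x - v n))\<^sup>2 < d\<^sup>2 + e\<^sup>2 / 4"
      using e by (intro order_tendstoD(2)) auto
    then obtain K where K: "\<And>n. n \<ge> K \<Longrightarrow> (norm (x - v n))\<^sup>2 < d\<^sup>2 + e\<^sup>2 / 4"
      by (auto simp: eventually_sequentially)
    have "dist (v m) (v n) < e" if "m \<ge> K" "n \<ge> K" for m n
    proof -
      have "(norm (v m - v n))\<^sup>2 < e\<^sup>2" using par[of m n] K[OF that(1)] K[OF that(2)] by linarith
      then show ?thesis using e by (simp add: dist_norm power2_less_imp_less)
    qed
    then show "\<exists>M. \<forall>m\<ge>M. \<forall>n\<ge>M. dist (v m) (v n) < e" by blast
  qed
  then obtain u where u: "v \<longlonglongrightarrow> u" using Cauchy_convergent convergent_def by blast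
  have uL: "u \<in> L" by (rule closed_sequentially[OF L(2)]) (use v u in auto)
  have "(\<lambda>n. norm (x - v n)) \<longlonglongrightarrow> norm (x - u)" by (intro tendsto_intros u)
  then have nu: "norm (x - u) = d" using lim LIMSEQ_unique by blast
  have "inner (x - u) w = 0" if w: "w \<in> L" for w
  proof (rule ccontr)
    assume ne0: "inner (x - u) w \<noteq> 0"
    then have w0: "inner w w > 0" by auto
    \<comment> \<open>The minimizer of the quadratic polynomial given by the squared distance from
      \<open>x\<close> to \<open>u + t w\<close>.\<close>
    define t where "t = inner (x - u) w / inner w w"
    have "u + t *\<^sub>R w \<in> L" by (intro subspace_add subspace_mul L uL w)
    from power_mono[OF dle[OF this] d0, of 2]
    have "(norm (x - u))\<^sup>2 \<le> (norm (x - u - t *\<^sub>R w))\<^sup>2" by (simp add: nu algebra_simps)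
    also have "\<dots> = (norm (x - u))\<^sup>2 - 2 * t * inner (x - u) w + t\<^sup>2 * inner w w"
      unfolding power2_norm_eq_inner
      by (simp add: inner_diff_left inner_diff_right inner_commute power2_eq_square algebra_simps)
    also have "\<dots> = (norm (x - u))\<^sup>2 - (inner (x - u) w)\<^sup>2 / inner w w"
      using w0 by (simp add: t_def power2_eq_square field_simps)
    finally have "(inner (x - u) w)\<^sup>2 / inner w w \<le> 0" by simp
    then show False using w0 ne0 by (simp add: divide_le_0_iff)
  qed
  then show ?thesis using uL by blast
qed

lemma riesz_representation:
  fixes f :: "'a::{real_inner,complete_space} \<Rightarrow> real"
  assumes f: "bounded_linear f"
  shows "\<exists>z. \<forall>x. f x = inner x z"
proof (cases "\<forall>x. f x = 0")
  case True
  then show ?thesis by (intro exI[of _ 0]) simp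
next
  case False
  then obtain x0 where x0: "f x0 \<noteq> 0" by blast
  interpret bounded_linear f by fact
  define L where "L = {x. f x = 0}"
  have "subspace L" unfolding L_def subspace_def by (simp add: add scaleR zero)
  moreover have "closed L" unfolding L_def
    by (intro closed_Collect_eq continuous_on continuous_on_const continuous_on_id)
  ultimately obtain v where v: "v \<in> L" "\<And>w. w \<in> L \<Longrightarrow> inner (x0 - v) w = 0"
    using ex_orthogonal_projection[of L x0] by blast
  define e where "e = x0 - v"
  have fe: "f e = f x0" using v by (simp add: e_def diff L_def)
  then have e0: "inner e e \<noteq> 0" using x0 zero by (metis inner_eq_zero_iff)
  have "f x = inner x ((f e / inner e e) *\<^sub>R e)" for x
  proof -
    have "x - (f x / f e) *\<^sub>R e \<in> L" using fe x0 by (simp add: L_def diff scaleR)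
    from v(2)[OF this] have "inner e x = (f x / f e) * inner e e"
      by (simp add: inner_diff_right flip: e_def)
    then show ?thesis using fe x0 e0 by (simp add: inner_commute)
  qed
  then show ?thesis by blast
qed

text \<open>Apart from adjoints, this produces weak limits of operators: limits of forms along an
  ultrafilter are again bounded forms.\<close>

lemma riesz_operator:
  fixes B :: "'a::{real_inner,complete_space} \<Rightarrow> 'a \<Rightarrow> real"
  assumes add: "\<And>x y z. B (x + y) z = B x z + B y z"
    and scale: "\<And>r x z. B (r *\<^sub>R x) z = r * B x z"
    and add': "\<And>x y z. B x (y + z) = B x y + B x z"
    and scale': "\<And>r x z. B x (r *\<^sub>R z) = r * B x z"
    and bound: "\<And>x y. \<bar>B x y\<bar> \<le> K * norm x * norm y"
  obtains S :: "'a \<Rightarrow>\<^sub>L 'a" where "\<And>x y. inner (S x) y = B x y"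
proof -
  have "\<exists>z. \<forall>y. B x y = inner y z" for x
  proof (rule riesz_representation, rule bounded_linear_intro[of _ "K * norm x"])
    show "norm (B x y) \<le> norm y * (K * norm x)" for y using bound[of x y] by (simp add: mult_ac)
  qed (simp_all add: add' scale')
  then obtain S where S: "\<And>x y. B x y = inner y (S x)" by metis
  have "bounded_linear S"
  proof (rule bounded_linear_intro[of _ K])
    show "S (x + y) = S x + S y" for x y
      by (rule inner_eqI_right) (simp add: inner_add_right add flip: S)
    show "S (r *\<^sub>R x) = r *\<^sub>R S x" for r x
      by (rule inner_eqI_right) (simp add: scale flip: S)
    show "norm (S x) \<le> norm x * K" for x
    proof (cases "S x = 0")
      case True
      have "0 \<le> norm x * K"
      proof (cases "x = 0")
        case False
        have "0 \<le> K * (norm x * norm x)" using bound[of x x] by (simp add: mult.assoc)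
        then have "0 \<le> K" using False by (simp add: zero_le_mult_iff flip: power2_eq_square)
        then show ?thesis by simp
      qed simp
      then show ?thesis using True by simp
    next
      case False
      have "norm (S x) * norm (S x) = B x (S x)"
        by (simp add: S flip: power2_norm_eq_inner power2_eq_square)
      also have "\<dots> \<le> norm x * K * norm (S x)" using bound[of x "S x"] by (simp add: mult_ac)
      finally show ?thesis using False by simp
    qed
  qed
  then have "\<And>x y. inner (Blinfun S x) y = B x y"
    by (simp add: bounded_linear_Blinfun_apply S inner_commute)
  then show thesis using that by blast
qed

lemma ex_adjoint:
  fixes T :: "'a::{real_inner,complete_space} \<Rightarrow>\<^sub>L 'a"
  shows "\<exists>S :: 'a \<Rightarrow>\<^sub>L 'a. \<forall>x y. inner (T x) y = inner x (S y)"
proof -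
  obtain S :: "'a \<Rightarrow>\<^sub>L 'a" where S: "\<And>x y. inner (S x) y = inner x (T y)"
  proof (rule riesz_operator[of "\<lambda>x y. inner x (T y)" "norm T"])
    show "\<bar>inner x (T y)\<bar> \<le> norm T * norm x * norm y" for x y
      using Cauchy_Schwarz_ineq2[of x "T y"] mult_left_mono[OF norm_blinfun[of T y] norm_ge_zero[of x]]
      by (simp add: mult_ac)
  qed (auto simp: inner_add_left inner_add_right blinfun.bilinear_simps)
  have "inner (T x) y = inner x (S y)" for x y
    using S[of y x] by (simp only: inner_commute)
  then show ?thesis by blast
qed

text \<open>The witness for the definite description in \<open>star\<close> is the adjoint for the
  real inner product. Complex linearity of \<open>T\<close> makes it an adjoint for
  \<open>cinner\<close> too, since the imaginary part is a real inner product with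
  \<open>\<i>\<close> times the vector.\<close>

lemma star_props:
  fixes T :: "'h::chilbert_space op"
  assumes T: "T \<in> bounded_ops"
  shows star_cinner: "cinner (T x) y = cinner x (star T y)"
    and star_inner: "inner (T x) y = inner x (star T y)"
proof -
  obtain S :: "'h op" where S: "\<And>x y. inner (T x) y = inner x (S y)" using ex_adjoint[of T] by blast
  have i: "\<i> *\<^sub>C T x = T (\<i> *\<^sub>C x)" for x using T by (simp add: bounded_ops_iff)
  have c: "cinner (T x) y = cinner x (S y)" for x y by (rule cinner_eqI) (simp_all add: S i)
  have "star T = S" unfolding star_def
  proof (rule the_equality)
    show "\<forall>x y. cinner (T x) y = cinner x (S y)" by (simp add: c)
    fix S' :: "'h op" assume S': "\<forall>x y. cinner (T x) y = cinner x (S' y)"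
    have "inner x (S' y) = inner x (S y)" for x y
      using S'[rule_format, of x y] c[of x y] by (simp flip: Re_cinner)
    show "S' = S" by (rule blinfun_eqI, rule inner_eqI_right) fact
  qed
  with c S show "cinner (T x) y = cinner x (star T y)" "inner (T x) y = inner x (star T y)"
    by simp_all
qed

lemma star_inner_left:
  assumes "T \<in> bounded_ops" shows "inner (star T x) y = inner x (T y)"
proof -
  have "inner x (T y) = inner (T y) x" by (rule inner_commute)
  also have "\<dots> = inner y (star T x)" by (rule star_inner[OF assms])
  finally show ?thesis by (simp only: inner_commute)
qed

lemma star_unique:
  fixes S T :: "'h::chilbert_space op"
  assumes T: "T \<in> bounded_ops" and "\<And>x y. inner (T x) y = inner x (S y)"
  shows "star T = S"
  by (rule blinfun_eqI, rule inner_eqI_right) (simp flip: star_inner[OF T] add: assms(2))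

lemma star_bounded_ops [simp, intro]: assumes T: "T \<in> bounded_ops" shows "star T \<in> bounded_ops"
  unfolding bounded_ops_iff
proof (intro allI)
  fix c x
  show "star T (c *\<^sub>C x) = c *\<^sub>C star T x"
  proof (rule inner_eqI)
    fix z
    have "inner (star T (c *\<^sub>C x)) z = inner x (cnj c *\<^sub>C T z)"
      by (simp add: star_inner_left[OF T] inner_scaleC_left)
    also have "\<dots> = inner (c *\<^sub>C star T x) z"
      using T by (simp add: inner_scaleC_left star_inner_left bounded_ops_iff)
    finally show "inner (star T (c *\<^sub>C x)) z = inner (c *\<^sub>C star T x) z" .
  qed
qed

lemma bounded_ops_closure [simp, intro]:
  "id_blinfun \<in> bounded_ops" "0 \<in> bounded_ops"
  "a \<in> bounded_ops \<Longrightarrow> b \<in> bounded_ops \<Longrightarrow> a + b \<in> bounded_ops"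
  "a \<in> bounded_ops \<Longrightarrow> b \<in> bounded_ops \<Longrightarrow> a - b \<in> bounded_ops"
  "a \<in> bounded_ops \<Longrightarrow> b \<in> bounded_ops \<Longrightarrow> a o\<^sub>L b \<in> bounded_ops"
  "a \<in> bounded_ops \<Longrightarrow> r *\<^sub>R a \<in> bounded_ops"
  "a \<in> bounded_ops \<Longrightarrow> - a \<in> bounded_ops"
  "a \<in> bounded_ops \<Longrightarrow> cscale c a \<in> bounded_ops"
  by (auto simp: linear_simps(4)[OF bounded_linear_scaleC] bounded_ops_iff blinfun.bilinear_simps scaleC_add_right scaleC_diff_right
      scaleC_scaleR scaleC_scaleC mult.commute)

lemma star_star [simp]: "T \<in> bounded_ops \<Longrightarrow> star (star T) = T"
  by (rule star_unique) (auto simp: star_inner_left)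

lemma star_add: "a \<in> bounded_ops \<Longrightarrow> b \<in> bounded_ops \<Longrightarrow> star (a + b) = star a + star b"
  by (rule star_unique) (auto simp: blinfun.bilinear_simps inner_add_left inner_add_right star_inner)
lemma star_diff: "a \<in> bounded_ops \<Longrightarrow> b \<in> bounded_ops \<Longrightarrow> star (a - b) = star a - star b"
  by (rule star_unique) (auto simp: blinfun.bilinear_simps inner_diff_left inner_diff_right star_inner)
lemma star_scaleR: "a \<in> bounded_ops \<Longrightarrow> star (r *\<^sub>R a) = r *\<^sub>R star a"
  by (rule star_unique) (auto simp: blinfun.bilinear_simps star_inner)
lemma star_compose: "a \<in> bounded_ops \<Longrightarrow> b \<in> bounded_ops \<Longrightarrow> star (a o\<^sub>L b) = star b o\<^sub>L star a"
  by (rule star_unique) (auto simp: star_inner)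
lemma star_id [simp]: "star id_blinfun = id_blinfun" by (rule star_unique) auto
lemma star_zero [simp]: "star 0 = 0" by (rule star_unique) auto
lemma star_cscale: "a \<in> bounded_ops \<Longrightarrow> star (cscale c a) = cscale (cnj c) (star a)"
  using star_bounded_ops[of a]
  by (intro star_unique) (auto simp: inner_scaleC_left star_inner bounded_ops_iff scaleC_scaleC mult.commute)

lemma norm_star_le: assumes T: "T \<in> bounded_ops" shows "norm (star T) \<le> norm T"
proof (rule norm_blinfun_bound)
  fix x
  have "norm (star T x) * norm (star T x) = inner (T (star T x)) x"
    by (simp add: star_inner[OF T] flip: power2_norm_eq_inner power2_eq_square)
  also have "\<dots> \<le> norm (T (star T x)) * norm x" by (rule norm_cauchy_schwarz)
  also have "\<dots> \<le> (norm T * norm (star T x)) * norm x" by (intro mult_right_mono norm_blinfun) simp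
  finally show "norm (star T x) \<le> norm T * norm x"
    by (cases "star T x = 0") (auto simp: mult_ac)
qed simp

lemma norm_star: "T \<in> bounded_ops \<Longrightarrow> norm (star T) = norm T"
  using norm_star_le[of T] norm_star_le[of "star T"] by simp

lemma star_norm_sq: "T \<in> bounded_ops \<Longrightarrow> inner ((star T o\<^sub>L T) x) x = (norm (T x))\<^sup>2"
  by (simp add: star_inner_left power2_norm_eq_inner)

lemma abs_inner_op_le:
  fixes T :: "'a::real_inner \<Rightarrow>\<^sub>L 'a"
  shows "\<bar>inner (T x) y\<bar> \<le> norm T * norm x * norm y"
  by (meson Cauchy_Schwarz_ineq2 mult_right_mono norm_blinfun norm_ge_zero order_trans)

lemma blinfun_eq_inner:
  fixes S T :: "'a::real_normed_vector \<Rightarrow>\<^sub>L 'b::real_inner"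
  assumes "\<And>x y. inner (S x) y = inner (T x) y" shows "S = T"
  by (rule blinfun_eqI, rule inner_eqI) (rule assms)

lemma bounded_ops_if_inner:
  fixes S :: "'h::chilbert_space op"
  assumes "\<And>c x y. inner (S (c *\<^sub>C x)) y = inner (S x) (cnj c *\<^sub>C y)"
  shows "S \<in> bounded_ops"
  unfolding bounded_ops_iff by (intro allI, rule inner_eqI) (simp add: inner_scaleC_left assms)

text \<open>Testing against the multiple of \<open>y \<xi>\<close> that has the length of
  \<open>\<xi>\<close> makes the arithmetic mean equal to the product of the norms, so no factor is
  lost. Averages by families of projections satisfy exactly this kind of bound.\<close>

lemma norm_le_of_quadratic:
  fixes y :: "'a::real_inner \<Rightarrow>\<^sub>L 'a"
  assumes c: "c \<ge> 0" and q: "\<And>\<xi> \<eta>. inner (y \<xi>) \<eta> \<le> c * (((norm \<xi>)\<^sup>2 + (norm \<eta>)\<^sup>2) / 2)"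
  shows "norm y \<le> c"
proof (rule norm_blinfun_bound[OF c])
  fix \<xi>
  show "norm (y \<xi>) \<le> c * norm \<xi>"
  proof (cases "\<xi> = 0 \<or> y \<xi> = 0")
    case True then show ?thesis using c by auto
  next
    case False
    then have pos: "norm \<xi> > 0" "norm (y \<xi>) > 0" by auto
    define r where "r = norm \<xi> / norm (y \<xi>)"
    have n: "norm (r *\<^sub>R y \<xi>) = norm \<xi>" using pos by (simp add: r_def)
    have "norm \<xi> * norm (y \<xi>) = inner (y \<xi>) (r *\<^sub>R y \<xi>)"
      using pos by (simp add: r_def power2_eq_square flip: power2_norm_eq_inner)
    also have "\<dots> \<le> c * (norm \<xi>)\<^sup>2" using q[of \<xi> "r *\<^sub>R y \<xi>"] unfolding n by simp
    finally have "norm \<xi> * norm (y \<xi>) \<le> norm \<xi> * (c * norm \<xi>)" by (simp add: power2_eq_square mult_ac)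
    then show ?thesis using pos by simp
  qed
qed

section \<open>Square-summable families\<close>

lift_definition ell2_single :: "'i \<Rightarrow> 'h::chilbert_space \<Rightarrow> ('i, 'h) ell2"
  is "\<lambda>t h s. if s = t then h else 0"
proof -
  fix t :: 'i and h :: 'h
  have "(\<lambda>s. (norm (if s = t then h else 0))\<^sup>2) summable_on {t}" by simp
  then show "(\<lambda>s. (norm (if s = t then h else 0))\<^sup>2) summable_on UNIV"
    by (rule summable_on_cong_neutral[THEN iffD1, rotated -1]) auto
qed

lemma ell2_single_apply: "ell2_fun (ell2_single t h) s = (if s = t then h else 0)"
  by (simp add: ell2_single.rep_eq)

lemma ell2_eqI: "(\<And>t. ell2_fun x t = ell2_fun y t) \<Longrightarrow> x = y"
  by (metis ell2_fun_inject ext)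

lemma inner_single_left: "inner (ell2_single t h) x = inner h (ell2_fun x t)"
proof -
  have "inner (ell2_single t h) x = (\<Sum>\<^sub>\<infinity>s. inner (if s = t then h else 0) (ell2_fun x s))"
    by (simp add: inner_ell2_def ell2_single_apply)
  also have "\<dots> = (\<Sum>\<^sub>\<infinity>s\<in>{t}. inner h (ell2_fun x s))"
    by (rule infsum_cong_neutral) auto
  finally show ?thesis by simp
qed

lemma inner_single_right: "inner x (ell2_single t h) = inner (ell2_fun x t) h"
  by (metis inner_commute inner_single_left)

lemma norm_single [simp]: "norm (ell2_single t h) = norm h"
  by (simp add: norm_eq_sqrt_inner inner_single_left ell2_single_apply)

lemma scaleC_single: "c *\<^sub>C ell2_single t h = ell2_single t (c *\<^sub>C h)"
  by (rule ell2_eqI) (simp add: scaleC_ell2.rep_eq ell2_single_apply)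

lemma add_single: "ell2_single t (h + k) = ell2_single t h + ell2_single t k"
  by (rule ell2_eqI) (simp add: plus_ell2.rep_eq ell2_single_apply)

lemma bounded_linear_single: "bounded_linear (ell2_single t)"
  by (rule bounded_linear_intro[of _ 1])
    (auto simp: add_single intro!: ell2_eqI simp: scaleR_ell2.rep_eq ell2_single_apply)

lemma bounded_linear_ell2_fun: "bounded_linear (\<lambda>x. ell2_fun x t)"
  by (rule bounded_linear_intro[of _ 1])
    (auto simp: plus_ell2.rep_eq scaleR_ell2.rep_eq ell2_component_le)

text \<open>Taking adjoints avoids the density of finitely supported vectors: the coordinates of an
  adjoint are determined by the operator on vectors supported at one point.\<close>

lemma ell2_op_eqI:
  fixes S T :: "('i, 'h::chilbert_space) ell2 op"
  assumes "\<And>s t h. ell2_fun (S (ell2_single t h)) s = ell2_fun (T (ell2_single t h)) s"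
  shows "S = T"
proof -
  obtain S' :: "('i, 'h) ell2 op" where S': "\<And>x y. inner (S x) y = inner x (S' y)" using ex_adjoint[of S] by blast
  obtain T' :: "('i, 'h) ell2 op" where T': "\<And>x y. inner (T x) y = inner x (T' y)" using ex_adjoint[of T] by blast
  have eq: "S (ell2_single t h) = T (ell2_single t h)" for t h by (rule ell2_eqI) (rule assms)
  have "S' y = T' y" for y
  proof (rule ell2_eqI, rule inner_eqI_right)
    fix t and h :: 'h
    show "inner h (ell2_fun (S' y) t) = inner h (ell2_fun (T' y) t)"
      by (simp flip: inner_single_left S' T' add: eq)
  qed
  then show ?thesis by (intro blinfun_eq_inner) (simp add: S' T')
qed

section \<open>Diagonal operators and amplifications\<close>

definition diag_op :: "('i \<Rightarrow> 'h op) \<Rightarrow> ('i, 'h::chilbert_space) ell2 op" where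
  "diag_op f = Blinfun (\<lambda>\<xi>. Abs_ell2 (\<lambda>t. f t (ell2_fun \<xi> t)))"

text \<open>The operator \<open>a\<close> tensored with the identity. A sequence of vectors becomes
  a single vector, and simultaneous convergence on the sequence is captured by convergence at that
  vector.\<close>

definition amp :: "'h op \<Rightarrow> ('i, 'h::chilbert_space) ell2 op" where
  "amp a = diag_op (\<lambda>_. a)"

lemma diag_op_summable:
  fixes f :: "'i \<Rightarrow> 'h::chilbert_space op"
  assumes "\<And>t. norm (f t) \<le> K"
  shows "(\<lambda>t. (norm (f t (ell2_fun \<xi> t)))\<^sup>2) summable_on UNIV"
    and "(\<Sum>\<^sub>\<infinity>t. (norm (f t (ell2_fun \<xi> t)))\<^sup>2) \<le> (K * norm \<xi>)\<^sup>2"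
proof -
  have le: "(norm (f t (ell2_fun \<xi> t)))\<^sup>2 \<le> K\<^sup>2 * (norm (ell2_fun \<xi> t))\<^sup>2" for t
    unfolding power_mult_distrib[symmetric]
    by (intro power_mono order_trans[OF norm_blinfun] mult_right_mono assms) auto
  have s: "(\<lambda>t. K\<^sup>2 * (norm (ell2_fun \<xi> t))\<^sup>2) summable_on UNIV"
    by (intro summable_on_cmult_right ell2_summable)
  show 1: "(\<lambda>t. (norm (f t (ell2_fun \<xi> t)))\<^sup>2) summable_on UNIV"
    by (rule summable_on_comparison_test[OF s]) (use le in auto)
  have "(\<Sum>\<^sub>\<infinity>t. (norm (f t (ell2_fun \<xi> t)))\<^sup>2) \<le> (\<Sum>\<^sub>\<infinity>t. K\<^sup>2 * (norm (ell2_fun \<xi> t))\<^sup>2)"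
    by (rule infsum_mono[OF 1 s]) (rule le)
  also have "\<dots> = (K * norm \<xi>)\<^sup>2"
    by (simp add: infsum_cmult_right ell2_summable ell2_norm_sq power_mult_distrib)
  finally show "(\<Sum>\<^sub>\<infinity>t. (norm (f t (ell2_fun \<xi> t)))\<^sup>2) \<le> (K * norm \<xi>)\<^sup>2" .
qed

lemma diag_op_aux:
  fixes f :: "'i \<Rightarrow> 'h::chilbert_space op"
  assumes K: "\<And>t. norm (f t) \<le> K"
  shows diag_op_apply: "ell2_fun (diag_op f \<xi>) t = f t (ell2_fun \<xi> t)"
    and norm_diag_op: "norm (diag_op f) \<le> K"
proof -
  have K0: "0 \<le> K" using K norm_ge_zero order_trans by blast
  define g where "g = (\<lambda>\<xi>. Abs_ell2 (\<lambda>t. f t (ell2_fun \<xi> t)))"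
  have g: "ell2_fun (g \<xi>) t = f t (ell2_fun \<xi> t)" for \<xi> t
    unfolding g_def by (subst Abs_ell2_inverse) (use diag_op_summable(1)[of f K] K in auto)
  have ng: "norm (g \<xi>) \<le> K * norm \<xi>" for \<xi>
  proof (rule power2_le_imp_le)
    show "(norm (g \<xi>))\<^sup>2 \<le> (K * norm \<xi>)\<^sup>2"
      using diag_op_summable(2)[of f K \<xi>] K by (simp add: ell2_norm_sq g)
  qed (use K0 in simp)
  have "bounded_linear g"
  proof (rule bounded_linear_intro[of _ K])
    show "norm (g x) \<le> norm x * K" for x using ng[of x] by (simp add: mult.commute)
  qed (auto intro!: ell2_eqI simp: g plus_ell2.rep_eq scaleR_ell2.rep_eq blinfun.bilinear_simps)
  then have a: "diag_op f \<xi> = g \<xi>" for \<xi>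
    unfolding diag_op_def g_def[symmetric] by (simp add: bounded_linear_Blinfun_apply)
  show "ell2_fun (diag_op f \<xi>) t = f t (ell2_fun \<xi> t)" by (simp add: a g)
  show "norm (diag_op f) \<le> K" by (rule norm_blinfun_bound) (use K0 ng a in auto)
qed

lemma diag_op_single:
  fixes f :: "'i \<Rightarrow> 'h::chilbert_space op"
  shows "(\<And>t. norm (f t) \<le> K) \<Longrightarrow> diag_op f (ell2_single t h) = ell2_single t (f t h)"
  by (rule ell2_eqI) (auto simp: diag_op_apply[of f K] ell2_single_apply)

lemma diag_op_bounded_ops:
  fixes f :: "'i \<Rightarrow> 'h::chilbert_space op"
  shows "(\<And>t. norm (f t) \<le> K) \<Longrightarrow> (\<And>t. f t \<in> bounded_ops) \<Longrightarrow> diag_op f \<in> bounded_ops"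
  unfolding bounded_ops_iff by (auto intro!: ell2_eqI simp: diag_op_apply[of f K] scaleC_ell2.rep_eq)

lemma star_diag_op:
  fixes f :: "'i \<Rightarrow> 'h::chilbert_space op"
  assumes K: "\<And>t. norm (f t) \<le> K" and f: "\<And>t. f t \<in> bounded_ops"
  shows "star (diag_op f) = diag_op (\<lambda>t. star (f t))"
proof (rule star_unique)
  have K': "\<And>t. norm (star (f t)) \<le> K" using K f by (simp add: norm_star)
  show "inner (diag_op f x) y = inner x (diag_op (\<lambda>t. star (f t)) y)" for x y
    unfolding inner_ell2_def
    by (simp add: diag_op_apply[of f, OF K] diag_op_apply[of "\<lambda>t. star (f t)", OF K'] star_inner[OF f])
qed (use diag_op_bounded_ops K f in blast)

lemma amp_apply [simp]: "ell2_fun (amp a \<xi>) t = a (ell2_fun \<xi> t)"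
  unfolding amp_def by (rule diag_op_apply[of _ "norm a"]) simp
lemma amp_single [simp]: "amp a (ell2_single t h) = ell2_single t (a h)"
  by (rule ell2_eqI) (simp add: ell2_single_apply)
lemma amp_bounded_ops [simp, intro]: "a \<in> bounded_ops \<Longrightarrow> amp a \<in> bounded_ops"
  unfolding amp_def by (rule diag_op_bounded_ops[of _ "norm a"]) auto
lemma star_amp: "a \<in> bounded_ops \<Longrightarrow> star (amp a) = amp (star a)"
  unfolding amp_def by (rule star_diag_op[of _ "norm a"]) auto
lemma norm_amp: "norm (amp a) \<le> norm a"
  unfolding amp_def by (rule norm_diag_op) simp
lemma amp_add: "amp (a + b) = amp a + amp b"
  by (intro blinfun_eqI ell2_eqI) (simp add: blinfun.bilinear_simps plus_ell2.rep_eq)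
lemma amp_diff: "amp (a - b) = amp a - amp b"
  by (intro blinfun_eqI ell2_eqI) (simp add: blinfun.bilinear_simps minus_ell2.rep_eq)
lemma amp_scaleR: "amp (r *\<^sub>R a) = r *\<^sub>R amp a"
  by (intro blinfun_eqI ell2_eqI) (simp add: blinfun.bilinear_simps scaleR_ell2.rep_eq)
lemma amp_compose: "amp (a o\<^sub>L b) = amp a o\<^sub>L amp b"
  by (intro blinfun_eqI ell2_eqI) simp
lemma amp_cscale: "amp (cscale c a) = cscale c (amp a)"
  by (intro blinfun_eqI ell2_eqI) (simp add: scaleC_ell2.rep_eq)
lemma amp_id [simp]: "amp id_blinfun = id_blinfun"
  by (intro blinfun_eqI ell2_eqI) simp
lemma amp_inj: "amp a = (amp b :: ('i, 'h::chilbert_space) ell2 op) \<longleftrightarrow> a = b"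
proof
  assume *: "amp a = (amp b :: ('i, 'h) ell2 op)"
  have "a h = b h" for h
    using arg_cong[OF *, of "\<lambda>T. ell2_fun (T (ell2_single undefined h)) undefined"]
    by (simp add: ell2_single_apply)
  then show "a = b" by (rule blinfun_eqI)
qed simp

section \<open>Operator matrices\<close>

definition entry :: "('i, 'h::chilbert_space) ell2 op \<Rightarrow> 'i \<Rightarrow> 'i \<Rightarrow> 'h op" where
  "entry T s t = Blinfun (\<lambda>h. ell2_fun (T (ell2_single t h)) s)"

lemma entry_apply: "entry T s t h = ell2_fun (T (ell2_single t h)) s"
  unfolding entry_def
  by (subst bounded_linear_Blinfun_apply)
    (auto intro!: bounded_linear_compose[OF bounded_linear_ell2_fun]
      bounded_linear_compose[OF blinfun.bounded_linear_right] bounded_linear_single)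

lemma inner_entry: "inner (entry T s t h) k = inner (T (ell2_single t h)) (ell2_single s k)"
  by (simp add: inner_single_right entry_apply)

lemma norm_entry: "norm (entry T s t) \<le> norm T"
proof (rule norm_blinfun_bound)
  show "norm (entry T s t h) \<le> norm T * norm h" for h
    unfolding entry_apply
    by (rule order_trans[OF ell2_component_le]) (use norm_blinfun[of T "ell2_single t h"] in simp)
qed simp

lemma entry_bounded_ops: "T \<in> bounded_ops \<Longrightarrow> entry T s t \<in> bounded_ops"
  unfolding bounded_ops_iff by (simp add: entry_apply scaleC_ell2.rep_eq flip: scaleC_single)

lemma entry_eqI: "(\<And>s t. entry S s t = entry T s t) \<Longrightarrow> S = T"
  by (rule ell2_op_eqI) (metis entry_apply)

lemma entry_add: "entry (S + T) s t = entry S s t + entry T s t"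
  by (rule blinfun_eqI) (simp add: entry_apply blinfun.bilinear_simps plus_ell2.rep_eq)

lemma entry_diag_op:
  fixes f :: "'i \<Rightarrow> 'h::chilbert_space op"
  shows "(\<And>t. norm (f t) \<le> K) \<Longrightarrow> entry (diag_op f) s t = (if s = t then f t else 0)"
  by (rule blinfun_eqI) (auto simp: entry_apply diag_op_single[of f K] ell2_single_apply)

text \<open>The matrix product converges only weakly, hence the pairing with \<open>h\<close> and
  \<open>k\<close>: the sum is the coordinate expansion of the inner product of
  \<open>T (ell2_single t h)\<close> with \<open>star S (ell2_single s k)\<close>.\<close>

lemma entry_compose_has_sum:
  fixes S T :: "('i, 'h::chilbert_space) ell2 op"
  assumes S: "S \<in> bounded_ops"
  shows "((\<lambda>r. inner ((entry S s r o\<^sub>L entry T r t) h) k) has_sum inner (entry (S o\<^sub>L T) s t h) k) UNIV"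
proof -
  define x where "x = T (ell2_single t h)"
  define y where "y = star S (ell2_single s k)"
  have "inner ((entry S s r o\<^sub>L entry T r t) h) k = inner (ell2_fun x r) (ell2_fun y r)" for r
  proof -
    have "inner ((entry S s r o\<^sub>L entry T r t) h) k = inner (entry S s r (ell2_fun x r)) k"
      by (simp add: x_def entry_apply)
    also have "\<dots> = inner (ell2_single r (ell2_fun x r)) y"
      by (simp add: inner_entry star_inner[OF S] y_def)
    finally show ?thesis by (simp add: inner_single_left)
  qed
  moreover have "inner (entry (S o\<^sub>L T) s t h) k = inner x y"
    by (simp add: inner_entry star_inner[OF S] x_def y_def)
  moreover have "((\<lambda>r. inner (ell2_fun x r) (ell2_fun y r)) has_sum inner x y) UNIV"
    unfolding inner_ell2_def by (rule has_sum_infsum[OF ell2_inner_summable])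
  ultimately show ?thesis by simp
qed

section \<open>Commutants and density\<close>

definition star_alg :: "'h::chilbert_space op set \<Rightarrow> bool" where
  "star_alg A \<longleftrightarrow> A \<subseteq> bounded_ops \<and> id_blinfun \<in> A \<and> (\<forall>a\<in>A. \<forall>b\<in>A. a + b \<in> A \<and> a o\<^sub>L b \<in> A)
     \<and> (\<forall>a\<in>A. star a \<in> A) \<and> (\<forall>a\<in>A. \<forall>c. cscale c a \<in> A)"

lemma star_algD:
  assumes "star_alg A"
  shows "a \<in> A \<Longrightarrow> a \<in> bounded_ops" "id_blinfun \<in> A" "a \<in> A \<Longrightarrow> b \<in> A \<Longrightarrow> a + b \<in> A"
    "a \<in> A \<Longrightarrow> b \<in> A \<Longrightarrow> a o\<^sub>L b \<in> A" "a \<in> A \<Longrightarrow> star a \<in> A" "a \<in> A \<Longrightarrow> cscale c a \<in> A"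
    "a \<in> A \<Longrightarrow> r *\<^sub>R a \<in> A" "0 \<in> A" "a \<in> A \<Longrightarrow> - a \<in> A" "a \<in> A \<Longrightarrow> b \<in> A \<Longrightarrow> a - b \<in> A"
proof -
  show 1: "a \<in> A \<Longrightarrow> a \<in> bounded_ops" "id_blinfun \<in> A" "a \<in> A \<Longrightarrow> b \<in> A \<Longrightarrow> a + b \<in> A"
    "a \<in> A \<Longrightarrow> b \<in> A \<Longrightarrow> a o\<^sub>L b \<in> A" "a \<in> A \<Longrightarrow> star a \<in> A" "a \<in> A \<Longrightarrow> cscale c a \<in> A" for a b c
    using assms by (auto simp: star_alg_def)
  show 2: "a \<in> A \<Longrightarrow> r *\<^sub>R a \<in> A" for a r using 1(6)[of a "of_real r"] by (simp add: cscale_of_real)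
  show "0 \<in> A" using 2[OF 1(2), of 0] by simp
  show 3: "a \<in> A \<Longrightarrow> - a \<in> A" for a using 2[of a "-1"] by simp
  show "a \<in> A \<Longrightarrow> b \<in> A \<Longrightarrow> a - b \<in> A" using 1(3)[of a "- b"] 3[of b] by simp
qed

lemma star_alg_sum: "star_alg A \<Longrightarrow> (\<And>i. i \<in> F \<Longrightarrow> f i \<in> A) \<Longrightarrow> sum f F \<in> A"
  by (induction F rule: infinite_finite_induct) (auto intro: star_algD)

lemma star_alg_bounded_ops: "star_alg bounded_ops"
  by (auto simp: star_alg_def)

lemma commutant_bounded_ops: "commutant S \<subseteq> bounded_ops"
  by (auto simp: commutant_def)

lemma commutant_antimono: "S \<subseteq> T \<Longrightarrow> commutant T \<subseteq> commutant S"
  by (auto simp: commutant_def)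

lemma subset_bicommutant: "S \<subseteq> bounded_ops \<Longrightarrow> S \<subseteq> commutant (commutant S)"
  by (auto simp: commutant_def)

lemma commutant3: "S \<subseteq> bounded_ops \<Longrightarrow> commutant (commutant (commutant S)) = commutant S"
  by (intro antisym commutant_antimono subset_bicommutant commutant_bounded_ops)

lemma commutant_star_alg:
  assumes S: "S \<subseteq> bounded_ops" "\<And>a. a \<in> S \<Longrightarrow> star a \<in> S"
  shows "star_alg (commutant S)"
proof -
  have st: "star T \<in> commutant S" if T: "T \<in> commutant S" for T
  proof -
    have TB: "T \<in> bounded_ops" using T by (simp add: commutant_def)
    have "star T o\<^sub>L a = a o\<^sub>L star T" if a: "a \<in> S" for a
    proof -
      have aB: "a \<in> bounded_ops" using a S by blast
      have "star (star a o\<^sub>L T) = star (T o\<^sub>L star a)"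
        using T S(2)[OF a] by (simp add: commutant_def)
      then show ?thesis using aB TB by (simp add: star_compose)
    qed
    then show ?thesis using TB by (simp add: commutant_def)
  qed
  have cp: "a o\<^sub>L b \<in> commutant S" if "a \<in> commutant S" "b \<in> commutant S" for a b
    using that by (auto simp: commutant_def compose_assoc) (simp flip: compose_assoc)
  have sc: "cscale c T \<in> commutant S" if T: "T \<in> commutant S" for T c
  proof -
    have "cscale c T o\<^sub>L a = a o\<^sub>L cscale c T" if a: "a \<in> S" for a
    proof (rule blinfun_eqI)
      fix x
      have "(T o\<^sub>L a) x = (a o\<^sub>L T) x" using T a by (simp add: commutant_def)
      moreover have "a (c *\<^sub>C T x) = c *\<^sub>C a (T x)" using S(1) a by (auto simp: bounded_ops_iff)
      ultimately show "(cscale c T o\<^sub>L a) x = (a o\<^sub>L cscale c T) x" by simp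
    qed
    then show ?thesis using T by (simp add: commutant_def)
  qed
  show ?thesis unfolding star_alg_def
    using st cp sc by (auto simp: commutant_def compose_add_left compose_add_right)
qed

lemma von_neumann_algebra_commutant:
  assumes S: "S \<subseteq> bounded_ops" "\<And>a. a \<in> S \<Longrightarrow> star a \<in> S"
  shows "von_neumann_algebra (commutant S)"
  using commutant_star_alg[OF S] commutant3[OF S(1)]
  by (auto simp: von_neumann_algebra_def star_alg_def)

lemma von_neumann_algebra_bicommutant:
  assumes S: "S \<subseteq> bounded_ops" "\<And>a. a \<in> S \<Longrightarrow> star a \<in> S"
  shows "von_neumann_algebra (commutant (commutant S))"
  by (rule von_neumann_algebra_commutant[OF commutant_bounded_ops])
    (rule star_algD(5)[OF commutant_star_alg[OF S]])

lemma vn_star_alg: assumes M: "von_neumann_algebra M" shows "star_alg M"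
proof -
  have "star_alg (commutant M)" using M by (intro commutant_star_alg) (auto simp: von_neumann_algebra_def)
  then have "star_alg (commutant (commutant M))"
    by (intro commutant_star_alg commutant_bounded_ops) (auto simp: star_alg_def)
  then show ?thesis using M by (simp add: von_neumann_algebra_def)
qed

lemma vn_generated_eq:
  assumes S: "S \<subseteq> bounded_ops" "\<And>a. a \<in> S \<Longrightarrow> star a \<in> S"
  shows "vn_generated S = commutant (commutant S)"
proof
  show "vn_generated S \<subseteq> commutant (commutant S)"
    unfolding vn_generated_def
    using von_neumann_algebra_bicommutant[OF S] subset_bicommutant[OF S(1)] by blast
  have "commutant (commutant S) \<subseteq> P" if P: "von_neumann_algebra P" "S \<subseteq> P" for P
    using commutant_antimono[OF commutant_antimono[OF P(2)]] P(1) by (simp add: von_neumann_algebra_def)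
  then show "commutant (commutant S) \<subseteq> vn_generated S" unfolding vn_generated_def by blast
qed

lemma vn_generated_least: "von_neumann_algebra P \<Longrightarrow> S \<subseteq> P \<Longrightarrow> vn_generated S \<subseteq> P"
  by (auto simp: vn_generated_def)

lemma vn_generated_superset: "S \<subseteq> vn_generated S"
  by (auto simp: vn_generated_def)

lemma von_neumann_algebra_Int:
  assumes "von_neumann_algebra P" "von_neumann_algebra Q"
  shows "von_neumann_algebra (P \<inter> Q)"
proof -
  have "commutant (commutant (P \<inter> Q)) \<subseteq> commutant (commutant P)"
       "commutant (commutant (P \<inter> Q)) \<subseteq> commutant (commutant Q)"
    by (intro commutant_antimono; simp)+
  moreover have "P \<inter> Q \<subseteq> bounded_ops" using assms by (auto simp: von_neumann_algebra_def)
  ultimately show ?thesis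
    using assms subset_bicommutant[of "P \<inter> Q"] by (auto simp: von_neumann_algebra_def)
qed

lemma von_neumann_algebra_join:
  assumes "von_neumann_algebra P" "von_neumann_algebra Q"
  shows "von_neumann_algebra (vn_generated (P \<union> Q))"
proof -
  have S: "P \<union> Q \<subseteq> bounded_ops" "\<And>a. a \<in> P \<union> Q \<Longrightarrow> star a \<in> P \<union> Q"
    using assms by (auto simp: von_neumann_algebra_def)
  have "vn_generated (P \<union> Q) = commutant (commutant (P \<union> Q))" by (rule vn_generated_eq) (use S in auto)
  then show ?thesis using von_neumann_algebra_bicommutant[of "P \<union> Q"] S by simp
qed

lemma bounded_ops_wot_closed:
  fixes a :: "'h::chilbert_space op"
  assumes F: "F \<noteq> bot" and ai: "\<And>i. f i \<in> bounded_ops"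
    and lim: "\<And>x y. ((\<lambda>i. inner (f i x) y) \<longlongrightarrow> inner (a x) y) F"
  shows "a \<in> bounded_ops"
proof (rule bounded_ops_if_inner)
  fix c x y
  have "((\<lambda>i. inner (f i (c *\<^sub>C x)) y) \<longlongrightarrow> inner (a x) (cnj c *\<^sub>C y)) F"
    using lim[of x "cnj c *\<^sub>C y"] ai by (simp add: bounded_ops_iff inner_scaleC_left)
  then show "inner (a (c *\<^sub>C x)) y = inner (a x) (cnj c *\<^sub>C y)"
    using lim tendsto_unique[OF F] by blast
qed

lemma commutant_wot_closed:
  fixes a :: "'h::chilbert_space op"
  assumes S: "S \<subseteq> bounded_ops" and F: "F \<noteq> bot" and ai: "\<And>i. f i \<in> commutant S"
    and lim: "\<And>x y. ((\<lambda>i. inner (f i x) y) \<longlongrightarrow> inner (a x) y) F"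
  shows "a \<in> commutant S"
proof -
  have "a \<in> bounded_ops"
    by (rule bounded_ops_wot_closed[OF F _ lim]) (use ai in \<open>auto simp: commutant_def\<close>)
  moreover have "a o\<^sub>L b = b o\<^sub>L a" if b: "b \<in> S" for b
  proof (rule blinfun_eq_inner)
    fix x y
    have bB: "b \<in> bounded_ops" using b S by blast
    have "(f i o\<^sub>L b) x = (b o\<^sub>L f i) x" for i using ai b by (simp add: commutant_def)
    then have "inner (f i (b x)) y = inner (f i x) (star b y)" for i
      by (simp add: star_inner[OF bB])
    then have "((\<lambda>i. inner (f i (b x)) y) \<longlongrightarrow> inner (a x) (star b y)) F"
      using lim[of x "star b y"] by simp
    then have "inner (a (b x)) y = inner (a x) (star b y)"
      using lim tendsto_unique[OF F] by blast
    then show "inner ((a o\<^sub>L b) x) y = inner ((b o\<^sub>L a) x) y" by (simp add: star_inner[OF bB])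
  qed
  ultimately show ?thesis by (simp add: commutant_def)
qed

lemma vn_wot_closed:
  fixes a :: "'h::chilbert_space op"
  assumes M: "von_neumann_algebra M" and F: "F \<noteq> bot" and ai: "\<And>i. f i \<in> M"
    and lim: "\<And>x y. ((\<lambda>i. inner (f i x) y) \<longlongrightarrow> inner (a x) y) F"
  shows "a \<in> M"
proof -
  have "a \<in> commutant (commutant M)"
    by (rule commutant_wot_closed[OF commutant_bounded_ops F _ lim])
      (use ai M in \<open>auto simp: von_neumann_algebra_def\<close>)
  then show ?thesis using M by (simp add: von_neumann_algebra_def)
qed

lemma tendsto_blinfun_apply: "(f \<longlongrightarrow> a) F \<Longrightarrow> ((\<lambda>i. blinfun_apply (f i) x) \<longlongrightarrow> blinfun_apply a x) F"
  by (intro blinfun.tendsto tendsto_const)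

lemma vn_closed: assumes M: "von_neumann_algebra M" shows "closed M"
  unfolding closed_sequential_limits
proof (intro allI impI)
  fix f l assume f: "(\<forall>n. f n \<in> M) \<and> f \<longlonglongrightarrow> l"
  show "l \<in> M"
  proof (rule vn_wot_closed[OF M trivial_limit_sequentially])
    show "f i \<in> M" for i using f by blast
    show "(\<lambda>i. inner (f i x) y) \<longlonglongrightarrow> inner (l x) y" for x y
      using f by (intro tendsto_inner tendsto_blinfun_apply tendsto_const) blast
  qed
qed

lemma closed_bounded_ops: "closed (bounded_ops :: 'h::chilbert_space op set)"
  unfolding closed_sequential_limits
proof (intro allI impI)
  fix f and l :: "'h op" assume f: "(\<forall>n. f n \<in> bounded_ops) \<and> f \<longlonglongrightarrow> l"
  show "l \<in> bounded_ops"
  proof (rule bounded_ops_wot_closed[OF trivial_limit_sequentially])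
    show "f i \<in> bounded_ops" for i using f by blast
    show "(\<lambda>i. inner (f i x) y) \<longlonglongrightarrow> inner (l x) y" for x y
      using f by (intro tendsto_inner tendsto_blinfun_apply tendsto_const) blast
  qed
qed

lemma subspace_closure:
  fixes W :: "'a::real_normed_vector set"
  assumes W: "subspace W" shows "subspace (closure W)"
  unfolding subspace_def
proof (intro conjI ballI allI)
  show "0 \<in> closure W" using subspace_0[OF W] closure_subset by blast
  fix x assume "x \<in> closure W"
  then obtain f where f: "\<And>n. f n \<in> W" "f \<longlonglongrightarrow> x" unfolding closure_sequential by blast
  show "c *\<^sub>R x \<in> closure W" for c
    unfolding closure_sequential
    by (rule exI[of _ "\<lambda>n. c *\<^sub>R f n"]) (use f W in \<open>auto intro!: tendsto_intros subspace_mul\<close>)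
  fix y assume "y \<in> closure W"
  then obtain g where g: "\<And>n. g n \<in> W" "g \<longlonglongrightarrow> y" unfolding closure_sequential by blast
  show "x + y \<in> closure W"
    unfolding closure_sequential
    by (rule exI[of _ "\<lambda>n. f n + g n"]) (use f g W in \<open>auto intro!: tendsto_intros subspace_add\<close>)
qed

section \<open>Approximation of bicommutant elements on countably many vectors\<close>

lemma amp_star_alg: "star_alg A \<Longrightarrow> star_alg (amp ` A)"
  unfolding star_alg_def
  by (auto simp: star_amp subset_iff simp flip: amp_add amp_compose amp_cscale amp_id)

text \<open>The matrix entries of an operator commuting with all \<open>amp a\<close> lie in the
  commutant of \<open>A\<close>, so \<open>x\<close> commutes with each of them.\<close>

lemma amp_bicommutant:
  assumes x: "x \<in> commutant (commutant A)"
  shows "(amp x :: ('i, 'h::chilbert_space) ell2 op) \<in> commutant (commutant (amp ` A))"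
proof -
  have "amp x o\<^sub>L T = T o\<^sub>L amp x" if T: "T \<in> commutant (amp ` A)" for T :: "('i, 'h) ell2 op"
  proof (rule ell2_op_eqI)
    fix s t h
    have e: "entry T s t \<in> commutant A"
    proof -
      have "entry T s t o\<^sub>L a = a o\<^sub>L entry T s t" if "a \<in> A" for a
      proof (rule blinfun_eqI)
        fix k
        have "(T o\<^sub>L amp a) (ell2_single t k) = (amp a o\<^sub>L T) (ell2_single t k)"
          using T that by (simp add: commutant_def)
        then show "(entry T s t o\<^sub>L a) k = (a o\<^sub>L entry T s t) k" by (simp add: entry_apply)
      qed
      then show ?thesis using T by (simp add: commutant_def entry_bounded_ops)
    qed
    have "(x o\<^sub>L entry T s t) h = (entry T s t o\<^sub>L x) h" using x e by (simp add: commutant_def)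
    then show "ell2_fun ((amp x o\<^sub>L T) (ell2_single t h)) s = ell2_fun ((T o\<^sub>L amp x) (ell2_single t h)) s"
      by (simp add: entry_apply)
  qed
  then show ?thesis using x by (simp add: commutant_def)
qed

lemma ex_projection_op:
  fixes L :: "'a::{real_inner,complete_space} set"
  assumes L: "subspace L" "closed L"
  obtains P :: "'a \<Rightarrow>\<^sub>L 'a" where "\<And>x. P x \<in> L" "\<And>x w. w \<in> L \<Longrightarrow> inner (x - P x) w = 0"
    "\<And>x y. y \<in> L \<Longrightarrow> (\<And>w. w \<in> L \<Longrightarrow> inner (x - y) w = 0) \<Longrightarrow> P x = y"
proof -
  obtain P where P: "\<And>x. P x \<in> L" "\<And>x w. w \<in> L \<Longrightarrow> inner (x - P x) w = 0"
    using ex_orthogonal_projection[OF L] by metis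
  have uniq: "P x = y" if y: "y \<in> L" "\<And>w. w \<in> L \<Longrightarrow> inner (x - y) w = 0" for x y
  proof -
    have d: "P x - y \<in> L" by (intro subspace_diff L P y)
    have "inner (P x - y) (P x - y) = inner (x - y) (P x - y) - inner (x - P x) (P x - y)"
      by (simp add: inner_diff_left)
    also have "\<dots> = 0" by (simp only: y(2)[OF d] P(2)[OF d])
    finally show ?thesis by simp
  qed
  have "bounded_linear P"
  proof (rule bounded_linear_intro[of _ 1])
    show "P (x + y) = P x + P y" for x y
    proof (rule uniq)
      show "P x + P y \<in> L" by (intro subspace_add L P)
      fix w assume w: "w \<in> L"
      have "inner (x + y - (P x + P y)) w = inner (x - P x) w + inner (y - P y) w"
        by (simp add: inner_diff_left inner_add_left)
      then show "inner (x + y - (P x + P y)) w = 0" by (simp only: P(2)[OF w])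
    qed
    show "P (r *\<^sub>R x) = r *\<^sub>R P x" for r x
    proof (rule uniq)
      show "r *\<^sub>R P x \<in> L" by (intro subspace_mul L P)
      fix w assume w: "w \<in> L"
      have "inner (r *\<^sub>R x - r *\<^sub>R P x) w = r * inner (x - P x) w"
        by (simp add: inner_diff_left right_diff_distrib)
      then show "inner (r *\<^sub>R x - r *\<^sub>R P x) w = 0" by (simp only: P(2)[OF w])
    qed
    show "norm (P x) \<le> norm x * 1" for x
    proof -
      have "norm (P x) * norm (P x) = inner x (P x)"
        using P(2)[OF P(1), of x x] by (simp add: inner_diff_left flip: power2_norm_eq_inner power2_eq_square)
      also have "\<dots> \<le> norm x * norm (P x)" by (rule norm_cauchy_schwarz)
      finally show ?thesis by (cases "P x = 0") auto
    qed
  qed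
  then have "blinfun_apply (Blinfun P) = P" by (rule bounded_linear_Blinfun_apply)
  then show thesis using that[of "Blinfun P"] P uniq by simp
qed

text \<open>The projection onto the closure of \<open>A v\<close> commutes with \<open>A\<close>,
  because that subspace is invariant under \<open>A\<close> and its adjoints. Hence it commutes with
  \<open>x\<close>, and it fixes \<open>v\<close> as \<open>A\<close> is unital.\<close>

lemma bicommutant_apply_closure:
  fixes v :: "'h::chilbert_space"
  assumes A: "star_alg A" and x: "x \<in> commutant (commutant A)"
  shows "x v \<in> closure ((\<lambda>T. blinfun_apply T v) ` A)"
proof -
  define W where "W = (\<lambda>T. blinfun_apply T v) ` A"
  define L where "L = closure W"
  have "subspace W" unfolding subspace_def W_def
  proof (intro conjI ballI allI)
    show "0 \<in> (\<lambda>T. blinfun_apply T v) ` A"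
      by (rule image_eqI[of _ _ 0]) (use star_algD(8)[OF A] in auto)
    fix a c assume "a \<in> (\<lambda>T. blinfun_apply T v) ` A"
    then obtain T :: "'h op" where T: "a = T v" "T \<in> A" by auto
    show "c *\<^sub>R a \<in> (\<lambda>T. blinfun_apply T v) ` A"
      by (rule image_eqI[of _ _ "c *\<^sub>R T"]) (use T star_algD(7)[OF A] in \<open>auto simp: blinfun.scaleR_left\<close>)
    fix b assume "b \<in> (\<lambda>T. blinfun_apply T v) ` A"
    then obtain S :: "'h op" where S: "b = S v" "S \<in> A" by auto
    show "a + b \<in> (\<lambda>T. blinfun_apply T v) ` A"
      by (rule image_eqI[of _ _ "T + S"]) (use T S star_algD(3)[OF A] in \<open>auto simp: blinfun.add_left\<close>)
  qed
  then have L: "subspace L" "closed L" unfolding L_def by (auto intro: subspace_closure)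
  obtain P :: "'h op" where P: "\<And>x. P x \<in> L" "\<And>x w. w \<in> L \<Longrightarrow> inner (x - P x) w = 0"
    "\<And>x y. y \<in> L \<Longrightarrow> (\<And>w. w \<in> L \<Longrightarrow> inner (x - y) w = 0) \<Longrightarrow> P x = y"
    using ex_projection_op[OF L] by metis
  have inv: "blinfun_apply T w \<in> L" if T: "T \<in> A" and w: "w \<in> L" for T w
  proof -
    have "blinfun_apply T ` closure W \<subseteq> closure (blinfun_apply T ` W)"
      by (rule closure_bounded_linear_image_subset) (rule blinfun.bounded_linear_right)
    also have "\<dots> \<subseteq> closure W"
    proof (rule closure_mono)
      have "blinfun_apply T (S v) \<in> W" if "S \<in> A" for S :: "'h op" unfolding W_def
        by (rule image_eqI[of _ _ "T o\<^sub>L S"]) (use T that star_algD(4)[OF A] in auto)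
      then show "blinfun_apply T ` W \<subseteq> W" unfolding W_def by auto
    qed
    finally show ?thesis using w unfolding L_def by blast
  qed
  have PT: "P (blinfun_apply T y) = blinfun_apply T (P y)" if T: "T \<in> A" for T y
  proof (rule P(3))
    show "T (P y) \<in> L" by (rule inv[OF T P(1)])
    fix w assume w: "w \<in> L"
    have TB: "T \<in> bounded_ops" by (rule star_algD(1)[OF A T])
    have "inner (T y - T (P y)) w = inner (y - P y) (star T w)"
      by (simp add: star_inner[OF TB, symmetric] blinfun.bilinear_simps)
    also have "\<dots> = 0" by (rule P(2)) (rule inv[OF star_algD(5)[OF A T] w])
    finally show "inner (T y - T (P y)) w = 0" .
  qed
  \<comment> \<open>Complex linearity of \<open>P\<close> is an instance of commuting with
    \<open>A\<close>, which contains the scalars.\<close>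
  have "P \<in> bounded_ops" unfolding bounded_ops_iff
  proof (intro allI)
    fix c y
    show "P (c *\<^sub>C y) = c *\<^sub>C P y"
      using PT[OF star_algD(6)[OF A star_algD(2)[OF A]], of c y] by simp
  qed
  then have "P \<in> commutant A" by (auto simp: commutant_def PT intro!: blinfun_eqI)
  then have "(x o\<^sub>L P) v = (P o\<^sub>L x) v" using x by (simp add: commutant_def)
  moreover have "P v = v"
  proof (rule P(3))
    have "v \<in> W" unfolding W_def using star_algD(2)[OF A] by (intro image_eqI[of _ _ id_blinfun]) auto
    then show "v \<in> L" unfolding L_def using closure_subset by blast
  qed simp
  ultimately have "x v = P (x v)" by simp
  then show ?thesis using P(1)[of "x v"] by (simp add: L_def W_def)
qed

lemma ell2_pair:
  fixes u v :: "'h::chilbert_space"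
  obtains w :: "(bool, 'h) ell2" where "ell2_fun w True = u" "ell2_fun w False = v"
proof -
  have "ell2_fun (Abs_ell2 (\<lambda>b. if b then u else v)) = (\<lambda>b. if b then u else v)"
    by (rule Abs_ell2_inverse) simp
  then show thesis using that by (metis (full_types))
qed

text \<open>A vector \<open>\<eta>\<close> orthogonal to \<open>A\<^sub>s\<^sub>a v\<close> gives the functional
  \<open>T \<mapsto> \<langle>T v, \<eta>\<rangle> + \<langle>T \<eta>, v\<rangle>\<close>, which vanishes on \<open>A\<close> and hence at \<open>x\<close>.\<close>

lemma bicommutant_selfadjoint_closure:
  fixes v :: "'h::chilbert_space"
  assumes A: "star_alg A" and x: "x \<in> commutant (commutant A)" and xs: "star x = x"
  shows "x v \<in> closure ((\<lambda>T. blinfun_apply T v) ` {T \<in> A. star T = T})"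
proof -
  have xB: "x \<in> bounded_ops" using x by (simp add: commutant_def)
  define W where "W = (\<lambda>T. blinfun_apply T v) ` {T \<in> A. star T = T}"
  have "subspace W" unfolding subspace_def W_def
  proof (intro conjI ballI allI)
    show "0 \<in> (\<lambda>T. blinfun_apply T v) ` {T \<in> A. star T = T}"
      by (rule image_eqI[of _ _ 0]) (use star_algD[OF A] in auto)
    fix a c assume a: "a \<in> (\<lambda>T. blinfun_apply T v) ` {T \<in> A. star T = T}"
    then obtain T :: "'h op" where T: "a = T v" "T \<in> A" "star T = T" by auto
    show "c *\<^sub>R a \<in> (\<lambda>T. blinfun_apply T v) ` {T \<in> A. star T = T}"
      by (rule image_eqI[of _ _ "c *\<^sub>R T"])
        (use T star_algD(1,7)[OF A] in \<open>auto simp: star_scaleR blinfun.scaleR_left\<close>)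
    fix b assume "b \<in> (\<lambda>T. blinfun_apply T v) ` {T \<in> A. star T = T}"
    then obtain S :: "'h op" where S: "b = S v" "S \<in> A" "star S = S" by auto
    show "a + b \<in> (\<lambda>T. blinfun_apply T v) ` {T \<in> A. star T = T}"
      by (rule image_eqI[of _ _ "T + S"])
        (use T S star_algD(1,3)[OF A] in \<open>auto simp: star_add blinfun.add_left\<close>)
  qed
  then have "subspace (closure W)" by (rule subspace_closure)
  from ex_orthogonal_projection[OF this closed_closure, of "x v"]
  obtain u where u: "u \<in> closure W" "\<And>w. w \<in> closure W \<Longrightarrow> inner (x v - u) w = 0" by blast
  define e where "e = x v - u"
  have zero: "inner (blinfun_apply T v) e + inner (blinfun_apply T e) v = 0" if T: "T \<in> A" for T
  proof -
    have TB: "T \<in> bounded_ops" by (rule star_algD(1)[OF A T])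
    have "(T + star T) v \<in> W" unfolding W_def
      by (rule image_eqI[of _ _ "T + star T"])
        (use T TB star_algD(3,5)[OF A] in \<open>auto simp: star_add add.commute\<close>)
    then have "inner e ((T + star T) v) = 0"
      unfolding e_def by (intro u(2)) (use closure_subset in blast)
    moreover have "inner e ((T + star T) v) = inner (T v) e + inner (T e) v"
      using star_inner[OF TB, of e v] inner_commute[of e "T v"] by (simp add: blinfun.add_left inner_add_right)
    ultimately show ?thesis by simp
  qed
  \<comment> \<open>The functional evaluates operators at both \<open>v\<close> and
    \<open>e\<close>, so \<open>x\<close> has to be approximated at the two vectors
    simultaneously.\<close>
  obtain w :: "(bool, 'h) ell2" where w: "ell2_fun w True = v" "ell2_fun w False = e"
    by (rule ell2_pair)
  have "amp x w \<in> closure ((\<lambda>T. blinfun_apply T w) ` amp ` A)"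
    by (rule bicommutant_apply_closure[OF amp_star_alg[OF A] amp_bicommutant[OF x]])
  then obtain f where f: "\<And>n. f n \<in> (\<lambda>T. blinfun_apply T w) ` amp ` A" "f \<longlonglongrightarrow> amp x w"
    unfolding closure_sequential by blast
  have "\<exists>T. T \<in> A \<and> f n = amp T w" for n using f(1)[of n] by auto
  then obtain T where T: "\<And>n. T n \<in> A" "\<And>n. f n = amp (T n) w" by metis
  have lim: "(\<lambda>n. T n (ell2_fun w b)) \<longlonglongrightarrow> x (ell2_fun w b)" for b
    using bounded_linear.tendsto[OF bounded_linear_ell2_fun f(2), of b] by (simp add: T)
  have "(\<lambda>n. inner (T n v) e + inner (T n e) v) \<longlonglongrightarrow> inner (x v) e + inner (x e) v"
    using lim[of True] lim[of False] by (auto simp: w intro!: tendsto_intros)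
  then have "(\<lambda>n::nat. 0) \<longlonglongrightarrow> inner (x v) e + inner (x e) v" by (simp only: zero[OF T(1)])
  then have "inner (x v) e + inner (x e) v = 0" by (simp add: LIMSEQ_const_iff)
  moreover have "inner (x e) v = inner (x v) e"
    using star_inner[OF xB, of e v] xs inner_commute[of e "x v"] by simp
  ultimately have "inner (x v) e = 0" by simp
  moreover have "inner u e = 0" using u(2)[OF u(1)] by (simp add: e_def inner_commute)
  ultimately have "inner e e = 0" by (simp add: e_def inner_diff_left)
  then have "x v = u" by (simp add: e_def)
  then show ?thesis using u(1) by (simp add: W_def)
qed

text \<open>Damping makes any sequence of vectors square-summable. As the weights are positive,
  convergence of amplified operators at the packed vector still gives convergence at every
  \<open>w k\<close>.\<close>

lemma ex_scaled_ell2: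
  fixes w :: "nat \<Rightarrow> 'h::chilbert_space"
  obtains \<zeta> :: "(nat, 'h) ell2" and c where "\<And>k. c k > 0" "\<And>k. ell2_fun \<zeta> k = c k *\<^sub>R w k"
proof -
  define c where "c k = (1/2)^k / (1 + norm (w k))" for k
  have c0: "c k > 0" for k by (simp add: c_def add_pos_nonneg)
  have le: "norm (c k *\<^sub>R w k) \<le> (1/2)^k" for k
  proof -
    have "norm (c k *\<^sub>R w k) = (1/2)^k * (norm (w k) / (1 + norm (w k)))" using c0[of k] by (simp add: c_def)
    also have "\<dots> \<le> (1/2)^k * 1" by (intro mult_left_mono) (auto simp: field_simps add_pos_nonneg)
    finally show ?thesis by simp
  qed
  have "(norm (c k *\<^sub>R w k))\<^sup>2 \<le> (1/4)^k" for k
  proof -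
    have "(norm (c k *\<^sub>R w k))\<^sup>2 \<le> ((1/2)^k)\<^sup>2" by (intro power_mono le) simp
    also have "\<dots> = (1/4)^k" by (simp add: power_mult[symmetric] mult.commute power2_eq_square flip: power_mult_distrib)
    finally show ?thesis .
  qed
  then have "summable (\<lambda>k. (norm (c k *\<^sub>R w k))\<^sup>2)"
    by (intro summable_comparison_test'[OF summable_geometric[of "1/4"]]) auto
  then have "(\<lambda>k. (norm (c k *\<^sub>R w k))\<^sup>2) summable_on UNIV"
    by (subst summable_on_UNIV_nonneg_real_iff) auto
  then have "ell2_fun (Abs_ell2 (\<lambda>k. c k *\<^sub>R w k)) = (\<lambda>k. c k *\<^sub>R w k)"
    by (intro Abs_ell2_inverse) simp
  then show thesis using that[of c "Abs_ell2 (\<lambda>k. c k *\<^sub>R w k)"] c0 by simp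
qed

lemma bicommutant_selfadjoint_dense:
  fixes w :: "nat \<Rightarrow> 'h::chilbert_space"
  assumes A: "star_alg A" and x: "x \<in> commutant (commutant A)" and xs: "star x = x"
  obtains y where "\<And>n. y n \<in> A" "\<And>n. star (y n) = y n" "\<And>k. (\<lambda>n. blinfun_apply (y n) (w k)) \<longlonglongrightarrow> x (w k)"
proof -
  obtain \<zeta> :: "(nat, 'h) ell2" and c where \<zeta>: "\<And>k. c k > 0" "\<And>k. ell2_fun \<zeta> k = c k *\<^sub>R w k"
    using ex_scaled_ell2[of w] by metis
  have xB: "x \<in> bounded_ops" using x by (simp add: commutant_def)
  have "amp x \<zeta> \<in> closure ((\<lambda>T. blinfun_apply T \<zeta>) ` {T \<in> amp ` A. star T = T})"
    by (rule bicommutant_selfadjoint_closure[OF amp_star_alg[OF A] amp_bicommutant[OF x]])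
      (simp add: star_amp xB xs)
  then obtain f where f: "\<And>n. f n \<in> (\<lambda>T. blinfun_apply T \<zeta>) ` {T \<in> amp ` A. star T = T}" "f \<longlonglongrightarrow> amp x \<zeta>"
    unfolding closure_sequential by blast
  have "\<exists>y. y \<in> A \<and> star y = y \<and> f n = amp y \<zeta>" for n
  proof -
    obtain y where y: "y \<in> A" "star (amp y :: (nat, 'h) ell2 op) = amp y" "f n = amp y \<zeta>" using f(1)[of n] by auto
    then show ?thesis by (auto simp: star_amp[OF star_algD(1)[OF A]] amp_inj)
  qed
  then obtain y where y: "\<And>n. y n \<in> A" "\<And>n. star (y n) = y n" "\<And>n. f n = amp (y n) \<zeta>" by metis
  have "(\<lambda>n. y n (w k)) \<longlonglongrightarrow> x (w k)" for k
  proof -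
    have "(\<lambda>n. ell2_fun (f n) k) \<longlonglongrightarrow> ell2_fun (amp x \<zeta>) k"
      by (rule bounded_linear.tendsto[OF bounded_linear_ell2_fun f(2)])
    then have "(\<lambda>n. (1 / c k) *\<^sub>R ell2_fun (f n) k) \<longlonglongrightarrow> (1 / c k) *\<^sub>R ell2_fun (amp x \<zeta>) k"
      by (intro tendsto_intros)
    then show ?thesis using \<zeta>(1)[of k] by (simp add: y(3) \<zeta>(2) blinfun.scaleR_right)
  qed
  then show thesis using that y by blast
qed

section \<open>Limits along ultrafilters\<close>

lemma free_ultrafilterD:
  assumes "free_ultrafilter \<omega>"
  shows "\<omega> \<noteq> bot" "eventually P \<omega> \<or> eventually (\<lambda>i. \<not> P i) \<omega>" "eventually (\<lambda>i. i \<ge> n) \<omega>"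
proof -
  show "\<omega> \<noteq> bot" "eventually P \<omega> \<or> eventually (\<lambda>i. \<not> P i) \<omega>" using assms by (auto simp: free_ultrafilter_def)
  have "eventually (\<lambda>i. i \<ge> n) sequentially" by (rule eventually_ge_at_top)
  then show "eventually (\<lambda>i. i \<ge> n) \<omega>"
    using assms by (auto simp: free_ultrafilter_def cofinite_eq_sequentially le_filter_def)
qed

lemma ultrafilter_tendsto:
  fixes f :: "nat \<Rightarrow> real"
  assumes u: "free_ultrafilter \<omega>" and bd: "\<And>i. \<bar>f i\<bar> \<le> K"
  shows "(f \<longlongrightarrow> Lim \<omega> f) \<omega>"
proof -
  have ne: "filtermap f \<omega> \<noteq> bot" using free_ultrafilterD(1)[OF u] by (simp add: filtermap_bot_iff)
  have "eventually (\<lambda>x. x \<in> {-K..K}) (filtermap f \<omega>)"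
    using bd by (auto simp: eventually_filtermap abs_le_iff minus_le_iff intro!: always_eventually)
  then obtain x where x: "inf (nhds x) (filtermap f \<omega>) \<noteq> bot"
    using compact_Icc[of "-K" K] ne unfolding compact_filter by blast
  have "(f \<longlongrightarrow> x) \<omega>"
  proof (rule topological_tendstoI)
    fix S assume S: "open S" "x \<in> S"
    show "eventually (\<lambda>i. f i \<in> S) \<omega>"
    proof (rule ccontr)
      assume "\<not> eventually (\<lambda>i. f i \<in> S) \<omega>"
      then have "eventually (\<lambda>i. f i \<notin> S) \<omega>" using free_ultrafilterD(2)[OF u] by blast
      then have "eventually (\<lambda>y. y \<notin> S) (filtermap f \<omega>)" by (simp add: eventually_filtermap)
      moreover have "eventually (\<lambda>y. y \<in> S) (nhds x)" using S by (rule eventually_nhds_in_open)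
      ultimately have "eventually (\<lambda>y. False) (inf (nhds x) (filtermap f \<omega>))"
        unfolding eventually_inf by blast
      then show False using x by (simp add: trivial_limit_def)
    qed
  qed
  then show ?thesis using tendsto_Lim[OF free_ultrafilterD(1)[OF u]] by metis
qed

text \<open>Weak compactness of balls: the limits of the forms of the \<open>f i\<close> constitute
  a bounded form, which is represented by an operator.\<close>

lemma ultrafilter_op_limit:
  fixes f :: "nat \<Rightarrow> 'h::chilbert_space op"
  assumes u: "free_ultrafilter \<omega>" and B: "\<And>i. f i \<in> bounded_ops" and K: "\<And>i. norm (f i) \<le> K"
  obtains a where "a \<in> bounded_ops" "norm a \<le> K"
    "\<And>x y. ((\<lambda>i. inner (f i x) y) \<longlongrightarrow> inner (a x) y) \<omega>"
proof -
  note bot = free_ultrafilterD(1)[OF u]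
  have K0: "0 \<le> K" using K norm_ge_zero order_trans by blast
  have bd: "\<bar>inner (f i x) y\<bar> \<le> K * norm x * norm y" for i x y
    by (rule order_trans[OF abs_inner_op_le]) (intro mult_right_mono K norm_ge_zero)
  have lim: "((\<lambda>i. inner (f i x) y) \<longlongrightarrow> Lim \<omega> (\<lambda>i. inner (f i x) y)) \<omega>" for x y
    by (rule ultrafilter_tendsto[OF u bd])
  have uniq: "Lim \<omega> g = l" if "(g \<longlongrightarrow> l) \<omega>" for g and l :: real by (rule tendsto_Lim[OF bot that])
  obtain a :: "'h op" where a: "\<And>x y. inner (a x) y = Lim \<omega> (\<lambda>i. inner (f i x) y)"
  proof (rule riesz_operator[of "\<lambda>x y. Lim \<omega> (\<lambda>i. inner (f i x) y)" K])
    show "\<bar>Lim \<omega> (\<lambda>i. inner (f i x) y)\<bar> \<le> K * norm x * norm y" for x y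
      by (rule tendsto_upperbound[OF tendsto_rabs[OF lim] _ bot]) (simp add: bd)
  qed (rule uniq, auto intro!: tendsto_intros lim simp: inner_add_left inner_add_right blinfun.bilinear_simps)+
  have wot: "((\<lambda>i. inner (f i x) y) \<longlongrightarrow> inner (a x) y) \<omega>" for x y using lim by (simp add: a)
  have "norm a \<le> K"
  proof (rule norm_blinfun_bound[OF K0])
    fix x
    have "inner (a x) (a x) \<le> K * norm x * norm (a x)"
      by (rule tendsto_upperbound[OF wot _ bot]) (use bd in \<open>auto intro!: always_eventually simp: abs_le_iff\<close>)
    then have "norm (a x) * norm (a x) \<le> K * norm x * norm (a x)"
      by (simp flip: power2_norm_eq_inner power2_eq_square)
    then show "norm (a x) \<le> K * norm x" using K0 by (cases "a x = 0") auto
  qed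
  moreover have "a \<in> bounded_ops" by (rule bounded_ops_wot_closed[OF bot B wot])
  ultimately show thesis using that wot by blast
qed

text \<open>\<open>sel i\<close> is the largest \<open>n \<le> i\<close> such that the conditions 1
  to \<open>n\<close> all hold at \<open>i\<close>. Condition 0 is left out so that 0 is always
  admissible and the maximum exists.\<close>

lemma diagonal_selection:
  assumes u: "free_ultrafilter \<omega>" and A: "\<And>n. eventually (A n) \<omega>"
  shows "\<exists>sel :: nat \<Rightarrow> nat. (\<forall>n. eventually (\<lambda>i. n \<le> sel i) \<omega>) \<and> (\<forall>i m. 1 \<le> m \<longrightarrow> m \<le> sel i \<longrightarrow> A m i)"
proof -
  define T where "T i = {n. n \<le> i \<and> (\<forall>m. 1 \<le> m \<longrightarrow> m \<le> n \<longrightarrow> A m i)}" for i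
  define sel where "sel i = Max (T i)" for i
  have fin: "finite (T i)" for i by (rule finite_subset[of _ "{..i}"]) (auto simp: T_def)
  have "0 \<in> T i" for i by (auto simp: T_def)
  then have "sel i \<in> T i" for i unfolding sel_def using fin by (intro Max_in) auto
  then have 1: "A m i" if "1 \<le> m" "m \<le> sel i" for m i using that by (auto simp: T_def)
  have 2: "eventually (\<lambda>i. n \<le> sel i) \<omega>" for n
  proof -
    have "eventually (\<lambda>i. \<forall>m\<in>{..n}. A m i) \<omega>" using A by (intro eventually_ball_finite) auto
    then show ?thesis using free_ultrafilterD(3)[OF u, of n]
    proof eventually_elim
      case (elim i)
      then have "n \<in> T i" by (auto simp: T_def)
      then show ?case unfolding sel_def by (rule Max_ge[OF fin])
    qed
  qed
  show ?thesis using 1 2 by (intro exI[of _ sel]) simp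
qed

lemma vn_ultrafilter_limit:
  assumes u: "free_ultrafilter \<omega>" and Q: "von_neumann_algebra Q" and f: "\<And>i. f i \<in> Q" "\<And>i. norm (f i) \<le> K"
  shows "\<exists>a\<in>Q. norm a \<le> K \<and> (\<forall>x y. ((\<lambda>i. inner (f i x) y) \<longlongrightarrow> inner (blinfun_apply a x) y) \<omega>)"
proof (rule ultrafilter_op_limit[OF u star_algD(1)[OF vn_star_alg[OF Q] f(1)] f(2)])
  fix a assume a: "norm a \<le> K" "\<And>x y. ((\<lambda>i. inner (f i x) y) \<longlongrightarrow> inner (blinfun_apply a x) y) \<omega>"
  have "a \<in> Q" by (rule vn_wot_closed[OF Q free_ultrafilterD(1)[OF u] f(1) a(2)])
  then show ?thesis using a by blast
qed

section \<open>Positive operators\<close>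

definition pos :: "'h::chilbert_space op \<Rightarrow> bool" where
  "pos a \<longleftrightarrow> a \<in> bounded_ops \<and> star a = a \<and> (\<forall>x. 0 \<le> inner (a x) x)"

lemma posD: "pos a \<Longrightarrow> a \<in> bounded_ops" "pos a \<Longrightarrow> star a = a" "pos a \<Longrightarrow> 0 \<le> inner (a x) x"
  by (auto simp: pos_def)

lemma inner_selfadjoint:
  assumes "a \<in> bounded_ops" "star a = a"
  shows "inner (a x) y = inner x (a y)"
  using star_inner[OF assms(1), of x y] assms(2) by simp

lemma pos_zero [simp]: "pos 0" by (simp add: pos_def)
lemma pos_id [simp]: "pos id_blinfun" by (simp add: pos_def)
lemma pos_add: "pos a \<Longrightarrow> pos b \<Longrightarrow> pos (a + b)"
  by (auto simp: pos_def star_add blinfun.add_left inner_add_left)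
lemma pos_scaleR: "pos a \<Longrightarrow> 0 \<le> r \<Longrightarrow> pos (r *\<^sub>R a)"
  by (auto simp: pos_def star_scaleR blinfun.scaleR_left)
lemma pos_sum: "(\<And>i. i \<in> F \<Longrightarrow> pos (f i)) \<Longrightarrow> pos (sum f F)"
  by (induction F rule: infinite_finite_induct) (auto intro: pos_add)
lemma pos_star_compose: "c \<in> bounded_ops \<Longrightarrow> pos (star c o\<^sub>L c)"
  by (simp add: pos_def star_compose star_norm_sq[simplified] star_inner_left)
lemma pos_conj: "pos a \<Longrightarrow> c \<in> bounded_ops \<Longrightarrow> pos (star c o\<^sub>L (a o\<^sub>L c))"
  by (simp add: pos_def star_compose star_inner_left compose_assoc)
lemma pos_square: "a \<in> bounded_ops \<Longrightarrow> star a = a \<Longrightarrow> pos (a o\<^sub>L a)"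
  using pos_star_compose[of a] by simp
lemma pos_trans: "pos (b - a) \<Longrightarrow> pos (c - b) \<Longrightarrow> pos (c - a)"
  using pos_add[of "b - a" "c - b"] by simp

lemma pos_Cauchy_Schwarz:
  assumes a: "pos a"
  shows "(inner (a x) y)\<^sup>2 \<le> inner (a x) x * inner (a y) y"
proof -
  define p q r where "p = inner (a x) x" and "q = inner (a x) y" and "r = inner (a y) y"
  have sym: "inner (a y) x = q"
    using inner_selfadjoint[OF posD(1,2)[OF a], of y x] by (simp add: q_def inner_commute)
  have quad: "0 \<le> p * s\<^sup>2 + 2 * s * t * q + r * t\<^sup>2" for s t
  proof -
    have "0 \<le> inner (a (s *\<^sub>R x + t *\<^sub>R y)) (s *\<^sub>R x + t *\<^sub>R y)" by (rule posD(3)[OF a])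
    also have "\<dots> = p * s\<^sup>2 + 2 * s * t * q + r * t\<^sup>2"
      using sym by (simp add: blinfun.bilinear_simps inner_add_left inner_add_right p_def q_def r_def
          power2_eq_square algebra_simps)
    finally show ?thesis .
  qed
  have p0: "0 \<le> p" using posD(3)[OF a] by (auto simp: p_def)
  have "q\<^sup>2 \<le> p * r"
  proof (cases "p = 0")
    case True
    have "q = 0"
    proof (rule ccontr)
      assume "q \<noteq> 0"
      have "0 \<le> 2 * (-(r+1)/(2*q)) * q + r" using quad[of "-(r+1)/(2*q)" 1] True by simp
      then show False using \<open>q \<noteq> 0\<close> by (simp add: field_simps)
    qed
    then show ?thesis using True by simp
  next
    case False
    then have pp: "p > 0" using p0 by simp
    have "0 \<le> p * (-q)\<^sup>2 + 2 * (-q) * p * q + r * p\<^sup>2" using quad[of "-q" p] .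
    also have "\<dots> = p * (p * r - q\<^sup>2)" by (simp add: power2_eq_square algebra_simps)
    finally show ?thesis using pp by (simp add: zero_le_mult_iff)
  qed
  then show ?thesis by (simp add: p_def q_def r_def)
qed

text \<open>Cauchy-Schwarz for the form of \<open>a\<close> at \<open>x\<close> and
  \<open>a x\<close> bounds the fourth power of \<open>norm (a x)\<close>, and one square cancels;
  this is the inequality between the square of \<open>a\<close> and \<open>K\<close> times
  \<open>a\<close>.\<close>

lemma pos_norm_apply:
  assumes a: "pos a" and K: "pos (K *\<^sub>R id_blinfun - a)"
  shows "(norm (a x))\<^sup>2 \<le> K * inner (a x) x" "norm (a x) \<le> K * norm x"
proof -
  have le: "inner (a y) y \<le> K * (norm y)\<^sup>2" for y
    using posD(3)[OF K, of y] by (simp add: blinfun.bilinear_simps inner_diff_left power2_norm_eq_inner)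
  have "((norm (a x))\<^sup>2)\<^sup>2 \<le> inner (a x) x * inner (a (a x)) (a x)"
    using pos_Cauchy_Schwarz[OF a, of x "a x"] by (simp add: power2_norm_eq_inner)
  also have "\<dots> \<le> inner (a x) x * (K * (norm (a x))\<^sup>2)" by (intro mult_left_mono le posD(3)[OF a])
  finally have sq: "(norm (a x))\<^sup>2 * (norm (a x))\<^sup>2 \<le> (K * inner (a x) x) * (norm (a x))\<^sup>2"
    by (simp add: power2_eq_square[of "(norm (a x))\<^sup>2"] mult_ac)
  show 1: "(norm (a x))\<^sup>2 \<le> K * inner (a x) x"
  proof (cases "a x = 0")
    case False
    then have "0 < (norm (a x))\<^sup>2" by simp
    then show ?thesis by (rule mult_right_le_imp_le[OF sq])
  qed simp
  show "norm (a x) \<le> K * norm x"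
  proof (cases "a x = 0 \<or> x = 0")
    case True
    have "0 \<le> K * norm x"
    proof (cases "x = 0")
      case False
      have "0 \<le> K * (norm x)\<^sup>2" using order_trans[OF posD(3)[OF a] le] .
      then show ?thesis using False by (simp add: zero_le_mult_iff)
    qed simp
    then show ?thesis using True by auto
  next
    case False
    have "0 \<le> K * (norm x)\<^sup>2" using order_trans[OF posD(3)[OF a] le] .
    then have K0: "0 \<le> K" using False by (simp add: zero_le_mult_iff)
    have "(norm (a x))\<^sup>2 \<le> K * (K * (norm x)\<^sup>2)"
      by (rule order_trans[OF 1]) (intro mult_left_mono le K0)
    then have "(norm (a x))\<^sup>2 \<le> (K * norm x)\<^sup>2" by (simp add: power2_eq_square mult_ac)
    then show ?thesis by (rule power2_le_imp_le) (simp add: K0)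
  qed
qed

lemma pos_norm_le: "pos a \<Longrightarrow> pos (K *\<^sub>R id_blinfun - a) \<Longrightarrow> 0 \<le> K \<Longrightarrow> norm a \<le> K"
  by (rule norm_blinfun_bound) (auto intro: pos_norm_apply)

lemma pos_norm_bound:
  fixes a :: "'h::chilbert_space op"
  assumes "a \<in> bounded_ops" "star a = a" "norm a \<le> K"
  shows "pos (K *\<^sub>R id_blinfun - a)" "pos (K *\<^sub>R id_blinfun + a)"
proof -
  have "\<bar>inner (a x) x\<bar> \<le> K * inner x x" for x
  proof -
    have "\<bar>inner (a x) x\<bar> \<le> norm a * norm x * norm x" by (rule abs_inner_op_le)
    also have "\<dots> \<le> K * norm x * norm x" by (intro mult_right_mono assms norm_ge_zero)
    finally show ?thesis by (simp add: mult.assoc flip: power2_norm_eq_inner power2_eq_square)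
  qed
  then have "inner (a x) x \<le> K * inner x x" "- inner (a x) x \<le> K * inner x x" for x
    by (auto simp: abs_le_iff)
  then show "pos (K *\<^sub>R id_blinfun - a)" "pos (K *\<^sub>R id_blinfun + a)"
    using assms by (auto simp: pos_def star_diff star_add star_scaleR blinfun.bilinear_simps
        inner_diff_left inner_add_left) (smt (verit))
qed

lemma pos_antisym:
  assumes "pos a" "pos (- a)" shows "a = 0"
proof (rule blinfun_eqI)
  fix x
  have "inner (a x) x = 0" using posD(3)[OF assms(1), of x] posD(3)[OF assms(2), of x]
    by (simp add: blinfun.bilinear_simps)
  then have "(inner (a x) (a x))\<^sup>2 \<le> 0" using pos_Cauchy_Schwarz[OF assms(1), of x "a x"] by simp
  then show "a x = blinfun_apply 0 x" by simp
qed

lemma pos_inner_mono: "pos (b - a) \<Longrightarrow> inner (a x) x \<le> inner (b x) x"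
  using posD(3)[of "b - a" x] by (simp add: blinfun.bilinear_simps inner_diff_left)

lemma pos_wot_closed:
  fixes a :: "'h::chilbert_space op"
  assumes F: "F \<noteq> bot" and ai: "\<And>i. pos (f i)"
    and lim: "\<And>x y. ((\<lambda>i. inner (f i x) y) \<longlongrightarrow> inner (a x) y) F"
  shows "pos a"
proof -
  have aB: "a \<in> bounded_ops" by (rule bounded_ops_wot_closed[OF F _ lim]) (rule posD(1)[OF ai])
  have "star a = a"
  proof (rule star_unique[OF aB])
    fix x y
    have "((\<lambda>i. inner (f i y) x) \<longlongrightarrow> inner (a x) y) F"
      using lim[of x y] inner_selfadjoint[OF posD(1,2)[OF ai], of _ x y] by (simp add: inner_commute)
    then have "inner (a x) y = inner (a y) x" using lim[of y x] by (rule tendsto_unique[OF F])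
    then show "inner (a x) y = inner x (a y)" by (simp add: inner_commute)
  qed
  moreover have "0 \<le> inner (a x) x" for x
    by (rule tendsto_lowerbound[OF lim _ F]) (simp add: posD(3)[OF ai])
  ultimately show ?thesis using aB by (simp add: pos_def)
qed

lemma tendsto_inner_op:
  fixes a :: "'h::chilbert_space op"
  shows "(f \<longlongrightarrow> a) F \<Longrightarrow> ((\<lambda>i. inner (blinfun_apply (f i) x) y) \<longlongrightarrow> inner (a x) y) F"
  by (intro tendsto_inner tendsto_blinfun_apply tendsto_const)

lemma pos_closed:
  fixes a :: "'h::chilbert_space op"
  shows "f \<longlonglongrightarrow> a \<Longrightarrow> (\<And>n. pos (f n)) \<Longrightarrow> pos a"
  by (rule pos_wot_closed[OF trivial_limit_sequentially _ tendsto_inner_op])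

subsection \<open>The resolvent at -1\<close>

definition resolvent1 :: "'h::chilbert_space op \<Rightarrow> 'h op" where
  "resolvent1 a = (SOME r. r o\<^sub>L (id_blinfun + a) = id_blinfun \<and> (id_blinfun + a) o\<^sub>L r = id_blinfun)"

text \<open>With \<open>K = norm a\<close>, the equation \<open>(1 + a) r = 1\<close> is the fixed
  point equation \<open>(1 + K) r = 1 + (K - a) r\<close>, a contraction with ratio
  \<open>K / (1 + K)\<close>. Running it inside the closed set \<open>A\<close> yields an inverse in
  \<open>A\<close> without spectral theory.\<close>

lemma ex_resolvent1:
  assumes A: "star_alg A" "closed A" and a: "a \<in> A" and pa: "pos a"
  shows "\<exists>r\<in>A. r o\<^sub>L (id_blinfun + a) = id_blinfun \<and> (id_blinfun + a) o\<^sub>L r = id_blinfun"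
proof -
  note AD = star_algD[OF A(1)]
  define K where "K = norm a"
  have K0: "0 \<le> K" by (simp add: K_def)
  define T where "T = K *\<^sub>R id_blinfun - a"
  have TA: "T \<in> A" unfolding T_def using AD(10)[OF AD(7)[OF AD(2)] a] .
  have "pos T" unfolding T_def using pos_norm_bound[of a K] posD[OF pa] by (simp add: K_def)
  moreover have "pos (K *\<^sub>R id_blinfun - T)" using pa by (simp add: T_def)
  ultimately have nT: "norm T \<le> K" using K0 by (intro pos_norm_le)
  define F where "F r = (1 / (1 + K)) *\<^sub>R (id_blinfun + (T o\<^sub>L r))" for r
  have "\<exists>!r\<in>A. F r = r"
  proof (rule Banach_fix)
    show "complete A" using A(2) by (simp add: complete_eq_closed)
    show "A \<noteq> {}" using a by auto
    show "0 \<le> K / (1 + K)" "K / (1 + K) < 1" using K0 by auto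
    show "F ` A \<subseteq> A" unfolding F_def using TA by (auto intro!: AD(7) AD(3)[OF AD(2)] AD(4)[OF TA])
    fix x y
    have "F x - F y = (1 / (1 + K)) *\<^sub>R (T o\<^sub>L (x - y))"
      by (simp add: F_def compose_diff_right algebra_simps)
    then have "dist (F x) (F y) = norm (T o\<^sub>L (x - y)) / (1 + K)"
      using K0 by (simp add: dist_norm)
    also have "\<dots> \<le> (norm T * norm (x - y)) / (1 + K)"
      using K0 by (intro divide_right_mono norm_blinfun_compose) auto
    also have "\<dots> \<le> (K * norm (x - y)) / (1 + K)"
      using K0 nT by (intro divide_right_mono mult_right_mono) auto
    finally show "dist (F x) (F y) \<le> K / (1 + K) * dist x y" by (simp add: dist_norm)
  qed
  then obtain r where r: "r \<in> A" "F r = r" by blast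
  have "(1 + K) *\<^sub>R r = (1 + K) *\<^sub>R F r" using r by simp
  also have "\<dots> = id_blinfun + (T o\<^sub>L r)" using K0 by (simp add: F_def)
  also have "\<dots> = id_blinfun + K *\<^sub>R r - (a o\<^sub>L r)"
    unfolding T_def by (rule blinfun_eqI) (simp add: blinfun.bilinear_simps)
  finally have "r + (a o\<^sub>L r) = id_blinfun" by (simp add: algebra_simps)
  then have R: "(id_blinfun + a) o\<^sub>L r = id_blinfun" by (simp add: compose_add_left)
  have rB: "r \<in> bounded_ops" and aB: "id_blinfun + a \<in> bounded_ops" "star (id_blinfun + a) = id_blinfun + a"
    using r AD(1) posD[OF pa] by (auto simp: star_add)
  \<comment> \<open>The adjoint of a right inverse of a selfadjoint operator is a left inverse, and
    the two then coincide.\<close>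
  have L: "star r o\<^sub>L (id_blinfun + a) = id_blinfun"
    using star_compose[OF aB(1) rB] R aB(2) by simp
  have "star r = star r o\<^sub>L ((id_blinfun + a) o\<^sub>L r)" by (simp add: R)
  also have "\<dots> = r" by (simp add: L flip: compose_assoc)
  finally show ?thesis using L R r by auto
qed

text \<open>By uniqueness the inverse found inside a closed star-algebra is the one chosen by
  \<open>resolvent1\<close>; thus it lies in every such algebra that contains
  \<open>a\<close>.\<close>

lemma resolvent1:
  assumes pa: "pos a"
  shows resolvent1_left: "resolvent1 a o\<^sub>L (id_blinfun + a) = id_blinfun"
    and resolvent1_right: "(id_blinfun + a) o\<^sub>L resolvent1 a = id_blinfun"
    and resolvent1_mem: "star_alg A \<Longrightarrow> closed A \<Longrightarrow> a \<in> A \<Longrightarrow> resolvent1 a \<in> A"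
    and resolvent1_pos: "pos (resolvent1 a)"
    and norm_resolvent1: "norm (resolvent1 a) \<le> 1"
    and resolvent1_unique: "(id_blinfun + a) o\<^sub>L r = id_blinfun \<Longrightarrow> r = resolvent1 a"
    and resolvent1_apply: "resolvent1 a x + a (resolvent1 a x) = x" "resolvent1 a (x + a x) = x"
proof -
  have ex: "\<exists>r\<in>bounded_ops. r o\<^sub>L (id_blinfun + a) = id_blinfun \<and> (id_blinfun + a) o\<^sub>L r = id_blinfun"
    by (rule ex_resolvent1[OF star_alg_bounded_ops closed_bounded_ops posD(1)[OF pa] pa])
  then have "\<exists>r. r o\<^sub>L (id_blinfun + a) = id_blinfun \<and> (id_blinfun + a) o\<^sub>L r = id_blinfun" by blast
  from someI_ex[OF this] show l: "resolvent1 a o\<^sub>L (id_blinfun + a) = id_blinfun"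
    and r: "(id_blinfun + a) o\<^sub>L resolvent1 a = id_blinfun" by (auto simp: resolvent1_def)
  show u: "r = resolvent1 a" if "(id_blinfun + a) o\<^sub>L r = id_blinfun" for r
  proof -
    have "r = (resolvent1 a o\<^sub>L (id_blinfun + a)) o\<^sub>L r" by (simp add: l)
    also have "\<dots> = resolvent1 a" by (simp add: that compose_assoc)
    finally show ?thesis .
  qed
  show "resolvent1 a \<in> A" if "star_alg A" "closed A" "a \<in> A" for A
    using ex_resolvent1[OF that pa] u by metis
  have rB: "resolvent1 a \<in> bounded_ops" using ex u by metis
  show ap: "resolvent1 a x + a (resolvent1 a x) = x" for x
    using arg_cong[OF r, of "\<lambda>T. blinfun_apply T x"] by (simp add: blinfun.add_left)
  show "resolvent1 a (x + a x) = x"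
    using arg_cong[OF l, of "\<lambda>T. blinfun_apply T x"] by (simp add: blinfun.bilinear_simps)
  have aB: "id_blinfun + a \<in> bounded_ops" "star (id_blinfun + a) = id_blinfun + a"
    using posD[OF pa] by (auto simp: star_add)
  have sr: "star (resolvent1 a) = resolvent1 a"
    by (rule u) (use star_compose[OF rB aB(1)] l aB(2) in simp)
  have ge: "inner (resolvent1 a x) x \<ge> (norm (resolvent1 a x))\<^sup>2" for x
  proof -
    have "inner (resolvent1 a x) x = inner (resolvent1 a x) (resolvent1 a x + a (resolvent1 a x))" by (simp only: ap)
    also have "\<dots> \<ge> (norm (resolvent1 a x))\<^sup>2"
      using posD(3)[OF pa, of "resolvent1 a x"] by (simp add: inner_add_right power2_norm_eq_inner inner_commute)
    finally show ?thesis .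
  qed
  show "pos (resolvent1 a)"
    using rB sr ge order_trans[OF zero_le_power2] by (auto simp: pos_def)
  show "norm (resolvent1 a) \<le> 1"
  proof (rule norm_blinfun_bound)
    fix x
    have "norm (resolvent1 a x) * norm (resolvent1 a x) \<le> norm (resolvent1 a x) * norm x"
      using ge[of x] norm_cauchy_schwarz[of "resolvent1 a x" x] by (simp add: power2_eq_square)
    then show "norm (resolvent1 a x) \<le> 1 * norm x" by (cases "resolvent1 a x = 0") auto
  qed simp
qed

text \<open>Let \<open>u\<close> and \<open>v\<close> be the resolvents of \<open>a\<close> and
  \<open>b\<close> at \<open>x\<close>. Expanding the nonnegative form of \<open>1 + a\<close> at
  \<open>v - u\<close> bounds \<open>2 * inner v x\<close> by \<open>inner u x\<close> plus the form
  of \<open>1 + a\<close> at \<open>v\<close>, and the latter is at most the form of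
  \<open>1 + b\<close> at \<open>v\<close>, which is \<open>inner v x\<close>.\<close>

lemma resolvent1_antimono:
  assumes a: "pos a" and ba: "pos (b - a)"
  shows "pos (resolvent1 a - resolvent1 b)"
proof -
  have b: "pos b" using pos_add[OF a ba] by simp
  have "inner (resolvent1 b x) x \<le> inner (resolvent1 a x) x" for x
  proof -
    define u where "u = resolvent1 a x"
    define v where "v = resolvent1 b x"
    have xu: "x = u + a u" and xv: "x = v + b v" unfolding u_def v_def by (simp_all add: resolvent1_apply a b)
    have "0 \<le> inner (v - u) (v - u) + inner (a (v - u)) (v - u)" using posD(3)[OF a] by simp
    also have "\<dots> = inner v v + inner (a v) v - 2 * inner v (u + a u) + inner u (u + a u)"
      using inner_selfadjoint[OF posD(1,2)[OF a], of v u] inner_selfadjoint[OF posD(1,2)[OF a], of u v]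
      by (simp add: blinfun.bilinear_simps inner_diff_left inner_diff_right inner_add_right inner_commute algebra_simps)
    finally have 1: "2 * inner v x \<le> inner v v + inner (a v) v + inner u x" by (simp flip: xu)
    have "inner v v + inner (a v) v \<le> inner v v + inner (b v) v"
      using pos_inner_mono[OF ba, of v] by simp
    also have "\<dots> = inner v x" by (subst xv) (simp add: inner_add_right inner_commute)
    finally show ?thesis using 1 by (simp add: u_def v_def)
  qed
  moreover have "resolvent1 a - resolvent1 b \<in> bounded_ops"
    "star (resolvent1 a - resolvent1 b) = resolvent1 a - resolvent1 b"
    using posD(1,2)[OF resolvent1_pos[OF a]] posD(1,2)[OF resolvent1_pos[OF b]]
    by (auto simp: star_diff)
  ultimately show ?thesis by (simp add: pos_def blinfun.bilinear_simps inner_diff_left)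
qed

text \<open>The bounded transform \<open>a (1 + a)\<^sup>-\<^sup>1\<close>.\<close>

definition btrans :: "'h::chilbert_space op \<Rightarrow> 'h op" where
  "btrans a = id_blinfun - resolvent1 a"

lemma btrans:
  assumes a: "pos a"
  shows btrans_eq: "btrans a = a o\<^sub>L resolvent1 a" "btrans a = resolvent1 a o\<^sub>L a"
    and btrans_pos: "pos (btrans a)" and btrans_le_one: "pos (id_blinfun - btrans a)"
    and btrans_le: "pos (a - btrans a)" and norm_btrans: "norm (btrans a) \<le> 1"
    and btrans_mem: "star_alg A \<Longrightarrow> closed A \<Longrightarrow> a \<in> A \<Longrightarrow> btrans a \<in> A"
proof -
  show r: "btrans a = a o\<^sub>L resolvent1 a"
    using resolvent1_right[OF a] by (simp add: btrans_def compose_add_left algebra_simps)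
  show l: "btrans a = resolvent1 a o\<^sub>L a"
    using resolvent1_left[OF a] by (simp add: btrans_def compose_add_right algebra_simps)
  show p1: "pos (id_blinfun - btrans a)" by (simp add: btrans_def resolvent1_pos a)
  show p: "pos (btrans a)"
  proof -
    have "resolvent1 (0 :: 'a op) = id_blinfun" by (rule resolvent1_unique[symmetric]) auto
    then show ?thesis using resolvent1_antimono[of 0 a] a by (simp add: btrans_def)
  qed
  have "a - btrans a = star a o\<^sub>L (resolvent1 a o\<^sub>L a)"
  proof -
    have "a - btrans a = a o\<^sub>L (id_blinfun - resolvent1 a)" by (simp add: r compose_diff_right)
    then show ?thesis using l posD(2)[OF a] by (simp add: btrans_def)
  qed
  then show "pos (a - btrans a)" using pos_conj[OF resolvent1_pos[OF a] posD(1)[OF a]] by simp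
  show "norm (btrans a) \<le> 1" by (rule pos_norm_le) (use p p1 in auto)
  show "star_alg A \<Longrightarrow> closed A \<Longrightarrow> a \<in> A \<Longrightarrow> btrans a \<in> A" for A
    unfolding btrans_def using star_algD(10,2)[of A] resolvent1_mem[OF a, of A] by blast
qed

lemma btrans_mono: "pos a \<Longrightarrow> pos (b - a) \<Longrightarrow> pos (btrans b - btrans a)"
  using resolvent1_antimono[of a b] by (simp add: btrans_def)

subsection \<open>Square roots\<close>

text \<open>The iteration \<open>y\<^sub>n\<^sub>+\<^sub>1 = (x + y\<^sub>n\<^sup>2) / 2\<close> converges to \<open>1 - sqrt (1 - x)\<close>; it is
  majorized in norm by the scalar iteration with \<open>x = 1\<close>.\<close>

primrec sqrt_iter :: "'h::chilbert_space op \<Rightarrow> nat \<Rightarrow> 'h op" where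
  "sqrt_iter x 0 = 0"
| "sqrt_iter x (Suc n) = (1/2) *\<^sub>R (x + (sqrt_iter x n o\<^sub>L sqrt_iter x n))"

primrec sqrt_rate :: "nat \<Rightarrow> real" where
  "sqrt_rate 0 = 0"
| "sqrt_rate (Suc n) = (1 + (sqrt_rate n)\<^sup>2) / 2"

lemma sqrt_rate: "0 \<le> sqrt_rate n" "sqrt_rate n \<le> 1" "sqrt_rate n \<le> sqrt_rate (Suc n)"
proof -
  show 0: "0 \<le> sqrt_rate n" for n by (cases n) auto
  show 1: "sqrt_rate n \<le> 1" for n
  proof (induction n)
    case (Suc n)
    then have "(sqrt_rate n)\<^sup>2 \<le> 1" using 0[of n] by (simp add: power_le_one)
    then show ?case by simp
  qed simp
  have "0 \<le> (1 - sqrt_rate n)\<^sup>2" by simp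
  then show "sqrt_rate n \<le> sqrt_rate (Suc n)" by (simp add: power2_diff field_simps)
qed

lemma sqrt_rate_lim: "sqrt_rate \<longlonglongrightarrow> 1"
proof -
  have "incseq sqrt_rate" by (rule incseq_SucI) (rule sqrt_rate)
  then obtain L where L: "sqrt_rate \<longlonglongrightarrow> L"
    using incseq_convergent[of sqrt_rate 1] sqrt_rate(2) by blast
  have "(\<lambda>n. (1 + (sqrt_rate n)\<^sup>2) / 2) \<longlonglongrightarrow> (1 + L\<^sup>2) / 2" by (intro tendsto_intros L) simp
  moreover have "(\<lambda>n. (1 + (sqrt_rate n)\<^sup>2) / 2) \<longlonglongrightarrow> L" using LIMSEQ_Suc[OF L] by simp
  ultimately have "(1 + L\<^sup>2) / 2 = L" by (rule LIMSEQ_unique)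
  then have "(1 - L)\<^sup>2 = 0" by (simp add: power2_diff field_simps)
  then show ?thesis using L by simp
qed

text \<open>For successive iterates \<open>v\<close> and \<open>u\<close> the next increment is half
  of \<open>u (u - v) + (u - v) v\<close>, an identity that holds in this order of the factors. The
  scalar iteration satisfies it too, with all terms nonnegative, so it majorizes.\<close>

lemma sqrt_iter_norm:
  assumes x: "norm x \<le> 1"
  shows "norm (sqrt_iter x n) \<le> sqrt_rate n"
    and "norm (sqrt_iter x (Suc n) - sqrt_iter x n) \<le> sqrt_rate (Suc n) - sqrt_rate n"
    and "m \<le> n \<Longrightarrow> norm (sqrt_iter x n - sqrt_iter x m) \<le> sqrt_rate n - sqrt_rate m"
proof -
  show 1: "norm (sqrt_iter x n) \<le> sqrt_rate n" for n
  proof (induction n)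
    case (Suc n)
    have "norm (x + (sqrt_iter x n o\<^sub>L sqrt_iter x n)) \<le> 1 + norm (sqrt_iter x n) * norm (sqrt_iter x n)"
      by (intro norm_triangle_le add_mono x norm_blinfun_compose)
    also have "\<dots> \<le> 1 + sqrt_rate n * sqrt_rate n"
      by (intro add_left_mono mult_mono Suc sqrt_rate norm_ge_zero)
    finally show ?case by (simp add: power2_eq_square)
  qed simp
  show 2: "norm (sqrt_iter x (Suc n) - sqrt_iter x n) \<le> sqrt_rate (Suc n) - sqrt_rate n" for n
  proof (induction n)
    case 0 then show ?case using x by simp
  next
    case (Suc n)
    define u where "u = sqrt_iter x (Suc n)"
    define v where "v = sqrt_iter x n"
    have uv: "norm u \<le> sqrt_rate (Suc n)" "norm v \<le> sqrt_rate n" "norm (u - v) \<le> sqrt_rate (Suc n) - sqrt_rate n"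
      using 1 Suc unfolding u_def v_def by blast+
    have "sqrt_iter x (Suc (Suc n)) - sqrt_iter x (Suc n) = (1/2) *\<^sub>R ((u o\<^sub>L (u - v)) + ((u - v) o\<^sub>L v))"
    proof -
      have "sqrt_iter x (Suc (Suc n)) = (1/2) *\<^sub>R (x + (u o\<^sub>L u))" by (simp add: u_def)
      moreover have "sqrt_iter x (Suc n) = (1/2) *\<^sub>R (x + (v o\<^sub>L v))" by (simp add: v_def)
      ultimately show ?thesis
        by (simp only:) (rule blinfun_eqI, simp add: blinfun.bilinear_simps algebra_simps)
    qed
    then have "norm (sqrt_iter x (Suc (Suc n)) - sqrt_iter x (Suc n))
        = norm ((u o\<^sub>L (u - v)) + ((u - v) o\<^sub>L v)) / 2" by simp
    also have "\<dots> \<le> (norm u * norm (u - v) + norm (u - v) * norm v) / 2"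
      by (intro divide_right_mono norm_triangle_le add_mono norm_blinfun_compose) simp
    also have "\<dots> \<le> (sqrt_rate (Suc n) * (sqrt_rate (Suc n) - sqrt_rate n)
        + (sqrt_rate (Suc n) - sqrt_rate n) * sqrt_rate n) / 2"
      using sqrt_rate(1)[of n] sqrt_rate(1)[of "Suc n"] sqrt_rate(3)[of n]
      by (intro divide_right_mono add_mono mult_mono uv norm_ge_zero) linarith+
    also have "\<dots> = (1 + (sqrt_rate (Suc n))\<^sup>2) / 2 - (1 + (sqrt_rate n)\<^sup>2) / 2"
      by (simp only: power2_eq_square) argo
    also have "\<dots> = sqrt_rate (Suc (Suc n)) - sqrt_rate (Suc n)"
      by (simp only: sqrt_rate.simps)
    finally show ?case .
  qed
  show "norm (sqrt_iter x n - sqrt_iter x m) \<le> sqrt_rate n - sqrt_rate m" if "m \<le> n"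
    using that
  proof (induction n rule: dec_induct)
    case (step n)
    have "sqrt_iter x (Suc n) - sqrt_iter x m = (sqrt_iter x (Suc n) - sqrt_iter x n) + (sqrt_iter x n - sqrt_iter x m)"
      by simp
    then have "norm (sqrt_iter x (Suc n) - sqrt_iter x m)
        \<le> norm (sqrt_iter x (Suc n) - sqrt_iter x n) + norm (sqrt_iter x n - sqrt_iter x m)"
      using norm_triangle_ineq by metis
    then show ?case using 2[of n] step.IH by linarith
  qed simp
qed

lemma sqrt_iter_convergent:
  fixes x :: "'h::chilbert_space op"
  assumes x: "norm x \<le> 1"
  shows "sqrt_iter x \<longlonglongrightarrow> lim (sqrt_iter x)"
    and "norm (lim (sqrt_iter x) - sqrt_iter x m) \<le> 1 - sqrt_rate m"
proof -
  have "Cauchy (sqrt_iter x)"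
  proof (rule metric_CauchyI)
    fix e :: real assume e: "0 < e"
    from metric_CauchyD[OF LIMSEQ_imp_Cauchy[OF sqrt_rate_lim] e]
    obtain M where M: "\<And>m n. m \<ge> M \<Longrightarrow> n \<ge> M \<Longrightarrow> dist (sqrt_rate m) (sqrt_rate n) < e" by blast
    have le: "dist (sqrt_iter x m) (sqrt_iter x n) \<le> dist (sqrt_rate m) (sqrt_rate n)" for m n
    proof (cases "m \<le> n")
      case True
      then show ?thesis using sqrt_iter_norm(3)[OF x True] by (simp add: dist_norm norm_minus_commute)
    next
      case False
      then show ?thesis using sqrt_iter_norm(3)[OF x, of n m] by (simp add: dist_norm)
    qed
    show "\<exists>M. \<forall>m\<ge>M. \<forall>n\<ge>M. dist (sqrt_iter x m) (sqrt_iter x n) < e"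
      using M le order_le_less_trans by metis
  qed
  then show 1: "sqrt_iter x \<longlonglongrightarrow> lim (sqrt_iter x)"
    by (simp add: Cauchy_convergent_iff convergent_LIMSEQ_iff)
  show "norm (lim (sqrt_iter x) - sqrt_iter x m) \<le> 1 - sqrt_rate m"
  proof (rule LIMSEQ_le)
    show "(\<lambda>n. norm (sqrt_iter x n - sqrt_iter x m)) \<longlonglongrightarrow> norm (lim (sqrt_iter x) - sqrt_iter x m)"
      by (intro tendsto_intros 1)
    show "(\<lambda>n. sqrt_rate n - sqrt_rate m) \<longlonglongrightarrow> 1 - sqrt_rate m" by (intro tendsto_intros sqrt_rate_lim)
    show "\<exists>N. \<forall>n\<ge>N. norm (sqrt_iter x n - sqrt_iter x m) \<le> sqrt_rate n - sqrt_rate m"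
      using sqrt_iter_norm(3)[OF x] by blast
  qed
qed

lemma sqrt_iter_selfadjoint:
  assumes "x \<in> bounded_ops" "star x = x"
  shows "sqrt_iter x n \<in> bounded_ops" "star (sqrt_iter x n) = sqrt_iter x n"
proof -
  have "sqrt_iter x n \<in> bounded_ops \<and> star (sqrt_iter x n) = sqrt_iter x n"
    using assms by (induction n) (auto simp: star_scaleR star_add star_compose)
  then show "sqrt_iter x n \<in> bounded_ops" "star (sqrt_iter x n) = sqrt_iter x n" by auto
qed

lemma sqrt_iter_commute:
  assumes "b o\<^sub>L x = x o\<^sub>L b" shows "b o\<^sub>L sqrt_iter x n = sqrt_iter x n o\<^sub>L b"
proof (induction n)
  case (Suc n)
  have "b o\<^sub>L (sqrt_iter x n o\<^sub>L sqrt_iter x n) = (sqrt_iter x n o\<^sub>L sqrt_iter x n) o\<^sub>L b"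
    by (metis Suc compose_assoc)
  then have "b o\<^sub>L (x + (sqrt_iter x n o\<^sub>L sqrt_iter x n)) = (x + (sqrt_iter x n o\<^sub>L sqrt_iter x n)) o\<^sub>L b"
    using assms by (simp add: compose_add_left compose_add_right)
  then have "(b o\<^sub>L (x + (sqrt_iter x n o\<^sub>L sqrt_iter x n))) z = ((x + (sqrt_iter x n o\<^sub>L sqrt_iter x n)) o\<^sub>L b) z" for z
    by simp
  then show ?case by (intro blinfun_eqI) (simp add: blinfun.bilinear_simps)
qed simp

text \<open>\<open>K\<close> is any bound for the norm of \<open>a\<close>. It is a parameter so
  that one normalization serves all entries of a bounded sequence of operators.\<close>

definition op_sqrt :: "real \<Rightarrow> 'h::chilbert_space op \<Rightarrow> 'h op" where
  "op_sqrt K a = sqrt K *\<^sub>R (id_blinfun - lim (sqrt_iter (id_blinfun - (1/K) *\<^sub>R a)))"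

lemma sqrt_arg:
  assumes a: "pos a" and K: "norm a \<le> K" "0 < K"
  shows "pos (id_blinfun - (1/K) *\<^sub>R a)" "norm (id_blinfun - (1/K) *\<^sub>R a) \<le> 1"
proof -
  have "pos ((1/K) *\<^sub>R (K *\<^sub>R id_blinfun - a))"
    by (intro pos_scaleR pos_norm_bound posD[OF a] K) (use K in simp)
  then show p: "pos (id_blinfun - (1/K) *\<^sub>R a)" using K by (simp add: scaleR_diff_right)
  show "norm (id_blinfun - (1/K) *\<^sub>R a) \<le> 1"
    by (rule pos_norm_le[OF p]) (use K in \<open>auto intro: pos_scaleR a\<close>)
qed

text \<open>The error depends on \<open>m\<close> and \<open>K\<close> only. Along a bounded
  sequence of operators the square roots are therefore uniform limits of polynomials, which is how
  they remain central sequences.\<close>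

lemma op_sqrt_approx:
  assumes a: "pos a" and K: "norm a \<le> K" "0 < K"
  shows "norm (op_sqrt K a - sqrt K *\<^sub>R (id_blinfun - sqrt_iter (id_blinfun - (1/K) *\<^sub>R a) m))
    \<le> sqrt K * (1 - sqrt_rate m)"
proof -
  let ?x = "id_blinfun - (1/K) *\<^sub>R a"
  have "op_sqrt K a - sqrt K *\<^sub>R (id_blinfun - sqrt_iter ?x m) = - (sqrt K *\<^sub>R (lim (sqrt_iter ?x) - sqrt_iter ?x m))"
    by (simp add: op_sqrt_def algebra_simps)
  then show ?thesis
    using sqrt_iter_convergent(2)[OF sqrt_arg(2)[OF assms], of m] K
    by (simp add: mult_left_mono)
qed

lemma op_sqrt:
  assumes a: "pos a" and K: "norm a \<le> K" "0 < K"
  shows op_sqrt_square: "op_sqrt K a o\<^sub>L op_sqrt K a = a"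
    and op_sqrt_pos: "pos (op_sqrt K a)"
    and op_sqrt_commute: "b o\<^sub>L a = a o\<^sub>L b \<Longrightarrow> b o\<^sub>L op_sqrt K a = op_sqrt K a o\<^sub>L b"
    and op_sqrt_mem: "star_alg A \<Longrightarrow> closed A \<Longrightarrow> a \<in> A \<Longrightarrow> op_sqrt K a \<in> A"
proof -
  define x where "x = id_blinfun - (1/K) *\<^sub>R a"
  define Y where "Y = lim (sqrt_iter x)"
  note px = sqrt_arg[OF assms, folded x_def]
  have lim: "sqrt_iter x \<longlonglongrightarrow> Y" unfolding Y_def by (rule sqrt_iter_convergent[OF px(2)])
  have s: "op_sqrt K a = sqrt K *\<^sub>R (id_blinfun - Y)" by (simp add: op_sqrt_def x_def Y_def)
  have "(\<lambda>n. (1/2) *\<^sub>R (x + (sqrt_iter x n o\<^sub>L sqrt_iter x n))) \<longlonglongrightarrow> (1/2) *\<^sub>R (x + (Y o\<^sub>L Y))"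
    by (intro tendsto_intros lim bounded_bilinear.tendsto[OF bounded_bilinear_blinfun_compose])
  then have "(\<lambda>n. sqrt_iter x (Suc n)) \<longlonglongrightarrow> (1/2) *\<^sub>R (x + (Y o\<^sub>L Y))" by simp
  from LIMSEQ_unique[OF LIMSEQ_Suc[OF lim] this]
  have "2 *\<^sub>R Y = 2 *\<^sub>R ((1/2) *\<^sub>R (x + (Y o\<^sub>L Y)))" by (rule arg_cong)
  then have "2 *\<^sub>R Y = x + (Y o\<^sub>L Y)" by simp
  then have Y2: "Y o\<^sub>L Y = 2 *\<^sub>R Y - x" by simp
  have "op_sqrt K a o\<^sub>L op_sqrt K a = K *\<^sub>R (id_blinfun - 2 *\<^sub>R Y + (Y o\<^sub>L Y))"
  proof (rule blinfun_eqI)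
    fix v
    have "\<bar>K\<bar> = K" using K by simp
    then show "(op_sqrt K a o\<^sub>L op_sqrt K a) v = (K *\<^sub>R (id_blinfun - 2 *\<^sub>R Y + (Y o\<^sub>L Y))) v"
      by (simp add: s blinfun.bilinear_simps algebra_simps flip: scaleR_2)
  qed
  also have "\<dots> = a" using K by (simp add: Y2 x_def)
  finally show "op_sqrt K a o\<^sub>L op_sqrt K a = a" .
  note si = sqrt_iter_selfadjoint[OF posD(1,2)[OF px(1)]]
  have nle: "norm (sqrt_iter x n) \<le> 1" for n
    using sqrt_iter_norm(1)[OF px(2), of n] sqrt_rate(2)[of n] by linarith
  have "pos (id_blinfun - Y)"
  proof (rule pos_closed)
    show "(\<lambda>n. id_blinfun - sqrt_iter x n) \<longlonglongrightarrow> id_blinfun - Y" by (intro tendsto_intros lim)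
    show "pos (id_blinfun - sqrt_iter x n)" for n
      using pos_norm_bound(1)[OF si nle, of n] by simp
  qed
  then show "pos (op_sqrt K a)" unfolding s using K by (intro pos_scaleR) auto
  show "op_sqrt K a \<in> A" if A: "star_alg A" "closed A" "a \<in> A" for A
  proof -
    note AD = star_algD[OF A(1)]
    have xA: "x \<in> A" unfolding x_def using AD(10)[OF AD(2) AD(7)[OF A(3)]] .
    have "sqrt_iter x n \<in> A" for n
    proof (induction n)
      case (Suc n)
      then show ?case using AD(7)[OF AD(3)[OF xA AD(4)[OF Suc Suc]]] by (simp del: scaleR_add_right)
    qed (simp add: AD(8))
    then have "Y \<in> A" using lim A(2) closed_sequentially by blast
    then show ?thesis unfolding s using AD(7)[OF AD(10)[OF AD(2)]] by blast
  qed
  show "b o\<^sub>L op_sqrt K a = op_sqrt K a o\<^sub>L b" if "b o\<^sub>L a = a o\<^sub>L b"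
  proof -
    have "(b o\<^sub>L a) z = (a o\<^sub>L b) z" for z using that by simp
    then have "b o\<^sub>L x = x o\<^sub>L b" unfolding x_def by (intro blinfun_eqI) (simp add: blinfun.bilinear_simps)
    then have c: "b o\<^sub>L sqrt_iter x n = sqrt_iter x n o\<^sub>L b" for n by (rule sqrt_iter_commute)
    have "(\<lambda>n. (b o\<^sub>L sqrt_iter x n)) \<longlonglongrightarrow> (b o\<^sub>L Y)"
      by (intro tendsto_intros lim bounded_bilinear.tendsto[OF bounded_bilinear_blinfun_compose])
    moreover have "(\<lambda>n. sqrt_iter x n o\<^sub>L b) \<longlonglongrightarrow> (Y o\<^sub>L b)"
      by (intro tendsto_intros lim bounded_bilinear.tendsto[OF bounded_bilinear_blinfun_compose])
    ultimately have "b o\<^sub>L Y = Y o\<^sub>L b" unfolding c by (rule LIMSEQ_unique)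
    then have "(b o\<^sub>L Y) z = (Y o\<^sub>L b) z" for z by simp
    then show ?thesis unfolding s by (intro blinfun_eqI) (simp add: blinfun.bilinear_simps)
  qed
qed

lemma pos_compose_commute:
  assumes a: "pos a" and b: "pos b" and ab: "a o\<^sub>L b = b o\<^sub>L a"
  shows "pos (a o\<^sub>L b)"
proof -
  define s where "s = op_sqrt (norm b + 1) b"
  have K: "norm b \<le> norm b + 1" "0 < norm b + 1" by (auto simp: add_nonneg_pos)
  have s: "pos s" "s o\<^sub>L s = b" "a o\<^sub>L s = s o\<^sub>L a"
    unfolding s_def by (intro op_sqrt_pos[OF b K] op_sqrt_square[OF b K] op_sqrt_commute[OF b K ab])+
  have "a o\<^sub>L b = star s o\<^sub>L (a o\<^sub>L s)"
    using s posD(2)[OF s(1)] by (metis compose_assoc)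
  then show ?thesis using pos_conj[OF a posD(1)[OF s(1)]] by simp
qed

text \<open>Every iterate \<open>y\<close> stays below \<open>1 - u\<close>: the next value of
  \<open>1 - u - y\<close> is half of the product of \<open>1 - u - y\<close> and
  \<open>1 - u + y\<close>, which are commuting positive operators.\<close>

lemma op_sqrt_square_ge:
  fixes u :: "'h::chilbert_space op"
  assumes u: "u \<in> bounded_ops" "star u = u" "norm u \<le> 1"
  shows "pos (op_sqrt 1 (u o\<^sub>L u) - u)"
proof -
  define x where "x = id_blinfun - (u o\<^sub>L u)"
  have pu2: "pos (u o\<^sub>L u)" by (rule pos_square[OF u(1,2)])
  have "norm (u o\<^sub>L u) \<le> norm u * norm u" by (rule norm_blinfun_compose)
  also have "\<dots> \<le> 1 * 1" by (intro mult_mono u) auto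
  finally have nu2: "norm (u o\<^sub>L u) \<le> 1" by simp
  note px = sqrt_arg[OF pu2 nu2, simplified, folded x_def]
  have ux: "u o\<^sub>L x = x o\<^sub>L u" by (simp add: x_def compose_diff_left compose_diff_right compose_assoc)
  note c = sqrt_iter_commute[OF ux]
  note si = sqrt_iter_selfadjoint[OF posD(1,2)[OF px(1)]]
  have p1u: "pos (id_blinfun - u)" using pos_norm_bound(1)[OF u] by simp
  have py: "pos (sqrt_iter x n)" for n
  proof (cases n)
    case (Suc m)
    then show ?thesis using pos_scaleR[OF pos_add[OF px(1) pos_square[OF si[of m]]], of "1/2"]
      by (simp del: scaleR_add_right)
  qed simp
  have pn: "pos (id_blinfun - u - sqrt_iter x n)" for n
  proof (induction n)
    case 0 then show ?case using p1u by simp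
  next
    case (Suc n)
    define y where "y = sqrt_iter x n"
    have uy: "(u o\<^sub>L y) z = (y o\<^sub>L u) z" for z using c[of n] by (simp add: y_def)
    have com: "(id_blinfun - u - y) o\<^sub>L (id_blinfun - u + y) = (id_blinfun - u + y) o\<^sub>L (id_blinfun - u - y)"
      using uy by (intro blinfun_eqI) (simp add: blinfun.bilinear_simps algebra_simps)
    have "pos ((id_blinfun - u - y) o\<^sub>L (id_blinfun - u + y))"
      by (rule pos_compose_commute[OF _ _ com]) (use Suc pos_add[OF p1u py] in \<open>auto simp: y_def\<close>)
    then have "pos ((1/2) *\<^sub>R ((id_blinfun - u - y) o\<^sub>L (id_blinfun - u + y)))" by (rule pos_scaleR) simp
    also have "(1/2) *\<^sub>R ((id_blinfun - u - y) o\<^sub>L (id_blinfun - u + y)) = id_blinfun - u - sqrt_iter x (Suc n)"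
    proof (rule blinfun_eqI)
      fix z
      have p: "((id_blinfun - u - y) o\<^sub>L (id_blinfun - u + y)) z = z - u z - u z + u (u z) - y (y z)"
        using uy[of z] by (simp add: blinfun.bilinear_simps algebra_simps)
      have s: "sqrt_iter x (Suc n) z = (1/2) *\<^sub>R (z - u (u z) + y (y z))"
        by (simp add: y_def x_def blinfun.bilinear_simps)
      have "2 *\<^sub>R (((1/2) *\<^sub>R ((id_blinfun - u - y) o\<^sub>L (id_blinfun - u + y))) z)
          = 2 *\<^sub>R ((id_blinfun - u - sqrt_iter x (Suc n)) z)"
        unfolding blinfun.scaleR_left blinfun.diff_left s p scaleR_diff_right
        by (simp add: scaleR_2)
      then show "((1/2) *\<^sub>R ((id_blinfun - u - y) o\<^sub>L (id_blinfun - u + y))) z = (id_blinfun - u - sqrt_iter x (Suc n)) z"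
        by simp
    qed
    finally show ?case .
  qed
  have "pos (id_blinfun - u - lim (sqrt_iter x))"
    by (rule pos_closed[of "\<lambda>n. id_blinfun - u - sqrt_iter x n", OF _ pn]) (intro tendsto_intros sqrt_iter_convergent(1)[OF px(2)])
  then show ?thesis by (simp add: op_sqrt_def x_def algebra_simps)
qed

section \<open>Separating vectors and normality of automorphisms\<close>

text \<open>\<open>\<zeta>\<close> takes the place of a faithful normal state: its coordinates form
  a sequence of vectors separating for \<open>M\<close>, and \<open>norm (amp a \<zeta>)\<close>
  will metrize strong convergence on bounded subsets of \<open>M\<close>.\<close>

definition separating :: "(nat, 'h::chilbert_space) ell2 \<Rightarrow> 'h op set \<Rightarrow> bool" where
  "separating \<zeta> M \<longleftrightarrow> (\<forall>a\<in>M. amp a \<zeta> = 0 \<longrightarrow> a = 0)"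

text \<open>Strong continuity on bounded sets, expressed through the norm \<open>a \<mapsto> \<parallel>amp a \<zeta>\<parallel>\<close>.\<close>

definition normal_on ::
    "(nat, 'h::chilbert_space) ell2 \<Rightarrow> 'h op set \<Rightarrow> ('h op \<Rightarrow> 'k::chilbert_space op) \<Rightarrow> bool" where
  "normal_on \<zeta> M \<rho> \<longleftrightarrow> (\<forall>\<xi>. \<forall>e>0. \<exists>d>0. \<forall>a\<in>M. norm a \<le> 1 \<longrightarrow> norm (amp a \<zeta>) < d \<longrightarrow> norm (\<rho> a \<xi>) < e)"

lemma norm_cinner: "cmod (cinner x y) \<le> norm (x::'h::chilbert_space) * norm y"
proof (cases "cinner x y = 0")
  case False
  define z where "z = cinner x y"
  define c where "c = cnj z / of_real (cmod z)"
  have "cmod c = 1" using False by (simp add: c_def z_def norm_divide)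
  have "c * z = of_real (cmod z)"
    using False by (simp add: c_def z_def divide_simps mult.commute flip: complex_norm_square power2_eq_square)
  then have "cmod z = Re (cinner (c *\<^sub>C x) y)" by (simp add: cinner_scaleC_left z_def)
  also have "\<dots> \<le> norm (c *\<^sub>C x) * norm y" by (simp add: Re_cinner norm_cauchy_schwarz)
  finally show ?thesis by (simp add: z_def norm_scaleC \<open>cmod c = 1\<close>)
qed simp

section \<open>Predual functionals and existence of separating sequences\<close>

lemma predual_bounded:
  assumes "\<phi> \<in> predual M"
  obtains C where "C \<ge> 0" "\<And>a. a \<in> M \<Longrightarrow> cmod (\<phi> a) \<le> C * norm a"
proof -
  obtain \<xi> \<eta> where s: "summable (\<lambda>n. (norm (\<xi> n))\<^sup>2)" "summable (\<lambda>n. (norm (\<eta> n))\<^sup>2)"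
    and \<phi>: "\<And>a. a \<in> M \<Longrightarrow> \<phi> a = (\<Sum>n. cinner (blinfun_apply a (\<xi> n)) (\<eta> n))"
    using assms unfolding predual_def by blast
  have s2: "summable (\<lambda>n. (norm (\<xi> n))\<^sup>2 + (norm (\<eta> n))\<^sup>2)" by (rule summable_add[OF s])
  define C where "C = (\<Sum>n. (norm (\<xi> n))\<^sup>2 + (norm (\<eta> n))\<^sup>2)"
  have "C \<ge> 0" unfolding C_def by (rule suminf_nonneg[OF s2]) simp
  moreover have "cmod (\<phi> a) \<le> C * norm a" if a: "a \<in> M" for a
  proof -
    have le: "cmod (cinner (a (\<xi> n)) (\<eta> n)) \<le> ((norm (\<xi> n))\<^sup>2 + (norm (\<eta> n))\<^sup>2) * norm a" for n
    proof -
      have "cmod (cinner (a (\<xi> n)) (\<eta> n)) \<le> norm (a (\<xi> n)) * norm (\<eta> n)" by (rule norm_cinner)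
      also have "\<dots> \<le> (norm a * norm (\<xi> n)) * norm (\<eta> n)" by (intro mult_right_mono norm_blinfun) simp
      also have "\<dots> \<le> ((norm (\<xi> n))\<^sup>2 + (norm (\<eta> n))\<^sup>2) * norm a"
      proof -
        have "norm (\<xi> n) * norm (\<eta> n) \<le> (norm (\<xi> n))\<^sup>2 + (norm (\<eta> n))\<^sup>2"
          using sum_squares_bound[of "norm (\<xi> n)" "norm (\<eta> n)"]
            mult_nonneg_nonneg[OF norm_ge_zero[of "\<xi> n"] norm_ge_zero[of "\<eta> n"]] by linarith
        from mult_right_mono[OF this norm_ge_zero[of a]] show ?thesis by (simp add: mult_ac)
      qed
      finally show ?thesis .
    qed
    have sm: "summable (\<lambda>n. ((norm (\<xi> n))\<^sup>2 + (norm (\<eta> n))\<^sup>2) * norm a)" by (rule summable_mult2[OF s2])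
    have sn: "summable (\<lambda>n. cmod (cinner (a (\<xi> n)) (\<eta> n)))"
      by (rule summable_comparison_test'[OF sm, of 0]) (use le in auto)
    have "cmod (\<phi> a) \<le> (\<Sum>n. cmod (cinner (a (\<xi> n)) (\<eta> n)))"
      unfolding \<phi>[OF a] by (rule summable_norm[OF sn])
    also have "\<dots> \<le> (\<Sum>n. ((norm (\<xi> n))\<^sup>2 + (norm (\<eta> n))\<^sup>2) * norm a)" by (rule suminf_le[OF le sn sm])
    also have "\<dots> = C * norm a" unfolding C_def by (rule suminf_mult2[OF s2, symmetric])
    finally show ?thesis .
  qed
  ultimately show thesis using that by blast
qed

text \<open>A supremum of reals is meaningful only for sets bounded above, so some bound
  \<open>C\<close> has to be supplied; its size does not enter the conclusion.\<close>

lemma functional_norm_ge: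
  assumes "\<And>b. b \<in> M \<Longrightarrow> norm b \<le> 1 \<Longrightarrow> cmod (\<phi> b) \<le> C" and "a \<in> M" "norm a \<le> 1"
  shows "cmod (\<phi> a) \<le> functional_norm M \<phi>"
  unfolding functional_norm_def by (rule cSUP_upper) (use assms in \<open>auto intro!: bdd_aboveI2\<close>)

lemma functional_norm_le:
  assumes "\<And>b. b \<in> M \<Longrightarrow> norm b \<le> 1 \<Longrightarrow> cmod (\<phi> b) \<le> C" and "0 \<in> M"
  shows "functional_norm M \<phi> \<le> C"
  unfolding functional_norm_def by (rule cSUP_least) (use assms in \<open>auto intro!: exI[of _ 0]\<close>)

lemma functional_norm_ge_scaled:
  assumes M: "star_alg M" and C: "\<And>b. b \<in> M \<Longrightarrow> norm b \<le> 1 \<Longrightarrow> cmod (\<phi> b) \<le> C"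
    and h: "\<And>r b. b \<in> M \<Longrightarrow> \<phi> (r *\<^sub>R b) = of_real r * \<phi> b" and a: "a \<in> M"
  shows "cmod (\<phi> a) \<le> functional_norm M \<phi> * norm a"
proof (cases "a = 0")
  case True
  then show ?thesis using h[OF a, of 0] by simp
next
  case False
  define b where "b = (1 / norm a) *\<^sub>R a"
  have b: "b \<in> M" "norm b \<le> 1" using star_algD(7)[OF M a] False by (auto simp: b_def)
  have "\<phi> a = of_real (norm a) * \<phi> b" using h[OF b(1), of "norm a"] False by (simp add: b_def)
  then have "cmod (\<phi> a) = cmod (\<phi> b) * norm a" by (simp add: norm_mult)
  also have "\<dots> \<le> functional_norm M \<phi> * norm a"
    by (intro mult_right_mono functional_norm_ge[OF C b]) auto
  finally show ?thesis .
qed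

lemma vector_functional_predual: "(\<lambda>a. cinner (blinfun_apply a \<xi>) \<eta>) \<in> predual M"
proof -
  have "summable (\<lambda>n::nat. (norm (if n = 0 then z else 0))\<^sup>2)" for z :: 'a
    by (rule summable_finite[of "{0}"]) auto
  moreover have "cinner (blinfun_apply a \<xi>) \<eta> = (\<Sum>n::nat. cinner (blinfun_apply a (if n = 0 then \<xi> else 0)) (if n = 0 then \<eta> else 0))" for a
  proof -
    have z: "cinner 0 (0::'a) = 0" using norm_cinner[of "0::'a" 0] by simp
    show ?thesis by (subst suminf_finite[of "{0}"]) (auto simp: z)
  qed
  ultimately show ?thesis unfolding predual_def mem_Collect_eq
    by (intro exI[of _ "\<lambda>n. if n = 0 then \<xi> else 0"] exI[of _ "\<lambda>n. if n = 0 then \<eta> else 0"]) blast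
qed

text \<open>The sequence lists the vectors \<open>\<xi> \<psi> n\<close> representing a countable
  dense set of functionals \<open>\<psi>\<close>. An operator that kills them all is killed by every
  \<open>\<psi>\<close>, hence by every functional in the predual.\<close>

lemma ex_separating:
  fixes M :: "'h::chilbert_space op set"
  assumes M: "star_alg M" and sep: "separable_predual M"
  obtains \<zeta> where "separating \<zeta> M"
proof -
  obtain D where D: "countable D" "D \<subseteq> predual M"
    "\<And>\<phi> e. \<phi> \<in> predual M \<Longrightarrow> e > 0 \<Longrightarrow> \<exists>\<psi>\<in>D. functional_norm M (\<lambda>a. \<phi> a - \<psi> a) < e"
    using sep unfolding separable_predual_def by blast
  have "D \<noteq> {}" using D(3)[OF vector_functional_predual[of 0 0], of 1] by auto
  have "\<forall>\<psi>\<in>D. \<exists>\<xi> :: nat \<Rightarrow> 'h. \<exists>\<eta>. \<forall>a\<in>M. \<psi> a = (\<Sum>n. cinner (blinfun_apply a (\<xi> n)) (\<eta> n))"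
    using D(2) unfolding predual_def by blast
  then obtain \<xi> :: "_ \<Rightarrow> nat \<Rightarrow> 'h" and \<eta> where
    rep: "\<And>\<psi> a. \<psi> \<in> D \<Longrightarrow> a \<in> M \<Longrightarrow> \<psi> a = (\<Sum>n. cinner (blinfun_apply a (\<xi> \<psi> n)) (\<eta> \<psi> n))"
    by metis
  define w where "w k = \<xi> (from_nat_into D (fst (prod_decode k))) (snd (prod_decode k))" for k
  obtain \<zeta> :: "(nat, 'h) ell2" and c where \<zeta>: "\<And>k. c k > 0" "\<And>k. ell2_fun \<zeta> k = c k *\<^sub>R w k"
    using ex_scaled_ell2[of w] by metis
  have "a = 0" if a: "a \<in> M" and 0: "amp a \<zeta> = 0" for a
  proof -
    have "a (w k) = 0" for k
      using arg_cong[OF 0, of "\<lambda>v. ell2_fun v k"] \<zeta>(1)[of k]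
      by (simp add: \<zeta>(2) blinfun.scaleR_right zero_ell2.rep_eq)
    moreover have "\<exists>k. w k = \<xi> \<psi> n" if \<psi>: "\<psi> \<in> D" for \<psi> n
    proof -
      obtain j where "from_nat_into D j = \<psi>" using from_nat_into_surj[OF D(1) \<psi>] by blast
      then show ?thesis by (intro exI[of _ "prod_encode (j, n)"]) (simp add: w_def)
    qed
    ultimately have "a (\<xi> \<psi> n) = 0" if "\<psi> \<in> D" for \<psi> n using that by metis
    moreover have "cinner 0 (y::'h) = 0" for y using norm_cinner[of 0 y] by simp
    ultimately have \<psi>0: "\<psi> a = 0" if "\<psi> \<in> D" for \<psi> using rep[OF that a] that by simp
    have "a h = 0" for h
    proof (rule ccontr)
      assume h: "a h \<noteq> 0"
      define \<phi> where "\<phi> = (\<lambda>b. cinner (blinfun_apply b h) (a h))"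
      have \<phi>: "\<phi> \<in> predual M" unfolding \<phi>_def by (rule vector_functional_predual)
      have a0: "norm a > 0" using h by auto
      \<comment> \<open>The value of \<open>\<phi>\<close> at the normalized \<open>a\<close>; a
        functional within distance \<open>e\<close> of \<open>\<phi>\<close> cannot vanish
        there.\<close>
      define e where "e = (norm (a h))\<^sup>2 / norm a"
      have "e > 0" using h a0 by (simp add: e_def)
      from D(3)[OF \<phi> this] obtain \<psi> where \<psi>: "\<psi> \<in> D" "functional_norm M (\<lambda>a. \<phi> a - \<psi> a) < e" by blast
      have \<psi>P: "\<psi> \<in> predual M" using D \<psi> by blast
      obtain C1 where C1: "C1 \<ge> 0" "\<And>a. a \<in> M \<Longrightarrow> cmod (\<phi> a) \<le> C1 * norm a" using predual_bounded[OF \<phi>] by blast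
      obtain C2 where C2: "C2 \<ge> 0" "\<And>a. a \<in> M \<Longrightarrow> cmod (\<psi> a) \<le> C2 * norm a" using predual_bounded[OF \<psi>P] by blast
      define b where "b = (1 / norm a) *\<^sub>R a"
      have b: "b \<in> M" "norm b \<le> 1" using star_algD(7)[OF M a] a0 by (auto simp: b_def)
      have "\<psi> b = 0"
      proof -
        have "b (\<xi> \<psi> n) = 0" for n using \<open>\<And>n \<psi>. \<psi> \<in> D \<Longrightarrow> a (\<xi> \<psi> n) = 0\<close>[OF \<psi>(1)] by (simp add: b_def blinfun.scaleR_left)
        moreover have "cinner 0 (y::'h) = 0" for y using norm_cinner[of 0 y] by simp
        ultimately show ?thesis using rep[OF \<psi>(1) b(1)] by simp
      qed
      have "cmod (\<phi> b - \<psi> b) \<le> functional_norm M (\<lambda>a. \<phi> a - \<psi> a)"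
      proof (rule functional_norm_ge[where C = "C1 + C2", OF _ b])
        fix b assume b: "b \<in> M" "norm b \<le> 1"
        have "cmod (\<phi> b) \<le> C1" using C1(2)[OF b(1)] mult_left_mono[OF b(2) C1(1)] by simp
        moreover have "cmod (\<psi> b) \<le> C2" using C2(2)[OF b(1)] mult_left_mono[OF b(2) C2(1)] by simp
        ultimately show "cmod (\<phi> b - \<psi> b) \<le> C1 + C2" using norm_triangle_ineq4[of "\<phi> b" "\<psi> b"] by linarith
      qed
      then have lt: "cmod (\<phi> b) < e" using \<psi>(2) \<open>\<psi> b = 0\<close> by simp
      have "\<phi> b = of_real (1 / norm a) * cinner (a h) (a h)"
        by (simp add: \<phi>_def b_def blinfun.scaleR_left cinner_scaleC_left flip: scaleC_of_real)
      also have "cmod \<dots> = e" by (simp add: cinner_same norm_mult e_def norm_divide norm_power)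
      finally show False using lt by simp
    qed
    then show "a = 0" by (intro blinfun_eqI) simp
  qed
  then show thesis using that[of \<zeta>] by (auto simp: separating_def)
qed

section \<open>Strong convergence on bounded sets\<close>

lemma ell2_finite_approx:
  fixes \<xi> :: "('i, 'h::chilbert_space) ell2"
  assumes e: "e > 0"
  obtains T where "finite T" "norm (\<xi> - (\<Sum>t\<in>T. ell2_single t (ell2_fun \<xi> t))) < e"
proof -
  have "((\<lambda>t. (norm (ell2_fun \<xi> t))\<^sup>2) has_sum (norm \<xi>)\<^sup>2) UNIV"
    unfolding ell2_norm_sq by (rule has_sum_infsum[OF ell2_summable])
  then have "(sum (\<lambda>t. (norm (ell2_fun \<xi> t))\<^sup>2) \<longlongrightarrow> (norm \<xi>)\<^sup>2) (finite_subsets_at_top UNIV)"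
    by (simp add: has_sum_def)
  then have "\<forall>\<^sub>F T in finite_subsets_at_top UNIV. (norm \<xi>)\<^sup>2 - e\<^sup>2 < (\<Sum>t\<in>T. (norm (ell2_fun \<xi> t))\<^sup>2)"
    using e by (intro order_tendstoD(1)) auto
  then obtain T where T: "finite T" "(norm \<xi>)\<^sup>2 - e\<^sup>2 < (\<Sum>t\<in>T. (norm (ell2_fun \<xi> t))\<^sup>2)"
    unfolding eventually_finite_subsets_at_top by blast
  define p where "p = (\<Sum>t\<in>T. ell2_single t (ell2_fun \<xi> t))"
  have comp: "ell2_fun p t = (if t \<in> T then ell2_fun \<xi> t else 0)" for t
  proof -
    have "ell2_fun p t = (\<Sum>s\<in>T. ell2_fun (ell2_single s (ell2_fun \<xi> s)) t)"
      unfolding p_def by (rule bounded_linear.linear[OF bounded_linear_ell2_fun, THEN linear_sum])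
    also have "\<dots> = (\<Sum>s\<in>T. if t = s then ell2_fun \<xi> s else 0)"
      by (rule sum.cong) (auto simp: ell2_single_apply)
    also have "\<dots> = (if t \<in> T then ell2_fun \<xi> t else 0)" using T(1) by simp
    finally show ?thesis .
  qed
  have ip: "inner v p = (\<Sum>t\<in>T. inner (ell2_fun v t) (ell2_fun \<xi> t))" for v
    unfolding p_def by (simp add: inner_sum_right inner_single_right)
  have "inner \<xi> p = (\<Sum>t\<in>T. (norm (ell2_fun \<xi> t))\<^sup>2)" by (simp add: ip power2_norm_eq_inner)
  moreover have "inner p p = (\<Sum>t\<in>T. (norm (ell2_fun \<xi> t))\<^sup>2)"
    unfolding ip by (rule sum.cong) (auto simp: comp power2_norm_eq_inner)
  ultimately have "(norm (\<xi> - p))\<^sup>2 = (norm \<xi>)\<^sup>2 - (\<Sum>t\<in>T. (norm (ell2_fun \<xi> t))\<^sup>2)"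
    by (simp add: power2_norm_eq_inner inner_diff_left inner_diff_right inner_commute[of p \<xi>])
  then have "(norm (\<xi> - p))\<^sup>2 < e\<^sup>2" using T(2) by linarith
  then have "norm (\<xi> - p) < e" using e by (simp add: power2_less_imp_less)
  then show thesis using that[OF T(1)] by (simp add: p_def)
qed

text \<open>Given the uniform bound \<open>K\<close>, the part of \<open>\<xi>\<close> outside
  finitely many coordinates contributes little for all \<open>x\<close> at once.\<close>

lemma diag_op_tendsto_zero:
  fixes f :: "'x \<Rightarrow> 'i \<Rightarrow> 'h::chilbert_space op" and \<xi> :: "('i, 'h) ell2"
  assumes K: "\<And>x t. norm (f x t) \<le> K"
    and lim: "\<And>t. ((\<lambda>x. f x t (ell2_fun \<xi> t)) \<longlongrightarrow> 0) F"
  shows "((\<lambda>x. diag_op (f x) \<xi>) \<longlongrightarrow> 0) F"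
proof (rule tendstoI)
  fix e :: real assume e: "e > 0"
  have K0: "0 \<le> K" using K norm_ge_zero order_trans by blast
  define d where "d = e / (2 * (K + 1))"
  have d: "d > 0" "K * d < e / 2" using e K0 by (auto simp: d_def field_simps add_nonneg_pos)
  obtain T where T: "finite T" "norm (\<xi> - (\<Sum>t\<in>T. ell2_single t (ell2_fun \<xi> t))) < d"
    by (rule ell2_finite_approx[OF d(1)])
  define p where "p = (\<Sum>t\<in>T. ell2_single t (ell2_fun \<xi> t))"
  have dp: "diag_op (f x) p = (\<Sum>t\<in>T. ell2_single t (f x t (ell2_fun \<xi> t)))" for x
    unfolding p_def by (simp add: blinfun.sum_right diag_op_single[of "f x" K] K)
  have "((\<lambda>x. \<Sum>t\<in>T. ell2_single t (f x t (ell2_fun \<xi> t))) \<longlongrightarrow> (\<Sum>t\<in>T. ell2_single t 0)) F"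
    by (intro tendsto_sum bounded_linear.tendsto[OF bounded_linear_single] lim)
  moreover have "(\<Sum>t\<in>T. ell2_single t 0) = (0 :: ('i, 'h) ell2)"
    by (simp add: linear_simps(3)[OF bounded_linear_single])
  ultimately have "((\<lambda>x. diag_op (f x) p) \<longlongrightarrow> 0) F" by (simp add: dp)
  then have "\<forall>\<^sub>F x in F. dist (diag_op (f x) p) 0 < e / 2" by (rule tendstoD) (use e in simp)
  then show "\<forall>\<^sub>F x in F. dist (diag_op (f x) \<xi>) 0 < e"
  proof eventually_elim
    case (elim x)
    have "diag_op (f x) \<xi> = diag_op (f x) p + diag_op (f x) (\<xi> - p)" by (simp add: blinfun.bilinear_simps)
    then have "norm (diag_op (f x) \<xi>) \<le> norm (diag_op (f x) p) + norm (diag_op (f x) (\<xi> - p))"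
      by (metis norm_triangle_ineq)
    also have "norm (diag_op (f x) (\<xi> - p)) \<le> norm (diag_op (f x)) * norm (\<xi> - p)" by (rule norm_blinfun)
    also have "\<dots> \<le> K * d"
      using T(2) K0 by (intro mult_mono norm_diag_op K) (auto simp: p_def)
    finally show ?case using elim d(2) by simp
  qed
qed

lemma amp_tendsto_zero:
  fixes f :: "'x \<Rightarrow> 'h::chilbert_space op" and \<xi> :: "('i, 'h) ell2"
  assumes "\<And>x. norm (f x) \<le> K" and "\<And>t. ((\<lambda>x. f x (ell2_fun \<xi> t)) \<longlongrightarrow> 0) F"
  shows "((\<lambda>x. amp (f x) \<xi>) \<longlongrightarrow> 0) F"
  unfolding amp_def by (rule diag_op_tendsto_zero) (use assms in auto)

lemma normal_on_tendsto_zero: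
  assumes n: "normal_on \<zeta> M \<rho>" and M: "star_alg M"
    and h: "\<And>r a. a \<in> M \<Longrightarrow> \<rho> (r *\<^sub>R a) = r *\<^sub>R \<rho> a"
    and f: "\<And>x. f x \<in> M" "\<And>x. norm (f x) \<le> K" "((\<lambda>x. amp (f x) \<zeta>) \<longlongrightarrow> 0) F"
  shows "((\<lambda>x. \<rho> (f x) \<xi>) \<longlongrightarrow> 0) F"
proof (rule tendstoI)
  fix e :: real assume e: "e > 0"
  define L where "L = max K 1"
  have L: "L > 0" "\<And>x. norm (f x) \<le> L" using order_trans[OF f(2) max.cobounded1[of K 1]] by (auto simp: L_def)
  define g where "g x = (1/L) *\<^sub>R f x" for x
  have g: "g x \<in> M" "norm (g x) \<le> 1" "f x = L *\<^sub>R g x" for x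
    unfolding g_def using L star_algD(7)[OF M f(1)] by auto
  obtain d where d: "d > 0" "\<And>a. a \<in> M \<Longrightarrow> norm a \<le> 1 \<Longrightarrow> norm (amp a \<zeta>) < d \<Longrightarrow> norm (\<rho> a \<xi>) < e / L"
    using n[unfolded normal_on_def, rule_format, of "e / L" \<xi>] e L by auto
  have "\<forall>\<^sub>F x in F. dist (amp (f x) \<zeta>) 0 < d * L" by (rule tendstoD[OF f(3)]) (use d L in simp)
  then show "\<forall>\<^sub>F x in F. dist (\<rho> (f x) \<xi>) 0 < e"
  proof eventually_elim
    case (elim x)
    then have "norm (amp (g x) \<zeta>) < d"
      using L by (simp add: g(3) amp_scaleR blinfun.scaleR_left mult.commute)
    from d(2)[OF g(1,2) this] have "norm (\<rho> (g x) \<xi>) < e / L" .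
    then show ?case using L by (simp add: g(3)[of x] h[OF g(1)] blinfun.scaleR_left field_simps)
  qed
qed

lemma normal_onI:
  fixes \<rho> :: "'h::chilbert_space op \<Rightarrow> 'k::chilbert_space op"
  assumes "\<And>f \<xi>. (\<And>n. f n \<in> M) \<Longrightarrow> (\<And>n. norm (f n) \<le> 1) \<Longrightarrow> (\<lambda>n. amp (f n) \<zeta>) \<longlonglongrightarrow> 0
    \<Longrightarrow> (\<lambda>n. \<rho> (f n) \<xi>) \<longlonglongrightarrow> 0"
  shows "normal_on \<zeta> M \<rho>"
  unfolding normal_on_def
proof (intro allI impI, rule ccontr)
  fix \<xi> and e :: real assume e: "e > 0"
  assume "\<not> (\<exists>d>0. \<forall>a\<in>M. norm a \<le> 1 \<longrightarrow> norm (amp a \<zeta>) < d \<longrightarrow> norm (\<rho> a \<xi>) < e)"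
  then have "\<exists>a\<in>M. norm a \<le> 1 \<and> norm (amp a \<zeta>) < 1 / real (Suc n) \<and> \<not> norm (\<rho> a \<xi>) < e" for n
    by (metis of_nat_0_less_iff zero_less_Suc zero_less_divide_1_iff)
  then obtain f where f: "\<And>n. f n \<in> M" "\<And>n. norm (f n) \<le> 1" "\<And>n. norm (amp (f n) \<zeta>) < 1 / real (Suc n)"
    "\<And>n. \<not> norm (\<rho> (f n) \<xi>) < e" by metis
  have "(\<lambda>n. amp (f n) \<zeta>) \<longlonglongrightarrow> 0"
  proof (rule Lim_null_comparison)
    show "\<forall>\<^sub>F n in sequentially. norm (amp (f n) \<zeta>) \<le> 1 / real (Suc n)"
      by (intro always_eventually allI less_imp_le f)
    show "(\<lambda>n. 1 / real (Suc n)) \<longlonglongrightarrow> 0" using LIMSEQ_Suc[OF lim_inverse_n'] by simp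
  qed
  from assms[OF f(1,2) this, of \<xi>] have "\<forall>\<^sub>F n in sequentially. dist (\<rho> (f n) \<xi>) 0 < e"
    using e by (rule tendstoD)
  then show False using f(4) by (auto simp: eventually_sequentially)
qed

lemma pos_amp:
  fixes a :: "'h::chilbert_space op"
  assumes a: "pos a" shows "pos (amp a :: ('i, 'h) ell2 op)"
proof -
  have "0 \<le> inner (amp a x) x" for x :: "('i, 'h) ell2"
    by (simp add: inner_ell2_def infsum_nonneg posD(3)[OF a])
  then show ?thesis using posD(1,2)[OF a] by (simp add: pos_def star_amp)
qed

lemma pos_amp_component:
  assumes a: "pos a" shows "inner (a (ell2_fun \<xi> t)) (ell2_fun \<xi> t) \<le> inner (amp a \<xi>) \<xi>"
proof -
  have "(\<Sum>t\<in>{t}. inner (ell2_fun (amp a \<xi>) t) (ell2_fun \<xi> t)) \<le> inner (amp a \<xi>) \<xi>"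
    unfolding inner_ell2_def
    by (rule finite_sum_le_infsum[OF ell2_inner_summable]) (auto simp: posD(3)[OF a])
  then show ?thesis by simp
qed

section \<open>Automorphisms preserve order and norm, and are normal\<close>

lemma vn_automorphismD:
  assumes M: "star_alg M" and \<theta>: "vn_automorphism M \<theta>"
  shows "a \<in> M \<Longrightarrow> \<theta> a \<in> M" "a \<in> M \<Longrightarrow> b \<in> M \<Longrightarrow> \<theta> (a + b) = \<theta> a + \<theta> b"
    "a \<in> M \<Longrightarrow> b \<in> M \<Longrightarrow> \<theta> (a o\<^sub>L b) = \<theta> a o\<^sub>L \<theta> b" "a \<in> M \<Longrightarrow> \<theta> (cscale c a) = cscale c (\<theta> a)"
    "a \<in> M \<Longrightarrow> \<theta> (star a) = star (\<theta> a)" "a \<in> M \<Longrightarrow> \<theta> (r *\<^sub>R a) = r *\<^sub>R \<theta> a" "\<theta> 0 = 0"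
    "a \<in> M \<Longrightarrow> b \<in> M \<Longrightarrow> \<theta> (a - b) = \<theta> a - \<theta> b" "\<theta> id_blinfun = id_blinfun"
proof -
  show 1: "a \<in> M \<Longrightarrow> \<theta> a \<in> M" "a \<in> M \<Longrightarrow> b \<in> M \<Longrightarrow> \<theta> (a + b) = \<theta> a + \<theta> b"
    "a \<in> M \<Longrightarrow> b \<in> M \<Longrightarrow> \<theta> (a o\<^sub>L b) = \<theta> a o\<^sub>L \<theta> b" "a \<in> M \<Longrightarrow> \<theta> (cscale c a) = cscale c (\<theta> a)"
    "a \<in> M \<Longrightarrow> \<theta> (star a) = star (\<theta> a)" for a b c
    using \<theta> by (auto simp: vn_automorphism_def bij_betw_def)
  show 2: "a \<in> M \<Longrightarrow> \<theta> (r *\<^sub>R a) = r *\<^sub>R \<theta> a" for a r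
    using 1(4)[of a "of_real r"] by (simp add: cscale_of_real)
  show "\<theta> 0 = 0" using 2[OF star_algD(2)[OF M], of 0] by simp
  show "\<theta> (a - b) = \<theta> a - \<theta> b" if "a \<in> M" "b \<in> M"
    using 1(2)[OF that(1) star_algD(7)[OF M that(2)], of "-1"] 2[OF that(2), of "-1"] by simp
  obtain e where e: "e \<in> M" "\<theta> e = id_blinfun"
    using \<theta> star_algD(2)[OF M] unfolding vn_automorphism_def bij_betw_def by (metis imageE)
  show "\<theta> id_blinfun = id_blinfun" using 1(3)[OF star_algD(2)[OF M] e(1)] e(2) by simp
qed

text \<open>The square root of a positive element stays in the norm closed algebra \<open>M\<close>,
  so positivity is an algebraic property there.\<close>

lemma vn_automorphism_pos:
  assumes M: "von_neumann_algebra M" and \<theta>: "vn_automorphism M \<theta>" and a: "a \<in> M" "pos a"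
  shows "pos (\<theta> a)"
proof -
  note S = vn_star_alg[OF M]
  note D = vn_automorphismD[OF S \<theta>]
  define s where "s = op_sqrt (norm a + 1) a"
  have K: "norm a \<le> norm a + 1" "0 < norm a + 1" by (auto simp: add_nonneg_pos)
  have s: "s \<in> M" "s o\<^sub>L s = a" "star s = s"
    unfolding s_def using op_sqrt_mem[OF a(2) K S vn_closed[OF M] a(1)] op_sqrt_square[OF a(2) K]
      posD(2)[OF op_sqrt_pos[OF a(2) K]] by auto
  have "\<theta> a = star (\<theta> s) o\<^sub>L \<theta> s" using D(3)[OF s(1,1)] D(5)[OF s(1)] s by simp
  then show ?thesis using pos_star_compose[OF star_algD(1)[OF S D(1)[OF s(1)]]] by simp
qed

text \<open>Contractivity follows from the order: \<open>\<theta>\<close> preserves the inequality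
  between \<open>star a o\<^sub>L a\<close> and the square of \<open>norm a\<close>.\<close>

lemma vn_automorphism_norm:
  assumes M: "von_neumann_algebra M" and \<theta>: "vn_automorphism M \<theta>" and a: "a \<in> M"
  shows "norm (\<theta> a) \<le> norm a"
proof -
  note S = vn_star_alg[OF M]
  note D = vn_automorphismD[OF S \<theta>]
  note A = star_algD[OF S]
  have aB: "a \<in> bounded_ops" and tB: "\<theta> a \<in> bounded_ops" using A(1) a D(1) by blast+
  define b where "b = (norm a)\<^sup>2 *\<^sub>R id_blinfun - (star a o\<^sub>L a)"
  have aa: "star a o\<^sub>L a \<in> M" by (rule A(4)[OF A(5)[OF a] a])
  have bM: "b \<in> M" unfolding b_def by (rule A(10)[OF A(7)[OF A(2)] aa])
  have "norm (star a o\<^sub>L a) \<le> (norm a)\<^sup>2"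
    using norm_blinfun_compose[of "star a" a] norm_star[OF aB] by (simp add: power2_eq_square)
  then have "pos b" unfolding b_def
    by (intro pos_norm_bound posD[OF pos_star_compose[OF aB]])
  then have "pos (\<theta> b)" by (rule vn_automorphism_pos[OF M \<theta> bM])
  moreover have "\<theta> b = (norm a)\<^sup>2 *\<^sub>R id_blinfun - (star (\<theta> a) o\<^sub>L \<theta> a)"
    unfolding b_def using D(8)[OF A(7)[OF A(2)] aa] D(6)[OF A(2)] D(9) D(3)[OF A(5)[OF a] a] D(5)[OF a] by simp
  ultimately have p: "pos ((norm a)\<^sup>2 *\<^sub>R id_blinfun - (star (\<theta> a) o\<^sub>L \<theta> a))" by simp
  show ?thesis
  proof (rule norm_blinfun_bound)
    fix x
    have "(norm (\<theta> a x))\<^sup>2 \<le> (norm a * norm x)\<^sup>2"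
      using posD(3)[OF p, of x] star_norm_sq[OF tB, of x]
      by (simp add: blinfun.bilinear_simps inner_diff_left power_mult_distrib power2_norm_eq_inner)
    then show "norm (\<theta> a x) \<le> norm a * norm x" by (rule power2_le_imp_le) simp
  qed simp
qed

lemma ex_increasing_limit:
  fixes f :: "nat \<Rightarrow> 'h::chilbert_space op"
  assumes u: "free_ultrafilter \<omega>" and M: "von_neumann_algebra M"
    and f: "\<And>n. f n \<in> M" "\<And>n. norm (f n) \<le> K" "\<And>n. pos (f (Suc n) - f n)"
  shows "\<exists>c\<in>M. (\<forall>n. pos (c - f n)) \<and> (\<forall>x y. ((\<lambda>i. inner (f i x) y) \<longlongrightarrow> inner (c x) y) \<omega>)"
proof -
  note bot = free_ultrafilterD(1)[OF u]
  obtain c where c: "c \<in> bounded_ops" "norm c \<le> K" "\<And>x y. ((\<lambda>i. inner (f i x) y) \<longlongrightarrow> inner (c x) y) \<omega>"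
    using ultrafilter_op_limit[OF u, of f K] f(1,2) star_algD(1)[OF vn_star_alg[OF M]] by blast
  have cM: "c \<in> M" by (rule vn_wot_closed[OF M bot f(1) c(3)])
  have mono: "pos (f m - f n)" if "n \<le> m" for n m using that
  proof (induction m rule: dec_induct)
    case (step m)
    show ?case by (rule pos_trans[OF step.IH f(3)])
  qed simp
  have "pos (c - f n)" for n
  proof (rule pos_wot_closed[OF bot])
    \<comment> \<open>Using \<open>max i n\<close> instead of \<open>i\<close> makes the difference
      positive for every \<open>i\<close>. It changes only indices below \<open>n\<close>, which a
      free ultrafilter ignores.\<close>
    show "pos (f (max i n) - f n)" for i by (rule mono) simp
    fix x y
    have "((\<lambda>i. inner (f (max i n) x) y) \<longlongrightarrow> inner (c x) y) \<omega>"
    proof (rule tendsto_cong[THEN iffD1, OF _ c(3)])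
      show "\<forall>\<^sub>F i in \<omega>. inner (f i x) y = inner (f (max i n) x) y"
        using free_ultrafilterD(3)[OF u, of n] by eventually_elim (simp add: max_absorb1)
    qed
    then have "((\<lambda>i. inner (f (max i n) x) y - inner (f n x) y) \<longlongrightarrow> inner (c x) y - inner (f n x) y) \<omega>"
      by (intro tendsto_diff tendsto_const)
    then show "((\<lambda>i. inner ((f (max i n) - f n) x) y) \<longlongrightarrow> inner ((c - f n) x) y) \<omega>"
      by (simp add: blinfun.diff_left inner_diff_left)
  qed
  then show ?thesis using cM c(3) by blast
qed

text \<open>This is \<open>2 a / (1 + a) - a = a (1 - a) / (1 + a)\<close>, a product of commuting
  positive operators. It says that the bounded transform loses at most a factor 2 on operators
  between 0 and 1.\<close>

lemma pos_half_btrans: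
  assumes a: "pos a" and a1: "pos (id_blinfun - a)"
  shows "pos (2 *\<^sub>R btrans a - a)"
proof -
  define r where "r = resolvent1 a"
  have "r o\<^sub>L a = a o\<^sub>L r" using btrans_eq[OF a] by (simp add: r_def)
  then have raz: "r (a z) = a (r z)" for z by (metis blinfun_apply_blinfun_compose)
  have "pos (a o\<^sub>L (id_blinfun - a))"
    by (rule pos_compose_commute[OF a a1]) (simp add: compose_diff_left compose_diff_right)
  moreover have "r o\<^sub>L (a o\<^sub>L (id_blinfun - a)) = (a o\<^sub>L (id_blinfun - a)) o\<^sub>L r"
    by (rule blinfun_eqI) (simp add: blinfun.bilinear_simps raz)
  ultimately have "pos (r o\<^sub>L (a o\<^sub>L (id_blinfun - a)))"
    by (rule pos_compose_commute[OF resolvent1_pos[OF a, folded r_def]])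
  moreover have "r o\<^sub>L (a o\<^sub>L (id_blinfun - a)) = 2 *\<^sub>R btrans a - a"
  proof (rule blinfun_eqI)
    fix z
    have "a z = r (a z) + r (a (a z))"
      using resolvent1_apply(2)[OF a, of "a z"] by (simp add: r_def blinfun.bilinear_simps)
    moreover have "btrans a z = r (a z)" using btrans_eq(2)[OF a] by (simp add: r_def)
    ultimately show "(r o\<^sub>L (a o\<^sub>L (id_blinfun - a))) z = (2 *\<^sub>R btrans a - a) z"
      by (simp add: blinfun.bilinear_simps scaleR_2 algebra_simps)
  qed
  ultimately show ?thesis by simp
qed

text \<open>If \<open>\<theta>\<close> were not continuous along a sequence \<open>a\<^sub>n \<rightarrow> 0\<close>, then the decreasing
  sequence \<open>c\<^sub>n = sup\<^sub>m btrans (a\<^sub>n + \<dots> + a\<^sub>n\<^sub>+\<^sub>m)\<close> would tend to 0 whereas \<open>\<theta> c\<^sub>n \<ge> \<theta> a\<^sub>n / 2\<close>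
  does not, contradicting that the order isomorphism \<open>\<theta>\<close> preserves infima.\<close>

lemma automorphism_continuous_pos:
  fixes \<theta> \<theta>' :: "'h::chilbert_space op \<Rightarrow> 'h op"
  assumes u: "free_ultrafilter \<omega>" and M: "von_neumann_algebra M" and sep: "separating \<zeta> M"
    and \<theta>: "vn_automorphism M \<theta>" and \<theta>': "vn_automorphism M \<theta>'"
    and inv: "\<And>a. a \<in> M \<Longrightarrow> \<theta>' (\<theta> a) = a" "\<And>a. a \<in> M \<Longrightarrow> \<theta> (\<theta>' a) = a"
    and e: "e > 0"
  shows "\<exists>d>0. \<forall>a\<in>M. pos a \<longrightarrow> pos (id_blinfun - a) \<longrightarrow> inner (amp a \<zeta>) \<zeta> < d \<longrightarrow> inner (\<theta> a h) h < e"
proof (rule ccontr)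
  note S = vn_star_alg[OF M]
  note A = star_algD[OF S]
  note D = vn_automorphismD[OF S \<theta>]
  note D' = vn_automorphismD[OF S \<theta>']
  note bot = free_ultrafilterD(1)[OF u]
  assume "\<not> ?thesis"
  then have "\<exists>a\<in>M. pos a \<and> pos (id_blinfun - a) \<and> inner (amp a \<zeta>) \<zeta> < (1/2)^n \<and> \<not> inner (\<theta> a h) h < e" for n
    by (metis half_gt_zero_iff zero_less_one zero_less_power)
  then obtain a where a: "\<And>n. a n \<in> M" "\<And>n. pos (a n)" "\<And>n. pos (id_blinfun - a n)"
    "\<And>n. inner (amp (a n) \<zeta>) \<zeta> < (1/2)^n" "\<And>n. \<not> inner (\<theta> (a n) h) h < e" by metis
  \<comment> \<open>The partial sums may be unbounded in norm as \<open>m\<close> grows. Their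
    bounded transforms are still monotone in \<open>m\<close> and stay below 1, so they have a limit
    in \<open>M\<close>.\<close>
  define s where "s n m = (\<Sum>k\<in>{n..<n+m}. a k)" for n m
  define C where "C n m = btrans (s n m)" for n m
  have sM: "s n m \<in> M" and ps: "pos (s n m)" for n m
    unfolding s_def by (intro star_alg_sum[OF S] pos_sum a)+
  have CM: "C n m \<in> M" for n m unfolding C_def by (rule btrans_mem[OF ps S vn_closed[OF M] sM])
  have nC: "norm (C n m) \<le> 1" for n m unfolding C_def by (rule norm_btrans[OF ps])
  have C1: "pos (C n (Suc m) - C n m)" for n m
    unfolding C_def by (rule btrans_mono[OF ps]) (simp add: s_def a(2))
  have C2: "pos (C n (Suc m) - C (Suc n) m)" for n m
  proof -
    have "s n (Suc m) - s (Suc n) m = a n" by (simp add: s_def sum.atLeast_Suc_lessThan)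
    then show ?thesis unfolding C_def using a(2) by (intro btrans_mono[OF ps]) simp
  qed
  have "\<exists>c\<in>M. (\<forall>m. pos (c - C n m)) \<and> (\<forall>x y. ((\<lambda>m. inner (C n m x) y) \<longlongrightarrow> inner (c x) y) \<omega>)" for n
    by (rule ex_increasing_limit[of \<omega> M "C _" 1, OF u M CM nC C1])
  then obtain c where c: "\<And>n. c n \<in> M" "\<And>n m. pos (c n - C n m)"
    "\<And>n x y. ((\<lambda>m. inner (C n m x) y) \<longlongrightarrow> inner (c n x) y) \<omega>" by metis
  have C0: "C n 0 = 0" for n
    using pos_antisym[OF btrans_pos[OF ps, of n 0]] btrans_le[OF ps, of n 0] by (simp add: C_def s_def)
  have pc: "pos (c n)" for n using c(2)[of n 0] C0 by simp
  have cdec: "pos (c n - c (Suc n))" for n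
  proof (rule pos_wot_closed[OF bot])
    show "pos (c n - C (Suc n) m)" for m by (rule pos_trans[OF C2 c(2)])
    show "((\<lambda>m. inner ((c n - C (Suc n) m) x) y) \<longlongrightarrow> inner ((c n - c (Suc n)) x) y) \<omega>" for x y
      unfolding blinfun.diff_left inner_diff_left by (intro tendsto_intros c(3))
  qed
  have cn1: "norm (c n) \<le> 1" for n
  proof (rule pos_norm_le[OF pc])
    have "pos (id_blinfun - c n)"
    proof (rule pos_wot_closed[OF bot])
      show "pos (id_blinfun - C n m)" for m unfolding C_def by (rule btrans_le_one[OF ps])
      show "((\<lambda>m. inner ((id_blinfun - C n m) x) y) \<longlongrightarrow> inner ((id_blinfun - c n) x) y) \<omega>" for x y
        unfolding blinfun.diff_left inner_diff_left by (intro tendsto_intros c(3))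
    qed
    then show "pos (1 *\<^sub>R id_blinfun - c n)" by simp
  qed simp
  have csmall: "inner (c n (ell2_fun \<zeta> k)) (ell2_fun \<zeta> k) \<le> 2 * (1/2)^n" for n k
  proof (rule tendsto_upperbound[OF c(3) _ bot], intro always_eventually allI)
    fix m
    have geo: "(\<Sum>k\<in>{n..<n+m}. (1/2::real)^k) \<le> 2 * (1/2)^n"
    proof -
      have "(\<Sum>k\<in>{n..<n+m}. (1/2::real)^k) = 2 * (1/2)^n - 2 * (1/2)^(n+m)"
        by (induction m) auto
      then show ?thesis by simp
    qed
    have "inner (C n m (ell2_fun \<zeta> k)) (ell2_fun \<zeta> k) \<le> inner (s n m (ell2_fun \<zeta> k)) (ell2_fun \<zeta> k)"
      unfolding C_def by (rule pos_inner_mono[OF btrans_le[OF ps]])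
    also have "\<dots> = (\<Sum>j\<in>{n..<n+m}. inner (a j (ell2_fun \<zeta> k)) (ell2_fun \<zeta> k))"
      by (simp add: s_def blinfun.sum_left inner_sum_left)
    also have "\<dots> \<le> (\<Sum>j\<in>{n..<n+m}. (1/2)^j)"
      by (intro sum_mono order_trans[OF pos_amp_component[OF a(2)]] less_imp_le a(4))
    also note geo
    finally show "inner (C n m (ell2_fun \<zeta> k)) (ell2_fun \<zeta> k) \<le> 2 * (1/2)^n" .
  qed
  \<comment> \<open>The decreasing sequence \<open>c\<close> is negated in order to fit the lemma on
    increasing limits; the same is done below for its image under \<open>\<theta>\<close>.\<close>
  have "\<exists>i\<in>M. (\<forall>n. pos (i - (- c n))) \<and> (\<forall>x y. ((\<lambda>n. inner ((- c n) x) y) \<longlongrightarrow> inner (i x) y) \<omega>)"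
  proof (rule ex_increasing_limit[OF u M, of "\<lambda>n. - c n" 1])
    show "- c n \<in> M" for n by (rule A(9)[OF c(1)])
    show "pos (- c (Suc n) - - c n)" for n using cdec[of n] by simp
  qed (use cn1 in auto)
  then obtain i where i: "i \<in> M" "\<And>n. pos (i - (- c n))" "\<And>x y. ((\<lambda>n. inner ((- c n) x) y) \<longlongrightarrow> inner (i x) y) \<omega>"
    by blast
  have i0: "i = 0"
  proof -
    have pi: "pos (- i)"
    proof (rule pos_wot_closed[OF bot pc])
      show "((\<lambda>n. inner (c n x) y) \<longlongrightarrow> inner ((- i) x) y) \<omega>" for x y
        using tendsto_minus[OF i(3)[of x y]] by (simp add: blinfun.bilinear_simps)
    qed
    have "amp (- i) \<zeta> = 0"
    proof (rule ell2_eqI)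
      fix k
      let ?z = "ell2_fun \<zeta> k"
      have "inner ((- i) ?z) ?z \<le> 2 * (1/2)^n" for n
        using pos_inner_mono[of "c n" "- i" ?z] i(2)[of n] csmall[of n k] by (simp add: algebra_simps)
      moreover have "(\<lambda>n. 2 * (1/2)^n :: real) \<longlonglongrightarrow> 2 * 0" by (intro tendsto_intros LIMSEQ_power_zero) auto
      ultimately have "inner ((- i) ?z) ?z \<le> 2 * 0" by (intro LIMSEQ_le_const) blast+
      then have "(inner ((- i) ?z) ((- i) ?z))\<^sup>2 \<le> 0"
        using pos_Cauchy_Schwarz[OF pi, of ?z "(- i) ?z"] posD(3)[OF pi, of ?z] by simp
      then show "ell2_fun (amp (- i) \<zeta>) k = ell2_fun 0 k" by (simp add: zero_ell2.rep_eq)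
    qed
    then have "- i = 0" using sep A(9)[OF i(1)] unfolding separating_def by blast
    then show ?thesis by simp
  qed
  have "\<exists>j\<in>M. (\<forall>n. pos (j - (- \<theta> (c n)))) \<and> (\<forall>x y. ((\<lambda>n. inner ((- \<theta> (c n)) x) y) \<longlongrightarrow> inner (j x) y) \<omega>)"
  proof (rule ex_increasing_limit[OF u M, of "\<lambda>n. - \<theta> (c n)" 1])
    show "- \<theta> (c n) \<in> M" for n by (intro A(9) D(1) c(1))
    show "norm (- \<theta> (c n)) \<le> 1" for n
      using vn_automorphism_norm[OF M \<theta> c(1), of n] cn1[of n] by simp
    show "pos (- \<theta> (c (Suc n)) - - \<theta> (c n))" for n
      using vn_automorphism_pos[OF M \<theta> A(10)[OF c(1,1)] cdec[of n]] D(8)[OF c(1,1), of n "Suc n"] by simp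
  qed
  then obtain j where j: "j \<in> M" "\<And>n. pos (j - (- \<theta> (c n)))"
    "\<And>x y. ((\<lambda>n. inner ((- \<theta> (c n)) x) y) \<longlongrightarrow> inner (j x) y) \<omega>"
    by blast
  have "j = 0"
  proof -
    have pj: "pos (- j)"
    proof (rule pos_wot_closed[OF bot vn_automorphism_pos[OF M \<theta> c(1) pc]])
      show "((\<lambda>n. inner (\<theta> (c n) x) y) \<longlongrightarrow> inner ((- j) x) y) \<omega>" for x y
        using tendsto_minus[OF j(3)[of x y]] by (simp add: blinfun.bilinear_simps)
    qed
    \<comment> \<open>\<open>- j\<close> is a positive lower bound of all
      \<open>\<theta> (c n)\<close>. Its preimage is a positive lower bound of all
      \<open>c n\<close>, hence 0 because the \<open>c n\<close> tend weakly to 0.\<close>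
    define b where "b = \<theta>' (- j)"
    have mj: "- j \<in> M" by (rule A(9)[OF j(1)])
    have b: "b \<in> M" "pos b" unfolding b_def by (rule D'(1)[OF mj], rule vn_automorphism_pos[OF M \<theta>' mj pj])
    have "pos (c n - b)" for n
    proof -
      have "pos (\<theta> (c n) - (- j))" using j(2)[of n] by (simp add: add.commute)
      then have "pos (\<theta>' (\<theta> (c n) - (- j)))"
        by (rule vn_automorphism_pos[OF M \<theta>' A(10)[OF D(1)[OF c(1)] mj]])
      then show ?thesis using D'(8)[OF D(1)[OF c(1)] mj] inv(1)[OF c(1)] by (simp add: b_def)
    qed
    then have "pos (- i - b)"
    proof (rule pos_wot_closed[OF bot])
      show "((\<lambda>n. inner ((c n - b) x) y) \<longlongrightarrow> inner ((- i - b) x) y) \<omega>" for x y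
        using tendsto_diff[OF tendsto_minus[OF i(3)[of x y]] tendsto_const[of "inner (b x) y"]]
        by (simp add: blinfun.bilinear_simps inner_diff_left)
    qed
    then have "b = 0" using pos_antisym[OF b(2)] i0 by simp
    then show ?thesis using inv(2)[OF mj] D(7) by (simp add: b_def)
  qed
  then have "((\<lambda>n. inner (\<theta> (c n) h) h) \<longlongrightarrow> 0) \<omega>"
    using tendsto_minus[OF j(3)[of h h]] by (simp add: blinfun.bilinear_simps)
  then have "\<forall>\<^sub>F n in \<omega>. inner (\<theta> (c n) h) h < e / 2" using e by (intro order_tendstoD(2)) auto
  then obtain n where n: "inner (\<theta> (c n) h) h < e / 2" using eventually_happens'[OF bot] by blast
  have "pos (2 *\<^sub>R c n - a n)"
  proof -
    have "C n 1 = btrans (a n)" by (simp add: C_def s_def)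
    then have "pos (2 *\<^sub>R C n 1 - a n)" using pos_half_btrans[OF a(2,3)] by simp
    moreover have "pos (2 *\<^sub>R (c n - C n 1))" by (intro pos_scaleR c(2)) simp
    ultimately show ?thesis using pos_add by (fastforce simp: scaleR_diff_right)
  qed
  then have "pos (\<theta> (2 *\<^sub>R c n - a n))" by (rule vn_automorphism_pos[OF M \<theta> A(10)[OF A(7)[OF c(1)] a(1)]])
  then have "pos (2 *\<^sub>R \<theta> (c n) - \<theta> (a n))" using D(8)[OF A(7)[OF c(1)] a(1)] D(6)[OF c(1)] by simp
  from pos_inner_mono[OF this, of h] have "inner (\<theta> (a n) h) h \<le> 2 * inner (\<theta> (c n) h) h"
    by (simp add: blinfun.scaleR_left)
  then show False using n a(5)[of n] by simp
qed

text \<open>Apply the positive case to \<open>star a o\<^sub>L a\<close>, whose form at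
  \<open>\<zeta>\<close> is the square of \<open>norm (amp a \<zeta>)\<close>.\<close>

lemma automorphism_normal:
  assumes u: "free_ultrafilter \<omega>" and M: "von_neumann_algebra M" and sep: "separating \<zeta> M"
    and \<theta>: "vn_automorphism M \<theta>" and \<theta>': "vn_automorphism M \<theta>'"
    and inv: "\<And>a. a \<in> M \<Longrightarrow> \<theta>' (\<theta> a) = a" "\<And>a. a \<in> M \<Longrightarrow> \<theta> (\<theta>' a) = a"
  shows "normal_on \<zeta> M \<theta>"
  unfolding normal_on_def
proof (intro allI impI)
  note S = vn_star_alg[OF M]
  note A = star_algD[OF S]
  note D = vn_automorphismD[OF S \<theta>]
  fix h and e :: real assume e: "e > 0"
  obtain d where d: "d > 0" "\<And>a. a \<in> M \<Longrightarrow> pos a \<Longrightarrow> pos (id_blinfun - a) \<Longrightarrow> inner (amp a \<zeta>) \<zeta> < d \<Longrightarrow> inner (\<theta> a h) h < e\<^sup>2"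
    using automorphism_continuous_pos[OF u M sep \<theta> \<theta>' inv, of "e\<^sup>2" h] e by auto
  have "norm (\<theta> a h) < e" if a: "a \<in> M" "norm a \<le> 1" "norm (amp a \<zeta>) < sqrt d" for a
  proof -
    have aB: "a \<in> bounded_ops" and tB: "\<theta> a \<in> bounded_ops" using A(1) a D(1) by blast+
    define b where "b = star a o\<^sub>L a"
    have bM: "b \<in> M" unfolding b_def by (rule A(4)[OF A(5)[OF a(1)] a(1)])
    have pb: "pos b" unfolding b_def by (rule pos_star_compose[OF aB])
    have "norm b \<le> norm a * norm a" unfolding b_def using norm_blinfun_compose[of "star a" a] norm_star[OF aB] by simp
    also have "\<dots> \<le> 1 * 1" by (intro mult_mono a) auto
    finally have p1: "pos (id_blinfun - b)" using pos_norm_bound(1)[OF posD(1,2)[OF pb], of 1] by simp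
    have "inner (amp b \<zeta>) \<zeta> = (norm (amp a \<zeta>))\<^sup>2"
      using star_norm_sq[OF amp_bounded_ops[OF aB], of \<zeta>] by (simp add: b_def amp_compose star_amp[OF aB])
    also have "\<dots> < (sqrt d)\<^sup>2" using a(3) by (intro power_strict_mono) auto
    finally have "inner (\<theta> b h) h < e\<^sup>2" using d(1) by (intro d(2)[OF bM pb p1]) simp
    moreover have "\<theta> b = star (\<theta> a) o\<^sub>L \<theta> a" unfolding b_def using D(3)[OF A(5)[OF a(1)] a(1)] D(5)[OF a(1)] by simp
    ultimately have "(norm (\<theta> a h))\<^sup>2 < e\<^sup>2" using star_norm_sq[OF tB, of h] by simp
    then show ?thesis using e by (simp add: power2_less_imp_less)
  qed
  then show "\<exists>d>0. \<forall>a\<in>M. norm a \<le> 1 \<longrightarrow> norm (amp a \<zeta>) < d \<longrightarrow> norm (\<theta> a h) < e"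
    using d(1) by (intro exI[of _ "sqrt d"]) auto
qed

text \<open>The map is trivial but the conclusion is not: on the unit ball of \<open>M\<close>,
  smallness at the separating sequence forces smallness at every vector.\<close>

lemma identity_normal:
  assumes "free_ultrafilter \<omega>" "von_neumann_algebra M" "separating \<zeta> M"
  shows "normal_on \<zeta> M (\<lambda>a. a)"
proof -
  have "vn_automorphism M (\<lambda>a. a)" by (simp add: vn_automorphism_def bij_betw_def)
  then show ?thesis by (intro automorphism_normal[OF assms]) auto
qed

section \<open>Sequentially closed subspaces containing a star-algebra\<close>

lemma star_alg_closure:
  assumes A: "star_alg A" shows "star_alg (closure A)"
proof -
  note D = star_algD[OF A]
  have B: "closure A \<subseteq> bounded_ops"
    by (rule closure_minimal) (use D(1) closed_bounded_ops in auto)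
  have seq: "\<exists>f. (\<forall>n. f n \<in> A) \<and> f \<longlonglongrightarrow> a" if "a \<in> closure A" for a
    using that unfolding closure_sequential by blast
  have I: "a \<in> closure A" if "\<And>n. f n \<in> A" "f \<longlonglongrightarrow> a" for f a
    using that unfolding closure_sequential by blast
  have cp: "a o\<^sub>L b \<in> closure A" if ab: "a \<in> closure A" "b \<in> closure A" for a b
  proof -
    obtain f g where fg: "\<And>n. f n \<in> A" "f \<longlonglongrightarrow> a" "\<And>n. g n \<in> A" "g \<longlonglongrightarrow> b" using seq ab by metis
    show ?thesis
      by (rule I[of "\<lambda>n. f n o\<^sub>L g n"])
        (use fg D(4) in \<open>auto intro: bounded_bilinear.tendsto[OF bounded_bilinear_blinfun_compose]\<close>)
  qed
  have ad: "a + b \<in> closure A" if ab: "a \<in> closure A" "b \<in> closure A" for a b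
  proof -
    obtain f g where fg: "\<And>n. f n \<in> A" "f \<longlonglongrightarrow> a" "\<And>n. g n \<in> A" "g \<longlonglongrightarrow> b" using seq ab by metis
    show ?thesis by (rule I[of "\<lambda>n. f n + g n"]) (use fg D(3) in \<open>auto intro: tendsto_add\<close>)
  qed
  have st: "star a \<in> closure A" if a: "a \<in> closure A" for a
  proof -
    obtain f where f: "\<And>n. f n \<in> A" "f \<longlonglongrightarrow> a" using seq a by metis
    have "norm (star (f n) - star a) = norm (f n - a)" for n
      using norm_star[of "f n - a"] star_diff[of "f n" a] D(1)[OF f(1)] a B by auto
    then have "(\<lambda>n. star (f n)) \<longlonglongrightarrow> star a"
      using f(2) by (simp add: tendsto_iff dist_norm)
    then show ?thesis by (rule I[rotated]) (use f D(5) in auto)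
  qed
  have cs: "cscale c a \<in> closure A" if a: "a \<in> closure A" for a c
  proof -
    have "cscale c a = cscale c id_blinfun o\<^sub>L a" by (rule blinfun_eqI) simp
    then show ?thesis using cp[OF subsetD[OF closure_subset D(6)[OF D(2)]] a] by simp
  qed
  show ?thesis unfolding star_alg_def
    by (intro conjI ballI allI B cp ad st cs subsetD[OF closure_subset D(2)])
qed

text \<open>The function \<open>t / (1 + t^2)\<close> of a selfadjoint operator. It makes
  approximants of uncontrolled norm uniformly bounded while respecting strong convergence.\<close>

definition bfun :: "'h::chilbert_space op \<Rightarrow> 'h op" where
  "bfun y = y o\<^sub>L resolvent1 (y o\<^sub>L y)"

lemma bfun:
  fixes y :: "'h::chilbert_space op"
  assumes y: "y \<in> bounded_ops" "star y = y"
  shows norm_bfun: "norm (bfun y) \<le> 1"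
    and bfun_commute: "resolvent1 (y o\<^sub>L y) o\<^sub>L y = bfun y"
    and bfun_mem: "star_alg A \<Longrightarrow> closed A \<Longrightarrow> y \<in> A \<Longrightarrow> bfun y \<in> A"
    and bfun_diff: "y - bfun y = y o\<^sub>L (y o\<^sub>L bfun y)"
proof -
  let ?r = "resolvent1 (y o\<^sub>L y)"
  have p: "pos (y o\<^sub>L y)" by (rule pos_square[OF y])
  note ap = resolvent1_apply[OF p]
  show com: "?r o\<^sub>L y = bfun y"
  proof (rule blinfun_eqI)
    fix z
    have "?r (y z) = ?r (y (?r z + y (y (?r z))))" using ap(1)[of z] by simp
    also have "\<dots> = ?r (y (?r z) + y (y (y (?r z))))" by (simp add: blinfun.bilinear_simps)
    also have "\<dots> = y (?r z)" using ap(2)[of "y (?r z)"] by simp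
    finally show "(?r o\<^sub>L y) z = bfun y z" by (simp add: bfun_def)
  qed
  show "norm (bfun y) \<le> 1"
  proof (rule norm_blinfun_bound)
    fix z
    let ?v = "?r z"
    have "(norm (bfun y z))\<^sup>2 = inner (y (y ?v)) ?v"
      by (simp add: bfun_def power2_norm_eq_inner inner_selfadjoint[OF y])
    also have "\<dots> \<le> inner (y (y ?v)) (?v + y (y ?v))"
      using inner_ge_zero[of "y (y ?v)"] by (simp only: inner_add_right)
    also have "\<dots> = inner (z - ?v) z"
    proof -
      have yy: "y (y ?v) = z - ?v" using ap(1)[of z] by (simp add: eq_diff_eq add.commute)
      show ?thesis by (simp add: yy)
    qed
    also have "\<dots> \<le> (norm z)\<^sup>2"
      using posD(3)[OF resolvent1_pos[OF p], of z] by (simp add: inner_diff_left power2_norm_eq_inner)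
    finally have "norm (bfun y z) \<le> norm z" by (rule power2_le_imp_le) simp
    then show "norm (bfun y z) \<le> 1 * norm z" by simp
  qed simp
  show "bfun y \<in> A" if A: "star_alg A" "closed A" "y \<in> A" for A
    unfolding bfun_def
    by (rule star_algD(4)[OF A(1,3) resolvent1_mem[OF p A(1,2) star_algD(4)[OF A(1,3,3)]]])
  show "y - bfun y = y o\<^sub>L (y o\<^sub>L bfun y)"
  proof (rule blinfun_eqI)
    fix z
    have "y z = y (?r z + y (y (?r z)))" using ap(1)[of z] by simp
    then show "(y - bfun y) z = (y o\<^sub>L (y o\<^sub>L bfun y)) z"
      by (simp add: bfun_def blinfun.bilinear_simps)
  qed
qed

lemma normal_on_tendsto:
  fixes \<rho> :: "'h::chilbert_space op \<Rightarrow> 'k::chilbert_space op"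
  assumes n: "normal_on \<zeta> M \<rho>" and M: "star_alg M"
    and h: "\<And>r a. a \<in> M \<Longrightarrow> \<rho> (r *\<^sub>R a) = r *\<^sub>R \<rho> a"
    and d: "\<And>a b. a \<in> M \<Longrightarrow> b \<in> M \<Longrightarrow> \<rho> (a - b) = \<rho> a - \<rho> b"
    and f: "\<And>x. f x \<in> M" "\<And>x. norm (f x) \<le> K" "a \<in> M" "\<And>k. ((\<lambda>x. f x (ell2_fun \<zeta> k)) \<longlongrightarrow> a (ell2_fun \<zeta> k)) F"
  shows "((\<lambda>x. \<rho> (f x) \<xi>) \<longlongrightarrow> \<rho> a \<xi>) F"
proof -
  have nb: "norm (f x - a) \<le> K + norm a" for x
    using norm_triangle_ineq4[of "f x" a] f(2)[of x] by linarith
  have "((\<lambda>x. amp (f x - a) \<zeta>) \<longlongrightarrow> 0) F"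
  proof (rule amp_tendsto_zero[OF nb])
    show "((\<lambda>x. (f x - a) (ell2_fun \<zeta> k)) \<longlongrightarrow> 0) F" for k
      using tendsto_diff[OF f(4)[of k] tendsto_const[of "a (ell2_fun \<zeta> k)"]] by (simp add: blinfun.diff_left)
  qed
  then have "((\<lambda>x. \<rho> (f x - a) \<xi>) \<longlongrightarrow> 0) F"
    by (intro normal_on_tendsto_zero[where f = "\<lambda>x. f x - a" and K = "K + norm a", OF n M h] star_algD(10)[OF M f(1,3)] nb)
  then have "((\<lambda>x. \<rho> (f x) \<xi> - \<rho> a \<xi>) \<longlongrightarrow> 0) F" by (simp add: d f blinfun.diff_left)
  then show ?thesis by (rule LIM_zero_cancel)
qed

text \<open>A substitute for Kaplansky's density theorem: for selfadjoint \<open>x \<in> A''\<close> the elements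
  \<open>t x (1 + t\<^sup>2 x\<^sup>2)\<^sup>-\<^sup>1\<close> are strong limits of a bounded sequence in the norm closure of \<open>A\<close>,
  and \<open>x\<close> is a norm limit of multiples of them.\<close>

theorem bicommutant_subset_seq_closed:
  fixes M :: "'h::chilbert_space op set"
  assumes u: "free_ultrafilter \<omega>" and M: "von_neumann_algebra M" and sep: "separating \<zeta> M"
    and A: "star_alg A" "A \<subseteq> M" "A \<subseteq> B"
    and Badd: "\<And>a b. a \<in> B \<Longrightarrow> b \<in> B \<Longrightarrow> a + b \<in> B" and Bsc: "\<And>a c. a \<in> B \<Longrightarrow> cscale c a \<in> B"
    and Bcl: "\<And>f a K. (\<And>n::nat. f n \<in> B) \<Longrightarrow> (\<And>n. norm (f n) \<le> K) \<Longrightarrow> a \<in> M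
      \<Longrightarrow> (\<And>v. (\<lambda>n. f n v) \<longlonglongrightarrow> a v) \<Longrightarrow> a \<in> B"
  shows "commutant (commutant A) \<subseteq> B"
proof -
  note S = vn_star_alg[OF M]
  have A2M: "commutant (commutant A) \<subseteq> M"
    using commutant_antimono[OF commutant_antimono[OF A(2)]] M by (simp add: von_neumann_algebra_def)
  have AB: "A \<subseteq> bounded_ops" using star_algD(1)[OF A(1)] by blast
  have sA2: "star_alg (commutant (commutant A))"
    by (rule commutant_star_alg[OF commutant_bounded_ops])
      (rule star_algD(5)[OF commutant_star_alg[OF AB star_algD(5)[OF A(1)]]])
  have normB: "a \<in> B" if f: "\<And>n. f n \<in> B" "f \<longlonglongrightarrow> a" and a: "a \<in> M" for f a
  proof -
    have "Bseq f" using f(2) by (intro convergent_imp_Bseq convergentI)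
    then obtain K where K: "\<And>n. norm (f n) \<le> K" by (auto simp: Bseq_def)
    show ?thesis by (rule Bcl[OF f(1) K a tendsto_blinfun_apply[OF f(2)]])
  qed
  have clB: "closure A \<subseteq> B"
  proof
    fix a assume a: "a \<in> closure A"
    then obtain f where f: "\<And>n. f n \<in> A" "f \<longlonglongrightarrow> a" unfolding closure_sequential by blast
    have "closure A \<subseteq> M" by (rule closure_minimal[OF A(2) vn_closed[OF M]])
    then have "a \<in> M" using a by blast
    moreover have "f n \<in> B" for n using f(1) A(3) by blast
    ultimately show "a \<in> B" by (intro normB[OF _ f(2)])
  qed
  have bf: "bfun x \<in> B" if x: "x \<in> commutant (commutant A)" "star x = x" for x
  proof -
    have xB: "x \<in> bounded_ops" using x(1) by (simp add: commutant_def)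
    have p: "pos (x o\<^sub>L x)" by (rule pos_square[OF xB x(2)])
    let ?r = "resolvent1 (x o\<^sub>L x)"
    \<comment> \<open>Convergence of the approximants is needed exactly at the vectors on which they
      act in \<open>diff\<close> below: the resolvent and \<open>bfun x\<close> at the coordinates
      of \<open>\<zeta>\<close>, interleaved as even and odd terms.\<close>
    define w where "w k = (if even k then ?r (ell2_fun \<zeta> (k div 2)) else bfun x (ell2_fun \<zeta> (k div 2)))" for k
    obtain y where y: "\<And>n. y n \<in> A" "\<And>n. star (y n) = y n" "\<And>k. (\<lambda>n. y n (w k)) \<longlonglongrightarrow> x (w k)"
      using bicommutant_selfadjoint_dense[OF A(1) x, of w] by metis
    have yB: "y n \<in> bounded_ops" for n using y(1) AB by blast
    have l1: "(\<lambda>n. y n (?r (ell2_fun \<zeta> k))) \<longlonglongrightarrow> x (?r (ell2_fun \<zeta> k))" for k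
      using y(3)[of "2 * k"] by (simp add: w_def)
    have l2: "(\<lambda>n. y n (bfun x (ell2_fun \<zeta> k))) \<longlonglongrightarrow> x (bfun x (ell2_fun \<zeta> k))" for k
      using y(3)[of "2 * k + 1"] by (simp add: w_def)
    have gB: "bfun (y n) \<in> closure A" for n
      by (rule bfun_mem[OF yB y(2) star_alg_closure[OF A(1)] closed_closure]) (use y(1) closure_subset in blast)
    have gM: "bfun (y n) \<in> M" for n
      by (rule bfun_mem[OF yB y(2) S vn_closed[OF M]]) (use y(1) A(2) in blast)
    have ng: "norm (bfun (y n)) \<le> 1" for n by (rule norm_bfun[OF yB y(2)])
    have xM: "bfun x \<in> M" using bfun_mem[OF xB x(2) S vn_closed[OF M]] x(1) A2M by blast
    \<comment> \<open>A resolvent identity arranged so that \<open>y n\<close> and \<open>x\<close>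
      are compared only on vectors independent of \<open>n\<close>, while the factors depending on
      \<open>n\<close> stand to the left and are contractions.\<close>
    have diff: "bfun (y n) v - bfun x v = resolvent1 (y n o\<^sub>L y n) (y n (?r v) - x (?r v))
        + bfun (y n) (x (bfun x v) - y n (bfun x v))" for n v
    proof -
      let ?s = "resolvent1 (y n o\<^sub>L y n)"
      have pn: "pos (y n o\<^sub>L y n)" by (rule pos_square[OF yB y(2)])
      have cn: "?s (y n z) = bfun (y n) z" for z
        using arg_cong[OF bfun_commute[OF yB y(2), of n], of "\<lambda>T. blinfun_apply T z"] by simp
      have xr: "x (?r v) = bfun x v" by (simp add: bfun_def)
      have "bfun (y n) v = bfun (y n) (?r v + x (bfun x v))"
        using resolvent1_apply(1)[OF p, of v] by (simp add: bfun_def)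
      then have e1: "bfun (y n) v = ?s (y n (?r v)) + bfun (y n) (x (bfun x v))"
        by (simp add: blinfun.add_right cn)
      have e2: "bfun x v = ?s (bfun x v) + bfun (y n) (y n (bfun x v))"
        using resolvent1_apply(2)[OF pn, of "bfun x v"] by (simp add: blinfun.add_right cn)
      from arg_cong2[OF e1 e2, of minus] show ?thesis
        by (simp only: add_diff_add blinfun.diff_right xr)
    qed
    have g: "(\<lambda>n. bfun (y n) (ell2_fun \<zeta> k)) \<longlonglongrightarrow> bfun x (ell2_fun \<zeta> k)" for k
    proof -
      let ?v = "ell2_fun \<zeta> k"
      have b: "norm (bfun (y n) ?v - bfun x ?v) \<le> norm (y n (?r ?v) - x (?r ?v)) + norm (x (bfun x ?v) - y n (bfun x ?v))" for n
      proof -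
        have "norm (resolvent1 (y n o\<^sub>L y n) z) \<le> norm z" for z
          using norm_blinfun[of "resolvent1 (y n o\<^sub>L y n)" z]
            mult_right_mono[OF norm_resolvent1[OF pos_square[OF yB y(2)], of n] norm_ge_zero[of z]] by simp
        moreover have "norm (bfun (y n) z) \<le> norm z" for z
          using norm_blinfun[of "bfun (y n)" z] mult_right_mono[OF ng[of n] norm_ge_zero[of z]] by simp
        ultimately show ?thesis unfolding diff by (intro norm_triangle_le add_mono)
      qed
      have "(\<lambda>n. norm (y n (?r ?v) - x (?r ?v)) + norm (x (bfun x ?v) - y n (bfun x ?v))) \<longlonglongrightarrow>
          norm (x (?r ?v) - x (?r ?v)) + norm (x (bfun x ?v) - x (bfun x ?v))"
        by (intro tendsto_intros l1 l2)
      then have "(\<lambda>n. bfun (y n) ?v - bfun x ?v) \<longlonglongrightarrow> 0"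
        by (intro Lim_null_comparison[OF always_eventually[OF allI[OF b]]]) simp
      then show ?thesis by (rule LIM_zero_cancel)
    qed
    have "(\<lambda>n. bfun (y n) v) \<longlonglongrightarrow> bfun x v" for v
      by (rule normal_on_tendsto[OF identity_normal[OF u M sep] S _ _ gM ng xM g]) auto
    moreover have "bfun (y n) \<in> B" for n using gB clB by blast
    ultimately show "bfun x \<in> B" by (intro Bcl[of "\<lambda>n. bfun (y n)", OF _ ng xM])
  qed
  have Br: "r *\<^sub>R a \<in> B" if "a \<in> B" for r a using Bsc[OF that, of "of_real r"] by (simp add: cscale_of_real)
  have sa: "x \<in> B" if x: "x \<in> commutant (commutant A)" "star x = x" for x
  proof -
    have xB: "x \<in> bounded_ops" using x(1) by (simp add: commutant_def)
    define t where "t n = 1 / real (Suc n)" for n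
    have t: "t n > 0" for n by (simp add: t_def)
    define z where "z n = t n *\<^sub>R x" for n
    have zA: "z n \<in> commutant (commutant A)" for n unfolding z_def by (rule star_algD(7)[OF sA2 x(1)])
    have z: "star (z n) = z n" "z n \<in> bounded_ops" for n using xB x(2) by (auto simp: z_def star_scaleR)
    define f where "f n = (1 / t n) *\<^sub>R bfun (z n)" for n
    have fB: "f n \<in> B" for n unfolding f_def by (rule Br[OF bf[OF zA z(1)]])
    have le: "norm (x - f n) \<le> t n * (norm x * norm x)" for n
    proof -
      have "x - f n = (1 / t n) *\<^sub>R (z n - bfun (z n))" using t[of n] by (simp add: z_def f_def algebra_simps)
      also have "\<dots> = (1 / t n) *\<^sub>R (z n o\<^sub>L (z n o\<^sub>L bfun (z n)))" by (simp add: bfun_diff[OF z(2,1)])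
      also have "\<dots> = t n *\<^sub>R (x o\<^sub>L (x o\<^sub>L bfun (z n)))"
        using t[of n] by (intro blinfun_eqI) (simp add: z_def blinfun.bilinear_simps)
      finally have "norm (x - f n) = t n * norm (x o\<^sub>L (x o\<^sub>L bfun (z n)))" using t[of n] by simp
      also have "\<dots> \<le> t n * (norm x * (norm x * 1))"
        using t[of n] norm_bfun[OF z(2,1), of n]
        by (intro mult_left_mono order_trans[OF norm_blinfun_compose]) (auto simp: less_imp_le)
      finally show ?thesis by simp
    qed
    have "(\<lambda>n. t n * (norm x * norm x)) \<longlonglongrightarrow> 0 * (norm x * norm x)"
      unfolding t_def by (intro tendsto_mult tendsto_const LIMSEQ_Suc[OF lim_inverse_n'])
    then have "(\<lambda>n. x - f n) \<longlonglongrightarrow> 0"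
      by (intro Lim_null_comparison[OF always_eventually[OF allI[OF le]]]) simp
    from tendsto_diff[OF tendsto_const[of x] this] have "f \<longlonglongrightarrow> x" by simp
    moreover have "x \<in> M" using x(1) A2M by blast
    ultimately show "x \<in> B" by (intro normB[of f, OF fB])
  qed
  show ?thesis
  proof
    fix x assume x: "x \<in> commutant (commutant A)"
    note D = star_algD[OF sA2]
    have xB: "x \<in> bounded_ops" by (rule D(1)[OF x])
    define a where "a = (1/2) *\<^sub>R (x + star x)"
    define b where "b = cscale (- \<i> / 2) (x - star x)"
    have a: "a \<in> commutant (commutant A)" "star a = a"
      unfolding a_def using D(7)[OF D(3)[OF x D(5)[OF x]]] xB by (auto simp: star_scaleR star_add add.commute)
    have b: "b \<in> commutant (commutant A)"
      unfolding b_def by (rule D(6)[OF D(10)[OF x D(5)[OF x]]])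
    have "star b = b"
      unfolding b_def using xB
      by (simp add: star_cscale star_diff)
        (rule blinfun_eqI, simp add: blinfun.bilinear_simps scaleC_diff_right scaleC_minus_left)
    have "x = a + cscale \<i> b"
    proof (rule blinfun_eqI)
      fix v
      have "\<i> *\<^sub>C (- \<i> / 2) *\<^sub>C z = (1/2) *\<^sub>R z" for z :: 'h
        using scaleC_of_real[of "1/2" z] by (simp add: scaleC_scaleC del: scaleC_of_real)
      then have "(a + cscale \<i> b) v = (1/2) *\<^sub>R (x v + star x v) + (1/2) *\<^sub>R (x v - star x v)"
        by (simp add: a_def b_def blinfun.add_left blinfun.diff_left blinfun.scaleR_left)
      also have "\<dots> = x v" by (simp add: scaleR_add_right scaleR_diff_right flip: scaleR_add_left)
      finally show "x v = (a + cscale \<i> b) v" by simp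
    qed
    then show "x \<in> B" using Badd[OF sa[OF a] Bsc[OF sa[OF b \<open>star b = b\<close>]]] by simp
  qed
qed

section \<open>Crossed products\<close>

lemma cp_unitary_apply:
  fixes s :: "'g::group_add" and \<xi> :: "('g, 'h::chilbert_space) ell2"
  shows "ell2_fun (cp_unitary s \<xi>) t = ell2_fun \<xi> (- s + t)"
proof -
  define g where "g = (\<lambda>\<xi> :: ('g, 'h) ell2. Abs_ell2 (\<lambda>t. ell2_fun \<xi> (- s + t)))"
  have bij: "bij_betw (\<lambda>t. - s + t) UNIV UNIV"
    by (rule bij_betw_byWitness[of _ "\<lambda>t. s + t"]) (auto simp: add.assoc[symmetric])
  have g: "ell2_fun (g \<xi>) t = ell2_fun \<xi> (- s + t)" for \<xi> t
  proof -
    have "(\<lambda>t. (norm (ell2_fun \<xi> (- s + t)))\<^sup>2) summable_on UNIV"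
      using summable_on_reindex_bij_betw[OF bij, of "\<lambda>t. (norm (ell2_fun \<xi> t))\<^sup>2"] ell2_summable[of \<xi>] by simp
    then show ?thesis unfolding g_def by (subst Abs_ell2_inverse) auto
  qed
  have ng: "norm (g \<xi>) = norm \<xi>" for \<xi>
  proof -
    have "(norm (g \<xi>))\<^sup>2 = (norm \<xi>)\<^sup>2"
      unfolding ell2_norm_sq g
      by (rule infsum_reindex_bij_betw[OF bij, of "\<lambda>t. (norm (ell2_fun \<xi> t))\<^sup>2"])
    then show ?thesis by simp
  qed
  have "bounded_linear g"
    by (rule bounded_linear_intro[of _ 1])
      (auto intro!: ell2_eqI simp: g ng plus_ell2.rep_eq scaleR_ell2.rep_eq)
  then have "cp_unitary s \<xi> = g \<xi>" for \<xi>
    unfolding cp_unitary_def g_def[symmetric] by (simp add: bounded_linear_Blinfun_apply)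
  then show ?thesis by (simp add: g)
qed

lemma cp_unitary_bounded_ops: "cp_unitary s \<in> bounded_ops"
  unfolding bounded_ops_iff by (auto intro!: ell2_eqI simp: cp_unitary_apply scaleC_ell2.rep_eq)

lemma cp_unitary_add: "cp_unitary (s + t) = cp_unitary s o\<^sub>L cp_unitary t"
  by (intro blinfun_eqI ell2_eqI)
    (simp only: blinfun_apply_blinfun_compose cp_unitary_apply minus_add add.assoc)

lemma cp_unitary_zero: "cp_unitary 0 = id_blinfun"
  by (intro blinfun_eqI ell2_eqI) (simp add: cp_unitary_apply)

lemma cp_unitary_inverse: "cp_unitary s o\<^sub>L cp_unitary (- s) = id_blinfun" "cp_unitary (- s) o\<^sub>L cp_unitary s = id_blinfun"
  by (simp_all add: cp_unitary_zero flip: cp_unitary_add)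

lemma cp_unitary_single: "cp_unitary s (ell2_single t h) = ell2_single (s + t) h"
proof (rule ell2_eqI)
  fix r
  have "(- s + r = t) = (r = s + t)" by (metis add.assoc add.left_inverse add.right_inverse add_0)
  then show "ell2_fun (cp_unitary s (ell2_single t h)) r = ell2_fun (ell2_single (s + t) h) r"
    by (simp add: cp_unitary_apply ell2_single_apply)
qed

lemma star_cp_unitary:
  fixes s :: "'g::group_add"
  shows "star (cp_unitary s :: ('g, 'h::chilbert_space) ell2 op) = cp_unitary (- s)"
proof (rule star_unique[OF cp_unitary_bounded_ops])
  fix x y :: "('g, 'h) ell2"
  have bij: "bij_betw (\<lambda>t. s + t) UNIV UNIV"
    by (rule bij_betw_byWitness[of _ "\<lambda>t. - s + t"]) (auto simp: add.assoc[symmetric])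
  have "inner (cp_unitary s x) y = (\<Sum>\<^sub>\<infinity>t. inner (ell2_fun x (- s + t)) (ell2_fun y t))"
    by (simp add: inner_ell2_def cp_unitary_apply)
  also have "\<dots> = (\<Sum>\<^sub>\<infinity>t. inner (ell2_fun x (- s + (s + t))) (ell2_fun y (s + t)))"
    by (rule infsum_reindex_bij_betw[OF bij, symmetric])
  also have "\<dots> = inner x (cp_unitary (- s) y)"
    by (simp add: inner_ell2_def cp_unitary_apply flip: add.assoc)
  finally show "inner (cp_unitary s x) y = inner x (cp_unitary (- s) y)" .
qed

text \<open>Closing under sums suffices: by covariance, products, adjoints and scalar multiples of
  the basic terms are basic terms again.\<close>

inductive_set cp_span :: "('g::group_add \<Rightarrow> 'h::chilbert_space op \<Rightarrow> 'h op) \<Rightarrow> 'h op set \<Rightarrow> ('g, 'h) ell2 op set"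
  for \<alpha> M where
  base: "a \<in> M \<Longrightarrow> cp_embed \<alpha> a o\<^sub>L cp_unitary g \<in> cp_span \<alpha> M"
| add: "x \<in> cp_span \<alpha> M \<Longrightarrow> y \<in> cp_span \<alpha> M \<Longrightarrow> x + y \<in> cp_span \<alpha> M"

locale vn_dynamics =
  fixes \<omega> :: "nat filter" and M :: "'h::chilbert_space op set"
    and \<alpha> :: "'g::{group_add,countable} \<Rightarrow> 'h op \<Rightarrow> 'h op" and \<zeta> :: "(nat, 'h) ell2"
  assumes ultra: "free_ultrafilter \<omega>" and M: "von_neumann_algebra M"
    and action: "vn_action M \<alpha>" and sep: "separating \<zeta> M"
begin

abbreviation "pi_rep \<equiv> cp_embed \<alpha>"

lemmas bot = free_ultrafilterD(1)[OF ultra]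
lemmas SM = vn_star_alg[OF M]
lemmas MD = star_algD[OF SM]

lemma aut: "vn_automorphism M (\<alpha> s)" using action by (simp add: vn_action_def)
lemmas aD = vn_automorphismD[OF SM aut]
lemma alpha_zero: "a \<in> M \<Longrightarrow> \<alpha> 0 a = a" using action by (simp add: vn_action_def)
lemma alpha_add: "a \<in> M \<Longrightarrow> \<alpha> (s + t) a = \<alpha> s (\<alpha> t a)" using action by (simp add: vn_action_def)
lemma alpha_inverse: "a \<in> M \<Longrightarrow> \<alpha> (- s) (\<alpha> s a) = a" "a \<in> M \<Longrightarrow> \<alpha> s (\<alpha> (- s) a) = a"
  by (simp_all add: alpha_zero flip: alpha_add)
lemma norm_alpha: "a \<in> M \<Longrightarrow> norm (\<alpha> s a) \<le> norm a" by (rule vn_automorphism_norm[OF M aut])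

lemma alpha_normal: "normal_on \<zeta> M (\<alpha> s)"
  by (rule automorphism_normal[OF ultra M sep aut aut alpha_inverse])

lemma alpha_tendsto:
  assumes "\<And>x. f x \<in> M" "\<And>x. norm (f x) \<le> K" "a \<in> M" "\<And>v. ((\<lambda>x. f x v) \<longlongrightarrow> a v) F"
  shows "((\<lambda>x. \<alpha> s (f x) v) \<longlongrightarrow> \<alpha> s a v) F"
  by (rule normal_on_tendsto[OF alpha_normal SM aD(6) aD(8) assms])

lemma pi_diag: "pi_rep a = diag_op (\<lambda>t. \<alpha> (- t) a)"
  by (simp add: cp_embed_def diag_op_def)

lemma pi_bound: "a \<in> M \<Longrightarrow> norm (\<alpha> (- t) a) \<le> norm a" by (rule norm_alpha)

lemma pi_apply: "a \<in> M \<Longrightarrow> ell2_fun (pi_rep a \<xi>) t = \<alpha> (- t) a (ell2_fun \<xi> t)"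
  unfolding pi_diag by (rule diag_op_apply) (rule pi_bound)
lemma pi_single: "a \<in> M \<Longrightarrow> pi_rep a (ell2_single t h) = ell2_single t (\<alpha> (- t) a h)"
  unfolding pi_diag by (rule diag_op_single) (rule pi_bound)
lemma norm_pi: "a \<in> M \<Longrightarrow> norm (pi_rep a) \<le> norm a"
  unfolding pi_diag by (rule norm_diag_op) (rule pi_bound)
lemma pi_bounded_ops: "a \<in> M \<Longrightarrow> pi_rep a \<in> bounded_ops"
  unfolding pi_diag by (rule diag_op_bounded_ops[OF pi_bound]) (auto intro: MD(1) aD(1))
lemma pi_star: "a \<in> M \<Longrightarrow> star (pi_rep a) = pi_rep (star a)"
  unfolding pi_diag by (subst star_diag_op[OF pi_bound]) (auto intro: MD(1) aD(1) simp: aD(5))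
lemma pi_add: "a \<in> M \<Longrightarrow> b \<in> M \<Longrightarrow> pi_rep (a + b) = pi_rep a + pi_rep b"
  by (intro blinfun_eqI ell2_eqI) (simp add: pi_apply MD(3) aD(2) blinfun.add_left plus_ell2.rep_eq)
lemma pi_diff: "a \<in> M \<Longrightarrow> b \<in> M \<Longrightarrow> pi_rep (a - b) = pi_rep a - pi_rep b"
  by (intro blinfun_eqI ell2_eqI) (simp add: pi_apply MD(10) aD(8) blinfun.diff_left minus_ell2.rep_eq)
lemma pi_compose: "a \<in> M \<Longrightarrow> b \<in> M \<Longrightarrow> pi_rep (a o\<^sub>L b) = pi_rep a o\<^sub>L pi_rep b"
  by (intro blinfun_eqI ell2_eqI) (simp add: pi_apply MD(4) aD(3))
lemma pi_cscale: "a \<in> M \<Longrightarrow> pi_rep (cscale c a) = cscale c (pi_rep a)"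
  by (intro blinfun_eqI ell2_eqI) (simp add: pi_apply MD(6) aD(4) scaleC_ell2.rep_eq)
lemma pi_scaleR: "a \<in> M \<Longrightarrow> pi_rep (r *\<^sub>R a) = r *\<^sub>R pi_rep a"
  using pi_cscale[of a "of_real r"] by (simp add: cscale_of_real)
lemma pi_id: "pi_rep id_blinfun = id_blinfun"
  by (intro blinfun_eqI ell2_eqI) (simp add: pi_apply MD(2) aD(9))
lemma entry_pi: "a \<in> M \<Longrightarrow> entry (pi_rep a) s t = (if s = t then \<alpha> (- s) a else 0)"
  unfolding pi_diag by (subst entry_diag_op[OF pi_bound]) auto

lemma pi_covariant: "a \<in> M \<Longrightarrow> cp_unitary s o\<^sub>L pi_rep a = pi_rep (\<alpha> s a) o\<^sub>L cp_unitary s"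
  by (intro blinfun_eqI ell2_eqI)
    (simp add: cp_unitary_apply pi_apply aD(1) minus_add flip: alpha_add)

lemma pi_normal: "normal_on \<zeta> M pi_rep"
proof (rule normal_onI)
  fix f :: "nat \<Rightarrow> 'h op" and \<xi> :: "('g, 'h) ell2"
  assume f: "\<And>n. f n \<in> M" "\<And>n. norm (f n) \<le> 1" "(\<lambda>n. amp (f n) \<zeta>) \<longlonglongrightarrow> 0"
  show "(\<lambda>n. pi_rep (f n) \<xi>) \<longlonglongrightarrow> 0"
    unfolding pi_diag
  proof (rule diag_op_tendsto_zero)
    show "norm (\<alpha> (- t) (f n)) \<le> 1" for n t by (rule order_trans[OF norm_alpha[OF f(1)] f(2)])
    show "(\<lambda>n. \<alpha> (- t) (f n) (ell2_fun \<xi> t)) \<longlonglongrightarrow> 0" for t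
      by (rule normal_on_tendsto_zero[OF alpha_normal SM aD(6) f])
  qed
qed

lemma pi_tendsto:
  assumes "\<And>x. f x \<in> M" "\<And>x. norm (f x) \<le> K" "a \<in> M" "\<And>v. ((\<lambda>x. f x v) \<longlongrightarrow> a v) F"
  shows "((\<lambda>x. pi_rep (f x) \<xi>) \<longlongrightarrow> pi_rep a \<xi>) F"
  by (rule normal_on_tendsto[OF pi_normal SM pi_scaleR pi_diff assms])

subsection \<open>Generators and commutants\<close>

definition "gens P = pi_rep ` P \<union> range cp_unitary"

definition "inv_vn P \<longleftrightarrow> von_neumann_algebra P \<and> P \<subseteq> M \<and> invariant \<alpha> P"

lemma inv_vnD:
  assumes "inv_vn P"
  shows "von_neumann_algebra P" "star_alg P" "P \<subseteq> M" "a \<in> P \<Longrightarrow> \<alpha> s a \<in> P"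
  using assms vn_star_alg by (auto simp: inv_vn_def invariant_def image_subset_iff)

lemma inv_vn_M: "inv_vn M" using M aD(1) by (auto simp: inv_vn_def invariant_def)

lemma gens_star:
  assumes P: "star_alg P" "P \<subseteq> M"
  shows "gens P \<subseteq> bounded_ops" "a \<in> gens P \<Longrightarrow> star a \<in> gens P"
  unfolding gens_def
  using assms star_algD(5)[OF P(1)]
  by (auto simp: cp_unitary_bounded_ops star_cp_unitary subset_iff pi_bounded_ops pi_star)

lemma crossed_product_eq:
  assumes P: "star_alg P" "P \<subseteq> M"
  shows "crossed_product \<alpha> P = commutant (commutant (gens P))"
  unfolding crossed_product_def gens_def[symmetric] by (rule vn_generated_eq[OF gens_star[OF P]])

lemma crossed_product_vn: "star_alg P \<Longrightarrow> P \<subseteq> M \<Longrightarrow> von_neumann_algebra (crossed_product \<alpha> P)"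
  unfolding crossed_product_eq by (rule von_neumann_algebra_bicommutant[OF gens_star])

lemma gens_crossed_product: "gens P \<subseteq> crossed_product \<alpha> P"
  unfolding crossed_product_def gens_def by (rule vn_generated_superset)

lemma pi_mem: "a \<in> P \<Longrightarrow> pi_rep a \<in> crossed_product \<alpha> P" and cp_unitary_mem: "cp_unitary s \<in> crossed_product \<alpha> P"
  using gens_crossed_product[of P] by (auto simp: gens_def)

lemma crossed_product_mono:
  assumes "star_alg Q" "Q \<subseteq> M" "P \<subseteq> Q" shows "crossed_product \<alpha> P \<subseteq> crossed_product \<alpha> Q"
  unfolding crossed_product_def[of \<alpha> P]
  by (rule vn_generated_least[OF crossed_product_vn[OF assms(1,2)]])
    (use assms(3) gens_crossed_product[of Q] in \<open>auto simp: gens_def\<close>)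

text \<open>For \<open>y\<close> in the commutant of \<open>P\<close>, invariance of
  \<open>P\<close> makes \<open>amp y\<close> commute with the generators. Hence \<open>x\<close>
  commutes with \<open>amp y\<close>, and its entries commute with \<open>y\<close>.\<close>

lemma entry_crossed_product:
  assumes P: "inv_vn P" and x: "x \<in> crossed_product \<alpha> P"
  shows "entry x s t \<in> P"
proof -
  note PD = inv_vnD[OF P]
  have xB: "x \<in> bounded_ops" using star_algD(1)[OF vn_star_alg[OF crossed_product_vn[OF PD(2,3)]] x] .
  have "entry x s t o\<^sub>L y = y o\<^sub>L entry x s t" if y: "y \<in> commutant P" for y
  proof -
    have yB: "y \<in> bounded_ops" using y by (simp add: commutant_def)
    have "amp y o\<^sub>L g = g o\<^sub>L amp y" if g: "g \<in> gens P" for g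
    proof -
      consider a where "a \<in> P" "g = pi_rep a" | r where "g = cp_unitary r" using g by (auto simp: gens_def)
      then show ?thesis
      proof cases
        case 1
        have c: "y (\<alpha> (- r) a v) = \<alpha> (- r) a (y v)" for r v
        proof -
          have "(y o\<^sub>L \<alpha> (- r) a) v = (\<alpha> (- r) a o\<^sub>L y) v" using y PD(4)[OF 1(1)] by (simp add: commutant_def)
          then show ?thesis by simp
        qed
        have "a \<in> M" using 1 PD(3) by blast
        then show ?thesis unfolding 1 by (intro blinfun_eqI ell2_eqI) (simp add: pi_apply c)
      next
        case 2
        then show ?thesis by (intro blinfun_eqI ell2_eqI) (simp add: cp_unitary_apply)
      qed
    qed
    then have "amp y \<in> commutant (gens P)" using yB by (simp add: commutant_def)
    then have xy: "x o\<^sub>L amp y = amp y o\<^sub>L x" using x unfolding crossed_product_eq[OF PD(2,3)] by (simp add: commutant_def)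
    show ?thesis
    proof (rule blinfun_eqI)
      fix h
      show "(entry x s t o\<^sub>L y) h = (y o\<^sub>L entry x s t) h"
        using arg_cong[OF xy, of "\<lambda>T. ell2_fun (T (ell2_single t h)) s"] by (simp add: entry_apply)
    qed
  qed
  then have "entry x s t \<in> commutant (commutant P)" using xB by (simp add: commutant_def entry_bounded_ops)
  then show ?thesis using PD(1) by (simp add: von_neumann_algebra_def)
qed

lemma entry_M: "x \<in> crossed_product \<alpha> M \<Longrightarrow> entry x s t \<in> M"
  by (rule entry_crossed_product[OF inv_vn_M])

lemmas XvN = crossed_product_vn[OF SM subset_refl]
lemmas XD = star_algD[OF vn_star_alg[OF XvN]]

text \<open>Place a copy of \<open>\<zeta>\<close> in each of the countably many coordinates. An
  element killing all of them has entries in \<open>M\<close> that kill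
  \<open>\<zeta>\<close>.\<close>

lemma ex_separating_crossed_product:
  obtains \<zeta>' where "separating \<zeta>' (crossed_product \<alpha> M)"
proof -
  define w where "w k = ell2_single (from_nat (fst (prod_decode k)) :: 'g) (ell2_fun \<zeta> (snd (prod_decode k)))" for k
  obtain \<zeta>' :: "(nat, ('g, 'h) ell2) ell2" and c where \<zeta>': "\<And>k. c k > 0" "\<And>k. ell2_fun \<zeta>' k = c k *\<^sub>R w k"
    using ex_scaled_ell2[of w] by metis
  have "x = 0" if x: "x \<in> crossed_product \<alpha> M" and 0: "amp x \<zeta>' = 0" for x
  proof -
    have w0: "x (w k) = 0" for k
      using arg_cong[OF 0, of "\<lambda>v. ell2_fun v k"] \<zeta>'(1)[of k]
      by (simp add: \<zeta>'(2) blinfun.scaleR_right zero_ell2.rep_eq)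
    have "x (ell2_single t (ell2_fun \<zeta> j)) = 0" for t j
      using w0[of "prod_encode (to_nat t, j)"] by (simp add: w_def)
    then have "amp (entry x s t) \<zeta> = 0" for s t
      by (intro ell2_eqI) (simp add: entry_apply zero_ell2.rep_eq)
    then have "entry x s t = 0" for s t using sep entry_M[OF x] unfolding separating_def by blast
    moreover have "entry (0 :: ('g, 'h) ell2 op) s t = 0" for s t
      by (rule blinfun_eqI) (simp add: entry_apply zero_ell2.rep_eq)
    ultimately show "x = 0" by (intro entry_eqI) simp
  qed
  then show thesis using that[of \<zeta>'] by (auto simp: separating_def)
qed

section \<open>The algebraic crossed product and covariance of matrix entries\<close>

lemma cp_span_star_alg: "star_alg (cp_span \<alpha> M)"
proof -
  let ?A = "cp_span \<alpha> M"
  have B: "x \<in> bounded_ops" if "x \<in> ?A" for x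
    using that by induction (auto simp: pi_bounded_ops cp_unitary_bounded_ops)
  have I: "id_blinfun \<in> ?A" using cp_span.base[OF MD(2), of \<alpha> 0] by (simp add: pi_id cp_unitary_zero)
  have bb: "(pi_rep a o\<^sub>L cp_unitary g) o\<^sub>L (pi_rep b o\<^sub>L cp_unitary h) \<in> ?A" if "a \<in> M" "b \<in> M" for a b g h
  proof -
    have "(pi_rep a o\<^sub>L cp_unitary g) o\<^sub>L (pi_rep b o\<^sub>L cp_unitary h)
        = pi_rep a o\<^sub>L ((cp_unitary g o\<^sub>L pi_rep b) o\<^sub>L cp_unitary h)" by (simp add: compose_assoc)
    also have "\<dots> = pi_rep (a o\<^sub>L \<alpha> g b) o\<^sub>L cp_unitary (g + h)"
      using that by (simp add: pi_covariant pi_compose aD(1) cp_unitary_add compose_assoc)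
    finally show ?thesis using cp_span.base[OF MD(4)[OF that(1) aD(1)[OF that(2)]]] by simp
  qed
  have C1: "x o\<^sub>L (pi_rep b o\<^sub>L cp_unitary h) \<in> ?A" if "x \<in> ?A" "b \<in> M" for x b h
    using that by induction (auto simp: bb compose_add_left intro: cp_span.add)
  have C: "x o\<^sub>L y \<in> ?A" if "y \<in> ?A" "x \<in> ?A" for x y
    using that by induction (auto simp: C1 compose_add_right intro: cp_span.add)
  have St: "star x \<in> ?A" if "x \<in> ?A" for x
    using that
  proof induction
    case (base a g)
    have "star (pi_rep a o\<^sub>L cp_unitary g) = cp_unitary (- g) o\<^sub>L pi_rep (star a)"
      using base by (simp add: star_compose pi_bounded_ops cp_unitary_bounded_ops star_cp_unitary pi_star)
    also have "\<dots> = pi_rep (\<alpha> (- g) (star a)) o\<^sub>L cp_unitary (- g)" by (rule pi_covariant[OF MD(5)[OF base]])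
    finally show ?case using cp_span.base[OF aD(1)[OF MD(5)[OF base]]] by simp
  next
    case (add x y)
    then show ?case by (simp add: star_add B cp_span.add)
  qed
  have Sc: "cscale c x \<in> ?A" if "x \<in> ?A" for c x
    using that
  proof induction
    case (base a g)
    have "cscale c (pi_rep a o\<^sub>L cp_unitary g) = pi_rep (cscale c a) o\<^sub>L cp_unitary g"
      using base by (intro blinfun_eqI) (simp add: pi_cscale)
    then show ?case using cp_span.base[OF MD(6)[OF base]] by simp
  next
    case (add x y)
    have "cscale c (x + y) = cscale c x + cscale c y"
      by (rule blinfun_eqI) (simp add: blinfun.add_left scaleC_add_right)
    then show ?case using add by (simp add: cp_span.add)
  qed
  show ?thesis unfolding star_alg_def
    by (intro conjI ballI allI subsetI B I C St Sc cp_span.add)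
qed

lemma cp_span_bicommutant: "crossed_product \<alpha> M \<subseteq> commutant (commutant (cp_span \<alpha> M))"
proof -
  have "gens M \<subseteq> cp_span \<alpha> M"
  proof
    fix g assume "g \<in> gens M"
    then consider a where "a \<in> M" "g = pi_rep a" | r where "g = cp_unitary r" by (auto simp: gens_def)
    then show "g \<in> cp_span \<alpha> M"
    proof cases
      case 1
      then show ?thesis using cp_span.base[OF 1(1), of \<alpha> 0] by (simp add: cp_unitary_zero)
    next
      case 2
      then show ?thesis using cp_span.base[OF MD(2), of \<alpha> r] by (simp add: pi_id)
    qed
  qed
  then show ?thesis unfolding crossed_product_eq[OF SM subset_refl]
    by (intro commutant_antimono)
qed

lemma entry_base:
  assumes "a \<in> M" shows "entry (pi_rep a o\<^sub>L cp_unitary g) s t = (if s = g + t then \<alpha> (- s) a else 0)"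
  by (rule blinfun_eqI) (simp add: entry_apply cp_unitary_single pi_single assms ell2_single_apply)

text \<open>A computation on the span of the generators. Since \<open>\<alpha> r\<close> is known to
  be continuous only on bounded sets, the relation is extended by limits of bounded sequences, not
  by weak closure.\<close>

theorem entry_covariant:
  assumes x: "x \<in> crossed_product \<alpha> M"
  shows "\<alpha> r (entry x s t) = entry x (s - r) (t - r)"
proof -
  define B where "B = {x \<in> crossed_product \<alpha> M. \<forall>r s t. \<alpha> r (entry x s t) = entry x (s - r) (t - r)}"
  obtain \<zeta>' where \<zeta>': "separating \<zeta>' (crossed_product \<alpha> M)" by (rule ex_separating_crossed_product)
  have sub: "cp_span \<alpha> M \<subseteq> crossed_product \<alpha> M"
  proof
    fix x assume "x \<in> cp_span \<alpha> M"
    then show "x \<in> crossed_product \<alpha> M"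
      by induction (auto intro: XD(3) XD(4) pi_mem cp_unitary_mem)
  qed
  have "commutant (commutant (cp_span \<alpha> M)) \<subseteq> B"
  proof (rule bicommutant_subset_seq_closed[OF ultra XvN \<zeta>' cp_span_star_alg sub])
    show "cp_span \<alpha> M \<subseteq> B"
    proof
      fix x assume "x \<in> cp_span \<alpha> M"
      then show "x \<in> B"
      proof induction
        case (base a g)
        have "\<alpha> r (entry (pi_rep a o\<^sub>L cp_unitary g) s t) = entry (pi_rep a o\<^sub>L cp_unitary g) (s - r) (t - r)" for r s t
        proof -
          have "(s - r = g + (t - r)) = (s = g + t)" by (metis add_diff_eq diff_add_cancel)
          moreover have "\<alpha> r (\<alpha> (- s) a) = \<alpha> (- (s - r)) a" by (simp add: alpha_add[OF base, symmetric] minus_diff_eq)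
          ultimately show ?thesis by (simp only: entry_base[OF base] if_distrib[of "\<alpha> r"] aD(7))
        qed
        moreover have "pi_rep a o\<^sub>L cp_unitary g \<in> crossed_product \<alpha> M" by (intro XD(4) pi_mem cp_unitary_mem base)
        ultimately show ?case by (simp add: B_def)
      next
        case (add x y)
        then show ?case by (auto simp: B_def entry_add aD(2) entry_M intro: XD(3))
      qed
    qed
    show "a + b \<in> B" if "a \<in> B" "b \<in> B" for a b
      using that by (auto simp: B_def entry_add aD(2) entry_M intro: XD(3))
    show "cscale c a \<in> B" if "a \<in> B" for a c
    proof -
      have "entry (cscale c a) s t = cscale c (entry a s t)" for s t
        by (rule blinfun_eqI) (simp add: entry_apply scaleC_ell2.rep_eq)
      then show ?thesis using that by (auto simp: B_def aD(4) entry_M intro: XD(6))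
    qed
    fix f a K
    assume f: "\<And>n::nat. f n \<in> B" "\<And>n. norm (f n) \<le> K" and a: "a \<in> crossed_product \<alpha> M"
      and lim: "\<And>v. (\<lambda>n. f n v) \<longlonglongrightarrow> blinfun_apply a v"
    have fX: "f n \<in> crossed_product \<alpha> M" for n using f(1)[of n] by (simp add: B_def)
    have le: "(\<lambda>n. entry (f n) s t h) \<longlonglongrightarrow> entry a s t h" for s t h
      unfolding entry_apply by (rule bounded_linear.tendsto[OF bounded_linear_ell2_fun lim])
    have "\<alpha> r (entry a s t) = entry a (s - r) (t - r)" for r s t
    proof (rule blinfun_eqI)
      fix h
      have "(\<lambda>n. \<alpha> r (entry (f n) s t) h) \<longlonglongrightarrow> \<alpha> r (entry a s t) h"
        by (rule alpha_tendsto[OF entry_M[OF fX] _ entry_M[OF a] le]) (rule order_trans[OF norm_entry f(2)])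
      moreover have "\<alpha> r (entry (f n) s t) = entry (f n) (s - r) (t - r)" for n using f(1)[of n] by (simp add: B_def)
      ultimately have "(\<lambda>n. entry (f n) (s - r) (t - r) h) \<longlonglongrightarrow> \<alpha> r (entry a s t) h" by simp
      then show "\<alpha> r (entry a s t) h = entry a (s - r) (t - r) h" by (rule LIMSEQ_unique[OF _ le])
    qed
    then show "a \<in> B" using a by (simp add: B_def)
  qed
  then show ?thesis using x cp_span_bicommutant by (auto simp: B_def)
qed

text \<open>Row 0 carries the Fourier coefficients: for
  \<open>pi_rep a o\<^sub>L cp_unitary g\<close> the only nonzero entry in it can be
  \<open>a\<close> at column \<open>- g\<close>. So \<open>entry x 0 t\<close> is the coefficient at
  the inverse of \<open>t\<close>.\<close>

lemma entry_from_row: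
  assumes x: "x \<in> crossed_product \<alpha> M"
  shows "entry x s t = \<alpha> (- s) (entry x 0 (t - s))"
  using entry_covariant[OF x, of "- s" 0 "t - s"] by simp

text \<open>The products of \<open>x\<close> with any \<open>y\<close> in the commutant of the generators agree term by term.\<close>

theorem crossed_product_memI:
  assumes P: "inv_vn P" and x: "x \<in> crossed_product \<alpha> M" and row: "\<And>t. entry x 0 t \<in> P"
  shows "x \<in> crossed_product \<alpha> P"
proof -
  note PD = inv_vnD[OF P]
  have xB: "x \<in> bounded_ops" by (rule XD(1)[OF x])
  have "x o\<^sub>L y = y o\<^sub>L x" if y: "y \<in> commutant (gens P)" for y
  proof (rule entry_eqI, rule blinfun_eq_inner)
    fix s t h k
    have yB: "y \<in> bounded_ops" using y by (simp add: commutant_def)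
    have trans: "entry y r t' = entry y (g + r) (g + t')" for g r t'
    proof (rule blinfun_eqI)
      fix h
      have "cp_unitary g \<in> gens P" by (simp add: gens_def)
      then have "(cp_unitary g o\<^sub>L y) (ell2_single t' h) = (y o\<^sub>L cp_unitary g) (ell2_single t' h)"
        using y by (simp add: commutant_def)
      then show "entry y r t' h = entry y (g + r) (g + t') h"
        by (simp add: entry_apply flip: cp_unitary_single) (metis add.left_inverse add.assoc add_0 cp_unitary_apply minus_add_cancel)
    qed
    have com: "\<alpha> (- r) a o\<^sub>L entry y r q = entry y r q o\<^sub>L \<alpha> (- q) a" if a: "a \<in> P" for a r q
    proof (rule blinfun_eqI)
      fix h
      have aM: "a \<in> M" using a PD(3) by blast
      have "pi_rep a \<in> gens P" using a by (simp add: gens_def)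
      then have "(pi_rep a o\<^sub>L y) (ell2_single q h) = (y o\<^sub>L pi_rep a) (ell2_single q h)"
        using y by (simp add: commutant_def)
      from arg_cong[OF this, of "\<lambda>v. ell2_fun v r"]
      show "(\<alpha> (- r) a o\<^sub>L entry y r q) h = (entry y r q o\<^sub>L \<alpha> (- q) a) h"
        by (simp add: entry_apply pi_apply[OF aM] pi_single[OF aM])
    qed
    \<comment> \<open>The term at \<open>r\<close> of one product corresponds to the term at
      \<open>s - r + t\<close> of the other, so the weak sums are compared after a bijective change
      of index.\<close>
    have term_eq: "entry x s r o\<^sub>L entry y r t = entry y s (s - r + t) o\<^sub>L entry x (s - r + t) t" for r
    proof -
      let ?q = "s - r + t"
      have "entry y r t = entry y s ?q" using trans[of r t "s - r"] by simp
      then have "entry x s r o\<^sub>L entry y r t = \<alpha> (- s) (entry x 0 (r - s)) o\<^sub>L entry y s ?q"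
        using entry_from_row[OF x, of s r] by simp
      also have "\<dots> = entry y s ?q o\<^sub>L \<alpha> (- ?q) (entry x 0 (r - s))" by (rule com[OF row])
      also have "\<alpha> (- ?q) (entry x 0 (r - s)) = entry x ?q t"
      proof -
        have "t - ?q = r - s" by (simp only: diff_conv_add_uminus minus_add minus_minus add.assoc add_minus_cancel minus_add_cancel
            add.left_inverse add.right_inverse add_0_left add_0_right)
        then show ?thesis using entry_from_row[OF x, of ?q t] by simp
      qed
      finally show ?thesis .
    qed
    have bij: "bij_betw (\<lambda>r. s - r + t) UNIV UNIV"
    proof (rule bij_betw_byWitness[of _ "\<lambda>q. t - q + s"])
      show "\<forall>r\<in>UNIV. t - (s - r + t) + s = r" by (simp only: diff_conv_add_uminus minus_add minus_minus add.assoc add_minus_cancel minus_add_cancel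
            add.left_inverse add.right_inverse add_0_left add_0_right ball_UNIV simp_thms)
      show "\<forall>q\<in>UNIV. s - (t - q + s) + t = q" by (simp only: diff_conv_add_uminus minus_add minus_minus add.assoc add_minus_cancel minus_add_cancel
            add.left_inverse add.right_inverse add_0_left add_0_right ball_UNIV simp_thms)
    qed auto
    have "((\<lambda>q. inner ((entry y s q o\<^sub>L entry x q t) h) k) has_sum inner (entry (y o\<^sub>L x) s t h) k) UNIV"
      by (rule entry_compose_has_sum[OF yB])
    then have "((\<lambda>r. inner ((entry y s (s - r + t) o\<^sub>L entry x (s - r + t) t) h) k) has_sum inner (entry (y o\<^sub>L x) s t h) k) UNIV"
      by (subst has_sum_reindex_bij_betw[OF bij, of "\<lambda>q. inner ((entry y s q o\<^sub>L entry x q t) h) k"])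
    then have "((\<lambda>r. inner ((entry x s r o\<^sub>L entry y r t) h) k) has_sum inner (entry (y o\<^sub>L x) s t h) k) UNIV"
      by (simp only: term_eq)
    with entry_compose_has_sum[OF xB] show "inner (entry (x o\<^sub>L y) s t h) k = inner (entry (y o\<^sub>L x) s t h) k"
      by (rule has_sum_unique)
  qed
  then show ?thesis unfolding crossed_product_eq[OF PD(2,3)] using xB by (simp add: commutant_def)
qed

text \<open>The entry at \<open>(0, 0)\<close> recovers \<open>a\<close>. This makes the map from
  subalgebras to crossed products injective.\<close>

lemma pi_mem_iff:
  assumes P: "inv_vn P" and a: "a \<in> M" shows "pi_rep a \<in> crossed_product \<alpha> P \<longleftrightarrow> a \<in> P"
  using entry_crossed_product[OF P, of "pi_rep a" 0 0] pi_mem[of a P] by (auto simp: entry_pi[OF a] alpha_zero[OF a])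

text \<open>\<open>pi_rep\<close> is strongly continuous on bounded sets, so the preimage is closed
  under bounded limits in \<open>M\<close> and equals its bicommutant. Invariance holds because
  \<open>Q\<close> contains the implementing unitaries.\<close>

lemma preimage_vn:
  assumes Q: "von_neumann_algebra Q" "range cp_unitary \<subseteq> Q"
  shows "inv_vn {a \<in> M. pi_rep a \<in> Q}"
proof -
  let ?P = "{a \<in> M. pi_rep a \<in> Q}"
  note QD = star_algD[OF vn_star_alg[OF Q(1)]]
  have P: "star_alg ?P" unfolding star_alg_def
    using MD(1-6) QD(2-6) by (auto simp: pi_id pi_add pi_compose pi_cscale) (metis QD(5) pi_star)
  have PB: "?P \<subseteq> bounded_ops" using star_algD(1)[OF P] by blast
  have "commutant (commutant ?P) \<subseteq> ?P"
  proof (rule bicommutant_subset_seq_closed[OF ultra M sep P])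
    fix f and a :: "'h op" and K
    assume f: "\<And>n::nat. f n \<in> ?P" "\<And>n. norm (f n) \<le> K" "a \<in> M" "\<And>v. (\<lambda>n. f n v) \<longlonglongrightarrow> blinfun_apply a v"
    have fM: "f n \<in> M" and fQ: "pi_rep (f n) \<in> Q" for n using f(1)[of n] by auto
    have "pi_rep a \<in> Q"
    proof (rule vn_wot_closed[OF Q(1) trivial_limit_sequentially fQ])
      show "(\<lambda>n. inner (pi_rep (f n) x) y) \<longlonglongrightarrow> inner (pi_rep a x) y" for x y
        by (intro tendsto_inner tendsto_const pi_tendsto[OF fM f(2,3,4)])
    qed
    then show "a \<in> ?P" using f(3) by simp
  next
    show "?P \<subseteq> M" by blast
    show "a + b \<in> ?P" if "a \<in> ?P" "b \<in> ?P" for a b by (rule star_algD(3)[OF P that])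
    show "cscale c a \<in> ?P" if "a \<in> ?P" for a c by (rule star_algD(6)[OF P that])
  qed simp
  then have "von_neumann_algebra ?P"
    using PB star_algD(5)[OF P] subset_bicommutant[OF PB] by (auto simp: von_neumann_algebra_def)
  moreover have "pi_rep (\<alpha> s a) \<in> Q" if a: "a \<in> ?P" for s a
  proof -
    have "pi_rep (\<alpha> s a) = (pi_rep (\<alpha> s a) o\<^sub>L cp_unitary s) o\<^sub>L cp_unitary (- s)"
      by (simp add: compose_assoc cp_unitary_inverse)
    also have "\<dots> = (cp_unitary s o\<^sub>L pi_rep a) o\<^sub>L cp_unitary (- s)" using a by (simp add: pi_covariant)
    finally show ?thesis using a Q(2) by (auto intro!: QD(4))
  qed
  ultimately show ?thesis by (auto simp: inv_vn_def invariant_def aD(1))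
qed

lemma inv_vn_Int: "inv_vn P \<Longrightarrow> inv_vn Q \<Longrightarrow> inv_vn (P \<inter> Q)"
  by (auto simp: inv_vn_def invariant_def von_neumann_algebra_Int image_subset_iff)

text \<open>The action is not given by unitaries on the underlying space, so it does not commute
  with bicommutants for formal reasons. Instead, the elements sent by \<open>\<alpha> s\<close> into
  the generated algebra form a star-algebra that contains both subalgebras and is closed under
  bounded limits.\<close>

lemma inv_vn_join:
  assumes P: "inv_vn P" and Q: "inv_vn Q"
  shows "inv_vn (vn_generated (P \<union> Q))"
proof -
  let ?R = "vn_generated (P \<union> Q)"
  note PD = inv_vnD[OF P] and QD = inv_vnD[OF Q]
  have R: "von_neumann_algebra ?R" by (rule von_neumann_algebra_join[OF PD(1) QD(1)])
  have RM: "?R \<subseteq> M" by (rule vn_generated_least[OF M]) (use PD QD in auto)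
  note SR = vn_star_alg[OF R]
  note RD = star_algD[OF SR]
  have "\<alpha> s a \<in> ?R" if a: "a \<in> ?R" for s a
  proof -
    define S where "S = {a \<in> ?R. \<alpha> s a \<in> ?R}"
    have aM: "a \<in> M" if "a \<in> S" for a using that RM by (auto simp: S_def)
    have sS: "star_alg S" unfolding star_alg_def
    proof (intro conjI ballI allI)
      show "S \<subseteq> bounded_ops" using RD(1) by (auto simp: S_def)
      show "id_blinfun \<in> S" using RD(2) by (simp add: S_def aD(9))
      fix a assume a: "a \<in> S"
      show "star a \<in> S" using a RD(5) by (simp add: S_def aD(5)[OF aM[OF a]])
      show "cscale c a \<in> S" for c using a RD(6) by (simp add: S_def aD(4)[OF aM[OF a]])
      fix b assume b: "b \<in> S"
      show "a + b \<in> S" using a b RD(3) by (simp add: S_def aD(2)[OF aM[OF a] aM[OF b]])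
      show "a o\<^sub>L b \<in> S" using a b RD(4) by (simp add: S_def aD(3)[OF aM[OF a] aM[OF b]])
    qed
    have PQ: "P \<union> Q \<subseteq> S" using PD(4) QD(4) vn_generated_superset[of "P \<union> Q"] by (auto simp: S_def)
    have "commutant (commutant S) \<subseteq> S"
    proof (rule bicommutant_subset_seq_closed[OF ultra M sep sS])
      show "S \<subseteq> M" using aM by blast
      fix f a K
      assume f: "\<And>n::nat. f n \<in> S" "\<And>n. norm (f n) \<le> K" "a \<in> M" "\<And>v. (\<lambda>n. f n v) \<longlonglongrightarrow> blinfun_apply a v"
      have "f n \<in> ?R" "\<alpha> s (f n) \<in> ?R" for n using f(1)[of n] by (auto simp: S_def)
      note fR = this
      have "a \<in> ?R"
      proof (rule vn_wot_closed[OF R trivial_limit_sequentially fR(1)])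
        show "(\<lambda>n. inner (f n x) y) \<longlonglongrightarrow> inner (a x) y" for x y
          by (intro tendsto_inner tendsto_const f)
      qed
      moreover have "\<alpha> s a \<in> ?R"
      proof (rule vn_wot_closed[OF R trivial_limit_sequentially fR(2)])
        show "(\<lambda>n. inner (\<alpha> s (f n) x) y) \<longlonglongrightarrow> inner (\<alpha> s a x) y" for x y
          by (intro tendsto_inner tendsto_const alpha_tendsto[OF aM[OF f(1)] f(2,3,4)])
      qed
      ultimately show "a \<in> S" by (simp add: S_def)
    qed (use star_algD(3,6)[OF sS] in auto)
    moreover have "?R \<subseteq> commutant (commutant S)"
      using PQ star_algD(1,5)[OF sS] by (intro vn_generated_least von_neumann_algebra_bicommutant order_trans[OF PQ subset_bicommutant]) auto
    ultimately show ?thesis using a by (auto simp: S_def)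
  qed
  then show ?thesis using R RM by (auto simp: inv_vn_def invariant_def)
qed

end

section \<open>Normal representations\<close>

text \<open>Three instances occur: \<open>amp\<close> for measuring distances at
  \<open>\<zeta>\<close>, \<open>pi_rep\<close> for the norms of averages, and the identity for
  their coefficients. Normality of limit functionals is thereby proved once.\<close>

definition normal_rep ::
    "(nat, 'h::chilbert_space) ell2 \<Rightarrow> 'h op set \<Rightarrow> ('h op \<Rightarrow> 'k::chilbert_space op) \<Rightarrow> bool" where
  "normal_rep \<zeta> M \<rho> \<longleftrightarrow> normal_on \<zeta> M \<rho> \<and> (\<forall>a\<in>M. \<rho> a \<in> bounded_ops \<and> norm (\<rho> a) \<le> norm a
     \<and> \<rho> (star a) = star (\<rho> a)) \<and> (\<forall>a\<in>M. \<forall>c. \<rho> (cscale c a) = cscale c (\<rho> a))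
     \<and> (\<forall>a\<in>M. \<forall>b\<in>M. \<rho> (a + b) = \<rho> a + \<rho> b \<and> \<rho> (a o\<^sub>L b) = \<rho> a o\<^sub>L \<rho> b) \<and> \<rho> id_blinfun = id_blinfun"

lemma normal_repD:
  assumes \<rho>: "normal_rep \<zeta> M \<rho>" and M: "star_alg M"
  shows "normal_on \<zeta> M \<rho>" "a \<in> M \<Longrightarrow> \<rho> a \<in> bounded_ops" "a \<in> M \<Longrightarrow> norm (\<rho> a) \<le> norm a"
    "a \<in> M \<Longrightarrow> \<rho> (star a) = star (\<rho> a)" "a \<in> M \<Longrightarrow> \<rho> (cscale c a) = cscale c (\<rho> a)"
    "a \<in> M \<Longrightarrow> b \<in> M \<Longrightarrow> \<rho> (a + b) = \<rho> a + \<rho> b" "a \<in> M \<Longrightarrow> b \<in> M \<Longrightarrow> \<rho> (a o\<^sub>L b) = \<rho> a o\<^sub>L \<rho> b"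
    "\<rho> id_blinfun = id_blinfun" "a \<in> M \<Longrightarrow> \<rho> (r *\<^sub>R a) = r *\<^sub>R \<rho> a"
    "a \<in> M \<Longrightarrow> b \<in> M \<Longrightarrow> \<rho> (a - b) = \<rho> a - \<rho> b" "a \<in> M \<Longrightarrow> norm (\<rho> a v) \<le> norm a * norm v"
proof -
  show 1: "normal_on \<zeta> M \<rho>" "a \<in> M \<Longrightarrow> \<rho> a \<in> bounded_ops" "a \<in> M \<Longrightarrow> norm (\<rho> a) \<le> norm a"
    "a \<in> M \<Longrightarrow> \<rho> (star a) = star (\<rho> a)" "a \<in> M \<Longrightarrow> \<rho> (cscale c a) = cscale c (\<rho> a)"
    "a \<in> M \<Longrightarrow> b \<in> M \<Longrightarrow> \<rho> (a + b) = \<rho> a + \<rho> b" "a \<in> M \<Longrightarrow> b \<in> M \<Longrightarrow> \<rho> (a o\<^sub>L b) = \<rho> a o\<^sub>L \<rho> b"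
    "\<rho> id_blinfun = id_blinfun" for a b c
    using \<rho> by (auto simp: normal_rep_def)
  show 2: "a \<in> M \<Longrightarrow> \<rho> (r *\<^sub>R a) = r *\<^sub>R \<rho> a" for a r
    using 1(5)[of a "of_real r"] by (simp add: cscale_of_real)
  show "\<rho> (a - b) = \<rho> a - \<rho> b" if "a \<in> M" "b \<in> M"
    using 1(6)[OF that(1) star_algD(7)[OF M that(2)], of "-1"] 2[OF that(2), of "-1"] by simp
  show "norm (\<rho> a v) \<le> norm a * norm v" if "a \<in> M"
    using norm_blinfun[of "\<rho> a" v] mult_right_mono[OF 1(3)[OF that] norm_ge_zero[of v]] by linarith
qed

lemma predual_linear:
  assumes "\<phi> \<in> predual M" and M: "star_alg M"
  shows "a \<in> M \<Longrightarrow> b \<in> M \<Longrightarrow> \<phi> (a + b) = \<phi> a + \<phi> b" "a \<in> M \<Longrightarrow> \<phi> (cscale c a) = c * \<phi> a"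
    "a \<in> M \<Longrightarrow> b \<in> M \<Longrightarrow> \<phi> (a - b) = \<phi> a - \<phi> b" "a \<in> M \<Longrightarrow> \<phi> (r *\<^sub>R a) = of_real r * \<phi> a"
    "\<exists>\<psi>\<in>predual M. \<forall>a\<in>M. \<psi> a = cnj (\<phi> (star a))"
proof -
  obtain \<xi> \<eta> where s: "summable (\<lambda>n. (norm (\<xi> n))\<^sup>2)" "summable (\<lambda>n. (norm (\<eta> n))\<^sup>2)"
    and \<phi>: "\<And>a. a \<in> M \<Longrightarrow> \<phi> a = (\<Sum>n. cinner (blinfun_apply a (\<xi> n)) (\<eta> n))"
    using assms unfolding predual_def by blast
  have sm: "summable (\<lambda>n. cinner (blinfun_apply a (\<xi> n)) (\<eta> n))" for a
  proof (rule summable_comparison_test')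
    show "summable (\<lambda>n. (norm a)\<^sup>2 * (norm (\<xi> n))\<^sup>2 + (norm (\<eta> n))\<^sup>2)"
      by (intro summable_add summable_mult s)
    show "norm (cinner (a (\<xi> n)) (\<eta> n)) \<le> (norm a)\<^sup>2 * (norm (\<xi> n))\<^sup>2 + (norm (\<eta> n))\<^sup>2" if "n \<ge> 0" for n
    proof -
      have "(norm (a (\<xi> n)))\<^sup>2 \<le> (norm a * norm (\<xi> n))\<^sup>2" by (intro power_mono norm_blinfun) simp
      then show ?thesis using norm_cinner_le[of "a (\<xi> n)" "\<eta> n"] by (simp add: power_mult_distrib)
    qed
  qed
  show 1: "a \<in> M \<Longrightarrow> b \<in> M \<Longrightarrow> \<phi> (a + b) = \<phi> a + \<phi> b" for a b
    by (simp add: \<phi> star_algD(3)[OF M] blinfun.add_left cinner_add_left suminf_add[OF sm sm])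
  show 2: "a \<in> M \<Longrightarrow> \<phi> (cscale c a) = c * \<phi> a" for a c
    by (simp add: \<phi> star_algD(6)[OF M] cinner_scaleC_left suminf_mult[OF sm])
  show 3: "a \<in> M \<Longrightarrow> \<phi> (r *\<^sub>R a) = of_real r * \<phi> a" for a r
    using 2[of a "of_real r"] by (simp add: cscale_of_real)
  show "\<phi> (a - b) = \<phi> a - \<phi> b" if "a \<in> M" "b \<in> M"
    using 1[OF that(1) star_algD(7)[OF M that(2)], of "-1"] 3[OF that(2), of "-1"] by simp
  define \<psi> where "\<psi> a = (\<Sum>n. cinner (blinfun_apply a (\<eta> n)) (\<xi> n))" for a
  have "\<psi> a = cnj (\<phi> (star a))" if a: "a \<in> M" for a
  proof -
    have aB: "a \<in> bounded_ops" by (rule star_algD(1)[OF M a])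
    have "cnj (\<phi> (star a)) = (\<Sum>n. cnj (cinner (star a (\<xi> n)) (\<eta> n)))"
      unfolding \<phi>[OF star_algD(5)[OF M a]]
      by (rule sums_unique[OF sums_cnj[THEN iffD2, OF summable_sums[OF sm]]])
    also have "\<dots> = \<psi> a" unfolding \<psi>_def
    proof (rule suminf_cong)
      fix n
      have "cnj (cinner (star a (\<xi> n)) (\<eta> n)) = cinner (\<eta> n) (star a (\<xi> n))" by (rule cinner_commute[symmetric])
      then show "cnj (cinner (star a (\<xi> n)) (\<eta> n)) = cinner (a (\<eta> n)) (\<xi> n)" by (simp add: star_cinner[OF aB])
    qed
    finally show ?thesis by simp
  qed
  moreover have "\<psi> \<in> predual M" unfolding predual_def \<psi>_def using s by blast
  ultimately show "\<exists>\<psi>\<in>predual M. \<forall>a\<in>M. \<psi> a = cnj (\<phi> (star a))" by blast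
qed

text \<open>Rescale to norm 1. Both signs are covered because \<open>u\<close> and
  \<open>- u\<close> have the same square.\<close>

lemma op_sqrt_abs:
  fixes u :: "'h::chilbert_space op"
  assumes u: "u \<in> bounded_ops" "star u = u" "norm u \<le> K" and K: "K > 0"
  shows "pos (op_sqrt (K\<^sup>2) (u o\<^sub>L u) - u)" "pos (op_sqrt (K\<^sup>2) (u o\<^sub>L u) + u)"
proof -
  have 1: "pos (op_sqrt (K\<^sup>2) (w o\<^sub>L w) - w)" if w: "w \<in> bounded_ops" "star w = w" "norm w \<le> K" for w :: "'h op"
  proof -
    define v where "v = (1/K) *\<^sub>R w"
    have v: "v \<in> bounded_ops" "star v = v" "norm v \<le> 1" using w K by (auto simp: v_def star_scaleR)
    have e: "(1 / K\<^sup>2) *\<^sub>R (w o\<^sub>L w) = v o\<^sub>L v"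
      by (rule blinfun_eqI) (simp add: v_def blinfun.bilinear_simps power2_eq_square)
    have "op_sqrt (K\<^sup>2) (w o\<^sub>L w) - w = K *\<^sub>R (op_sqrt 1 (v o\<^sub>L v) - v)"
      using K by (simp add: op_sqrt_def e scaleR_diff_right) (simp add: v_def)
    then show ?thesis using pos_scaleR[OF op_sqrt_square_ge[OF v], of K] K by simp
  qed
  show "pos (op_sqrt (K\<^sup>2) (u o\<^sub>L u) - u)" by (rule 1[OF u])
  have "(- u) o\<^sub>L (- u) = u o\<^sub>L u" by (rule blinfun_eqI) (simp add: blinfun.bilinear_simps)
  moreover have "star (- u) = - u" using star_scaleR[OF u(1), of "-1"] u(2) by simp
  ultimately show "pos (op_sqrt (K\<^sup>2) (u o\<^sub>L u) + u)" using 1[of "- u"] u by simp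
qed

section \<open>Algebras of central sequences\<close>

locale central_dynamics = vn_dynamics \<omega> M \<alpha> \<zeta>
  for \<omega> :: "nat filter" and M :: "'h::chilbert_space op set"
    and \<alpha> :: "'g::{group_add,countable} \<Rightarrow> 'h op \<Rightarrow> 'h op" and \<zeta> :: "(nat, 'h) ell2" +
  fixes N :: "'h op set"
  assumes N: "von_neumann_algebra N" and NM: "N \<subseteq> M" and sepM: "separable_predual M"
begin

definition C :: "(nat \<Rightarrow> 'h op) set" where "C = bounded_sequences N \<inter> central_sequences \<omega> M"
definition I :: "(nat \<Rightarrow> 'h op) set" where "I = null_sequences \<omega> N"

lemmas SN = vn_star_alg[OF N]
lemmas ND = star_algD[OF SN]
lemma NMD: "a \<in> N \<Longrightarrow> a \<in> M" using NM by blast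
lemma NB: "a \<in> N \<Longrightarrow> a \<in> bounded_ops" by (rule ND(1))

text \<open>Convergence in the norm of the predual, written without a supremum. Being uniform over
  \<open>M\<close>, the inequality may be used with an \<open>X\<close> that varies with
  \<open>i\<close>.\<close>

definition asymp_central :: "(nat \<Rightarrow> 'h op) \<Rightarrow> bool" where
  "asymp_central a \<longleftrightarrow> (\<forall>\<phi>\<in>predual M. \<forall>e>0. \<forall>\<^sub>F i in \<omega>. \<forall>X\<in>M. cmod (\<phi> (a i o\<^sub>L X) - \<phi> (X o\<^sub>L a i)) \<le> e * norm X)"

lemma central_bounded:
  assumes \<phi>: "\<phi> \<in> predual M" and a: "a \<in> M"
  shows "\<exists>K. \<forall>b\<in>M. norm b \<le> 1 \<longrightarrow> cmod (\<phi> (a o\<^sub>L b) - \<phi> (b o\<^sub>L a)) \<le> K"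
proof -
  obtain K where K: "K \<ge> 0" "\<And>a. a \<in> M \<Longrightarrow> cmod (\<phi> a) \<le> K * norm a" using predual_bounded[OF \<phi>] by blast
  have "cmod (\<phi> (a o\<^sub>L b) - \<phi> (b o\<^sub>L a)) \<le> 2 * K * norm a" if b: "b \<in> M" "norm b \<le> 1" for b
  proof -
    have n: "norm (a o\<^sub>L b) \<le> norm a" "norm (b o\<^sub>L a) \<le> norm a"
      using norm_blinfun_compose[of a b] norm_blinfun_compose[of b a] mult_left_mono[OF b(2) norm_ge_zero[of a]]
      by (simp_all add: mult.commute)
    have "cmod (\<phi> (a o\<^sub>L b)) \<le> K * norm a" "cmod (\<phi> (b o\<^sub>L a)) \<le> K * norm a"
      using K(2)[OF MD(4)[OF a b(1)]] K(2)[OF MD(4)[OF b(1) a]] mult_left_mono[OF n(1) K(1)] mult_left_mono[OF n(2) K(1)]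
      by linarith+
    then show ?thesis using norm_triangle_ineq4[of "\<phi> (a o\<^sub>L b)" "\<phi> (b o\<^sub>L a)"] by linarith
  qed
  then show ?thesis by blast
qed

lemma C_iff: "a \<in> C \<longleftrightarrow> (\<forall>i. a i \<in> N) \<and> (\<exists>K. \<forall>i. norm (a i) \<le> K) \<and> asymp_central a"
proof -
  have eq: "(((\<lambda>i. functional_norm M (\<lambda>x. \<phi> (a i o\<^sub>L x) - \<phi> (x o\<^sub>L a i))) \<longlongrightarrow> 0) \<omega>)
      \<longleftrightarrow> (\<forall>e>0. \<forall>\<^sub>F i in \<omega>. \<forall>X\<in>M. cmod (\<phi> (a i o\<^sub>L X) - \<phi> (X o\<^sub>L a i)) \<le> e * norm X)" (is "?l \<longleftrightarrow> ?r")
    if \<phi>: "\<phi> \<in> predual M" and a: "\<And>i. a i \<in> N" for \<phi>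
  proof -
    define \<psi> where "\<psi> i x = \<phi> (a i o\<^sub>L x) - \<phi> (x o\<^sub>L a i)" for i x
    have aM: "a i \<in> M" for i using a NM by blast
    obtain K where K: "\<And>i b. b \<in> M \<Longrightarrow> norm b \<le> 1 \<Longrightarrow> cmod (\<psi> i b) \<le> K i"
      using central_bounded[OF \<phi> aM] unfolding \<psi>_def by metis
    have hom: "\<psi> i (r *\<^sub>R b) = of_real r * \<psi> i b" if "b \<in> M" for i r b
    proof -
      have "a i o\<^sub>L (r *\<^sub>R b) = r *\<^sub>R (a i o\<^sub>L b)" "(r *\<^sub>R b) o\<^sub>L a i = r *\<^sub>R (b o\<^sub>L a i)"
        by (rule blinfun_eqI, simp add: blinfun.bilinear_simps)+
      then show ?thesis unfolding \<psi>_def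
        using predual_linear(4)[OF \<phi> SM MD(4)[OF aM that]] predual_linear(4)[OF \<phi> SM MD(4)[OF that aM]]
        by (simp add: right_diff_distrib)
    qed
    have up: "cmod (\<psi> i X) \<le> functional_norm M (\<psi> i) * norm X" if "X \<in> M" for i X
      by (rule functional_norm_ge_scaled[OF SM K hom that])
    have nn: "0 \<le> functional_norm M (\<psi> i)" for i
      using order_trans[OF norm_ge_zero functional_norm_ge[of M "\<psi> i" "K i" 0, OF K MD(8)]] by simp
    have "((\<lambda>i. functional_norm M (\<psi> i)) \<longlongrightarrow> 0) \<omega> \<longleftrightarrow> (\<forall>e>0. \<forall>\<^sub>F i in \<omega>. \<forall>X\<in>M. cmod (\<psi> i X) \<le> e * norm X)"
    proof (intro iffI allI impI)
      fix e :: real assume e: "e > 0" and l: "((\<lambda>i. functional_norm M (\<psi> i)) \<longlongrightarrow> 0) \<omega>"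
      have "\<forall>\<^sub>F i in \<omega>. functional_norm M (\<psi> i) < e" by (rule order_tendstoD(2)[OF l e])
      then show "\<forall>\<^sub>F i in \<omega>. \<forall>X\<in>M. cmod (\<psi> i X) \<le> e * norm X"
      proof eventually_elim
        case (elim i)
        then show ?case using up mult_right_mono[OF less_imp_le[OF elim] norm_ge_zero] order_trans by blast
      qed
    next
      assume r: "\<forall>e>0. \<forall>\<^sub>F i in \<omega>. \<forall>X\<in>M. cmod (\<psi> i X) \<le> e * norm X"
      show "((\<lambda>i. functional_norm M (\<psi> i)) \<longlongrightarrow> 0) \<omega>"
      proof (rule tendstoI)
        fix e :: real assume e: "e > 0"
        then have "\<forall>\<^sub>F i in \<omega>. \<forall>X\<in>M. cmod (\<psi> i X) \<le> (e / 2) * norm X" by (intro r[rule_format]) simp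
        then show "\<forall>\<^sub>F i in \<omega>. dist (functional_norm M (\<psi> i)) 0 < e"
        proof eventually_elim
          case (elim i)
          have "functional_norm M (\<psi> i) \<le> e / 2"
          proof (rule functional_norm_le[OF _ MD(8)])
            fix b assume b: "b \<in> M" "norm b \<le> 1"
            have "(e / 2) * norm b \<le> (e / 2) * 1" by (rule mult_left_mono[OF b(2)]) (use e in simp)
            then show "cmod (\<psi> i b) \<le> e / 2" using elim b(1) by force
          qed
          then show ?case using nn[of i] e by simp
        qed
      qed
    qed
    then show ?thesis unfolding \<psi>_def .
  qed
  have bs: "a \<in> bounded_sequences P \<longleftrightarrow> (\<forall>i. a i \<in> P) \<and> (\<exists>K. \<forall>i. norm (a i) \<le> K)" for P :: "'h op set"
    by (auto simp: bounded_sequences_def bounded_iff)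
  show ?thesis
  proof
    assume "a \<in> C"
    then show "(\<forall>i. a i \<in> N) \<and> (\<exists>K. \<forall>i. norm (a i) \<le> K) \<and> asymp_central a"
      using eq by (auto simp: C_def central_sequences_def bs asymp_central_def)
  next
    assume "(\<forall>i. a i \<in> N) \<and> (\<exists>K. \<forall>i. norm (a i) \<le> K) \<and> asymp_central a"
    then show "a \<in> C"
      using eq NM by (auto simp: C_def central_sequences_def bs asymp_central_def)
  qed
qed

lemma CD:
  assumes "a \<in> C"
  shows "a i \<in> N" "a i \<in> M" "a i \<in> bounded_ops" "asymp_central a" "\<exists>K>0. \<forall>i. norm (a i) \<le> K"
proof -
  show 1: "a i \<in> N" "asymp_central a" using assms by (auto simp: C_iff)
  show "a i \<in> M" "a i \<in> bounded_ops" using 1(1) NMD NB by auto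
  obtain K where "\<forall>i. norm (a i) \<le> K" using assms by (auto simp: C_iff)
  then show "\<exists>K>0. \<forall>i. norm (a i) \<le> K" by (intro exI[of _ "max K 1"]) (auto intro: order_trans)
qed

lemma CI:
  "(\<And>i. a i \<in> N) \<Longrightarrow> (\<And>i. norm (a i) \<le> K) \<Longrightarrow>
    (\<And>\<phi> e. \<phi> \<in> predual M \<Longrightarrow> e > 0 \<Longrightarrow> \<forall>\<^sub>F i in \<omega>. \<forall>X\<in>M. cmod (\<phi> (a i o\<^sub>L X) - \<phi> (X o\<^sub>L a i)) \<le> e * norm X)
    \<Longrightarrow> a \<in> C"
  by (auto simp: C_iff asymp_central_def)

lemma C_centralD:
  assumes "a \<in> C" "\<phi> \<in> predual M" "e > 0"
  shows "\<forall>\<^sub>F i in \<omega>. \<forall>X\<in>M. cmod (\<phi> (a i o\<^sub>L X) - \<phi> (X o\<^sub>L a i)) \<le> e * norm X"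
  using CD(4)[OF assms(1)] assms(2,3) by (auto simp: asymp_central_def)

text \<open>In most uses \<open>X\<close> contains factors with index \<open>i\<close>; hence the
  quantifier over \<open>X\<close> stands inside \<open>eventually\<close>, and only a bound on the
  norm of \<open>X\<close> is required later.\<close>

lemma C_inner_central:
  assumes a: "a \<in> C" and e: "e > 0"
  shows "\<forall>\<^sub>F i in \<omega>. \<forall>X\<in>M. \<bar>inner (a i (blinfun_apply X \<xi>)) \<eta> - inner (blinfun_apply X (a i \<xi>)) \<eta>\<bar> \<le> e * norm X"
proof -
  have "\<forall>\<^sub>F i in \<omega>. \<forall>X\<in>M. cmod (cinner ((a i o\<^sub>L X) \<xi>) \<eta> - cinner ((X o\<^sub>L a i) \<xi>) \<eta>) \<le> e * norm X"
    by (rule C_centralD[OF a vector_functional_predual e])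
  then show ?thesis
  proof eventually_elim
    case (elim i)
    show ?case
    proof
      fix X assume X: "X \<in> M"
      have "inner (a i (X \<xi>)) \<eta> - inner (X (a i \<xi>)) \<eta> = Re (cinner ((a i o\<^sub>L X) \<xi>) \<eta> - cinner ((X o\<^sub>L a i) \<xi>) \<eta>)"
        by (simp add: Re_cinner)
      also have "\<bar>\<dots>\<bar> \<le> e * norm X" by (rule order_trans[OF abs_Re_le_cmod elim[rule_format, OF X]])
      finally show "\<bar>inner (a i (X \<xi>)) \<eta> - inner (X (a i \<xi>)) \<eta>\<bar> \<le> e * norm X" .
    qed
  qed
qed

lemma C_id: "(\<lambda>_. id_blinfun) \<in> C"
  by (rule CI[of _ 1]) (auto simp: ND(2) norm_blinfun_id_le)

lemma C_add:
  assumes a: "a \<in> C" and b: "b \<in> C" shows "(\<lambda>i. a i + b i) \<in> C"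
proof -
  obtain Ka Kb where K: "\<And>i. norm (a i) \<le> Ka" "\<And>i. norm (b i) \<le> Kb" using CD(5)[OF a] CD(5)[OF b] by blast
  show ?thesis
  proof (rule CI[of _ "Ka + Kb"])
    show "a i + b i \<in> N" for i by (rule ND(3)[OF CD(1)[OF a] CD(1)[OF b]])
    show "norm (a i + b i) \<le> Ka + Kb" for i by (rule norm_triangle_le[OF add_mono[OF K]])
    fix \<phi> and e :: real assume \<phi>: "\<phi> \<in> predual M" and e: "e > 0"
    from C_centralD[OF a \<phi> half_gt_zero[OF e]] C_centralD[OF b \<phi> half_gt_zero[OF e]]
    show "\<forall>\<^sub>F i in \<omega>. \<forall>X\<in>M. cmod (\<phi> ((a i + b i) o\<^sub>L X) - \<phi> (X o\<^sub>L (a i + b i))) \<le> e * norm X"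
    proof eventually_elim
      case (elim i)
      show ?case
      proof
        fix X assume X: "X \<in> M"
        note m = MD(4)[OF CD(2)[OF a] X, of i] MD(4)[OF CD(2)[OF b] X, of i] MD(4)[OF X CD(2)[OF a], of i] MD(4)[OF X CD(2)[OF b], of i]
        have "\<phi> ((a i + b i) o\<^sub>L X) - \<phi> (X o\<^sub>L (a i + b i)) = (\<phi> (a i o\<^sub>L X) - \<phi> (X o\<^sub>L a i)) + (\<phi> (b i o\<^sub>L X) - \<phi> (X o\<^sub>L b i))"
          using predual_linear(1)[OF \<phi> SM m(1,2)] predual_linear(1)[OF \<phi> SM m(3,4)]
          by (simp add: compose_add_left compose_add_right)
        also have "cmod \<dots> \<le> e / 2 * norm X + e / 2 * norm X"
          by (rule norm_triangle_le[OF add_mono[OF elim(1)[rule_format, OF X] elim(2)[rule_format, OF X]]])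
        finally show "cmod (\<phi> ((a i + b i) o\<^sub>L X) - \<phi> (X o\<^sub>L (a i + b i))) \<le> e * norm X" by (simp add: algebra_simps)
      qed
    qed
  qed
qed

text \<open>The commutator of \<open>a b\<close> with \<open>X\<close> is the sum of that of
  \<open>a\<close> with \<open>b X\<close> and that of \<open>b\<close> with \<open>X a\<close>, and
  both arguments are elements of \<open>M\<close> of controlled norm.\<close>

lemma C_compose:
  assumes a: "a \<in> C" and b: "b \<in> C" shows "(\<lambda>i. a i o\<^sub>L b i) \<in> C"
proof -
  obtain Ka Kb where K: "\<And>i. norm (a i) \<le> Ka" "\<And>i. norm (b i) \<le> Kb" "Ka > 0" "Kb > 0" using CD(5)[OF a] CD(5)[OF b] by blast
  show ?thesis
  proof (rule CI[of _ "Ka * Kb"])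
    show "a i o\<^sub>L b i \<in> N" for i by (rule ND(4)[OF CD(1)[OF a] CD(1)[OF b]])
    show "norm (a i o\<^sub>L b i) \<le> Ka * Kb" for i
      by (rule order_trans[OF norm_blinfun_compose mult_mono]) (use K in \<open>auto simp: less_imp_le\<close>)
    fix \<phi> and e :: real assume \<phi>: "\<phi> \<in> predual M" and e: "e > 0"
    define d where "d = e / (Ka + Kb)"
    have "Ka + Kb > 0" using K by simp
    then have "d > 0" "d * (Ka + Kb) = e" using e by (auto simp: d_def)
    then have d: "d > 0" "d * Ka + d * Kb = e" by (auto simp: distrib_left)
    from C_centralD[OF a \<phi> d(1)] C_centralD[OF b \<phi> d(1)]
    show "\<forall>\<^sub>F i in \<omega>. \<forall>X\<in>M. cmod (\<phi> ((a i o\<^sub>L b i) o\<^sub>L X) - \<phi> (X o\<^sub>L (a i o\<^sub>L b i))) \<le> e * norm X"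
    proof eventually_elim
      case (elim i)
      show ?case
      proof
        fix X assume X: "X \<in> M"
        have m: "b i o\<^sub>L X \<in> M" "X o\<^sub>L a i \<in> M" by (intro MD(4) X CD(2) a b)+
        have n: "norm (b i o\<^sub>L X) \<le> Kb * norm X" "norm (X o\<^sub>L a i) \<le> Ka * norm X"
          using norm_blinfun_compose[of "b i" X] norm_blinfun_compose[of X "a i"]
            mult_right_mono[OF K(2) norm_ge_zero[of X], of i] mult_right_mono[OF K(1) norm_ge_zero[of X], of i]
          by (simp_all add: mult.commute)
        have "\<phi> ((a i o\<^sub>L b i) o\<^sub>L X) - \<phi> (X o\<^sub>L (a i o\<^sub>L b i))
            = (\<phi> (a i o\<^sub>L (b i o\<^sub>L X)) - \<phi> ((b i o\<^sub>L X) o\<^sub>L a i)) + (\<phi> (b i o\<^sub>L (X o\<^sub>L a i)) - \<phi> ((X o\<^sub>L a i) o\<^sub>L b i))"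
          by (simp add: compose_assoc)
        also have "cmod \<dots> \<le> d * norm (b i o\<^sub>L X) + d * norm (X o\<^sub>L a i)"
          by (rule norm_triangle_le[OF add_mono[OF elim(1)[rule_format, OF m(1)] elim(2)[rule_format, OF m(2)]]])
        also have "\<dots> \<le> d * (Kb * norm X) + d * (Ka * norm X)"
          using n d by (intro add_mono mult_left_mono) auto
        also have "\<dots> = e * norm X" using d(2) by (metis add.commute distrib_right mult.assoc)
        finally show "cmod (\<phi> ((a i o\<^sub>L b i) o\<^sub>L X) - \<phi> (X o\<^sub>L (a i o\<^sub>L b i))) \<le> e * norm X" .
      qed
    qed
  qed
qed

lemma C_star:
  assumes a: "a \<in> C" shows "(\<lambda>i. star (a i)) \<in> C"
proof -
  obtain K where K: "\<And>i. norm (a i) \<le> K" using CD(5)[OF a] by blast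
  show ?thesis
  proof (rule CI[of _ K])
    show "star (a i) \<in> N" for i by (rule ND(5)[OF CD(1)[OF a]])
    show "norm (star (a i)) \<le> K" for i using K norm_star[OF CD(3)[OF a]] by simp
    fix \<phi> and e :: real assume \<phi>: "\<phi> \<in> predual M" and e: "e > 0"
    obtain \<psi> where \<psi>: "\<psi> \<in> predual M" "\<And>a. a \<in> M \<Longrightarrow> \<psi> a = cnj (\<phi> (star a))"
      using predual_linear(5)[OF \<phi> SM] by blast
    from C_centralD[OF a \<psi>(1) e]
    show "\<forall>\<^sub>F i in \<omega>. \<forall>X\<in>M. cmod (\<phi> (star (a i) o\<^sub>L X) - \<phi> (X o\<^sub>L star (a i))) \<le> e * norm X"
    proof eventually_elim
      case (elim i)
      show ?case
      proof
        fix X assume X: "X \<in> M"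
        have XB: "X \<in> bounded_ops" by (rule MD(1)[OF X])
        have aB: "a i \<in> bounded_ops" by (rule CD(3)[OF a])
        have e1: "\<phi> (star (a i) o\<^sub>L X) = cnj (\<psi> (star X o\<^sub>L a i))"
          using \<psi>(2)[OF MD(4)[OF MD(5)[OF X] CD(2)[OF a]], of i] XB aB by (simp add: star_compose)
        have e2: "\<phi> (X o\<^sub>L star (a i)) = cnj (\<psi> (a i o\<^sub>L star X))"
          using \<psi>(2)[OF MD(4)[OF CD(2)[OF a] MD(5)[OF X]], of i] XB aB by (simp add: star_compose)
        have "cmod (\<phi> (star (a i) o\<^sub>L X) - \<phi> (X o\<^sub>L star (a i))) = cmod (\<psi> (star X o\<^sub>L a i) - \<psi> (a i o\<^sub>L star X))"
          unfolding e1 e2 by (metis complex_cnj_diff complex_mod_cnj)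
        also have "\<dots> \<le> e * norm (star X)" using elim MD(5)[OF X] by (simp add: norm_minus_commute)
        finally show "cmod (\<phi> (star (a i) o\<^sub>L X) - \<phi> (X o\<^sub>L star (a i))) \<le> e * norm X" by (simp add: norm_star[OF XB])
      qed
    qed
  qed
qed

lemma C_scaleR:
  assumes a: "a \<in> C" shows "(\<lambda>i. r *\<^sub>R a i) \<in> C"
proof -
  have "(\<lambda>i. r *\<^sub>R id_blinfun) \<in> C"
  proof (rule CI[of _ "\<bar>r\<bar> * 1"])
    show "norm (r *\<^sub>R id_blinfun :: 'h op) \<le> \<bar>r\<bar> * 1"
      unfolding norm_scaleR by (intro mult_left_mono norm_blinfun_id_le) simp
    have "(r *\<^sub>R id_blinfun) o\<^sub>L X = X o\<^sub>L (r *\<^sub>R id_blinfun)" for X :: "'h op"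
      by (rule blinfun_eqI) (simp add: blinfun.bilinear_simps)
    then show "e > 0 \<Longrightarrow> \<forall>\<^sub>F i in \<omega>. \<forall>X\<in>M. cmod (\<phi> (r *\<^sub>R id_blinfun o\<^sub>L X) - \<phi> (X o\<^sub>L r *\<^sub>R id_blinfun)) \<le> e * norm X" for \<phi> :: "'h op \<Rightarrow> complex" and e
      by simp
  qed (rule ND(7)[OF ND(2)])
  from C_compose[OF this a] show ?thesis
    by (rule back_subst[where P = "\<lambda>f. f \<in> C"]) (auto intro!: blinfun_eqI simp: blinfun.bilinear_simps)
qed

lemma C_diff: "a \<in> C \<Longrightarrow> b \<in> C \<Longrightarrow> (\<lambda>i. a i - b i) \<in> C"
  using C_add[OF _ C_scaleR[of b "-1"], of a] by simp

text \<open>The error \<open>d n\<close> is the same for all entries, so a single \<open>b n\<close>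
  serves the whole sequence. The application is to iterated square roots.\<close>

lemma C_uniform_limit:
  assumes a: "\<And>i. a i \<in> N" and b: "\<And>n. b n \<in> C" and lim: "\<And>n i. norm (a i - b n i) \<le> d n" and d: "d \<longlonglongrightarrow> 0"
  shows "a \<in> C"
proof -
  obtain K where K: "\<And>i. norm (b 0 i) \<le> K" using CD(5)[OF b[of 0]] by blast
  show ?thesis
  proof (rule CI[of _ "d 0 + K"])
    show "a i \<in> N" for i by (rule a)
    show "norm (a i) \<le> d 0 + K" for i using norm_triangle_sub[of "a i" "b 0 i"] lim[of i 0] K[of i] by linarith
    fix \<phi> and e :: real assume \<phi>: "\<phi> \<in> predual M" and e: "e > 0"
    obtain L where L: "L \<ge> 0" "\<And>a. a \<in> M \<Longrightarrow> cmod (\<phi> a) \<le> L * norm a" using predual_bounded[OF \<phi>] by blast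
    have "\<forall>\<^sub>F n in sequentially. d n < e / (4 * (L + 1))" using d e L by (intro order_tendstoD(2)) auto
    then obtain n where n: "d n < e / (4 * (L + 1))" by (auto simp: eventually_sequentially)
    have dn: "0 \<le> d n" using lim[of 0 n] norm_ge_zero order_trans by blast
    have Ld: "L * d n \<le> e / 4"
    proof -
      have "L * d n \<le> (L + 1) * d n" using dn by (simp add: algebra_simps)
      also have "\<dots> \<le> (L + 1) * (e / (4 * (L + 1)))" using n L by (intro mult_left_mono) auto
      also have "\<dots> = e / 4" using L by (simp add: field_simps)
      finally show ?thesis .
    qed
    from C_centralD[OF b[of n] \<phi> half_gt_zero[OF e]]
    show "\<forall>\<^sub>F i in \<omega>. \<forall>X\<in>M. cmod (\<phi> (a i o\<^sub>L X) - \<phi> (X o\<^sub>L a i)) \<le> e * norm X"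
    proof eventually_elim
      case (elim i)
      show ?case
      proof
        fix X assume X: "X \<in> M"
        let ?w = "a i - b n i"
        have wM: "?w \<in> M" by (rule NMD[OF ND(10)[OF a CD(1)[OF b]]])
        note m = MD(4)[OF wM X] MD(4)[OF CD(2)[OF b] X, of n i] MD(4)[OF X wM] MD(4)[OF X CD(2)[OF b], of n i]
        have n1: "norm (?w o\<^sub>L X) \<le> d n * norm X" "norm (X o\<^sub>L ?w) \<le> d n * norm X"
          using norm_blinfun_compose[of ?w X] norm_blinfun_compose[of X ?w] mult_right_mono[OF lim[of i n] norm_ge_zero[of X]]
          by (simp_all add: mult.commute)
        have s: "cmod (\<phi> (?w o\<^sub>L X)) \<le> e / 4 * norm X" "cmod (\<phi> (X o\<^sub>L ?w)) \<le> e / 4 * norm X"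
          using L(2)[OF m(1)] L(2)[OF m(3)] mult_left_mono[OF n1(1) L(1)] mult_left_mono[OF n1(2) L(1)]
            mult_right_mono[OF Ld norm_ge_zero[of X]] by (simp_all add: mult.assoc)
        have "\<phi> (a i o\<^sub>L X) = \<phi> (?w o\<^sub>L X) + \<phi> (b n i o\<^sub>L X)" "\<phi> (X o\<^sub>L a i) = \<phi> (X o\<^sub>L ?w) + \<phi> (X o\<^sub>L b n i)"
          using predual_linear(1)[OF \<phi> SM m(1,2)] predual_linear(1)[OF \<phi> SM m(3,4)]
          by (simp_all add: compose_diff_left compose_diff_right)
        then have "\<phi> (a i o\<^sub>L X) - \<phi> (X o\<^sub>L a i) = (\<phi> (?w o\<^sub>L X) - \<phi> (X o\<^sub>L ?w)) + (\<phi> (b n i o\<^sub>L X) - \<phi> (X o\<^sub>L b n i))" by simp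
        also have "cmod \<dots> \<le> (e / 4 * norm X + e / 4 * norm X) + e / 2 * norm X"
          by (rule norm_triangle_le[OF add_mono[OF order_trans[OF norm_triangle_ineq4 add_mono[OF s]] elim[rule_format, OF X]]])
        finally show "cmod (\<phi> (a i o\<^sub>L X) - \<phi> (X o\<^sub>L a i)) \<le> e * norm X" by (simp add: algebra_simps)
      qed
    qed
  qed
qed

text \<open>With \<open>r = (1 + a)\<^sup>-\<^sup>1\<close> and \<open>Y = r X r\<close> the commutator \<open>[r, X]\<close> equals \<open>[Y, a]\<close>.\<close>

lemma C_resolvent1:
  assumes a: "a \<in> C" and pa: "\<And>i. pos (a i)"
  shows "(\<lambda>i. resolvent1 (a i)) \<in> C"
proof (rule CI[of _ 1])
  show rN: "resolvent1 (a i) \<in> N" for i by (rule resolvent1_mem[OF pa SN vn_closed[OF N] CD(1)[OF a]])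
  show n1: "norm (resolvent1 (a i)) \<le> 1" for i by (rule norm_resolvent1[OF pa])
  fix \<phi> and e :: real assume \<phi>: "\<phi> \<in> predual M" and e: "e > 0"
  from C_centralD[OF a \<phi> e]
  show "\<forall>\<^sub>F i in \<omega>. \<forall>X\<in>M. cmod (\<phi> (resolvent1 (a i) o\<^sub>L X) - \<phi> (X o\<^sub>L resolvent1 (a i))) \<le> e * norm X"
  proof eventually_elim
    case (elim i)
    show ?case
    proof
      fix X assume X: "X \<in> M"
      let ?r = "resolvent1 (a i)"
      define Y where "Y = ?r o\<^sub>L (X o\<^sub>L ?r)"
      have rM: "?r \<in> M" by (rule NMD[OF rN])
      have YM: "Y \<in> M" unfolding Y_def by (intro MD(4) rM X)
      have aM: "a i \<in> M" by (rule CD(2)[OF a])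
      have "norm Y \<le> norm ?r * (norm X * norm ?r)"
        unfolding Y_def by (rule order_trans[OF norm_blinfun_compose]) (intro mult_left_mono norm_blinfun_compose norm_ge_zero)
      also have "\<dots> \<le> 1 * (norm X * 1)" by (intro mult_mono n1) auto
      finally have nY: "norm Y \<le> norm X" by simp
      have rX: "?r o\<^sub>L X = Y + (Y o\<^sub>L a i)"
      proof (rule blinfun_eqI)
        fix v
        have "v = ?r v + ?r (a i v)" using resolvent1_apply(2)[OF pa, of i v] by (simp add: blinfun.add_right)
        then have "?r (X v) = ?r (X (?r v + ?r (a i v)))" by simp
        then show "(?r o\<^sub>L X) v = (Y + (Y o\<^sub>L a i)) v" by (simp add: Y_def blinfun.bilinear_simps)
      qed
      have Xr: "X o\<^sub>L ?r = Y + (a i o\<^sub>L Y)"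
        by (rule blinfun_eqI) (simp add: Y_def blinfun.add_left resolvent1_apply(1)[OF pa])
      have "\<phi> (?r o\<^sub>L X) - \<phi> (X o\<^sub>L ?r) = \<phi> (Y o\<^sub>L a i) - \<phi> (a i o\<^sub>L Y)"
        unfolding rX Xr using predual_linear(1)[OF \<phi> SM YM MD(4)[OF YM aM]] predual_linear(1)[OF \<phi> SM YM MD(4)[OF aM YM]] by simp
      then have "cmod (\<phi> (?r o\<^sub>L X) - \<phi> (X o\<^sub>L ?r)) \<le> e * norm Y"
        using elim YM by (simp add: norm_minus_commute)
      also have "\<dots> \<le> e * norm X" using nY e by simp
      finally show "cmod (\<phi> (?r o\<^sub>L X) - \<phi> (X o\<^sub>L ?r)) \<le> e * norm X" .
    qed
  qed
qed

lemma C_btrans: "a \<in> C \<Longrightarrow> (\<And>i. pos (a i)) \<Longrightarrow> (\<lambda>i. btrans (a i)) \<in> C"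
  unfolding btrans_def by (intro C_diff C_id C_resolvent1)

lemma C_op_sqrt:
  assumes a: "a \<in> C" and pa: "\<And>i. pos (a i)" and K: "\<And>i. norm (a i) \<le> K" "0 < K"
  shows "(\<lambda>i. op_sqrt K (a i)) \<in> C"
proof (rule C_uniform_limit)
  let ?x = "\<lambda>i. id_blinfun - (1/K) *\<^sub>R a i"
  show "op_sqrt K (a i) \<in> N" for i by (rule op_sqrt_mem[OF pa K SN vn_closed[OF N] CD(1)[OF a]])
  have x: "?x \<in> C" by (intro C_diff C_id C_scaleR a)
  have it: "(\<lambda>i. sqrt_iter (?x i) n) \<in> C" for n
  proof (induction n)
    case 0
    show ?case using C_scaleR[OF C_id, of 0] by simp
  next
    case (Suc n)
    show ?case using C_scaleR[OF C_add[OF x C_compose[OF Suc Suc]], of "1/2"] by (simp del: scaleR_add_right)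
  qed
  show "(\<lambda>i. sqrt K *\<^sub>R (id_blinfun - sqrt_iter (?x i) n)) \<in> C" for n by (intro C_diff C_id C_scaleR it)
  show "norm (op_sqrt K (a i) - sqrt K *\<^sub>R (id_blinfun - sqrt_iter (?x i) n)) \<le> sqrt K * (1 - sqrt_rate n)" for n i
    by (rule op_sqrt_approx[OF pa K])
  have "(\<lambda>n. sqrt K * (1 - sqrt_rate n)) \<longlonglongrightarrow> sqrt K * (1 - 1)" by (intro tendsto_intros sqrt_rate_lim)
  then show "(\<lambda>n. sqrt K * (1 - sqrt_rate n)) \<longlonglongrightarrow> 0" by simp
qed

subsection \<open>The ideal of null sequences\<close>

lemma ID:
  assumes "x \<in> I"
  shows "x i \<in> N" "x i \<in> M" "x i \<in> bounded_ops" "((\<lambda>i. x i \<xi>) \<longlongrightarrow> 0) \<omega>" "((\<lambda>i. star (x i) \<xi>) \<longlongrightarrow> 0) \<omega>"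
    "\<exists>K>0. \<forall>i. norm (x i) \<le> K"
proof -
  show 1: "x i \<in> N" "((\<lambda>i. x i \<xi>) \<longlongrightarrow> 0) \<omega>" "((\<lambda>i. star (x i) \<xi>) \<longlongrightarrow> 0) \<omega>"
    using assms by (auto simp: I_def null_sequences_def bounded_sequences_def)
  show "x i \<in> M" "x i \<in> bounded_ops" using 1(1) NMD NB by auto
  obtain K where "\<forall>i. norm (x i) \<le> K" using assms by (auto simp: I_def null_sequences_def bounded_sequences_def bounded_iff)
  then show "\<exists>K>0. \<forall>i. norm (x i) \<le> K" by (intro exI[of _ "max K 1"]) (auto intro: order_trans)
qed

lemma II:
  assumes "\<And>i. x i \<in> N" "\<And>i. norm (x i) \<le> K" "\<And>\<xi>. ((\<lambda>i. x i \<xi>) \<longlongrightarrow> 0) \<omega>" "\<And>\<xi>. ((\<lambda>i. star (x i) \<xi>) \<longlongrightarrow> 0) \<omega>"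
  shows "x \<in> I"
  using assms by (auto simp: I_def null_sequences_def bounded_sequences_def bounded_iff)

lemma I_add: assumes x: "x \<in> I" and y: "y \<in> I" shows "(\<lambda>i. x i + y i) \<in> I"
proof -
  obtain Kx Ky where K: "\<And>i. norm (x i) \<le> Kx" "\<And>i. norm (y i) \<le> Ky" using ID(6)[OF x] ID(6)[OF y] by blast
  show ?thesis
  proof (rule II[of _ "Kx + Ky"])
    show "x i + y i \<in> N" for i by (rule ND(3)[OF ID(1)[OF x] ID(1)[OF y]])
    show "norm (x i + y i) \<le> Kx + Ky" for i by (rule norm_triangle_le[OF add_mono[OF K]])
    show "((\<lambda>i. (x i + y i) \<xi>) \<longlongrightarrow> 0) \<omega>" for \<xi>
      using tendsto_add[OF ID(4)[OF x] ID(4)[OF y], of \<xi> \<xi>] by (simp add: blinfun.add_left)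
    show "((\<lambda>i. star (x i + y i) \<xi>) \<longlongrightarrow> 0) \<omega>" for \<xi>
      using tendsto_add[OF ID(5)[OF x] ID(5)[OF y], of \<xi> \<xi>] by (simp add: star_add ID(3)[OF x] ID(3)[OF y] blinfun.add_left)
  qed
qed

lemma I_star: assumes x: "x \<in> I" shows "(\<lambda>i. star (x i)) \<in> I"
proof -
  obtain K where K: "\<And>i. norm (x i) \<le> K" using ID(6)[OF x] by blast
  show ?thesis
    by (rule II[of _ K]) (use ND(5)[OF ID(1)[OF x]] K ID(3)[OF x] ID(4,5)[OF x] in \<open>auto simp: norm_star\<close>)
qed

lemma I_scaleR: assumes x: "x \<in> I" shows "(\<lambda>i. r *\<^sub>R x i) \<in> I"
proof -
  obtain K where K: "\<And>i. norm (x i) \<le> K" using ID(6)[OF x] by blast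
  show ?thesis
  proof (rule II[of _ "\<bar>r\<bar> * K"])
    show "r *\<^sub>R x i \<in> N" for i by (rule ND(7)[OF ID(1)[OF x]])
    show "norm (r *\<^sub>R x i) \<le> \<bar>r\<bar> * K" for i using K[of i] by (simp add: mult_left_mono)
    show "((\<lambda>i. (r *\<^sub>R x i) \<xi>) \<longlongrightarrow> 0) \<omega>" for \<xi>
      using tendsto_scaleR[OF tendsto_const ID(4)[OF x], of r \<xi>] by (simp add: blinfun.scaleR_left)
    show "((\<lambda>i. star (r *\<^sub>R x i) \<xi>) \<longlongrightarrow> 0) \<omega>" for \<xi>
      using tendsto_scaleR[OF tendsto_const ID(5)[OF x], of r \<xi>] by (simp add: star_scaleR[OF ID(3)[OF x]] blinfun.scaleR_left)
  qed
qed

lemma I_diff: "x \<in> I \<Longrightarrow> y \<in> I \<Longrightarrow> (\<lambda>i. x i - y i) \<in> I"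
  using I_add[OF _ I_scaleR[of y "-1"], of x] by simp

lemma tendsto_zero_bounded_apply:
  fixes f :: "nat \<Rightarrow> 'k::real_normed_vector \<Rightarrow>\<^sub>L 'l::real_normed_vector"
  assumes "\<And>i. norm (f i) \<le> K" "(g \<longlongrightarrow> 0) \<omega>"
  shows "((\<lambda>i. f i (g i)) \<longlongrightarrow> 0) \<omega>"
proof (rule Lim_null_comparison)
  show "\<forall>\<^sub>F i in \<omega>. norm (f i (g i)) \<le> K * norm (g i)"
    by (intro always_eventually allI order_trans[OF norm_blinfun] mult_right_mono assms(1) norm_ge_zero)
  show "((\<lambda>i. K * norm (g i)) \<longlongrightarrow> 0) \<omega>"
    using tendsto_mult[OF tendsto_const tendsto_norm[OF assms(2)], of K] by simp
qed

text \<open>The difficulty is that the vector \<open>a i \<xi>\<close> varies with \<open>i\<close>.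
  The squared norm of \<open>x i (a i \<xi>)\<close> is the form of \<open>star (a i)\<close>
  composed with \<open>X = star x x a\<close> at \<open>\<xi>\<close>; centrality moves
  \<open>star (a i)\<close> to the right of \<open>X\<close>, after which \<open>x i \<xi>\<close>
  appears as a factor and tends to 0.\<close>

lemma I_C:
  assumes x: "x \<in> I" and a: "a \<in> C" shows "(\<lambda>i. x i o\<^sub>L a i) \<in> I"
proof -
  obtain Kx Ka where K: "\<And>i. norm (x i) \<le> Kx" "\<And>i. norm (a i) \<le> Ka" "Kx > 0" "Ka > 0"
    using ID(6)[OF x] CD(5)[OF a] by blast
  have nxa: "norm (x i o\<^sub>L a i) \<le> Kx * Ka" for i
    by (rule order_trans[OF norm_blinfun_compose mult_mono]) (use K in \<open>auto simp: less_imp_le\<close>)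
  show ?thesis
  proof (rule II[of _ "Kx * Ka"])
    show "x i o\<^sub>L a i \<in> N" for i by (rule ND(4)[OF ID(1)[OF x] CD(1)[OF a]])
    show "norm (x i o\<^sub>L a i) \<le> Kx * Ka" for i by (rule nxa)
    show "((\<lambda>i. star (x i o\<^sub>L a i) \<xi>) \<longlongrightarrow> 0) \<omega>" for \<xi>
      using tendsto_zero_bounded_apply[of "\<lambda>i. star (a i)" Ka, OF _ ID(5)[OF x, of \<xi>]] K(2)
      by (simp add: star_compose ID(3)[OF x] CD(3)[OF a] norm_star)
    fix \<xi>
    show "((\<lambda>i. (x i o\<^sub>L a i) \<xi>) \<longlongrightarrow> 0) \<omega>"
    proof (rule tendstoI)
      fix e :: real assume e: "e > 0"
      define L where "L = Kx * (Kx * Ka)"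
      have L: "L > 0" using K by (simp add: L_def)
      define B where "B = Kx * (Ka * (Ka * norm \<xi>)) + 1"
      have B: "B > 0" using K by (simp add: B_def add_nonneg_pos)
      have 1: "\<forall>\<^sub>F i in \<omega>. \<forall>X\<in>M. \<bar>inner (star (a i) (blinfun_apply X \<xi>)) \<xi> - inner (blinfun_apply X (star (a i) \<xi>)) \<xi>\<bar> \<le> (e\<^sup>2 / (2 * L)) * norm X"
        by (rule C_inner_central[OF C_star[OF a]]) (use e L in simp)
      have 2: "\<forall>\<^sub>F i in \<omega>. dist (x i \<xi>) 0 < e\<^sup>2 / (2 * B)"
        by (rule tendstoD[OF ID(4)[OF x]]) (use e B in simp)
      from 1 2 show "\<forall>\<^sub>F i in \<omega>. dist ((x i o\<^sub>L a i) \<xi>) 0 < e"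
      proof eventually_elim
        case (elim i)
        define X where "X = star (x i) o\<^sub>L (x i o\<^sub>L a i)"
        have xB: "x i \<in> bounded_ops" and aB: "a i \<in> bounded_ops" using ID(3)[OF x] CD(3)[OF a] .
        have XM: "X \<in> M" unfolding X_def by (intro MD(4) MD(5) ID(2)[OF x] CD(2)[OF a])
        have nX: "norm X \<le> L" unfolding X_def L_def
          by (rule order_trans[OF norm_blinfun_compose mult_mono]) (use K nxa in \<open>auto simp: less_imp_le norm_star[OF xB]\<close>)
        have "(norm (x i (a i \<xi>)))\<^sup>2 = inner (star (a i) (X \<xi>)) \<xi>"
          by (simp add: X_def star_inner_left[OF aB] star_inner_left[OF xB] power2_norm_eq_inner)
        also have "\<dots> \<le> inner (X (star (a i) \<xi>)) \<xi> + (e\<^sup>2 / (2 * L)) * norm X"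
          using elim(1) XM by (force simp: abs_le_iff)
        also have "(e\<^sup>2 / (2 * L)) * norm X \<le> (e\<^sup>2 / (2 * L)) * L" using nX L by (intro mult_left_mono) auto
        also have "\<dots> = e\<^sup>2 / 2" using L by simp
        also have "inner (X (star (a i) \<xi>)) \<xi> = inner (x i (a i (star (a i) \<xi>))) (x i \<xi>)"
          by (simp add: X_def star_inner_left[OF xB])
        also have "\<dots> \<le> norm (x i (a i (star (a i) \<xi>))) * norm (x i \<xi>)" by (rule norm_cauchy_schwarz)
        also have "\<dots> \<le> B * norm (x i \<xi>)"
        proof (rule mult_right_mono)
          have "norm (x i (a i (star (a i) \<xi>))) \<le> Kx * norm (a i (star (a i) \<xi>))"
            by (rule order_trans[OF norm_blinfun mult_right_mono[OF K(1)]]) simp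
          also have "\<dots> \<le> Kx * (Ka * norm (star (a i) \<xi>))"
            using K by (intro mult_left_mono order_trans[OF norm_blinfun mult_right_mono[OF K(2)]]) auto
          also have "\<dots> \<le> Kx * (Ka * (Ka * norm \<xi>))"
            using K norm_blinfun[of "star (a i)" \<xi>] mult_right_mono[OF K(2)[of i] norm_ge_zero[of \<xi>]]
            by (intro mult_left_mono) (auto simp: norm_star[OF aB])
          finally show "norm (x i (a i (star (a i) \<xi>))) \<le> B" by (simp add: B_def)
        qed simp
        also have "B * norm (x i \<xi>) < B * (e\<^sup>2 / (2 * B))" using elim(2) B by (intro mult_strict_left_mono) auto
        also have "\<dots> = e\<^sup>2 / 2" using B by simp
        finally have "(norm (x i (a i \<xi>)))\<^sup>2 < e\<^sup>2" by simp
        then show ?case using e by (simp add: power2_less_imp_less)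
      qed
    qed
  qed
qed

lemma C_I:
  assumes x: "x \<in> I" and a: "a \<in> C" shows "(\<lambda>i. a i o\<^sub>L x i) \<in> I"
  using I_star[OF I_C[OF I_star[OF x] C_star[OF a]]]
  by (simp add: star_compose ID(3)[OF x] CD(3)[OF a])

subsection \<open>Positivity modulo null sequences\<close>

definition qpos :: "(nat \<Rightarrow> 'h op) \<Rightarrow> bool" where
  "qpos u \<longleftrightarrow> (\<exists>c\<in>C. (\<lambda>i. u i - (star (c i) o\<^sub>L c i)) \<in> I)"

lemma q_le_iff: "q_le C I x y \<longleftrightarrow> qpos (\<lambda>i. y i - x i)"
  by (simp add: q_le_def qpos_def)

lemma qpos_exact:
  assumes a: "a \<in> C" and p: "\<And>i. pos (a i)" shows "qpos a"
proof -
  obtain K where K: "K > 0" "\<And>i. norm (a i) \<le> K" using CD(5)[OF a] by blast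
  have "star (op_sqrt K (a i)) o\<^sub>L op_sqrt K (a i) = a i" for i
    using posD(2)[OF op_sqrt_pos[OF p K(2,1)]] op_sqrt_square[OF p K(2,1)] by simp
  moreover have "(\<lambda>i. 0) \<in> I" by (rule II[of _ 0]) (auto simp: ND(8))
  ultimately show ?thesis unfolding qpos_def using C_op_sqrt[OF a p K(2,1)] by (intro bexI) auto
qed

lemma qpos_I_add:
  assumes u: "qpos u" and x: "(\<lambda>i. v i - u i) \<in> I" shows "qpos v"
proof -
  obtain c where c: "c \<in> C" "(\<lambda>i. u i - (star (c i) o\<^sub>L c i)) \<in> I" using u by (auto simp: qpos_def)
  show ?thesis unfolding qpos_def using I_add[OF c(2) x] c(1) by (intro bexI[of _ c]) (auto simp: algebra_simps)
qed

lemma rep_null: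
  assumes \<rho>: "normal_rep \<zeta> M \<rho>" and x: "x \<in> I"
  shows "((\<lambda>i. \<rho> (x i) \<xi>) \<longlongrightarrow> 0) \<omega>"
proof -
  obtain K where K: "\<And>i. norm (x i) \<le> K" using ID(6)[OF x] by blast
  show ?thesis
    by (rule normal_on_tendsto_zero[OF normal_repD(1)[OF \<rho> SM] SM normal_repD(9)[OF \<rho> SM] ID(2)[OF x] K
          amp_tendsto_zero[OF K ID(4)[OF x]]])
qed

lemma rep_null_inner:
  assumes \<rho>: "normal_rep \<zeta> M \<rho>" and x: "x \<in> I" and \<eta>: "\<And>i. norm (\<eta> i) \<le> L"
  shows "((\<lambda>i. inner (\<rho> (x i) \<xi>) (\<eta> i)) \<longlongrightarrow> 0) \<omega>"
proof (rule Lim_null_comparison)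
  have "norm (inner (\<rho> (x i) \<xi>) (\<eta> i)) \<le> norm (\<rho> (x i) \<xi>) * L" for i
    using order_trans[OF Cauchy_Schwarz_ineq2 mult_left_mono[OF \<eta> norm_ge_zero]] by simp
  then show "\<forall>\<^sub>F i in \<omega>. norm (inner (\<rho> (x i) \<xi>) (\<eta> i)) \<le> norm (\<rho> (x i) \<xi>) * L"
    by (intro always_eventually allI)
  show "((\<lambda>i. norm (\<rho> (x i) \<xi>) * L) \<longlongrightarrow> 0) \<omega>"
    using tendsto_mult[OF tendsto_norm[OF rep_null[OF \<rho> x]] tendsto_const, of \<xi> L] by simp
qed

lemma rep_pos:
  assumes \<rho>: "normal_rep \<zeta> M \<rho>" and a: "a \<in> M" "pos a" shows "pos (\<rho> a)"
proof -
  note D = normal_repD[OF \<rho> SM]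
  define s where "s = op_sqrt (norm a + 1) a"
  have K: "norm a \<le> norm a + 1" "0 < norm a + 1" by (auto simp: add_nonneg_pos)
  have s: "s \<in> M" "s o\<^sub>L s = a" "star s = s"
    unfolding s_def using op_sqrt_mem[OF a(2) K SM vn_closed[OF M] a(1)] op_sqrt_square[OF a(2) K]
      posD(2)[OF op_sqrt_pos[OF a(2) K]] by auto
  have "\<rho> a = star (\<rho> s) o\<^sub>L \<rho> s" using D(7)[OF s(1,1)] D(4)[OF s(1)] s by simp
  then show ?thesis using pos_star_compose[OF D(2)[OF s(1)]] by simp
qed

lemma rep_star_square:
  assumes \<rho>: "normal_rep \<zeta> M \<rho>" and c: "c \<in> M"
  shows "inner (\<rho> (star c o\<^sub>L c) v) w = inner (\<rho> c v) (\<rho> c w)"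
proof -
  note D = normal_repD[OF \<rho> SM]
  show ?thesis using D(7)[OF MD(5)[OF c] c] D(4)[OF c] star_inner_left[OF D(2)[OF c]] by simp
qed

text \<open>Positivity is tested on vectors moving with \<open>i\<close>. The null part of
  \<open>u\<close> remains negligible there, because its product with the central sequence
  \<open>b\<close> is null again.\<close>

lemma qpos_ge:
  assumes \<rho>: "normal_rep \<zeta> M \<rho>" and u: "qpos u" and b: "b \<in> C" and e: "e > 0"
  shows "\<forall>\<^sub>F i in \<omega>. - e < inner (\<rho> (u i) (\<rho> (b i) \<xi>)) (\<rho> (b i) \<xi>)"
proof -
  note D = normal_repD[OF \<rho> SM]
  obtain c where c: "c \<in> C" "(\<lambda>i. u i - (star (c i) o\<^sub>L c i)) \<in> I" using u by (auto simp: qpos_def)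
  define n where "n i = u i - (star (c i) o\<^sub>L c i)" for i
  have nI: "n \<in> I" using c(2) by (simp add: n_def[abs_def])
  obtain K where K: "\<And>i. norm (b i) \<le> K" "K > 0" using CD(5)[OF b] by blast
  have "((\<lambda>i. inner (\<rho> (n i o\<^sub>L b i) \<xi>) (\<rho> (b i) \<xi>)) \<longlongrightarrow> 0) \<omega>"
    by (rule rep_null_inner[OF \<rho> I_C[OF nI b], of _ "K * norm \<xi>"])
      (rule order_trans[OF D(11)[OF CD(2)[OF b]] mult_right_mono[OF K(1)]], simp)
  then have "\<forall>\<^sub>F i in \<omega>. - e < inner (\<rho> (n i o\<^sub>L b i) \<xi>) (\<rho> (b i) \<xi>)" using e by (intro order_tendstoD(1)) auto
  then show ?thesis
  proof eventually_elim
    case (elim i)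
    let ?v = "\<rho> (b i) \<xi>"
    have cc: "star (c i) o\<^sub>L c i \<in> M" by (intro MD(4) MD(5) CD(2)[OF c(1)])
    have "u i = n i + (star (c i) o\<^sub>L c i)" by (simp add: n_def)
    then have "\<rho> (u i) = \<rho> (n i) + \<rho> (star (c i) o\<^sub>L c i)" using D(6)[OF ID(2)[OF nI] cc] by simp
    then have "inner (\<rho> (u i) ?v) ?v = inner (\<rho> (n i) ?v) ?v + inner (\<rho> (c i) ?v) (\<rho> (c i) ?v)"
      by (simp add: blinfun.add_left inner_add_left rep_star_square[OF \<rho> CD(2)[OF c(1)]])
    moreover have "\<rho> (n i) ?v = \<rho> (n i o\<^sub>L b i) \<xi>" using D(7)[OF ID(2)[OF nI] CD(2)[OF b]] by simp
    ultimately have "inner (\<rho> (u i) ?v) ?v = inner (\<rho> (n i o\<^sub>L b i) \<xi>) ?v + inner (\<rho> (c i) ?v) (\<rho> (c i) ?v)"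
      by simp
    then show ?case using elim inner_ge_zero[of "\<rho> (c i) ?v"] by linarith
  qed
qed

lemma normal_rep_id: "normal_rep \<zeta> M (\<lambda>a. a)"
  using identity_normal[OF ultra M sep] MD(1) by (auto simp: normal_rep_def)

lemma normal_rep_amp: "normal_rep \<zeta> M (amp :: 'h op \<Rightarrow> (nat, 'h) ell2 op)"
proof -
  have "normal_on \<zeta> M (amp :: 'h op \<Rightarrow> (nat, 'h) ell2 op)"
  proof (rule normal_onI)
    fix f :: "nat \<Rightarrow> 'h op" and \<xi> :: "(nat, 'h) ell2"
    assume f: "\<And>n. f n \<in> M" "\<And>n. norm (f n) \<le> 1" "(\<lambda>n. amp (f n) \<zeta>) \<longlonglongrightarrow> 0"
    show "(\<lambda>n. amp (f n) \<xi>) \<longlonglongrightarrow> 0"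
      by (rule amp_tendsto_zero[OF f(2)])
        (rule normal_on_tendsto_zero[OF normal_repD(1)[OF normal_rep_id SM] SM _ f], rule refl)
  qed
  then show ?thesis using MD(1) by (auto simp: normal_rep_def norm_amp star_amp amp_cscale amp_add amp_compose)
qed

lemma normal_rep_pi: "normal_rep \<zeta> M pi_rep"
  using pi_normal by (auto simp: normal_rep_def pi_bounded_ops norm_pi pi_star pi_cscale pi_add pi_compose pi_id)

text \<open>The negative part \<open>v\<close> of \<open>u\<close> satisfies \<open>v u v = - v\<^sup>3\<close>, which forces it to be a null sequence.\<close>

lemma qposI:
  assumes u: "u \<in> C" "\<And>i. star (u i) = u i"
    and ge: "\<And>b h e. b \<in> C \<Longrightarrow> e > 0 \<Longrightarrow> \<forall>\<^sub>F i in \<omega>. - e \<le> inner (u i (b i h)) (b i h)"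
  shows "qpos u"
proof -
  obtain K where K: "K > 0" "\<And>i. norm (u i) \<le> K" using CD(5)[OF u(1)] by blast
  note uB = CD(3)[OF u(1)]
  define s where "s i = op_sqrt (K\<^sup>2) (u i o\<^sub>L u i)" for i
  have uu: "pos (u i o\<^sub>L u i)" for i by (rule pos_square[OF uB u(2)])
  have nuu: "norm (u i o\<^sub>L u i) \<le> K\<^sup>2" "0 < K\<^sup>2" for i
    using order_trans[OF norm_blinfun_compose mult_mono[OF K(2) K(2)]] K(1) by (auto simp: power2_eq_square)
  have sC: "s \<in> C" unfolding s_def by (rule C_op_sqrt[OF C_compose[OF u(1) u(1)] uu nuu])
  have ss: "s i o\<^sub>L s i = u i o\<^sub>L u i" and us: "u i o\<^sub>L s i = s i o\<^sub>L u i" for i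
    unfolding s_def by (rule op_sqrt_square[OF uu nuu], rule op_sqrt_commute[OF uu nuu]) (simp add: compose_assoc)
  \<comment> \<open>With \<open>s\<close> as the absolute value of \<open>u\<close>, these are its
    negative and positive parts, again given by central sequences.\<close>
  define v where "v i = (1/2) *\<^sub>R (s i - u i)" for i
  define p where "p i = (1/2) *\<^sub>R (s i + u i)" for i
  have vC: "v \<in> C" unfolding v_def by (intro C_scaleR C_diff sC u)
  have pC: "p \<in> C" unfolding p_def by (intro C_scaleR C_add sC u)
  have pp: "pos (p i)" for i unfolding p_def s_def by (intro pos_scaleR op_sqrt_abs(2)[OF uB u(2) K(2,1)]) simp
  have pv: "pos (v i)" for i unfolding v_def s_def by (intro pos_scaleR op_sqrt_abs(1)[OF uB u(2) K(2,1)]) simp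
  have upv: "u i = p i - v i" for i by (rule blinfun_eqI)
      (simp add: p_def v_def blinfun.bilinear_simps scaleR_add_right scaleR_diff_right flip: scaleR_add_left)
  have uv: "u i (v i h) = - v i (v i h)" for i h
  proof -
    have "s i (s i h) = u i (u i h)" "u i (s i h) = s i (u i h)"
      using arg_cong[OF ss, of "\<lambda>T. blinfun_apply T h"] arg_cong[OF us, of "\<lambda>T. blinfun_apply T h"] by simp_all
    then have k': "2 *\<^sub>R (u i (s i h - u i h)) = - (s i (s i h - u i h) - u i (s i h - u i h))"
      by (simp add: blinfun.bilinear_simps scaleR_2 algebra_simps)
    define x where "x = s i h - u i h"
    note k = k'[folded x_def]
    have va: "v i w = (1/2) *\<^sub>R (s i w - u i w)" for w by (simp add: v_def blinfun.scaleR_left blinfun.diff_left)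
    have vh: "v i h = (1/2) *\<^sub>R x" by (simp add: va x_def)
    have "u i (v i h) = (1/4) *\<^sub>R (2 *\<^sub>R (u i x))" by (simp add: vh blinfun.scaleR_right)
    also have "\<dots> = - ((1/4) *\<^sub>R (s i x - u i x))" by (simp only: k scaleR_minus_right)
    also have "(1/4) *\<^sub>R (s i x - u i x) = v i (v i h)"
      by (simp add: vh blinfun.scaleR_right) (simp add: va)
    finally show ?thesis .
  qed
  obtain Kv where Kv: "Kv > 0" "\<And>i. norm (v i) \<le> Kv" using CD(5)[OF vC] by blast
  have v0: "((\<lambda>i. v i h) \<longlongrightarrow> 0) \<omega>" for h
  proof (rule tendstoI)
    fix e :: real assume e: "e > 0"
    \<comment> \<open>\<open>L\<close> bounds \<open>inner (v i h) h\<close>; the added 1 keeps it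
      positive. The fourth power of \<open>e\<close> below stems from Cauchy-Schwarz for the form of
      \<open>v\<close>, which estimates the fourth power of \<open>norm (v i h)\<close>.\<close>
    define L where "L = Kv * (norm h)\<^sup>2 + 1"
    have L: "L > 0" using Kv by (simp add: L_def add_nonneg_pos)
    have "\<forall>\<^sub>F i in \<omega>. - (e^4 / (2 * L)) \<le> inner (u i (v i h)) (v i h)" by (rule ge[OF vC]) (use e L in simp)
    then show "\<forall>\<^sub>F i in \<omega>. dist (v i h) 0 < e"
    proof eventually_elim
      case (elim i)
      have sm: "inner (v i (v i h)) (v i h) \<le> e^4 / (2 * L)" using elim by (simp add: uv)
      have "inner (v i h) h \<le> norm (v i) * norm h * norm h" using abs_inner_op_le[of "v i" h h] by simp
      also have "\<dots> \<le> Kv * norm h * norm h" by (intro mult_right_mono Kv) auto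
      finally have le: "inner (v i h) h \<le> L" by (simp add: L_def power2_eq_square)
      have "((norm (v i h))\<^sup>2)\<^sup>2 \<le> inner (v i h) h * inner (v i (v i h)) (v i h)"
        using pos_Cauchy_Schwarz[OF pv, of i h "v i h"] by (simp add: power2_norm_eq_inner)
      also have "\<dots> \<le> L * (e^4 / (2 * L))" by (rule mult_mono[OF le sm]) (use L posD(3)[OF pv] in auto)
      also have "\<dots> < e^4" using L e by simp
      finally have "(norm (v i h))^4 < e^4" by (simp flip: power_mult)
      then show ?case using e by (auto intro: power_less_imp_less_base)
    qed
  qed
  have "v \<in> I" by (rule II[OF CD(1)[OF vC] Kv(2) v0]) (simp add: posD(2)[OF pv] v0)
  then have "(\<lambda>i. u i - p i) \<in> I" using I_scaleR[of v "-1"] by (simp add: upv)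
  then show ?thesis by (rule qpos_I_add[OF qpos_exact[OF pC pp]])
qed

lemma inner_half_le: "inner x y \<le> ((norm x)\<^sup>2 + (norm (y::'k::real_inner))\<^sup>2) / 2"
proof -
  have "0 \<le> inner (x - y) (x - y)" by simp
  then show ?thesis by (simp add: power2_norm_eq_inner inner_diff_left inner_diff_right inner_commute)
qed

text \<open>The square of an element between 0 and 1 is at most the element, but here positivity
  holds only modulo null sequences. Writing \<open>u\<close> as a null sequence \<open>n\<close>
  plus \<open>star c c\<close> and using the mean inequality for \<open>c\<close> leaves error terms
  that all contain \<open>n\<close>. This converts a small value of a form into a small
  norm.\<close>

lemma qpos_square_le:
  assumes \<rho>: "normal_rep \<zeta> M \<rho>" and u: "u \<in> C" and u1: "\<And>i. pos (id_blinfun - u i)"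
    and q: "qpos u" and e: "e > 0"
  shows "\<forall>\<^sub>F i in \<omega>. (norm (\<rho> (u i) \<xi>))\<^sup>2 \<le> inner (\<rho> (u i) \<xi>) \<xi> + e"
proof -
  note D = normal_repD[OF \<rho> SM]
  obtain c where c: "c \<in> C" "(\<lambda>i. u i - (star (c i) o\<^sub>L c i)) \<in> I" using q by (auto simp: qpos_def)
  define n where "n i = u i - (star (c i) o\<^sub>L c i)" for i
  have nI: "n \<in> I" using c(2) by (simp add: n_def[abs_def])
  obtain K where K: "\<And>i. norm (u i) \<le> K" "K > 0" using CD(5)[OF u] by blast
  have nv: "norm (\<rho> (u i) \<xi>) \<le> K * norm \<xi>" for i
    by (rule order_trans[OF D(11)[OF CD(2)[OF u]] mult_right_mono[OF K(1)]]) simp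
  have s1: "((\<lambda>i. inner (\<rho> (n i) \<xi>) (\<rho> (u i) \<xi>)) \<longlongrightarrow> 0) \<omega>" by (rule rep_null_inner[OF \<rho> nI nv])
  have s2: "((\<lambda>i. inner (\<rho> (n i) \<xi>) \<xi>) \<longlongrightarrow> 0) \<omega>" by (rule rep_null_inner[OF \<rho> nI, of _ "norm \<xi>"]) simp
  have s3: "((\<lambda>i. inner (\<rho> (n i o\<^sub>L u i) \<xi>) (\<rho> (u i) \<xi>)) \<longlongrightarrow> 0) \<omega>" by (rule rep_null_inner[OF \<rho> I_C[OF nI u] nv])
  have "((\<lambda>i. 2 * inner (\<rho> (n i) \<xi>) (\<rho> (u i) \<xi>) - inner (\<rho> (n i) \<xi>) \<xi> - inner (\<rho> (n i o\<^sub>L u i) \<xi>) (\<rho> (u i) \<xi>)) \<longlongrightarrow> 2 * 0 - 0 - 0) \<omega>"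
    by (intro tendsto_intros s1 s2 s3)
  then have "\<forall>\<^sub>F i in \<omega>. 2 * inner (\<rho> (n i) \<xi>) (\<rho> (u i) \<xi>) - inner (\<rho> (n i) \<xi>) \<xi> - inner (\<rho> (n i o\<^sub>L u i) \<xi>) (\<rho> (u i) \<xi>) < e"
    using e by (intro order_tendstoD(2)) auto
  then show ?thesis
  proof eventually_elim
    case (elim i)
    define v where "v = \<rho> (u i) \<xi>"
    have cM: "c i \<in> M" by (rule CD(2)[OF c(1)])
    have cc: "star (c i) o\<^sub>L c i \<in> M" by (intro MD(4) MD(5) cM)
    have "u i = n i + (star (c i) o\<^sub>L c i)" by (simp add: n_def)
    then have ru: "\<rho> (u i) = \<rho> (n i) + \<rho> (star (c i) o\<^sub>L c i)" using D(6)[OF ID(2)[OF nI] cc] by simp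
    have dec: "inner (\<rho> (u i) x) y = inner (\<rho> (n i) x) y + inner (\<rho> (c i) x) (\<rho> (c i) y)" for x y
      by (simp add: ru blinfun.add_left inner_add_left rep_star_square[OF \<rho> cM])
    have nu: "\<rho> (n i) v = \<rho> (n i o\<^sub>L u i) \<xi>" using D(7)[OF ID(2)[OF nI] CD(2)[OF u]] by (simp add: v_def)
    have "pos (\<rho> (id_blinfun - u i))" by (rule rep_pos[OF \<rho> MD(10)[OF MD(2) CD(2)[OF u]] u1])
    then have "pos (id_blinfun - \<rho> (u i))" using D(10)[OF MD(2) CD(2)[OF u]] D(8) by simp
    from pos_inner_mono[OF this, of v] have uv: "inner (\<rho> (u i) v) v \<le> (norm v)\<^sup>2" by (simp add: power2_norm_eq_inner)
    have h1: "(norm v)\<^sup>2 = inner (\<rho> (n i) \<xi>) v + inner (\<rho> (c i) \<xi>) (\<rho> (c i) v)"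
      using dec[of \<xi> v] by (simp add: v_def power2_norm_eq_inner)
    have h2: "inner (\<rho> (c i) \<xi>) (\<rho> (c i) v) \<le> ((norm (\<rho> (c i) \<xi>))\<^sup>2 + (norm (\<rho> (c i) v))\<^sup>2) / 2" by (rule inner_half_le)
    have h3: "(norm (\<rho> (c i) \<xi>))\<^sup>2 = inner v \<xi> - inner (\<rho> (n i) \<xi>) \<xi>"
      using dec[of \<xi> \<xi>] by (simp add: v_def power2_norm_eq_inner)
    have h4: "(norm (\<rho> (c i) v))\<^sup>2 = inner (\<rho> (u i) v) v - inner (\<rho> (n i) v) v"
      using dec[of v v] by (simp add: power2_norm_eq_inner)
    from h1 h2 have "(norm v)\<^sup>2 \<le> inner (\<rho> (n i) \<xi>) v + ((inner v \<xi> - inner (\<rho> (n i) \<xi>) \<xi>) + ((norm v)\<^sup>2 - inner (\<rho> (n i) v) v)) / 2"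
      using uv unfolding h3 h4 by argo
    then have "(norm v)\<^sup>2 \<le> inner v \<xi> + (2 * inner (\<rho> (n i) \<xi>) v - inner (\<rho> (n i) \<xi>) \<xi> - inner (\<rho> (n i) v) v)" by argo
    then show ?case using elim unfolding nu unfolding v_def by linarith
  qed
qed

text \<open>Replace \<open>f\<close> by \<open>k = g + star c c\<close>, which dominates
  \<open>g\<close> exactly. The change is harmless, since the transforms of \<open>f\<close> and
  \<open>k\<close> differ by the null sequence \<open>f - k\<close> between two resolvents.\<close>

lemma btrans_qpos_mono:
  assumes f: "f \<in> C" "\<And>i. pos (f i)" and g: "g \<in> C" "\<And>i. pos (g i)" and q: "qpos (\<lambda>i. f i - g i)"
  shows "qpos (\<lambda>i. btrans (f i) - btrans (g i))"
proof -
  obtain c where c: "c \<in> C" "(\<lambda>i. f i - g i - (star (c i) o\<^sub>L c i)) \<in> I" using q by (auto simp: qpos_def)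
  define k where "k i = g i + (star (c i) o\<^sub>L c i)" for i
  have pc: "pos (star (c i) o\<^sub>L c i)" for i by (rule pos_star_compose[OF CD(3)[OF c(1)]])
  have k: "k \<in> C" "\<And>i. pos (k i)" unfolding k_def
    by (intro C_add g C_compose C_star c) (intro pos_add g pc)
  have "qpos (\<lambda>i. btrans (k i) - btrans (g i))"
    by (intro qpos_exact C_diff C_btrans k g btrans_mono) (simp add: k_def pc)
  then show ?thesis
  proof (rule qpos_I_add)
    have fk: "(\<lambda>i. f i - k i) \<in> I" using c(2) by (simp add: k_def algebra_simps)
    have "btrans (f i) - btrans (k i) = resolvent1 (k i) o\<^sub>L ((f i - k i) o\<^sub>L resolvent1 (f i))" for i
    proof (rule blinfun_eqI)
      fix v
      have 1: "v = resolvent1 (f i) v + f i (resolvent1 (f i) v)" by (simp add: resolvent1_apply f)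
      have 2: "resolvent1 (f i) v = resolvent1 (k i) (resolvent1 (f i) v) + resolvent1 (k i) (k i (resolvent1 (f i) v))"
        using resolvent1_apply(2)[OF k(2), of i "resolvent1 (f i) v"] by (simp add: blinfun.add_right)
      have 3: "resolvent1 (k i) v = resolvent1 (k i) (resolvent1 (f i) v) + resolvent1 (k i) (f i (resolvent1 (f i) v))"
        using arg_cong[OF 1, of "blinfun_apply (resolvent1 (k i))"] by (simp add: blinfun.add_right)
      from arg_cong2[OF 3 2, of minus]
      have e: "resolvent1 (k i) v - resolvent1 (f i) v = resolvent1 (k i) (f i (resolvent1 (f i) v)) - resolvent1 (k i) (k i (resolvent1 (f i) v))" by simp
      have "(btrans (f i) - btrans (k i)) v = resolvent1 (k i) v - resolvent1 (f i) v"
        by (simp add: btrans_def blinfun.diff_left)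
      also have "\<dots> = (resolvent1 (k i) o\<^sub>L ((f i - k i) o\<^sub>L resolvent1 (f i))) v"
        unfolding e by (simp add: blinfun.bilinear_simps)
      finally show "(btrans (f i) - btrans (k i)) v = (resolvent1 (k i) o\<^sub>L ((f i - k i) o\<^sub>L resolvent1 (f i))) v" .
    qed
    moreover have "(\<lambda>i. resolvent1 (k i) o\<^sub>L ((f i - k i) o\<^sub>L resolvent1 (f i))) \<in> I"
      by (rule C_I[OF I_C[OF fk C_resolvent1[OF f]] C_resolvent1[OF k]])
    ultimately show "(\<lambda>i. btrans (f i) - btrans (g i) - (btrans (k i) - btrans (g i))) \<in> I" by simp
  qed
qed

subsection \<open>Limit functionals\<close>

definition lim_form :: "('h op \<Rightarrow> 'k::chilbert_space op) \<Rightarrow> 'k \<Rightarrow> (nat \<Rightarrow> 'h op) \<Rightarrow> real" where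
  "lim_form \<rho> \<xi> x = Lim \<omega> (\<lambda>i. inner (\<rho> (x i) \<xi>) \<xi>)"

lemma lim_form_tendsto:
  assumes \<rho>: "normal_rep \<zeta> M \<rho>" and x: "x \<in> C"
  shows "((\<lambda>i. inner (\<rho> (x i) \<xi>) \<xi>) \<longlongrightarrow> lim_form \<rho> \<xi> x) \<omega>"
proof -
  obtain K where K: "\<And>i. norm (x i) \<le> K" using CD(5)[OF x] by blast
  have "\<bar>inner (\<rho> (x i) \<xi>) \<xi>\<bar> \<le> K * norm \<xi> * norm \<xi>" for i
    by (rule order_trans[OF abs_inner_op_le])
      (intro mult_right_mono order_trans[OF normal_repD(3)[OF \<rho> SM CD(2)[OF x]] K] norm_ge_zero)
  then show ?thesis unfolding lim_form_def by (rule ultrafilter_tendsto[OF ultra])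
qed

lemma lim_form_eqI:
  fixes \<rho> :: "'h op \<Rightarrow> 'k::chilbert_space op"
  assumes "((\<lambda>i. inner (\<rho> (x i) \<xi>) \<xi>) \<longlongrightarrow> l) \<omega>" shows "lim_form \<rho> \<xi> x = l"
  unfolding lim_form_def by (rule tendsto_Lim[OF bot assms])

lemma lim_form_diff:
  assumes \<rho>: "normal_rep \<zeta> M \<rho>" and "x \<in> C" "y \<in> C"
  shows "lim_form \<rho> \<xi> (\<lambda>i. x i - y i) = lim_form \<rho> \<xi> x - lim_form \<rho> \<xi> y"
  by (rule lim_form_eqI)
    (use tendsto_diff[OF lim_form_tendsto[OF assms(1,2), of \<xi>] lim_form_tendsto[OF assms(1,3), of \<xi>]]
      normal_repD(10)[OF \<rho> SM CD(2)[OF assms(2)] CD(2)[OF assms(3)]] in \<open>simp add: blinfun.diff_left inner_diff_left\<close>)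

lemma lim_form_cong_I:
  assumes \<rho>: "normal_rep \<zeta> M \<rho>" and "x \<in> C" "y \<in> C" "(\<lambda>i. x i - y i) \<in> I"
  shows "lim_form \<rho> \<xi> x = lim_form \<rho> \<xi> y"
proof -
  have "lim_form \<rho> \<xi> (\<lambda>i. x i - y i) = 0"
    by (rule lim_form_eqI, rule rep_null_inner[OF \<rho> assms(4), of _ "norm \<xi>"]) simp
  then show ?thesis using lim_form_diff[OF assms(1-3), of \<xi>] by simp
qed

lemma lim_form_qpos_mono:
  assumes \<rho>: "normal_rep \<zeta> M \<rho>" and x: "x \<in> C" and y: "y \<in> C" and q: "qpos (\<lambda>i. y i - x i)"
  shows "lim_form \<rho> \<xi> x \<le> lim_form \<rho> \<xi> y"
proof (rule ccontr)
  assume "\<not> ?thesis"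
  then have e: "lim_form \<rho> \<xi> x - lim_form \<rho> \<xi> y > 0" by simp
  have d: "(\<lambda>i. y i - x i) \<in> C" by (rule C_diff[OF y x])
  have "\<forall>\<^sub>F i in \<omega>. inner (\<rho> (y i - x i) \<xi>) \<xi> < - ((lim_form \<rho> \<xi> x - lim_form \<rho> \<xi> y) / 2)"
    by (rule order_tendstoD(2)[OF lim_form_tendsto[OF \<rho> d]], subst lim_form_diff[OF \<rho> y x]) (use e in argo)
  moreover have "\<forall>\<^sub>F i in \<omega>. - ((lim_form \<rho> \<xi> x - lim_form \<rho> \<xi> y) / 2) < inner (\<rho> (y i - x i) (\<rho> id_blinfun \<xi>)) (\<rho> id_blinfun \<xi>)"
    by (rule qpos_ge[OF \<rho> q C_id]) (use e in simp)
  ultimately have "\<forall>\<^sub>F i in \<omega>. False"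
    by eventually_elim (simp add: normal_repD(8)[OF \<rho> SM])
  then show False using bot by (simp add: trivial_limit_def)
qed

lemma lim_form_btrans_ge:
  assumes \<rho>: "normal_rep \<zeta> M \<rho>" and f: "f \<in> C" "\<And>i. pos (f i)" and g: "g \<in> C" "\<And>i. star (g i) = g i" "\<And>i. norm (g i) \<le> R"
    and R: "R > 0" and q: "qpos (\<lambda>i. g i - f i)"
  shows "lim_form \<rho> \<xi> f \<le> (1 + R) * lim_form \<rho> \<xi> (\<lambda>i. btrans (f i))"
proof (rule ccontr)
  note D = normal_repD[OF \<rho> SM]
  define t where "t i = btrans (f i)" for i
  have tC: "t \<in> C" unfolding t_def by (rule C_btrans[OF f])
  have pt: "pos (t i)" "norm (t i) \<le> 1" for i unfolding t_def by (rule btrans_pos[OF f(2)], rule norm_btrans[OF f(2)])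
  define s where "s i = op_sqrt 1 (t i)" for i
  have sC: "s \<in> C" unfolding s_def by (rule C_op_sqrt[OF tC pt]) simp
  have s: "pos (s i)" "s i o\<^sub>L s i = t i" "f i o\<^sub>L s i = s i o\<^sub>L f i" for i
  proof -
    show "pos (s i)" "s i o\<^sub>L s i = t i" unfolding s_def
      by (rule op_sqrt_pos[OF pt], simp, rule op_sqrt_square[OF pt], simp)
    have "f i o\<^sub>L (f i o\<^sub>L resolvent1 (f i)) = (f i o\<^sub>L resolvent1 (f i)) o\<^sub>L f i"
      using btrans_eq[OF f(2), of i] by (simp add: compose_assoc)
    then have "f i o\<^sub>L t i = t i o\<^sub>L f i" unfolding t_def btrans_eq(1)[OF f(2)] .
    then show "f i o\<^sub>L s i = s i o\<^sub>L f i" unfolding s_def by (rule op_sqrt_commute[OF pt zero_less_one])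
  qed
  assume "\<not> lim_form \<rho> \<xi> f \<le> (1 + R) * lim_form \<rho> \<xi> (\<lambda>i. btrans (f i))"
  then have d: "lim_form \<rho> \<xi> f - (1 + R) * lim_form \<rho> \<xi> t > 0" (is "?d > 0") by (simp add: t_def[abs_def])
  have "((\<lambda>i. inner (\<rho> (f i) \<xi>) \<xi> - (1 + R) * inner (\<rho> (t i) \<xi>) \<xi>) \<longlongrightarrow> ?d) \<omega>"
    by (intro tendsto_intros lim_form_tendsto[OF \<rho>] f tC)
  then have "\<forall>\<^sub>F i in \<omega>. ?d / 2 < inner (\<rho> (f i) \<xi>) \<xi> - (1 + R) * inner (\<rho> (t i) \<xi>) \<xi>"
    by (rule order_tendstoD(1)) (use d in simp)
  moreover have "\<forall>\<^sub>F i in \<omega>. - (?d / 2) < inner (\<rho> (g i - f i) (\<rho> (s i) \<xi>)) (\<rho> (s i) \<xi>)"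
    by (rule qpos_ge[OF \<rho> q sC]) (use d in simp)
  ultimately have "\<forall>\<^sub>F i in \<omega>. False"
  proof eventually_elim
    case (elim i)
    let ?v = "\<rho> (s i) \<xi>"
    note m = CD(2)[OF f(1), of i] CD(2)[OF g(1), of i] CD(2)[OF sC, of i] CD(2)[OF tC, of i]
    have sv: "inner (\<rho> (s i) x) y = inner x (\<rho> (s i) y)" for x y
      using D(4)[OF m(3)] posD(2)[OF s(1)] star_inner[OF D(2)[OF m(3)], of x y] by simp
    have vv: "inner ?v ?v = inner (\<rho> (t i) \<xi>) \<xi>"
      using sv[of "\<rho> (s i) \<xi>" \<xi>] D(7)[OF m(3,3)] s(2)[of i] by simp
    have "(s i o\<^sub>L f i) o\<^sub>L s i = f i - t i"
    proof -
      have "(s i o\<^sub>L f i) o\<^sub>L s i = f i o\<^sub>L t i" by (simp add: s(3)[symmetric] compose_assoc s(2))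
      also have "\<dots> = f i - t i"
      proof -
        have "t i = f i o\<^sub>L resolvent1 (f i)" unfolding t_def by (rule btrans_eq(1)[OF f(2)])
        moreover have "t i = id_blinfun - resolvent1 (f i)" by (simp add: t_def btrans_def)
        ultimately show ?thesis by (metis compose_diff_right compose_id(1))
      qed
      finally show ?thesis .
    qed
    then have "\<rho> (s i) (\<rho> (f i) ?v) = \<rho> (f i) \<xi> - \<rho> (t i) \<xi>"
      using D(7)[OF MD(4)[OF m(3,1)] m(3)] D(7)[OF m(3,1)] D(10)[OF m(1,4)]
      by (metis blinfun.diff_left blinfun_apply_blinfun_compose)
    then have fv: "inner (\<rho> (f i) ?v) ?v = inner (\<rho> (f i) \<xi>) \<xi> - inner (\<rho> (t i) \<xi>) \<xi>"
      using sv[of "\<rho> (f i) ?v" \<xi>] by (simp add: inner_diff_left)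
    have "pos (\<rho> (R *\<^sub>R id_blinfun - g i))"
      by (rule rep_pos[OF \<rho> MD(10)[OF MD(7)[OF MD(2)] m(2)] pos_norm_bound(1)[OF CD(3)[OF g(1)] g(2,3)]])
    then have "pos (R *\<^sub>R id_blinfun - \<rho> (g i))" using D(10)[OF MD(7)[OF MD(2)] m(2)] D(9)[OF MD(2)] D(8) by simp
    from pos_inner_mono[OF this, of ?v] have gv: "inner (\<rho> (g i) ?v) ?v \<le> R * inner (\<rho> (t i) \<xi>) \<xi>"
      by (simp add: blinfun.scaleR_left vv)
    have "inner (\<rho> (g i - f i) ?v) ?v = inner (\<rho> (g i) ?v) ?v - inner (\<rho> (f i) ?v) ?v"
      by (simp add: D(10)[OF m(2,1)] blinfun.diff_left inner_diff_left)
    moreover have "(1 + R) * inner (\<rho> (t i) \<xi>) \<xi> = inner (\<rho> (t i) \<xi>) \<xi> + R * inner (\<rho> (t i) \<xi>) \<xi>"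
      by (simp add: distrib_right)
    ultimately show False using elim gv fv by linarith
  qed
  then show False using bot by (simp add: trivial_limit_def)
qed

lemma predual_dense_sequence:
  shows "\<exists>\<psi> :: nat \<Rightarrow> 'h op \<Rightarrow> complex. (\<forall>l. \<psi> l \<in> predual M) \<and>
    (\<forall>\<phi>\<in>predual M. \<forall>e>0. \<exists>l. \<forall>Y\<in>M. cmod (\<phi> Y - \<psi> l Y) \<le> e * norm Y)"
proof -
  obtain D where D: "countable D" "D \<subseteq> predual M"
    "\<And>\<phi> e. \<phi> \<in> predual M \<Longrightarrow> e > 0 \<Longrightarrow> \<exists>\<psi>\<in>D. functional_norm M (\<lambda>a. \<phi> a - \<psi> a) < e"
    using sepM unfolding separable_predual_def by blast
  have "D \<noteq> {}" using D(3)[OF vector_functional_predual[of 0 0], of 1] by auto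
  then have 1: "from_nat_into D l \<in> predual M" for l using from_nat_into[of D l] D(2) by blast
  have 2: "\<exists>l. \<forall>Y\<in>M. cmod (\<phi> Y - from_nat_into D l Y) \<le> e * norm Y" if \<phi>: "\<phi> \<in> predual M" and e: "e > 0" for \<phi> e
  proof -
    obtain \<psi> where \<psi>: "\<psi> \<in> D" "functional_norm M (\<lambda>a. \<phi> a - \<psi> a) < e" using D(3)[OF \<phi> e] by blast
    have \<psi>P: "\<psi> \<in> predual M" using \<psi>(1) D(2) by blast
    obtain l where l: "from_nat_into D l = \<psi>" using from_nat_into_surj[OF D(1) \<psi>(1)] by blast
    obtain C1 where C1: "C1 \<ge> 0" "\<And>a. a \<in> M \<Longrightarrow> cmod (\<phi> a) \<le> C1 * norm a" using predual_bounded[OF \<phi>] by blast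
    obtain C2 where C2: "C2 \<ge> 0" "\<And>a. a \<in> M \<Longrightarrow> cmod (\<psi> a) \<le> C2 * norm a" using predual_bounded[OF \<psi>P] by blast
    have "cmod (\<phi> Y - \<psi> Y) \<le> e * norm Y" if Y: "Y \<in> M" for Y
    proof -
      have "cmod (\<phi> Y - \<psi> Y) \<le> functional_norm M (\<lambda>a. \<phi> a - \<psi> a) * norm Y"
      proof (rule functional_norm_ge_scaled[OF SM _ _ Y])
        fix b assume b: "b \<in> M" "norm b \<le> 1"
        have "cmod (\<phi> b) \<le> C1" using C1(2)[OF b(1)] mult_left_mono[OF b(2) C1(1)] by simp
        moreover have "cmod (\<psi> b) \<le> C2" using C2(2)[OF b(1)] mult_left_mono[OF b(2) C2(1)] by simp
        ultimately show "cmod (\<phi> b - \<psi> b) \<le> C1 + C2" using norm_triangle_ineq4[of "\<phi> b" "\<psi> b"] by linarith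
      next
        show "\<phi> (r *\<^sub>R b) - \<psi> (r *\<^sub>R b) = of_real r * (\<phi> b - \<psi> b)" if "b \<in> M" for r b
          by (simp add: predual_linear(4)[OF \<phi> SM that] predual_linear(4)[OF \<psi>P SM that] right_diff_distrib)
      qed
      also have "\<dots> \<le> e * norm Y" using \<psi>(2) by (intro mult_right_mono) auto
      finally show ?thesis .
    qed
    then show ?thesis using l by blast
  qed
  show ?thesis by (intro exI[of _ "from_nat_into D"] conjI allI ballI impI 1 2)
qed

text \<open>Completeness of the unit ball of the quotient for the distance given by
  \<open>\<zeta>\<close>. Centrality of the diagonal sequence must be enforced for all functionals
  by countably many conditions, which is where a countable dense set in the predual of
  \<open>M\<close> enters.\<close>

lemma diagonal_limit:
  assumes g: "\<And>n. g n \<in> C" "\<And>n i. norm (g n i) \<le> 1"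
    and cau: "\<And>n m. \<forall>\<^sub>F i in \<omega>. norm (amp (g n i - g m i) \<zeta>) < (1/2)^n + (1/2)^m"
  obtains sel where "(\<lambda>i. g (sel i) i) \<in> C"
    "\<And>n. \<forall>\<^sub>F i in \<omega>. norm (amp (g (sel i) i - g n i) \<zeta>) \<le> 2 * (1/2)^n"
proof -
  obtain \<psi> where \<psi>: "\<And>l::nat. \<psi> l \<in> predual M"
    "\<And>\<phi> e. \<phi> \<in> predual M \<Longrightarrow> e > 0 \<Longrightarrow> \<exists>l. \<forall>Y\<in>M. cmod (\<phi> Y - \<psi> l Y) \<le> e * norm Y"
    using predual_dense_sequence by blast
  \<comment> \<open>At stage \<open>m\<close> the first terms of the sequence must commute with
    \<open>M\<close> under the first functionals up to \<open>(1/2)^m\<close>, and the distances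
    must obey the Cauchy estimate.\<close>
  define A where "A m i \<longleftrightarrow> (\<forall>k\<in>{..m}. \<forall>l\<in>{..m}. \<forall>X\<in>M. cmod (\<psi> l (g k i o\<^sub>L X) - \<psi> l (X o\<^sub>L g k i)) \<le> (1/2)^m * norm X)
      \<and> (\<forall>k\<in>{..m}. norm (amp (g m i - g k i) \<zeta>) < (1/2)^m + (1/2)^k)" for m i
  have evA: "eventually (A m) \<omega>" for m
  proof -
    have "\<forall>\<^sub>F i in \<omega>. \<forall>X\<in>M. cmod (\<psi> l (g k i o\<^sub>L X) - \<psi> l (X o\<^sub>L g k i)) \<le> (1/2)^m * norm X" for k l
      by (rule C_centralD[OF g(1) \<psi>(1)]) simp
    then have st: "\<forall>\<^sub>F i in \<omega>. \<forall>l\<in>{..m}. \<forall>X\<in>M. cmod (\<psi> l (g k i o\<^sub>L X) - \<psi> l (X o\<^sub>L g k i)) \<le> (1/2)^m * norm X" for k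
      by (intro eventually_ball_finite[OF finite_atMost] ballI)
    have 1: "\<forall>\<^sub>F i in \<omega>. \<forall>k\<in>{..m}. \<forall>l\<in>{..m}. \<forall>X\<in>M. cmod (\<psi> l (g k i o\<^sub>L X) - \<psi> l (X o\<^sub>L g k i)) \<le> (1/2)^m * norm X"
    proof (rule eventually_ball_finite[OF finite_atMost], rule ballI)
      fix k
      show "\<forall>\<^sub>F i in \<omega>. \<forall>l\<in>{..m}. \<forall>X\<in>M. cmod (\<psi> l (g k i o\<^sub>L X) - \<psi> l (X o\<^sub>L g k i)) \<le> (1/2)^m * norm X" by (rule st)
    qed
    have 2: "\<forall>\<^sub>F i in \<omega>. \<forall>k\<in>{..m}. norm (amp (g m i - g k i) \<zeta>) < (1/2)^m + (1/2)^k"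
      by (intro eventually_ball_finite[OF finite_atMost] ballI cau)
    show ?thesis unfolding A_def by (rule eventually_conj[OF 1 2])
  qed
  obtain sel where sel: "\<And>n. eventually (\<lambda>i. n \<le> sel i) \<omega>" "\<And>i m. 1 \<le> m \<Longrightarrow> m \<le> sel i \<Longrightarrow> A m i"
    using diagonal_selection[where A = A, OF ultra] evA by auto
  have 1: "(\<lambda>i. g (sel i) i) \<in> C"
  proof (rule CI[of _ 1])
    show "g (sel i) i \<in> N" for i by (rule CD(1)[OF g(1)])
    show "norm (g (sel i) i) \<le> 1" for i by (rule g(2))
    fix \<phi> and e :: real assume \<phi>: "\<phi> \<in> predual M" and e: "e > 0"
    have e4: "e / 4 > 0" using e by simp
    obtain l where l: "\<And>Y. Y \<in> M \<Longrightarrow> cmod (\<phi> Y - \<psi> l Y) \<le> (e / 4) * norm Y" using \<psi>(2)[OF \<phi> e4] by blast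
    obtain n0 where n0: "(1/2::real)^n0 < e / 2" using real_arch_pow_inv[of "e / 2" "1/2"] e by auto
    define n where "n = Max {n0, l, 1}"
    have n: "n0 \<le> n" "l \<le> n" "1 \<le> n" by (auto simp: n_def)
    show "\<forall>\<^sub>F i in \<omega>. \<forall>X\<in>M. cmod (\<phi> (g (sel i) i o\<^sub>L X) - \<phi> (X o\<^sub>L g (sel i) i)) \<le> e * norm X"
      using sel(1)[of n]
    proof eventually_elim
      case (elim i)
      let ?z = "g (sel i) i"
      show ?case
      proof
        fix X assume X: "X \<in> M"
        have "A (sel i) i" using sel(2)[of "sel i" i] elim n by simp
        then have "cmod (\<psi> l (?z o\<^sub>L X) - \<psi> l (X o\<^sub>L ?z)) \<le> (1/2)^(sel i) * norm X"
          unfolding A_def using X elim n by auto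
        also have "\<dots> \<le> (e / 2) * norm X"
        proof (rule mult_right_mono)
          have "(1/2::real)^(sel i) \<le> (1/2)^n0" using elim n by (intro power_decreasing) auto
          then show "(1/2::real)^(sel i) \<le> e / 2" using n0 by linarith
        qed simp
        finally have a: "cmod (\<psi> l (?z o\<^sub>L X) - \<psi> l (X o\<^sub>L ?z)) \<le> (e / 2) * norm X" .
        have zM: "?z \<in> M" by (rule CD(2)[OF g(1)])
        have nz: "norm (?z o\<^sub>L X) \<le> norm X" "norm (X o\<^sub>L ?z) \<le> norm X"
          using norm_blinfun_compose[of ?z X] norm_blinfun_compose[of X ?z] mult_right_mono[OF g(2)[of "sel i" i] norm_ge_zero[of X]]
          by (simp_all add: mult.commute)
        have b: "cmod (\<phi> (?z o\<^sub>L X) - \<psi> l (?z o\<^sub>L X)) \<le> (e / 4) * norm X"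
          by (rule order_trans[OF l[OF MD(4)[OF zM X]] mult_left_mono[OF nz(1)]]) (use e in simp)
        have c: "cmod (\<phi> (X o\<^sub>L ?z) - \<psi> l (X o\<^sub>L ?z)) \<le> (e / 4) * norm X"
          by (rule order_trans[OF l[OF MD(4)[OF X zM]] mult_left_mono[OF nz(2)]]) (use e in simp)
        have "\<phi> (?z o\<^sub>L X) - \<phi> (X o\<^sub>L ?z) = (\<psi> l (?z o\<^sub>L X) - \<psi> l (X o\<^sub>L ?z))
            + ((\<phi> (?z o\<^sub>L X) - \<psi> l (?z o\<^sub>L X)) - (\<phi> (X o\<^sub>L ?z) - \<psi> l (X o\<^sub>L ?z)))" by simp
        also have "cmod \<dots> \<le> (e / 2) * norm X + ((e / 4) * norm X + (e / 4) * norm X)"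
          by (rule norm_triangle_le[OF add_mono[OF a order_trans[OF norm_triangle_ineq4 add_mono[OF b c]]]])
        finally show "cmod (\<phi> (?z o\<^sub>L X) - \<phi> (X o\<^sub>L ?z)) \<le> e * norm X" by (simp add: algebra_simps)
      qed
    qed
  qed
  have 2: "\<forall>\<^sub>F i in \<omega>. norm (amp (g (sel i) i - g n i) \<zeta>) \<le> 2 * (1/2)^n" for n
    using sel(1)[of "max n 1"]
  proof eventually_elim
    case (elim i)
    then have "A (sel i) i" using sel(2)[of "sel i" i] by simp
    then have "norm (amp (g (sel i) i - g n i) \<zeta>) < (1/2)^(sel i) + (1/2)^n" using elim by (auto simp: A_def)
    moreover have "(1/2::real)^(sel i) \<le> (1/2)^n" using elim by (intro power_decreasing) auto
    ultimately show ?case by linarith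
  qed
  show thesis by (rule that[OF 1 2])
qed

text \<open>Smallness at \<open>\<zeta>\<close> is transferred to an arbitrary vector of a normal
  representation. The constants are those of its later use: \<open>w\<close> is a difference of two
  operators of norm at most 1, at distance below \<open>(1/2)^n + 2 * (1/2)^n\<close>.\<close>

lemma rep_control:
  assumes \<rho>: "normal_rep \<zeta> M \<rho>" and e: "e > 0"
  obtains n where "\<And>w. (\<And>i. w i \<in> M) \<Longrightarrow> (\<And>i. norm (w i) \<le> 2) \<Longrightarrow>
    \<forall>\<^sub>F i in \<omega>. norm (amp (w i) \<zeta>) < 3 * (1/2)^n \<Longrightarrow> \<forall>\<^sub>F i in \<omega>. norm (\<rho> (w i) \<xi>) < e"
proof -
  note D = normal_repD[OF \<rho> SM]
  obtain d where d: "d > 0" "\<And>a. a \<in> M \<Longrightarrow> norm a \<le> 1 \<Longrightarrow> norm (amp a \<zeta>) < d \<Longrightarrow> norm (\<rho> a \<xi>) < e / 2"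
    using D(1)[unfolded normal_on_def, rule_format, of "e / 2" \<xi>] e by auto
  obtain n where n: "(1/2::real)^n < d / 3" using real_arch_pow_inv[of "d / 3" "1/2"] d(1) by auto
  show thesis
  proof (rule that)
    fix w assume w: "\<And>i. w i \<in> M" "\<And>i. norm (w i) \<le> 2" "\<forall>\<^sub>F i in \<omega>. norm (amp (w i) \<zeta>) < 3 * (1/2)^n"
    from w(3) show "\<forall>\<^sub>F i in \<omega>. norm (\<rho> (w i) \<xi>) < e"
    proof eventually_elim
      case (elim i)
      have "norm (amp ((1/2) *\<^sub>R w i) \<zeta>) < d"
        using elim n d(1) by (simp add: amp_scaleR blinfun.scaleR_left)
      then have "norm (\<rho> ((1/2) *\<^sub>R w i) \<xi>) < e / 2" by (intro d(2) MD(7) w(1)) (use w(2)[of i] in auto)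
      then show ?case by (simp add: D(9)[OF w(1)] blinfun.scaleR_left)
    qed
  qed
qed

lemma q_selfadjointD: "x \<in> q_selfadjoint C I \<Longrightarrow> x \<in> C" "x \<in> q_selfadjoint C I \<Longrightarrow> (\<lambda>i. star (x i) - x i) \<in> I"
  by (auto simp: q_selfadjoint_def)

text \<open>If \<open>\<Phi> x\<close> exceeded the supremum of \<open>\<Phi>\<close> on \<open>D\<close>, then a limit \<open>z\<close> of the bounded transforms
  of the elements \<open>x - d\<close>, \<open>d \<in> D\<close>, would satisfy \<open>0 \<le> z \<le> x - d\<close> for all \<open>d\<close> and \<open>\<Phi> z > 0\<close>;
  thus \<open>x - z\<close> would be a smaller upper bound.\<close>

lemma lim_form_lub_le:
  assumes \<rho>: "normal_rep \<zeta> M \<rho>" and D: "q_directed C I D" and x: "q_is_lub C I D x"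
    and \<sigma>: "\<And>d. d \<in> D \<Longrightarrow> lim_form \<rho> \<xi> d \<le> \<sigma>"
  shows "lim_form \<rho> \<xi> x \<le> \<sigma>"
proof (rule ccontr)
  assume "\<not> lim_form \<rho> \<xi> x \<le> \<sigma>"
  define \<gamma> where "\<gamma> = lim_form \<rho> \<xi> x - \<sigma>"
  have \<gamma>: "\<gamma> > 0" using \<open>\<not> _\<close> by (simp add: \<gamma>_def)
  have xs: "x \<in> q_selfadjoint C I" and xub: "\<And>d. d \<in> D \<Longrightarrow> qpos (\<lambda>i. x i - d i)"
    and xlub: "\<And>y. y \<in> q_selfadjoint C I \<Longrightarrow> (\<And>d. d \<in> D \<Longrightarrow> qpos (\<lambda>i. y i - d i)) \<Longrightarrow> qpos (\<lambda>i. y i - x i)"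
    using x unfolding q_is_lub_def q_le_iff by auto
  have xC: "x \<in> C" by (rule q_selfadjointD(1)[OF xs])
  have dC: "d \<in> C" if "d \<in> D" for d using D that by (auto simp: q_directed_def q_selfadjoint_def)
  \<comment> \<open>Representatives of the differences \<open>x - d\<close> whose entries are
    honestly positive, so that bounded transforms can be formed entrywise.\<close>
  define F where "F = {f. \<exists>c\<in>C. \<exists>d\<in>D. f = (\<lambda>i. star (c i) o\<^sub>L c i) \<and> (\<lambda>i. x i - d i - f i) \<in> I}"
  have FC: "f \<in> C" and Fp: "pos (f i)" if "f \<in> F" for f i
    using that by (auto simp: F_def intro: C_compose C_star pos_star_compose CD(3))
  have F1: "\<exists>f\<in>F. (\<lambda>i. x i - d i - f i) \<in> I" if d: "d \<in> D" for d
  proof -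
    obtain c where c: "c \<in> C" "(\<lambda>i. x i - d i - (star (c i) o\<^sub>L c i)) \<in> I" using xub[OF d] by (auto simp: qpos_def)
    then have "(\<lambda>i. star (c i) o\<^sub>L c i) \<in> F" unfolding F_def using d by blast
    then show ?thesis by (rule bexI[rotated]) (rule c(2))
  qed
  have F2: "\<exists>h\<in>F. qpos (\<lambda>i. f i - h i) \<and> qpos (\<lambda>i. g i - h i)" if f: "f \<in> F" and g: "g \<in> F" for f g
  proof -
    obtain d1 d2 where d: "d1 \<in> D" "(\<lambda>i. x i - d1 i - f i) \<in> I" "d2 \<in> D" "(\<lambda>i. x i - d2 i - g i) \<in> I"
      using f g by (auto simp: F_def)
    obtain d3 where d3: "d3 \<in> D" "qpos (\<lambda>i. d3 i - d1 i)" "qpos (\<lambda>i. d3 i - d2 i)"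
      using D d(1,3) unfolding q_directed_def q_le_iff by blast
    obtain h where h: "h \<in> F" "(\<lambda>i. x i - d3 i - h i) \<in> I" using F1[OF d3(1)] by blast
    have "qpos (\<lambda>i. f i - h i)"
      by (rule qpos_I_add[OF d3(2)]) (use I_diff[OF h(2) d(2)] in \<open>simp add: algebra_simps\<close>)
    moreover have "qpos (\<lambda>i. g i - h i)"
      by (rule qpos_I_add[OF d3(3)]) (use I_diff[OF h(2) d(4)] in \<open>simp add: algebra_simps\<close>)
    ultimately show ?thesis using h(1) by blast
  qed
  \<comment> \<open>Although the claim concerns \<open>\<rho>\<close> and \<open>\<xi>\<close>, the
    minimization is done at \<open>\<zeta>\<close>: smallness there controls every normal
    representation, and in particular also the order.\<close>
  define \<phi> where "\<phi> f = lim_form amp \<zeta> (\<lambda>i. btrans (f i))" for f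
  have tC: "(\<lambda>i. btrans (f i)) \<in> C" if "f \<in> F" for f by (rule C_btrans[OF FC[OF that] Fp[OF that]])
  have \<phi>0: "0 \<le> \<phi> f" if f: "f \<in> F" for f
    unfolding \<phi>_def
    by (rule tendsto_lowerbound[OF lim_form_tendsto[OF normal_rep_amp tC[OF f]] _ bot])
      (intro always_eventually allI posD(3) pos_amp btrans_pos Fp[OF f])
  have "D \<noteq> {}" using D by (simp add: q_directed_def)
  then obtain f0 where f0: "f0 \<in> F" using F1 by blast
  define \<tau> where "\<tau> = Inf (\<phi> ` F)"
  have bdd: "bdd_below (\<phi> ` F)" using \<phi>0 by (auto intro!: bdd_belowI[of _ 0])
  have \<tau>: "\<tau> \<le> \<phi> f" if "f \<in> F" for f unfolding \<tau>_def by (rule cInf_lower[OF imageI[OF that] bdd])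
  \<comment> \<open>The tolerance \<open>(1/4)^n\<close> governs squares of norms, so that distances
    are governed by \<open>(1/2)^n\<close>.\<close>
  have "\<exists>f\<in>F. \<phi> f < \<tau> + (1/4)^n" for n :: nat
  proof -
    have "Inf (\<phi> ` F) < \<tau> + (1/4)^n" by (simp add: \<tau>_def)
    then obtain y where "y \<in> \<phi> ` F" "y < \<tau> + (1/4)^n" using cInf_lessD[of "\<phi> ` F"] f0 by blast
    then show ?thesis by blast
  qed
  then obtain k where k: "\<And>n. k n \<in> F" "\<And>n. \<phi> (k n) < \<tau> + (1/4)^n" by metis
  have F3: "\<forall>\<^sub>F i in \<omega>. norm (amp (btrans (k n i) - btrans (h i)) \<zeta>) < (1/2)^n"
    if h: "h \<in> F" and q: "qpos (\<lambda>i. k n i - h i)" for h n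
  proof -
    define u where "u i = btrans (k n i) - btrans (h i)" for i
    have uC: "u \<in> C" unfolding u_def by (intro C_diff tC k h)
    have u1: "pos (id_blinfun - u i)" for i
      using pos_add[OF btrans_le_one[OF Fp[OF k(1)], of n i] btrans_pos[OF Fp[OF h], of i]] by (simp add: u_def algebra_simps)
    have uq: "qpos u" unfolding u_def by (rule btrans_qpos_mono[OF FC[OF k(1)] Fp[OF k(1)] FC[OF h] Fp[OF h] q])
    \<comment> \<open>Half of the slack in the choice of \<open>k n\<close>: the form of
      \<open>u\<close> at \<open>\<zeta>\<close> then stays below \<open>(1/4)^n - e\<close>, and
      \<open>e\<close> is spent on passing from the form to the squared norm.\<close>
    define e where "e = (\<tau> + (1/4)^n - \<phi> (k n)) / 2"
    have e: "e > 0" using k(2)[of n] by (simp add: e_def)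
    have "lim_form amp \<zeta> u = \<phi> (k n) - \<phi> h"
      unfolding u_def \<phi>_def by (rule lim_form_diff[OF normal_rep_amp tC[OF k(1)] tC[OF h]])
    moreover have "2 * e = \<tau> + (1/4)^n - \<phi> (k n)" by (simp add: e_def)
    ultimately have "lim_form amp \<zeta> u < (1/4)^n - e" using \<tau>[OF h] e by linarith
    then have "\<forall>\<^sub>F i in \<omega>. inner (amp (u i) \<zeta>) \<zeta> < (1/4)^n - e"
      by (rule order_tendstoD(2)[OF lim_form_tendsto[OF normal_rep_amp uC]])
    with qpos_square_le[OF normal_rep_amp uC u1 uq e, of \<zeta>] show ?thesis
    proof eventually_elim
      case (elim i)
      have "(norm (amp (u i) \<zeta>))\<^sup>2 < (1/4)^n" using elim by linarith
      also have "(1/4::real)^n = ((1/2)^n)\<^sup>2" by (simp add: power2_eq_square flip: power_mult_distrib)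
      finally show ?case unfolding u_def by (rule power2_less_imp_less) simp
    qed
  qed
  obtain sel where zC: "(\<lambda>i. btrans (k (sel i) i)) \<in> C"
    and zk: "\<And>n. \<forall>\<^sub>F i in \<omega>. norm (amp (btrans (k (sel i) i) - btrans (k n i)) \<zeta>) \<le> 2 * (1/2)^n"
  proof (rule diagonal_limit[of "\<lambda>n i. btrans (k n i)"])
    show "(\<lambda>i. btrans (k n i)) \<in> C" for n by (rule tC[OF k(1)])
    show "norm (btrans (k n i)) \<le> 1" for n i by (rule norm_btrans[OF Fp[OF k(1)]])
    fix n m
    obtain h where h: "h \<in> F" "qpos (\<lambda>i. k n i - h i)" "qpos (\<lambda>i. k m i - h i)" using F2[OF k(1) k(1)] by blast
    from F3[OF h(1,2)] F3[OF h(1,3)]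
    show "\<forall>\<^sub>F i in \<omega>. norm (amp (btrans (k n i) - btrans (k m i)) \<zeta>) < (1/2)^n + (1/2)^m"
    proof eventually_elim
      case (elim i)
      have eq: "amp (btrans (k n i) - btrans (k m i)) \<zeta> = amp (btrans (k n i) - btrans (h i)) \<zeta> - amp (btrans (k m i) - btrans (h i)) \<zeta>"
        by (simp add: amp_diff blinfun.diff_left)
      show ?case unfolding eq using elim norm_triangle_ineq4[of "amp (btrans (k n i) - btrans (h i)) \<zeta>" "amp (btrans (k m i) - btrans (h i)) \<zeta>"]
        by linarith
    qed
  next
    fix sel assume "(\<lambda>i. btrans (k (sel i) i)) \<in> C"
      "\<And>n. \<forall>\<^sub>F i in \<omega>. norm (amp (btrans (k (sel i) i) - btrans (k n i)) \<zeta>) \<le> 2 * (1/2) ^ n"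
    then show thesis by (rule that[of sel])
  qed
  define z where "z i = btrans (k (sel i) i)" for i
  have zC: "z \<in> C" using zC by (simp add: z_def[abs_def])
  have pz: "pos (z i)" and nz: "norm (z i) \<le> 1" for i
    unfolding z_def by (rule btrans_pos[OF Fp[OF k(1)]], rule norm_btrans[OF Fp[OF k(1)]])
  have F4: "\<exists>h\<in>F. qpos (\<lambda>i. f i - h i) \<and> (\<forall>\<^sub>F i in \<omega>. norm (amp (btrans (h i) - z i) \<zeta>) < 3 * (1/2)^n)"
    if f: "f \<in> F" for f n
  proof -
    obtain h where h: "h \<in> F" "qpos (\<lambda>i. f i - h i)" "qpos (\<lambda>i. k n i - h i)" using F2[OF f k(1)] by blast
    from F3[OF h(1,3)] zk[of n] have "\<forall>\<^sub>F i in \<omega>. norm (amp (btrans (h i) - z i) \<zeta>) < 3 * (1/2)^n"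
    proof eventually_elim
      case (elim i)
      have eq: "amp (btrans (h i) - z i) \<zeta> = - amp (btrans (k n i) - btrans (h i)) \<zeta> - amp (z i - btrans (k n i)) \<zeta>"
        by (simp add: amp_diff blinfun.diff_left)
      show ?case unfolding eq using elim[folded z_def] norm_triangle_ineq4[of "- amp (btrans (k n i) - btrans (h i)) \<zeta>" "amp (z i - btrans (k n i)) \<zeta>"]
        unfolding norm_minus_cancel by linarith
    qed
    then show ?thesis using h by blast
  qed
  have wM: "btrans (h i) - z i \<in> M" and nw: "norm (btrans (h i) - z i) \<le> 2" if h: "h \<in> F" for h i
    using MD(10)[OF CD(2)[OF tC[OF h]] CD(2)[OF zC]] norm_triangle_ineq4[of "btrans (h i)" "z i"] norm_btrans[OF Fp[OF h], of i] nz[of i]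
    by auto
  \<comment> \<open>Split \<open>f - z\<close> into \<open>f - f'\<close>, positive in the quotient,
    \<open>f' - btrans f'\<close>, positive entrywise, and \<open>btrans f' - z\<close>, which is
    small at \<open>h\<close>. Centrality of \<open>b\<close> carries that smallness over to the
    moving vectors \<open>b i h\<close>.\<close>
  have F5: "qpos (\<lambda>i. f i - z i)" if f: "f \<in> F" for f
  proof (rule qposI)
    show "(\<lambda>i. f i - z i) \<in> C" by (rule C_diff[OF FC[OF f] zC])
    show "star (f i - z i) = f i - z i" for i
      by (simp add: star_diff posD(1,2)[OF Fp[OF f]] posD(1,2)[OF pz])
    fix b and h :: 'h and e :: real assume b: "b \<in> C" and e: "e > 0"
    obtain K where K: "K > 0" "\<And>i. norm (b i) \<le> K" using CD(5)[OF b] by blast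
    define L where "L = K * (K * norm h) + 1"
    have L: "L > 0" using K by (simp add: L_def add_nonneg_pos)
    have "e / (3 * L) > 0" using e L by simp
    obtain n where n: "\<And>w. (\<And>i. w i \<in> M) \<Longrightarrow> (\<And>i. norm (w i) \<le> 2) \<Longrightarrow>
        \<forall>\<^sub>F i in \<omega>. norm (amp (w i) \<zeta>) < 3 * (1/2)^n \<Longrightarrow> \<forall>\<^sub>F i in \<omega>. norm (blinfun_apply (w i) h) < e / (3 * L)"
      using rep_control[OF normal_rep_id \<open>e / (3 * L) > 0\<close>, of h] by metis
    obtain f' where f': "f' \<in> F" "qpos (\<lambda>i. f i - f' i)" "\<forall>\<^sub>F i in \<omega>. norm (amp (btrans (f' i) - z i) \<zeta>) < 3 * (1/2)^n"
      using F4[OF f, of n] by blast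
    have e1: "\<forall>\<^sub>F i in \<omega>. norm (blinfun_apply (btrans (f' i) - z i) h) < e / (3 * L)"
      by (rule n[OF wM[OF f'(1)] nw[OF f'(1)] f'(3)])
    have e2: "\<forall>\<^sub>F i in \<omega>. - (e / 3) < inner ((f i - f' i) (b i h)) (b i h)"
      by (rule qpos_ge[OF normal_rep_id f'(2) b]) (use e in simp)
    have e3: "\<forall>\<^sub>F i in \<omega>. \<forall>X\<in>M. \<bar>inner (star (b i) (blinfun_apply X h)) h - inner (blinfun_apply X (star (b i) h)) h\<bar> \<le> (e / (6 * K)) * norm X"
      by (rule C_inner_central[OF C_star[OF b]]) (use e K in simp)
    from e1 e2 e3 show "\<forall>\<^sub>F i in \<omega>. - e \<le> inner ((f i - z i) (b i h)) (b i h)"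
    proof eventually_elim
      case (elim i)
      let ?v = "b i h"
      define w where "w = btrans (f' i) - z i"
      have bB: "b i \<in> bounded_ops" by (rule CD(3)[OF b])
      have wB: "w \<in> bounded_ops" unfolding w_def by (rule MD(1)[OF wM[OF f'(1)]])
      have ws: "star w = w" unfolding w_def
        by (simp add: star_diff posD(1,2)[OF btrans_pos[OF Fp[OF f'(1)]]] posD(1,2)[OF pz])
      have XM: "w o\<^sub>L b i \<in> M" unfolding w_def by (rule MD(4)[OF wM[OF f'(1)] CD(2)[OF b]])
      have "norm (w o\<^sub>L b i) \<le> 2 * K"
        by (rule order_trans[OF norm_blinfun_compose mult_mono]) (use nw[OF f'(1)] K in \<open>auto simp: w_def\<close>)
      then have nX: "(e / (6 * K)) * norm (w o\<^sub>L b i) \<le> e / 3"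
        using mult_left_mono[of "norm (w o\<^sub>L b i)" "2 * K" "e / (6 * K)"] e K by simp
      have "\<bar>inner (star (b i) (w ?v)) h - inner (w (b i (star (b i) h))) h\<bar> \<le> (e / (6 * K)) * norm (w o\<^sub>L b i)"
        using elim(3)[rule_format, OF XM] by simp
      moreover have "inner (star (b i) (w ?v)) h = inner (w ?v) ?v" by (rule star_inner_left[OF bB])
      moreover have "inner (w (b i (star (b i) h))) h = inner (b i (star (b i) h)) (w h)" by (rule inner_selfadjoint[OF wB ws])
      moreover have "\<bar>inner (b i (star (b i) h)) (w h)\<bar> \<le> e / 3"
      proof -
        have "norm (b i (star (b i) h)) \<le> norm (b i) * norm (star (b i) h)" by (rule norm_blinfun)
        also have "\<dots> \<le> K * (K * norm h)"
          using norm_blinfun[of "star (b i)" h] mult_right_mono[OF K(2)[of i] norm_ge_zero[of h]]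
          by (intro mult_mono K) (use K in \<open>auto simp: norm_star[OF bB]\<close>)
        finally have le: "norm (b i (star (b i) h)) \<le> L" by (simp add: L_def)
        have "\<bar>inner (b i (star (b i) h)) (w h)\<bar> \<le> norm (b i (star (b i) h)) * norm (w h)" by (rule Cauchy_Schwarz_ineq2)
        also have "\<dots> \<le> L * (e / (3 * L))" by (intro mult_mono le) (use elim(1) L in \<open>auto simp: w_def\<close>)
        also have "\<dots> = e / 3" using L by simp
        finally show ?thesis .
      qed
      ultimately have wv: "inner (w ?v) ?v \<ge> - (2 * e / 3)" using nX by linarith
      have "inner ((f i - z i) ?v) ?v = inner ((f i - f' i) ?v) ?v + inner ((f' i - btrans (f' i)) ?v) ?v + inner (w ?v) ?v"
        by (simp add: w_def blinfun.diff_left inner_diff_left)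
      moreover have "inner ((f' i - btrans (f' i)) ?v) ?v \<ge> 0" by (rule posD(3)[OF btrans_le[OF Fp[OF f'(1)]]])
      ultimately show ?case using elim(2) wv by linarith
    qed
  qed
  have Flow: "\<gamma> \<le> lim_form \<rho> \<xi> f" if f: "f \<in> F" for f
  proof -
    obtain d where d: "d \<in> D" "(\<lambda>i. x i - d i - f i) \<in> I" using f by (auto simp: F_def)
    have "lim_form \<rho> \<xi> f = lim_form \<rho> \<xi> x - lim_form \<rho> \<xi> d"
      using lim_form_cong_I[OF \<rho> C_diff[OF xC dC[OF d(1)]] FC[OF f] d(2), of \<xi>] lim_form_diff[OF \<rho> xC dC[OF d(1)], of \<xi>] by simp
    then show ?thesis using \<sigma>[OF d(1)] by (simp add: \<gamma>_def)
  qed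
  have zpos: "lim_form \<rho> \<xi> z > 0"
  proof -
    obtain R where R: "R > 0" "\<And>i. norm (f0 i) \<le> R" using CD(5)[OF FC[OF f0]] by blast
    \<comment> \<open>\<open>R\<close> comes from one fixed \<open>f0\<close>, and \<open>h\<close>
      is taken below it, so the lower bound \<open>\<gamma> / (1 + R)\<close> is the same for all
      such \<open>h\<close>. The error \<open>e * norm \<xi>\<close> is less than half of that
      bound.\<close>
    define e where "e = \<gamma> / (2 * (1 + R) * (norm \<xi> + 1))"
    have n1: "norm \<xi> + 1 > 0" by (simp add: add_nonneg_pos)
    have e: "e > 0" unfolding e_def using \<gamma> R n1 by (intro divide_pos_pos mult_pos_pos) auto
    obtain n where n: "\<And>w. (\<And>i. w i \<in> M) \<Longrightarrow> (\<And>i. norm (w i) \<le> 2) \<Longrightarrow>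
        \<forall>\<^sub>F i in \<omega>. norm (amp (w i) \<zeta>) < 3 * (1/2)^n \<Longrightarrow> \<forall>\<^sub>F i in \<omega>. norm (blinfun_apply (\<rho> (w i)) \<xi>) < e"
      using rep_control[OF \<rho> e, of \<xi>] by metis
    obtain h where h: "h \<in> F" "qpos (\<lambda>i. f0 i - h i)" "\<forall>\<^sub>F i in \<omega>. norm (amp (btrans (h i) - z i) \<zeta>) < 3 * (1/2)^n"
      using F4[OF f0, of n] by blast
    have "\<gamma> \<le> (1 + R) * lim_form \<rho> \<xi> (\<lambda>i. btrans (h i))"
      by (rule order_trans[OF Flow[OF h(1)] lim_form_btrans_ge[OF \<rho> FC[OF h(1)] Fp[OF h(1)] FC[OF f0] posD(2)[OF Fp[OF f0]] R(2,1) h(2)]])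
    then have th: "\<gamma> / (1 + R) \<le> lim_form \<rho> \<xi> (\<lambda>i. btrans (h i))" using R by (simp add: divide_le_eq mult.commute)
    have ev: "\<forall>\<^sub>F i in \<omega>. norm (\<rho> (btrans (h i) - z i) \<xi>) < e" by (rule n[OF wM[OF h(1)] nw[OF h(1)] h(3)])
    have "lim_form \<rho> \<xi> (\<lambda>i. btrans (h i) - z i) \<le> e * norm \<xi>"
    proof (rule tendsto_upperbound[OF lim_form_tendsto[OF \<rho> C_diff[OF tC[OF h(1)] zC]] _ bot])
      show "\<forall>\<^sub>F i in \<omega>. inner (\<rho> (btrans (h i) - z i) \<xi>) \<xi> \<le> e * norm \<xi>"
        using ev by eventually_elim (rule order_trans[OF norm_cauchy_schwarz mult_right_mono], auto)
    qed
    then have a: "lim_form \<rho> \<xi> (\<lambda>i. btrans (h i)) - lim_form \<rho> \<xi> z \<le> e * norm \<xi>"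
      using lim_form_diff[OF \<rho> tC[OF h(1)] zC, of \<xi>] by simp
    have "e * norm \<xi> < e * (norm \<xi> + 1)" using e by simp
    also have "\<dots> = \<gamma> / (2 * (1 + R))" using n1 by (simp add: e_def)
    also have "\<dots> < \<gamma> / (1 + R)" using \<gamma> R by (simp add: field_simps add_pos_pos)
    finally show ?thesis using a th by linarith
  qed
  have "qpos (\<lambda>i. (x i - z i) - x i)"
  proof (rule xlub)
    show "(\<lambda>i. x i - z i) \<in> q_selfadjoint C I"
      using C_diff[OF xC zC] q_selfadjointD(2)[OF xs]
      by (simp add: q_selfadjoint_def star_diff CD(3)[OF xC] posD(1,2)[OF pz])
    fix d assume d: "d \<in> D"
    obtain f where f: "f \<in> F" "(\<lambda>i. x i - d i - f i) \<in> I" using F1[OF d] by blast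
    show "qpos (\<lambda>i. x i - z i - d i)"
      by (rule qpos_I_add[OF F5[OF f(1)]]) (use f(2) in \<open>simp add: algebra_simps\<close>)
  qed
  from lim_form_qpos_mono[OF \<rho> xC C_diff[OF xC zC] this, of \<xi>]
  show False using zpos lim_form_diff[OF \<rho> xC zC, of \<xi>] by simp
qed

definition vform :: "('h op \<Rightarrow> 'k::chilbert_space op) \<Rightarrow> 'k \<Rightarrow> (nat \<Rightarrow> 'h op) \<Rightarrow> complex" where
  "vform \<rho> \<xi> x = Lim \<omega> (\<lambda>i. cinner (\<rho> (x i) \<xi>) \<xi>)"

lemma vform_tendsto:
  assumes \<rho>: "normal_rep \<zeta> M \<rho>" and x: "x \<in> C"
  shows "((\<lambda>i. cinner (\<rho> (x i) \<xi>) \<xi>) \<longlongrightarrow> vform \<rho> \<xi> x) \<omega>" and Re_vform: "Re (vform \<rho> \<xi> x) = lim_form \<rho> \<xi> x"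
proof -
  obtain K where K: "\<And>i. norm (x i) \<le> K" using CD(5)[OF x] by blast
  have "\<bar>Im (cinner (\<rho> (x i) \<xi>) \<xi>)\<bar> \<le> K * norm \<xi> * norm \<xi>" for i
  proof -
    have "\<bar>Im (cinner (\<rho> (x i) \<xi>) \<xi>)\<bar> \<le> norm (\<rho> (x i) \<xi>) * norm \<xi>"
      by (rule order_trans[OF abs_Im_le_cmod norm_cinner])
    also have "\<dots> \<le> (K * norm \<xi>) * norm \<xi>"
      by (intro mult_right_mono order_trans[OF normal_repD(11)[OF \<rho> SM CD(2)[OF x]]] mult_right_mono K norm_ge_zero)
    finally show ?thesis .
  qed
  then have im: "((\<lambda>i. Im (cinner (\<rho> (x i) \<xi>) \<xi>)) \<longlongrightarrow> Lim \<omega> (\<lambda>i. Im (cinner (\<rho> (x i) \<xi>) \<xi>))) \<omega>"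
    by (rule ultrafilter_tendsto[OF ultra])
  have t: "((\<lambda>i. cinner (\<rho> (x i) \<xi>) \<xi>) \<longlongrightarrow> Complex (lim_form \<rho> \<xi> x) (Lim \<omega> (\<lambda>i. Im (cinner (\<rho> (x i) \<xi>) \<xi>)))) \<omega>"
    unfolding tendsto_complex_iff using im lim_form_tendsto[OF \<rho> x, of \<xi>] by (simp add: Re_cinner)
  have "vform \<rho> \<xi> x = Complex (lim_form \<rho> \<xi> x) (Lim \<omega> (\<lambda>i. Im (cinner (\<rho> (x i) \<xi>) \<xi>)))"
    unfolding vform_def by (rule tendsto_Lim[OF bot t])
  then show "((\<lambda>i. cinner (\<rho> (x i) \<xi>) \<xi>) \<longlongrightarrow> vform \<rho> \<xi> x) \<omega>" "Re (vform \<rho> \<xi> x) = lim_form \<rho> \<xi> x"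
    using t by simp_all
qed

lemma vform_eqI:
  fixes \<rho> :: "'h op \<Rightarrow> 'k::chilbert_space op"
  assumes "((\<lambda>i. cinner (\<rho> (x i) \<xi>) \<xi>) \<longlongrightarrow> l) \<omega>" shows "vform \<rho> \<xi> x = l"
  unfolding vform_def by (rule tendsto_Lim[OF bot assms])

lemma vform_positive:
  assumes \<rho>: "normal_rep \<zeta> M \<rho>" shows "q_positive_functional C I (vform \<rho> \<xi>)"
  unfolding q_positive_functional_def
proof (intro conjI ballI allI)
  note D = normal_repD[OF \<rho> SM]
  fix x assume x: "x \<in> C"
  show "vform \<rho> \<xi> (\<lambda>i. cscale c (x i)) = c * vform \<rho> \<xi> x" for c
    by (rule vform_eqI) (use tendsto_mult[OF tendsto_const vform_tendsto(1)[OF \<rho> x]] in \<open>simp add: D(5)[OF CD(2)[OF x]] cinner_scaleC_left\<close>)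
  fix y assume y: "y \<in> C"
  show "vform \<rho> \<xi> (\<lambda>i. x i + y i) = vform \<rho> \<xi> x + vform \<rho> \<xi> y"
    by (rule vform_eqI) (use tendsto_add[OF vform_tendsto(1)[OF \<rho> x] vform_tendsto(1)[OF \<rho> y]] in
        \<open>simp add: D(6)[OF CD(2)[OF x] CD(2)[OF y]] blinfun.add_left cinner_add_left\<close>)
next
  fix x assume x: "x \<in> I"
  show "vform \<rho> \<xi> x = 0"
  proof (rule vform_eqI, rule Lim_null_comparison)
    show "\<forall>\<^sub>F i in \<omega>. norm (cinner (\<rho> (x i) \<xi>) \<xi>) \<le> norm (\<rho> (x i) \<xi>) * norm \<xi>"
      by (intro always_eventually allI norm_cinner)
    show "((\<lambda>i. norm (\<rho> (x i) \<xi>) * norm \<xi>) \<longlongrightarrow> 0) \<omega>"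
      using tendsto_mult[OF tendsto_norm[OF rep_null[OF \<rho> x]] tendsto_const, of \<xi> "norm \<xi>"] by simp
  qed
next
  note D = normal_repD[OF \<rho> SM]
  fix c assume c: "c \<in> C"
  let ?x = "\<lambda>i. star (c i) o\<^sub>L c i"
  have xC: "?x \<in> C" by (intro C_compose C_star c)
  have eq: "cinner (\<rho> (?x i) \<xi>) \<xi> = of_real ((norm (\<rho> (c i) \<xi>))\<^sup>2)" for i
  proof -
    have "cinner (\<rho> (?x i) \<xi>) \<xi> = cinner (star (\<rho> (c i)) (\<rho> (c i) \<xi>)) \<xi>"
      using D(7)[OF MD(5)[OF CD(2)[OF c]] CD(2)[OF c]] D(4)[OF CD(2)[OF c]] by simp
    also have "\<dots> = cinner (\<rho> (c i) \<xi>) (\<rho> (c i) \<xi>)"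
      using star_cinner[OF star_bounded_ops[OF D(2)[OF CD(2)[OF c]]]] star_star[OF D(2)[OF CD(2)[OF c]]] by simp
    finally show ?thesis by (simp add: cinner_same)
  qed
  have t: "((\<lambda>i. of_real ((norm (\<rho> (c i) \<xi>))\<^sup>2)) \<longlongrightarrow> vform \<rho> \<xi> ?x) \<omega>"
    using vform_tendsto(1)[OF \<rho> xC, of \<xi>] by (simp only: eq)
  have "((\<lambda>i. 0) \<longlongrightarrow> Im (vform \<rho> \<xi> ?x)) \<omega>" using tendsto_Im[OF t] by simp
  then have "Im (vform \<rho> \<xi> ?x) = 0" using tendsto_unique[OF bot _ tendsto_const] by metis
  then show "vform \<rho> \<xi> ?x \<in> \<real>" by (simp add: complex_is_Real_iff)
  show "0 \<le> Re (vform \<rho> \<xi> ?x)"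
    by (rule tendsto_lowerbound[OF tendsto_Re[OF t] _ bot]) simp
qed

text \<open>This is what allows \<open>q_sums\<close> to be evaluated on vectors.\<close>

theorem vform_normal:
  assumes \<rho>: "normal_rep \<zeta> M \<rho>" shows "q_normal_functional C I (vform \<rho> \<xi>)"
  unfolding q_normal_functional_def
proof (intro conjI allI impI)
  show "q_positive_functional C I (vform \<rho> \<xi>)" by (rule vform_positive[OF \<rho>])
  fix D x assume "q_directed C I D \<and> q_is_lub C I D x"
  then have D: "q_directed C I D" and x: "q_is_lub C I D x" by auto
  have DC: "d \<in> C" if "d \<in> D" for d using D that by (auto simp: q_directed_def q_selfadjoint_def)
  have xC: "x \<in> C" using x by (auto simp: q_is_lub_def q_selfadjoint_def)
  have up: "Re (vform \<rho> \<xi> d) \<le> Re (vform \<rho> \<xi> x)" if d: "d \<in> D" for d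
    unfolding Re_vform[OF \<rho> DC[OF d]] Re_vform[OF \<rho> xC]
    by (rule lim_form_qpos_mono[OF \<rho> DC[OF d] xC]) (use x d in \<open>auto simp: q_is_lub_def q_le_iff\<close>)
  have ne: "D \<noteq> {}" using D by (simp add: q_directed_def)
  have bdd: "bdd_above ((\<lambda>d. Re (vform \<rho> \<xi> d)) ` D)" using up by (auto intro!: bdd_aboveI2)
  show "Re (vform \<rho> \<xi> x) = (SUP d\<in>D. Re (vform \<rho> \<xi> d))"
  proof (rule antisym)
    show "(SUP d\<in>D. Re (vform \<rho> \<xi> d)) \<le> Re (vform \<rho> \<xi> x)" by (rule cSUP_least[OF ne up])
    show "Re (vform \<rho> \<xi> x) \<le> (SUP d\<in>D. Re (vform \<rho> \<xi> d))"
      unfolding Re_vform[OF \<rho> xC]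
      by (rule lim_form_lub_le[OF \<rho> D x]) (use cSUP_upper[OF _ bdd] Re_vform[OF \<rho> DC] in force)
  qed
qed

subsection \<open>Averaging over central projections\<close>

lemma q_projectionD:
  assumes "q_projection C I p"
  shows "p \<in> C" "(\<lambda>i. star (p i) - p i) \<in> I" "(\<lambda>i. (star (p i) o\<^sub>L p i) - p i) \<in> I"
    "(\<lambda>i. (p i o\<^sub>L star (p i)) - p i) \<in> I"
proof -
  show 1: "p \<in> C" "(\<lambda>i. star (p i) - p i) \<in> I" using assms by (auto simp: q_projection_def)
  have 2: "(\<lambda>i. (p i o\<^sub>L p i) - p i) \<in> I" using assms by (auto simp: q_projection_def)
  show "(\<lambda>i. (star (p i) o\<^sub>L p i) - p i) \<in> I" "(\<lambda>i. (p i o\<^sub>L star (p i)) - p i) \<in> I"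
    using I_add[OF I_C[OF 1(2,1)] 2] I_add[OF C_I[OF 1(2,1)] 2] by (simp_all add: compose_diff_left compose_diff_right)
qed

lemma projection_norm_tendsto:
  assumes \<rho>: "normal_rep \<zeta> M \<rho>" and p: "q_projection C I p"
  shows "((\<lambda>i. (norm (\<rho> (star (p i)) \<xi>))\<^sup>2) \<longlongrightarrow> lim_form \<rho> \<xi> p) \<omega>"
proof -
  note D = normal_repD[OF \<rho> SM] and pD = q_projectionD[OF p]
  have pM: "p i \<in> M" for i by (rule CD(2)[OF pD(1)])
  have pp: "(\<lambda>i. p i o\<^sub>L star (p i)) \<in> C" by (intro C_compose C_star pD)
  have "(norm (\<rho> (star (p i)) \<xi>))\<^sup>2 = inner (\<rho> (p i o\<^sub>L star (p i)) \<xi>) \<xi>" for i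
    using star_inner[OF D(2)[OF pM], of i "\<rho> (star (p i)) \<xi>" \<xi>]
    by (simp add: power2_norm_eq_inner D(7)[OF pM MD(5)[OF pM]] D(4)[OF pM])
  then show ?thesis
    using lim_form_tendsto[OF \<rho> pp, of \<xi>] lim_form_cong_I[OF \<rho> pp pD(1,4), of \<xi>] by simp
qed

text \<open>Polarization, with a correction term because the entries of \<open>p\<close> are
  selfadjoint only up to a null sequence.\<close>

lemma projection_inner_tendsto:
  assumes p: "q_projection C I p"
  shows "((\<lambda>i. inner (p i h) k) \<longlongrightarrow> (lim_form (\<lambda>a. a) (h + k) p - lim_form (\<lambda>a. a) (h - k) p) / 4) \<omega>"
proof -
  note pD = q_projectionD[OF p]
  let ?q = "\<lambda>i v. inner (p i v) v"
  have eq: "inner (p i h) k = (?q i (h + k) - ?q i (h - k)) / 4 - inner ((star (p i) - p i) h) k / 2" for i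
    using star_inner_left[OF CD(3)[OF pD(1)], of i h k]
    by (simp add: blinfun.add_right blinfun.diff_right blinfun.diff_left inner_add inner_diff inner_commute field_simps)
  have "((\<lambda>i. (?q i (h + k) - ?q i (h - k)) / 4 - inner ((star (p i) - p i) h) k / 2)
      \<longlongrightarrow> (lim_form (\<lambda>a. a) (h + k) p - lim_form (\<lambda>a. a) (h - k) p) / 4 - inner 0 k / 2) \<omega>"
    by (intro tendsto_diff tendsto_divide tendsto_const lim_form_tendsto[OF normal_rep_id pD(1)] tendsto_inner ID(4)[OF pD(2)]) auto
  then show ?thesis by (simp add: eq)
qed

lemma lim_form_sums:
  assumes \<rho>: "normal_rep \<zeta> M \<rho>" and p: "\<And>j. q_projection C I (p j)" and s: "q_sums C I p (\<lambda>_. id_blinfun)"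
  shows "(\<lambda>j. lim_form \<rho> \<xi> (p j)) sums (norm \<xi>)\<^sup>2"
proof -
  have "(\<lambda>j. vform \<rho> \<xi> (p j)) sums vform \<rho> \<xi> (\<lambda>_. id_blinfun)"
    using s vform_normal[OF \<rho>] by (auto simp: q_sums_def)
  from sums_Re[OF this] have "(\<lambda>j. lim_form \<rho> \<xi> (p j)) sums lim_form \<rho> \<xi> (\<lambda>_. id_blinfun)"
    by (simp only: Re_vform[OF \<rho> q_projectionD(1)[OF p]] Re_vform[OF \<rho> C_id])
  moreover have "lim_form \<rho> \<xi> (\<lambda>_. id_blinfun) = (norm \<xi>)\<^sup>2"
    by (rule lim_form_eqI) (simp add: normal_repD(8)[OF \<rho> SM] power2_norm_eq_inner)
  ultimately show ?thesis by simp
qed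

text \<open>Before the limit the averages are bounded only by a constant depending on
  \<open>J\<close>. In the limit, \<open>inner (y \<xi>) \<eta>\<close> is at most
  \<open>norm x\<close> times the mean of the sums of the limits of the squared norms of
  \<open>pi_rep (star (p j i))\<close> at \<open>\<xi>\<close> and at \<open>\<eta>\<close>; these
  are partial sums of nonnegative series with sums equal to the squared norms of
  \<open>\<xi>\<close> and \<open>\<eta>\<close>.\<close>

lemma partial_average:
  assumes p: "\<And>j. q_projection C I (p j)" and s: "q_sums C I p (\<lambda>_. id_blinfun)"
    and Q: "von_neumann_algebra Q" "\<And>a. a \<in> N \<Longrightarrow> pi_rep a \<in> Q" and x: "x \<in> Q"
  shows "\<exists>y\<in>Q. norm y \<le> norm x \<and> (\<forall>\<xi> \<eta>. ((\<lambda>i. \<Sum>j<J. inner (pi_rep (p j i) (blinfun_apply x (pi_rep (star (p j i)) \<xi>))) \<eta>)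
      \<longlongrightarrow> inner (blinfun_apply y \<xi>) \<eta>) \<omega>)"
proof -
  note QD = star_algD[OF vn_star_alg[OF Q(1)]]
  have pC: "p j \<in> C" for j by (rule q_projectionD(1)[OF p])
  have pN: "p j i \<in> N" and pM: "p j i \<in> M" for j i using CD(1,2)[OF pC] by auto
  define f where "f i = (\<Sum>j<J. pi_rep (p j i) o\<^sub>L (x o\<^sub>L pi_rep (star (p j i))))" for i
  have fa: "inner (f i \<xi>) \<eta> = (\<Sum>j<J. inner (pi_rep (p j i) (x (pi_rep (star (p j i)) \<xi>))) \<eta>)" for i \<xi> \<eta>
    by (simp add: f_def blinfun.sum_left inner_sum_left)
  have fQ: "f i \<in> Q" for i unfolding f_def
    by (rule star_alg_sum[OF vn_star_alg[OF Q(1)]]) (rule QD(4)[OF Q(2)[OF pN] QD(4)[OF x Q(2)[OF ND(5)[OF pN]]]])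
  have "\<forall>j. \<exists>K>0. \<forall>i. norm (p j i) \<le> K" using CD(5)[OF pC] by blast
  then obtain K where K: "\<And>j. K j > 0" "\<And>j i. norm (p j i) \<le> K j" by metis
  have bd: "norm (f i) \<le> (\<Sum>j<J. K j * (norm x * K j))" for i
    unfolding f_def
  proof (rule sum_norm_le)
    fix j
    have a: "norm (pi_rep (p j i)) \<le> K j" by (rule order_trans[OF norm_pi[OF pM] K(2)])
    have b: "norm (pi_rep (star (p j i))) \<le> K j"
      by (rule order_trans[OF norm_pi[OF MD(5)[OF pM]]]) (simp add: norm_star[OF MD(1)[OF pM]] K(2))
    have "norm (x o\<^sub>L pi_rep (star (p j i))) \<le> norm x * K j"
      by (rule order_trans[OF norm_blinfun_compose mult_left_mono[OF b norm_ge_zero]])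
    then show "norm (pi_rep (p j i) o\<^sub>L (x o\<^sub>L pi_rep (star (p j i)))) \<le> K j * (norm x * K j)"
      by (rule order_trans[OF norm_blinfun_compose mult_mono[OF a]]) (use K(1)[of j] in auto)
  qed
  obtain y where yQ: "y \<in> Q" and y: "\<And>\<xi> \<eta>. ((\<lambda>i. inner (f i \<xi>) \<eta>) \<longlongrightarrow> inner (y \<xi>) \<eta>) \<omega>"
    using vn_ultrafilter_limit[where f = f, OF ultra Q(1) fQ bd] by blast
  have t: "((\<lambda>i. \<Sum>j<J. (norm (pi_rep (star (p j i)) \<xi>))\<^sup>2) \<longlongrightarrow> (\<Sum>j<J. lim_form pi_rep \<xi> (p j))) \<omega>" for \<xi>
    by (intro tendsto_sum projection_norm_tendsto normal_rep_pi p)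
  have l0: "0 \<le> lim_form pi_rep \<xi> (p j)" for j \<xi>
    by (rule tendsto_lowerbound[OF projection_norm_tendsto[OF normal_rep_pi p] _ bot]) simp
  have le: "(\<Sum>j<J. lim_form pi_rep \<xi> (p j)) \<le> (norm \<xi>)\<^sup>2" for \<xi>
    using lim_form_sums[OF normal_rep_pi p s, of \<xi>] l0
    by (metis finite_lessThan sum_le_suminf sums_iff)
  have ny: "norm y \<le> norm x"
  proof (rule norm_le_of_quadratic[OF norm_ge_zero])
    fix \<xi> \<eta> :: "('g, 'h) ell2"
    let ?n = "\<lambda>i v. \<Sum>j<J. (norm (pi_rep (star (p j i)) v))\<^sup>2"
    have bound: "inner (f i \<xi>) \<eta> \<le> norm x * ((?n i \<xi> + ?n i \<eta>) / 2)" for i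
    proof -
      have "inner (pi_rep (p j i) (x (pi_rep (star (p j i)) \<xi>))) \<eta>
          \<le> norm x * (((norm (pi_rep (star (p j i)) \<xi>))\<^sup>2 + (norm (pi_rep (star (p j i)) \<eta>))\<^sup>2) / 2)" for j
      proof -
        let ?u = "pi_rep (star (p j i)) \<xi>" and ?v = "pi_rep (star (p j i)) \<eta>"
        have "inner (pi_rep (p j i) (x ?u)) \<eta> = inner (x ?u) ?v"
          using star_inner[OF pi_bounded_ops[OF pM], of j i "x ?u" \<eta>] by (simp add: pi_star[OF pM])
        also have "\<dots> \<le> norm (x ?u) * norm ?v" by (rule norm_cauchy_schwarz)
        also have "\<dots> \<le> (norm x * norm ?u) * norm ?v" by (intro mult_right_mono norm_blinfun) simp
        also have "\<dots> = norm x * (norm ?u * norm ?v)" by simp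
        also have "\<dots> \<le> norm x * (((norm ?u)\<^sup>2 + (norm ?v)\<^sup>2) / 2)"
          using sum_squares_bound[of "norm ?u" "norm ?v"] by (intro mult_left_mono) auto
        finally show ?thesis .
      qed
      then have "(\<Sum>j<J. inner (pi_rep (p j i) (x (pi_rep (star (p j i)) \<xi>))) \<eta>)
          \<le> (\<Sum>j<J. norm x * (((norm (pi_rep (star (p j i)) \<xi>))\<^sup>2 + (norm (pi_rep (star (p j i)) \<eta>))\<^sup>2) / 2))"
        by (rule sum_mono)
      then show ?thesis unfolding fa by (simp add: sum.distrib flip: sum_distrib_left sum_divide_distrib)
    qed
    have "((\<lambda>i. norm x * ((?n i \<xi> + ?n i \<eta>) / 2)) \<longlongrightarrow>
        norm x * (((\<Sum>j<J. lim_form pi_rep \<xi> (p j)) + (\<Sum>j<J. lim_form pi_rep \<eta> (p j))) / 2)) \<omega>"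
      by (intro tendsto_mult tendsto_const tendsto_divide tendsto_add t) simp
    then have "inner (y \<xi>) \<eta> \<le> norm x * (((\<Sum>j<J. lim_form pi_rep \<xi> (p j)) + (\<Sum>j<J. lim_form pi_rep \<eta> (p j))) / 2)"
      by (rule tendsto_le[OF bot _ y always_eventually]) (rule allI, rule bound)
    also have "\<dots> \<le> norm x * (((norm \<xi>)\<^sup>2 + (norm \<eta>)\<^sup>2) / 2)"
      using le[of \<xi>] le[of \<eta>] by (intro mult_left_mono) auto
    finally show "inner (y \<xi>) \<eta> \<le> norm x * (((norm \<xi>)\<^sup>2 + (norm \<eta>)\<^sup>2) / 2)" .
  qed
  show ?thesis using yQ ny y by (intro bexI[of _ y]) (auto simp: fa)
qed

text \<open>Centrality of \<open>p\<close> is applied to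
  \<open>X = a o\<^sub>L \<alpha> s (star (p i))\<close>, which varies with \<open>i\<close> but
  stays bounded in \<open>M\<close>. The factor \<open>p i\<close> thus moves next to
  \<open>\<alpha> s (star (p i))\<close>, and \<open>a\<close> no longer separates them.\<close>

lemma compressed_coefficient_tendsto:
  assumes p: "q_projection C I p" and a: "a \<in> M"
    and l: "((\<lambda>i. inner (\<alpha> s (star (p i)) (p i h)) (star a k)) \<longlongrightarrow> l) \<omega>"
  shows "((\<lambda>i. inner (p i (blinfun_apply a (\<alpha> s (star (p i)) h))) k) \<longlongrightarrow> l) \<omega>"
proof -
  note pC = q_projectionD(1)[OF p]
  obtain K where K: "K > 0" "\<And>i. norm (p i) \<le> K" using CD(5)[OF pC] by blast
  have pM: "p i \<in> M" for i by (rule CD(2)[OF pC])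
  let ?X = "\<lambda>i. a o\<^sub>L \<alpha> s (star (p i))"
  have XM: "?X i \<in> M" for i by (intro MD(4) a aD(1) MD(5) pM)
  have nX: "norm (?X i) \<le> norm a * K" for i
  proof (rule order_trans[OF norm_blinfun_compose mult_left_mono[OF _ norm_ge_zero]])
    show "norm (\<alpha> s (star (p i))) \<le> K"
      by (rule order_trans[OF norm_alpha[OF MD(5)[OF pM]]]) (simp add: norm_star[OF MD(1)[OF pM]] K(2))
  qed
  have "((\<lambda>i. inner (p i (?X i h)) k - inner (?X i (p i h)) k) \<longlongrightarrow> 0) \<omega>"
  proof (rule tendstoI)
    fix e :: real assume e: "e > 0"
    define d where "d = e / (norm a * K + 1)"
    have q: "norm a * K + 1 > 0" using K by (simp add: add_nonneg_pos)
    have "d > 0" using e q by (simp add: d_def)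
    from C_inner_central[OF pC this, of h k]
    show "\<forall>\<^sub>F i in \<omega>. dist (inner (p i (?X i h)) k - inner (?X i (p i h)) k) 0 < e"
    proof eventually_elim
      case (elim i)
      have "\<bar>inner (p i (?X i h)) k - inner (?X i (p i h)) k\<bar> \<le> d * norm (?X i)" by (rule elim[rule_format, OF XM])
      also have "\<dots> \<le> d * (norm a * K)" using nX \<open>d > 0\<close> by (intro mult_left_mono) auto
      also have "\<dots> < d * (norm a * K + 1)" using \<open>d > 0\<close> by simp
      also have "\<dots> = e" using q by (simp add: d_def)
      finally show ?case by simp
    qed
  qed
  moreover have "inner (?X i (p i h)) k = inner (\<alpha> s (star (p i)) (p i h)) (star a k)" for i
    using star_inner[OF MD(1)[OF a], of "\<alpha> s (star (p i)) (p i h)" k] by simp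
  ultimately have "((\<lambda>i. inner (p i (?X i h)) k - inner (\<alpha> s (star (p i)) (p i h)) (star a k)) \<longlongrightarrow> 0) \<omega>" by simp
  from tendsto_add[OF this l] show ?thesis by simp
qed

text \<open>The case of the neutral element: \<open>star p p\<close> agrees with \<open>p\<close>
  modulo null sequences, so the compression of \<open>a\<close> behaves like \<open>a p\<close>, and
  the sum over all projections will return \<open>a\<close>.\<close>

lemma diagonal_coefficient_tendsto:
  assumes p: "q_projection C I p" and a: "a \<in> M"
  shows "((\<lambda>i. inner (p i (blinfun_apply a (star (p i) h))) k) \<longlongrightarrow>
    (lim_form (\<lambda>a. a) (h + star a k) p - lim_form (\<lambda>a. a) (h - star a k) p) / 4) \<omega>"
proof -
  note pD = q_projectionD[OF p]
  have "((\<lambda>i. inner (((star (p i) o\<^sub>L p i) - p i) h) (star a k)) \<longlongrightarrow> inner 0 (star a k)) \<omega>"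
    by (intro tendsto_inner ID(4)[OF pD(3)] tendsto_const)
  from tendsto_add[OF this projection_inner_tendsto[OF p, of h "star a k"]]
  have "((\<lambda>i. inner (\<alpha> 0 (star (p i)) (p i h)) (star a k)) \<longlongrightarrow>
      (lim_form (\<lambda>a. a) (h + star a k) p - lim_form (\<lambda>a. a) (h - star a k) p) / 4) \<omega>"
    by (simp add: alpha_zero[OF MD(5)[OF CD(2)[OF pD(1)]]] blinfun.diff_left inner_diff_left)
  from compressed_coefficient_tendsto[OF p a this] show ?thesis
    by (simp add: alpha_zero[OF MD(5)[OF CD(2)[OF pD(1)]]])
qed

text \<open>Up to a null sequence, \<open>\<alpha> s (star p) p\<close> is the adjoint of
  \<open>p\<close> times \<open>\<alpha> s p\<close>, and the latter is null by freeness.\<close>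

lemma free_coefficient_tendsto:
  assumes p: "q_projection C I p" and a: "a \<in> M" and free: "(\<lambda>i. p i o\<^sub>L \<alpha> s (p i)) \<in> null_sequences \<omega> M"
  shows "((\<lambda>i. inner (p i (blinfun_apply a (\<alpha> s (star (p i)) h))) k) \<longlongrightarrow> 0) \<omega>"
proof (rule compressed_coefficient_tendsto[OF p a])
  note pD = q_projectionD[OF p]
  have pM: "p i \<in> M" for i by (rule CD(2)[OF pD(1)])
  obtain K where K: "K > 0" "\<And>i. norm (p i) \<le> K" using CD(5)[OF pD(1)] by blast
  have n: "norm (\<alpha> s (star (p i))) \<le> K" for i
    by (rule order_trans[OF norm_alpha[OF MD(5)[OF pM]]]) (simp add: norm_star[OF MD(1)[OF pM]] K(2))
  have 1: "((\<lambda>i. star (p i o\<^sub>L \<alpha> s (p i)) h) \<longlongrightarrow> 0) \<omega>" using free by (simp add: null_sequences_def)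
  have 2: "((\<lambda>i. \<alpha> s (star (p i)) ((star (p i) - p i) h)) \<longlongrightarrow> 0) \<omega>"
    by (rule tendsto_zero_bounded_apply[OF n ID(4)[OF pD(2)]])
  have "\<alpha> s (star (p i)) (p i h) = star (p i o\<^sub>L \<alpha> s (p i)) h - \<alpha> s (star (p i)) ((star (p i) - p i) h)" for i
    by (simp add: star_compose[OF MD(1)[OF pM] MD(1)[OF aD(1)[OF pM]]] aD(5)[OF pM, symmetric] blinfun.diff_left blinfun.diff_right)
  then have "((\<lambda>i. \<alpha> s (star (p i)) (p i h)) \<longlongrightarrow> 0) \<omega>" using tendsto_diff[OF 1 2] by simp
  from tendsto_inner[OF this tendsto_const, of "star a k"]
  show "((\<lambda>i. inner (\<alpha> s (star (p i)) (p i h)) (star a k)) \<longlongrightarrow> 0) \<omega>" by simp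
qed

section \<open>Removal of Fourier coefficients\<close>

lemma matrix_entry_conjugate:
  assumes q: "q \<in> M"
  shows "inner (pi_rep q (blinfun_apply x (pi_rep (star q) (ell2_single u h)))) (ell2_single 0 k)
    = inner (q (entry x 0 u (\<alpha> (- u) (star q) h))) k"
proof -
  have "inner (pi_rep q (blinfun_apply x (pi_rep (star q) (ell2_single u h)))) (ell2_single 0 k)
      = inner (x (ell2_single u (\<alpha> (- u) (star q) h))) (ell2_single 0 (star q k))"
    using star_inner[OF pi_bounded_ops[OF q], of "x (pi_rep (star q) (ell2_single u h))" "ell2_single 0 k"]
    by (simp add: pi_star[OF q] pi_single[OF MD(5)[OF q]] alpha_zero[OF MD(5)[OF q]])
  also have "\<dots> = inner (q (entry x 0 u (\<alpha> (- u) (star q) h))) k"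
    using star_inner[OF MD(1)[OF q], of "entry x 0 u (\<alpha> (- u) (star q) h)" k] by (simp add: inner_entry)
  finally show ?thesis .
qed

lemma remove_coefficient:
  assumes free: "centrally_free \<omega> \<alpha> N M"
    and Q: "von_neumann_algebra Q" "\<And>a. a \<in> N \<Longrightarrow> pi_rep a \<in> Q" "Q \<subseteq> crossed_product \<alpha> M"
    and x: "x \<in> Q" and u: "u \<noteq> 0"
  shows "\<exists>y\<in>Q. norm y \<le> norm x \<and> entry y 0 0 = entry x 0 0 \<and> entry y 0 u = 0
    \<and> (\<forall>v. entry x 0 v = 0 \<longrightarrow> entry y 0 v = 0)"
proof -
  have "\<forall>s. s \<noteq> 0 \<longrightarrow> (\<exists>p. (\<forall>j. q_projection C I (p j)) \<and> q_sums C I p (\<lambda>_. id_blinfun) \<and>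
      (\<forall>j. (\<lambda>i. p j i o\<^sub>L \<alpha> s (p j i)) \<in> null_sequences \<omega> M))"
    using free unfolding centrally_free_def Let_def C_def[symmetric] I_def[symmetric] .
  \<comment> \<open>Conjugation turns the entry \<open>a\<close> at \<open>(0, u)\<close> into
    \<open>p a\<close> followed by \<open>\<alpha> (- u) (star p)\<close>; freeness is therefore
    invoked for the inverse of \<open>u\<close>.\<close>
  from this[rule_format, of "- u"] u obtain p where p: "\<And>j. q_projection C I (p j)" "q_sums C I p (\<lambda>_. id_blinfun)"
    "\<And>j. (\<lambda>i. p j i o\<^sub>L \<alpha> (- u) (p j i)) \<in> null_sequences \<omega> M"
    by auto
  have pM: "p j i \<in> M" for j i by (rule CD(2)[OF q_projectionD(1)[OF p(1)]])
  have aM: "entry x 0 v \<in> M" for v using x Q(3) entry_M by blast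
  have "\<forall>J. \<exists>y. y \<in> Q \<and> norm y \<le> norm x \<and> (\<forall>\<xi> \<eta>. ((\<lambda>i. \<Sum>j<J. inner (pi_rep (p j i) (blinfun_apply x (pi_rep (star (p j i)) \<xi>))) \<eta>)
      \<longlongrightarrow> inner (blinfun_apply y \<xi>) \<eta>) \<omega>)"
    using partial_average[OF p(1,2) Q(1,2) x] by blast
  from choice[OF this] obtain g where g: "\<And>J. g J \<in> Q" "\<And>J. norm (g J) \<le> norm x"
    "\<And>J \<xi> \<eta>. ((\<lambda>i. \<Sum>j<J. inner (pi_rep (p j i) (x (pi_rep (star (p j i)) \<xi>))) \<eta>) \<longlongrightarrow> inner (g J \<xi>) \<eta>) \<omega>"
    by blast
  \<comment> \<open>A second limit, over the number of projections. It exists because the bound on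
    the partial averages does not depend on \<open>J\<close>.\<close>
  obtain y where yQ: "y \<in> Q" and y: "norm y \<le> norm x"
    "\<And>\<xi> \<eta>. ((\<lambda>J. inner (g J \<xi>) \<eta>) \<longlongrightarrow> inner (y \<xi>) \<eta>) \<omega>"
    using vn_ultrafilter_limit[where f = g, OF ultra Q(1) g(1,2)] by blast
  have ge: "((\<lambda>i. \<Sum>j<J. inner (p j i (entry x 0 v (\<alpha> (- v) (star (p j i)) h))) k) \<longlongrightarrow> inner (entry (g J) 0 v h) k) \<omega>" for J v h k
    unfolding inner_entry[of "g J"] matrix_entry_conjugate[OF pM, symmetric] by (rule g(3))
  have ye: "((\<lambda>J. inner (entry (g J) 0 v h) k) \<longlongrightarrow> inner (entry y 0 v h) k) \<omega>" for v h k
    unfolding inner_entry by (rule y(2))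
  have eqI: "entry y 0 v = b" if "\<And>h k. ((\<lambda>J. inner (entry (g J) 0 v h) k) \<longlongrightarrow> inner (b h) k) \<omega>" for v and b :: "'h op"
  proof (rule blinfun_eqI, rule inner_eqI)
    show "inner (entry y 0 v h) k = inner (b h) k" for h k by (rule tendsto_unique[OF bot ye that])
  qed
  have zero: "entry y 0 v = 0"
    if "\<And>j h k. ((\<lambda>i. inner (p j i (entry x 0 v (\<alpha> (- v) (star (p j i)) h))) k) \<longlongrightarrow> 0) \<omega>" for v
  proof (rule eqI)
    fix h k
    have "inner (entry (g J) 0 v h) k = 0" for J
      by (rule tendsto_unique[OF bot ge]) (use tendsto_sum[of "{..<J}", OF that] in simp)
    then show "((\<lambda>J. inner (entry (g J) 0 v h) k) \<longlongrightarrow> inner ((0 :: 'h op) h) k) \<omega>" by simp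
  qed
  have "entry y 0 u = 0" by (rule zero) (rule free_coefficient_tendsto[OF p(1) aM p(3)])
  moreover have "entry y 0 v = 0" if "entry x 0 v = 0" for v by (rule zero) (simp add: that)
  moreover have "entry y 0 0 = entry x 0 0"
  proof (rule eqI)
    fix h k
    let ?a = "entry x 0 0" and ?l = "\<lambda>v j. lim_form (\<lambda>a. a) v (p j)"
    let ?k = "star ?a k"
    \<comment> \<open>By polarization the entry is a partial sum of two series whose sums are known
      squared norms, and these recombine to \<open>inner (?a h) k\<close>.\<close>
    have "inner (entry (g J) 0 0 h) k = (\<Sum>j<J. (?l (h + ?k) j - ?l (h - ?k) j) / 4)" for J
    proof (rule tendsto_unique[OF bot ge])
      show "((\<lambda>i. \<Sum>j<J. inner (p j i (?a (\<alpha> (- 0) (star (p j i)) h))) k) \<longlongrightarrow> (\<Sum>j<J. (?l (h + ?k) j - ?l (h - ?k) j) / 4)) \<omega>"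
        using tendsto_sum[of "{..<J}", OF diagonal_coefficient_tendsto[OF p(1) aM]] by (simp add: alpha_zero[OF MD(5)[OF pM]])
    qed
    moreover have "(\<lambda>J. \<Sum>j<J. (?l (h + ?k) j - ?l (h - ?k) j) / 4) \<longlonglongrightarrow> ((norm (h + ?k))\<^sup>2 - (norm (h - ?k))\<^sup>2) / 4"
      using sums_divide[OF sums_diff[OF lim_form_sums[OF normal_rep_id p(1,2)] lim_form_sums[OF normal_rep_id p(1,2)]]]
      by (simp only: sums_def)
    moreover have "((norm (h + ?k))\<^sup>2 - (norm (h - ?k))\<^sup>2) / 4 = inner (?a h) k"
      using star_inner[OF MD(1)[OF aM], of 0 h k] by (simp add: power2_norm_eq_inner inner_add inner_diff inner_commute)
    ultimately have "(\<lambda>J. inner (entry (g J) 0 0 h) k) \<longlonglongrightarrow> inner (?a h) k" by simp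
    then show "((\<lambda>J. inner (entry (g J) 0 0 h) k) \<longlongrightarrow> inner (?a h) k) \<omega>"
      by (rule tendsto_mono[rotated]) (use ultra in \<open>simp add: free_ultrafilter_def cofinite_eq_sequentially\<close>)
  qed
  ultimately show ?thesis using yQ y(1) by blast
qed

text \<open>The coefficients at \<open>u \<noteq> 0\<close> are removed one at a time.\<close>

lemma expectation_mem:
  assumes free: "centrally_free \<omega> \<alpha> N M"
    and Q: "von_neumann_algebra Q" "\<And>a. a \<in> N \<Longrightarrow> pi_rep a \<in> Q" "Q \<subseteq> crossed_product \<alpha> M"
    and x: "x \<in> Q"
  shows "pi_rep (entry x 0 0) \<in> Q"
proof -
  have aM: "entry x 0 0 \<in> M" using x Q(3) entry_M by blast
  have "\<exists>y\<in>Q. norm y \<le> norm x \<and> entry y 0 0 = entry x 0 0 \<and> (\<forall>m<n. (from_nat m :: 'g) \<noteq> 0 \<longrightarrow> entry y 0 (from_nat m) = 0)" for n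
  proof (induction n)
    case 0 then show ?case using x by auto
  next
    case (Suc n)
    then obtain y where y: "y \<in> Q" "norm y \<le> norm x" "entry y 0 0 = entry x 0 0"
      "\<And>m. m < n \<Longrightarrow> (from_nat m :: 'g) \<noteq> 0 \<Longrightarrow> entry y 0 (from_nat m) = 0" by blast
    show ?case
    proof (cases "(from_nat n :: 'g) = 0")
      case True
      then show ?thesis using y by (intro bexI[of _ y]) (auto simp: less_Suc_eq)
    next
      case False
      obtain z where "z \<in> Q" "norm z \<le> norm y" "entry z 0 0 = entry y 0 0" "entry z 0 (from_nat n) = 0"
        "\<And>v. entry y 0 v = 0 \<Longrightarrow> entry z 0 v = 0"
        using remove_coefficient[OF free Q y(1) False] by blast
      then show ?thesis using y by (intro bexI[of _ z]) (auto simp: less_Suc_eq)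
    qed
  qed
  then have "\<forall>n. \<exists>y. y \<in> Q \<and> norm y \<le> norm x \<and> entry y 0 0 = entry x 0 0 \<and> (\<forall>m<n. (from_nat m :: 'g) \<noteq> 0 \<longrightarrow> entry y 0 (from_nat m) = 0)" by blast
  from choice[OF this] obtain f where f: "\<And>n. f n \<in> Q" "\<And>n. norm (f n) \<le> norm x" "\<And>n. entry (f n) 0 0 = entry x 0 0"
    "\<And>n m. m < n \<Longrightarrow> (from_nat m :: 'g) \<noteq> 0 \<Longrightarrow> entry (f n) 0 (from_nat m) = 0" by blast
  obtain y where yQ: "y \<in> Q" and y: "\<And>\<xi> \<eta>. ((\<lambda>n. inner (f n \<xi>) \<eta>) \<longlongrightarrow> inner (y \<xi>) \<eta>) \<omega>"
    using vn_ultrafilter_limit[where f = f, OF ultra Q(1) f(1,2)] by blast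
  have ye: "((\<lambda>n. inner (entry (f n) 0 v h) k) \<longlongrightarrow> inner (entry y 0 v h) k) \<omega>" for v h k
    unfolding inner_entry by (rule y)
  have row: "entry y 0 v = (if v = 0 then entry x 0 0 else 0)" for v
  proof (rule blinfun_eqI, rule inner_eqI)
    fix h k
    have "((\<lambda>n. inner (entry (f n) 0 v h) k) \<longlongrightarrow> inner ((if v = 0 then entry x 0 0 else 0) h) k) \<omega>"
    proof (rule tendsto_eventually)
      show "\<forall>\<^sub>F n in \<omega>. inner (entry (f n) 0 v h) k = inner ((if v = 0 then entry x 0 0 else 0) h) k"
        \<comment> \<open>Stage \<open>n\<close> has removed the coefficients with numbers strictly
          below \<open>n\<close>, thus the one at \<open>v\<close> from stage
          \<open>Suc (to_nat v)\<close> on.\<close>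
        using free_ultrafilterD(3)[OF ultra, of "Suc (to_nat v)"]
      proof eventually_elim
        case (elim n)
        then have "entry (f n) 0 v = (if v = 0 then entry x 0 0 else 0)" using f(3) f(4)[of "to_nat v" n] by auto
        then show ?case by simp
      qed
    qed
    then show "inner (entry y 0 v h) k = inner ((if v = 0 then entry x 0 0 else 0) h) k" by (rule tendsto_unique[OF bot ye])
  qed
  have yX: "y \<in> crossed_product \<alpha> M" using yQ Q(3) by blast
  have "y = pi_rep (entry x 0 0)"
  proof (rule entry_eqI)
    fix s t
    show "entry y s t = entry (pi_rep (entry x 0 0)) s t"
      by (subst entry_from_row[OF yX]) (auto simp: row entry_pi[OF aM] aD(7))
  qed
  then show ?thesis using yQ by simp
qed

section \<open>Intermediate algebras are crossed products\<close>

lemma coefficient_mem: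
  assumes free: "centrally_free \<omega> \<alpha> N M"
    and Q: "Q \<in> intermediate_vn (crossed_product \<alpha> N) (crossed_product \<alpha> M)" and x: "x \<in> Q"
  shows "pi_rep (entry x 0 u) \<in> Q"
proof -
  have Q: "von_neumann_algebra Q" "\<And>a. a \<in> N \<Longrightarrow> pi_rep a \<in> Q" "Q \<subseteq> crossed_product \<alpha> M" "cp_unitary s \<in> Q" for s
    using Q pi_mem[of _ N] cp_unitary_mem[of s N] by (auto simp: intermediate_vn_def)
  \<comment> \<open>Multiplying by a unitary from \<open>Q\<close> shifts the entry at
    \<open>(0, u)\<close> to \<open>(0, 0)\<close>, so the expectation also yields the other
    coefficients.\<close>
  have "x o\<^sub>L cp_unitary u \<in> Q" by (rule star_algD(4)[OF vn_star_alg[OF Q(1)] x Q(4)])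
  from expectation_mem[OF free Q(1-3) this]
  have "pi_rep (entry (x o\<^sub>L cp_unitary u) 0 0) \<in> Q" .
  moreover have "entry (x o\<^sub>L cp_unitary u) 0 0 = entry x 0 u"
    by (rule blinfun_eqI) (simp add: entry_apply cp_unitary_single)
  ultimately show ?thesis by simp
qed

lemma intermediate_eq_crossed_product:
  assumes free: "centrally_free \<omega> \<alpha> N M" and Q: "Q \<in> intermediate_vn (crossed_product \<alpha> N) (crossed_product \<alpha> M)"
  shows "{a \<in> M. pi_rep a \<in> Q} \<in> intermediate_invariant_vn \<alpha> N M" "crossed_product \<alpha> {a \<in> M. pi_rep a \<in> Q} = Q"
proof -
  let ?P = "{a \<in> M. pi_rep a \<in> Q}"
  have QD: "von_neumann_algebra Q" "\<And>a. a \<in> N \<Longrightarrow> pi_rep a \<in> Q" "Q \<subseteq> crossed_product \<alpha> M" "range cp_unitary \<subseteq> Q"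
    using Q pi_mem[of _ N] cp_unitary_mem[of _ N] by (auto simp: intermediate_vn_def)
  have P: "inv_vn ?P" by (rule preimage_vn[OF QD(1,4)])
  then show "?P \<in> intermediate_invariant_vn \<alpha> N M"
    using QD(2) NM by (auto simp: inv_vn_def intermediate_invariant_vn_def intermediate_vn_def)
  show "crossed_product \<alpha> ?P = Q"
  proof
    show "crossed_product \<alpha> ?P \<subseteq> Q" unfolding crossed_product_def
      by (rule vn_generated_least[OF QD(1)]) (use QD(4) in auto)
    show "Q \<subseteq> crossed_product \<alpha> ?P"
    proof
      fix x assume x: "x \<in> Q"
      then have xX: "x \<in> crossed_product \<alpha> M" using QD(3) by blast
      show "x \<in> crossed_product \<alpha> ?P"
        by (rule crossed_product_memI[OF P xX]) (use coefficient_mem[OF free Q x] entry_M[OF xX] in auto)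
    qed
  qed
qed

text \<open>Membership is decided by the entries in row 0, and these lie in
  \<open>P \<inter> R\<close> when they lie in both algebras.\<close>

lemma crossed_product_Int:
  assumes "inv_vn P" "inv_vn R"
  shows "crossed_product \<alpha> (P \<inter> R) = crossed_product \<alpha> P \<inter> crossed_product \<alpha> R"
proof
  note PD = inv_vnD[OF assms(1)] and RD = inv_vnD[OF assms(2)]
  show "crossed_product \<alpha> (P \<inter> R) \<subseteq> crossed_product \<alpha> P \<inter> crossed_product \<alpha> R"
    using crossed_product_mono[OF PD(2,3)] crossed_product_mono[OF RD(2,3)] by auto
  show "crossed_product \<alpha> P \<inter> crossed_product \<alpha> R \<subseteq> crossed_product \<alpha> (P \<inter> R)"
  proof
    fix x assume "x \<in> crossed_product \<alpha> P \<inter> crossed_product \<alpha> R"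
    then have x: "x \<in> crossed_product \<alpha> P" "x \<in> crossed_product \<alpha> R" by auto
    have "x \<in> crossed_product \<alpha> M" using x(1) crossed_product_mono[OF SM subset_refl PD(3)] by blast
    then show "x \<in> crossed_product \<alpha> (P \<inter> R)"
      by (rule crossed_product_memI[OF inv_vn_Int[OF assms]]) (use entry_crossed_product[OF assms(1) x(1)] entry_crossed_product[OF assms(2) x(2)] in auto)
  qed
qed

text \<open>The elements of \<open>M\<close> represented in the join form a von Neumann algebra
  containing \<open>P\<close> and \<open>R\<close>, hence the algebra generated by them.\<close>

lemma crossed_product_join:
  assumes P: "inv_vn P" and R: "inv_vn R"
  shows "crossed_product \<alpha> (vn_generated (P \<union> R)) = vn_generated (crossed_product \<alpha> P \<union> crossed_product \<alpha> R)"
    (is "_ = ?V")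
proof
  note PD = inv_vnD[OF P] and RD = inv_vnD[OF R] and JD = inv_vnD[OF inv_vn_join[OF P R]]
  have sup: "P \<subseteq> vn_generated (P \<union> R)" "R \<subseteq> vn_generated (P \<union> R)" using vn_generated_superset[of "P \<union> R"] by auto
  show "?V \<subseteq> crossed_product \<alpha> (vn_generated (P \<union> R))"
    using crossed_product_mono[OF JD(2,3) sup(1)] crossed_product_mono[OF JD(2,3) sup(2)]
    by (intro vn_generated_least crossed_product_vn JD) auto
  have V: "von_neumann_algebra ?V" by (intro von_neumann_algebra_join crossed_product_vn PD RD)
  have sup': "crossed_product \<alpha> P \<subseteq> ?V" "crossed_product \<alpha> R \<subseteq> ?V"
    using vn_generated_superset[of "crossed_product \<alpha> P \<union> crossed_product \<alpha> R"] by auto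
  have u: "range cp_unitary \<subseteq> ?V" using cp_unitary_mem[of _ P] sup' by blast
  have "vn_generated (P \<union> R) \<subseteq> {a \<in> M. pi_rep a \<in> ?V}"
    by (rule vn_generated_least[OF inv_vnD(1)[OF preimage_vn[OF V u]]])
      (use PD(3) RD(3) sup' pi_mem[of _ P] pi_mem[of _ R] in blast)
  then show "crossed_product \<alpha> (vn_generated (P \<union> R)) \<subseteq> ?V"
    unfolding crossed_product_def[of \<alpha> "vn_generated (P \<union> R)"]
    by (intro vn_generated_least[OF V]) (use u in auto)
qed

end

theorem theorem4p6:
  fixes N M :: "'h::chilbert_space op set"
    and \<alpha> :: "'g::{group_add,countable} \<Rightarrow> 'h op \<Rightarrow> 'h op"
    and \<omega> :: "nat filter"
  assumes "free_ultrafilter \<omega>"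
    and "von_neumann_algebra N" and "separable_predual N"
    and "von_neumann_algebra M" and "separable_predual M"
    and "N \<subseteq> M"
    and "vn_action M \<alpha>" and "invariant \<alpha> N"
    and "centrally_free \<omega> \<alpha> N M"
  shows "vn_lattice_isomorphism (crossed_product \<alpha>)
           (intermediate_invariant_vn \<alpha> N M)
           (intermediate_vn (crossed_product \<alpha> N) (crossed_product \<alpha> M))"
proof -
  obtain \<zeta> where \<zeta>: "separating \<zeta> M" using ex_separating[OF vn_star_alg[OF assms(4)] assms(5)] by blast
  interpret central_dynamics \<omega> M \<alpha> \<zeta> N by unfold_locales (use assms \<zeta> in auto)
  let ?L = "intermediate_invariant_vn \<alpha> N M" and ?L' = "intermediate_vn (crossed_product \<alpha> N) (crossed_product \<alpha> M)"
  have L_iff: "P \<in> ?L \<longleftrightarrow> inv_vn P \<and> N \<subseteq> P" for P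
    by (auto simp: inv_vn_def intermediate_invariant_vn_def intermediate_vn_def)
  have sub: "vn_generated (A \<union> B) \<subseteq> E" if "von_neumann_algebra E" "A \<subseteq> E" "B \<subseteq> E" for A B E :: "('g, 'h) ell2 op set"
    using vn_generated_least that by blast
  have lattice: "vn_lattice ?L"
    unfolding vn_lattice_def
  proof (intro ballI conjI)
    fix P Q assume "P \<in> ?L" "Q \<in> ?L"
    then have PQ: "inv_vn P" "inv_vn Q" "N \<subseteq> P" "N \<subseteq> Q" by (auto simp: L_iff)
    show "P \<inter> Q \<in> ?L" using inv_vn_Int[OF PQ(1,2)] PQ(3,4) by (simp add: L_iff)
    show "vn_generated (P \<union> Q) \<in> ?L"
      using inv_vn_join[OF PQ(1,2)] PQ(3) vn_generated_superset[of "P \<union> Q"] by (auto simp: L_iff)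
  qed
  have lattice': "vn_lattice ?L'"
    unfolding vn_lattice_def
  proof (intro ballI conjI)
    fix P Q assume PQ: "P \<in> ?L'" "Q \<in> ?L'"
    then show "P \<inter> Q \<in> ?L'" by (auto simp: intermediate_vn_def intro: von_neumann_algebra_Int)
    show "vn_generated (P \<union> Q) \<in> ?L'"
      using PQ vn_generated_superset[of "P \<union> Q"] sub[OF XvN] by (auto simp: intermediate_vn_def intro: von_neumann_algebra_join)
  qed
  have bij: "bij_betw (crossed_product \<alpha>) ?L ?L'"
  proof (rule bij_betw_byWitness[where f' = "\<lambda>Q. {a \<in> M. pi_rep a \<in> Q}"])
    show "\<forall>P\<in>?L. {a \<in> M. pi_rep a \<in> crossed_product \<alpha> P} = P"
    proof
      fix P assume "P \<in> ?L"
      then have P: "inv_vn P" by (simp add: L_iff)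
      show "{a \<in> M. pi_rep a \<in> crossed_product \<alpha> P} = P" using pi_mem_iff[OF P] inv_vnD(3)[OF P] by auto
    qed
    show "\<forall>Q\<in>?L'. crossed_product \<alpha> {a \<in> M. pi_rep a \<in> Q} = Q"
      using intermediate_eq_crossed_product(2)[OF assms(9)] by blast
    show "(\<lambda>Q. {a \<in> M. pi_rep a \<in> Q}) ` ?L' \<subseteq> ?L"
      using intermediate_eq_crossed_product(1)[OF assms(9)] by blast
    show "crossed_product \<alpha> ` ?L \<subseteq> ?L'"
    proof (rule image_subsetI)
      fix P assume "P \<in> ?L"
      then have P: "inv_vn P" "N \<subseteq> P" by (auto simp: L_iff)
      note PD = inv_vnD[OF P(1)]
      show "crossed_product \<alpha> P \<in> ?L'"
        unfolding intermediate_vn_def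
        using crossed_product_vn[OF PD(2,3)] crossed_product_mono[OF PD(2,3) P(2)] crossed_product_mono[OF SM subset_refl PD(3)] by simp
    qed
  qed
  show ?thesis unfolding vn_lattice_isomorphism_def
    using lattice lattice' bij crossed_product_Int crossed_product_join L_iff by simp
qed

end
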